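(* Let $R=\bigoplus_{n\ge 0}R_n$ be a graded commutative Noetherian ring, where $R_0$ is a Noetherian local ring with maximal ideal $\mathfrak{m}_0$ and $R$ is generated as an $R_0$-algebra by finitely many elements of $R_1$. Let $R_+=\bigoplus_{n>0}R_n$ and let $M$ be a non-zero finitely generated graded $R$-module. Let $i$ be a non-negative integer and suppose that $\mathrm{cd}(R_+,M)=f_{R_+}(M)+1$. Then $H^{i}_{\mathfrak{m}_0R}\bigl(H^{\mathrm{cd}(R_+,M)}_{R_+}(M)\bigr)$ is an Artinian $R$-module if and only if $H^{i+2}_{\mathfrak{m}_0R}\bigl(H^{f_{R_+}(M)}_{R_+}(M)\bigr)$ is an Artinian $R$-module.
   Context: For an ideal $\mathfrak{b}$ of $R$ and an $R$-module $T$, $H^i_{\mathfrak{b}}(T)$ denotes the $i$-th local cohomology module of $T$ with respect to $\mathfrak{b}$. The finiteness dimension $f_{R_+}(M)$ is the least non-negative integer $i$ such that $H^i_{R_+}(M)$ is not finitely generated ($\infty$ if there is no such $i$). The cohomological dimension $\mathrm{cd}(R_+,M)$ is the largest non-negative integer $i$ such that $H^i_{R_+}(M)\neq 0$. *)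

theory Defs
  imports "HOL-Algebra.Algebra" "HOL-Library.Extended_Nat"
begin

section \<open>Modules\<close>

definition module_hom ::
    "('a, 'r) ring_scheme \<Rightarrow> ('a, 'b, 'm) module_scheme \<Rightarrow> ('a, 'c, 'n) module_scheme \<Rightarrow> ('b \<Rightarrow> 'c) set"
  where "module_hom R M N =
    {h \<in> carrier M \<rightarrow> carrier N.
       (\<forall>x\<in>carrier M. \<forall>y\<in>carrier M. h (x \<oplus>\<^bsub>M\<^esub> y) = h x \<oplus>\<^bsub>N\<^esub> h y) \<and>
       (\<forall>a\<in>carrier R. \<forall>x\<in>carrier M. h (a \<odot>\<^bsub>M\<^esub> x) = a \<odot>\<^bsub>N\<^esub> h x)}"

text \<open>The record fields \<open>mult\<close> and \<open>one\<close> play no role for modules; here they are filled with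
  an arbitrary value.\<close>

definition quotient_module :: "('a, 'b, 'm) module_scheme \<Rightarrow> 'b set \<Rightarrow> ('a, 'b set) module"
  where "quotient_module M N =
    \<lparr>carrier = a_rcosets\<^bsub>M\<^esub> N,
     monoid.mult = (\<lambda>_ _. N), one = N,
     ring.zero = N,
     add = set_add M,
     smult = (\<lambda>a C. \<Union>x\<in>C. N +>\<^bsub>M\<^esub> (a \<odot>\<^bsub>M\<^esub> x))\<rparr>"

definition finitely_generated_module :: "('a, 'r) ring_scheme \<Rightarrow> ('a, 'b, 'm) module_scheme \<Rightarrow> bool"
  where "finitely_generated_module R M \<longleftrightarrow> module R M \<and>
    (\<exists>S. finite S \<and> S \<subseteq> carrier M \<and> \<Inter>{N. submodule N R M \<and> S \<subseteq> N} = carrier M)"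

definition artinian_module :: "('a, 'r) ring_scheme \<Rightarrow> ('a, 'b, 'm) module_scheme \<Rightarrow> bool"
  where "artinian_module R M \<longleftrightarrow> module R M \<and>
    (\<forall>N :: nat \<Rightarrow> 'b set. (\<forall>n. submodule (N n) R M \<and> N (Suc n) \<subseteq> N n) \<longrightarrow>
       (\<exists>k. \<forall>n\<ge>k. N n = N k))"

definition local_ring :: "('a, 'r) ring_scheme \<Rightarrow> 'a set \<Rightarrow> bool"
  where "local_ring R \<mm> \<longleftrightarrow> cring R \<and> maximalideal \<mm> R \<and> (\<forall>\<nn>. maximalideal \<nn> R \<longrightarrow> \<nn> = \<mm>)"


section \<open>Gradings\<close>

definition internal_direct_sum :: "('b, 'm) ring_scheme \<Rightarrow> ('i \<Rightarrow> 'b set) \<Rightarrow> bool"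
  where "internal_direct_sum M S \<longleftrightarrow>
    (\<forall>i. additive_subgroup (S i) M) \<and>
    (\<forall>x\<in>carrier M. \<exists>!f. (\<forall>i. f i \<in> S i) \<and> finite {i. f i \<noteq> \<zero>\<^bsub>M\<^esub>} \<and>
       x = (\<Oplus>\<^bsub>M\<^esub>i\<in>{i. f i \<noteq> \<zero>\<^bsub>M\<^esub>}. f i))"

definition graded_ring :: "('a, 'r) ring_scheme \<Rightarrow> (nat \<Rightarrow> 'a set) \<Rightarrow> bool"
  where "graded_ring R G \<longleftrightarrow> cring R \<and> internal_direct_sum R G \<and> \<one>\<^bsub>R\<^esub> \<in> G 0 \<and>
    (\<forall>m n. \<forall>a\<in>G m. \<forall>b\<in>G n. a \<otimes>\<^bsub>R\<^esub> b \<in> G (m + n))"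

text \<open>Modules are graded by the integers.\<close>

definition graded_module ::
    "('a, 'r) ring_scheme \<Rightarrow> (nat \<Rightarrow> 'a set) \<Rightarrow> ('a, 'b, 'm) module_scheme \<Rightarrow> (int \<Rightarrow> 'b set) \<Rightarrow> bool"
  where "graded_module R G M H \<longleftrightarrow> module R M \<and> internal_direct_sum M H \<and>
    (\<forall>m n. \<forall>a\<in>G m. \<forall>x\<in>H n. a \<odot>\<^bsub>M\<^esub> x \<in> H (int m + n))"

definition degree_zero_ring :: "('a, 'r) ring_scheme \<Rightarrow> (nat \<Rightarrow> 'a set) \<Rightarrow> ('a, 'r) ring_scheme"
  where "degree_zero_ring R G = R\<lparr>carrier := G 0\<rparr>"

definition generated_in_degree_one :: "('a, 'r) ring_scheme \<Rightarrow> (nat \<Rightarrow> 'a set) \<Rightarrow> bool"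
  where "generated_in_degree_one R G \<longleftrightarrow>
    (\<exists>S. finite S \<and> S \<subseteq> G 1 \<and> generate_ring R (G 0 \<union> S) = carrier R)"

definition irrelevant_ideal :: "('a, 'r) ring_scheme \<Rightarrow> (nat \<Rightarrow> 'a set) \<Rightarrow> 'a set"
  where "irrelevant_ideal R G =
    {\<Oplus>\<^bsub>R\<^esub>n\<in>A. f n | f A. finite A \<and> 0 \<notin> A \<and> (\<forall>n\<in>A. f n \<in> G n)}"


section \<open>Injective resolutions\<close>

text \<open>HOL does not allow quantification over types inside a definition, so the extension property
  is tested on modules whose carriers live in the type \<open>'a + 'e\<close>. This type contains copies of all
  ideals of \<open>R\<close>, so by Baer's criterion the definition describes injectivity in the category of
  all \<open>R\<close>-modules, whatever the type \<open>'e\<close> is.\<close>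

definition injective_module :: "('a, 'r) ring_scheme \<Rightarrow> ('a, 'e, 'm) module_scheme \<Rightarrow> bool"
  where "injective_module R E \<longleftrightarrow> module R E \<and>
    (\<forall>(A :: ('a, 'a + 'e) module) (B :: ('a, 'a + 'e) module) g f.
       module R A \<and> module R B \<and> g \<in> module_hom R A B \<and> inj_on g (carrier A) \<and> f \<in> module_hom R A E
       \<longrightarrow> (\<exists>h \<in> module_hom R B E. \<forall>x\<in>carrier A. h (g x) = f x))"

text \<open>\<open>0 \<rightarrow> T \<rightarrow> E 0 \<rightarrow> E 1 \<rightarrow> \<dots>\<close> is exact, with maps \<open>\<epsilon>, d 0, d 1, \<dots>\<close> and all \<open>E n\<close> injective.\<close>

definition injective_resolution ::
    "('a, 'r) ring_scheme \<Rightarrow> ('a, 'b, 'm) module_scheme \<Rightarrow>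
     ('b \<Rightarrow> 'e) \<Rightarrow> (nat \<Rightarrow> ('a, 'e) module) \<Rightarrow> (nat \<Rightarrow> 'e \<Rightarrow> 'e) \<Rightarrow> bool"
  where "injective_resolution R T \<epsilon> E d \<longleftrightarrow>
    (\<forall>n. injective_module R (E n)) \<and>
    \<epsilon> \<in> module_hom R T (E 0) \<and> inj_on \<epsilon> (carrier T) \<and>
    (\<forall>n. d n \<in> module_hom R (E n) (E (Suc n))) \<and>
    \<epsilon> ` carrier T = a_kernel (E 0) (E 1) (d 0) \<and>
    (\<forall>n. d n ` carrier (E n) = a_kernel (E (Suc n)) (E (Suc (Suc n))) (d (Suc n)))"


section \<open>Local cohomology\<close>

text \<open>\<open>\<Gamma>\<^sub>\<bb>(T)\<close>: the elements annihilated by some power of \<open>\<bb>\<close> (the zeroth power being \<open>R\<close>).\<close>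

definition torsion_part ::
    "('a, 'r) ring_scheme \<Rightarrow> 'a set \<Rightarrow> ('a, 'b, 'm) module_scheme \<Rightarrow> 'b set"
  where "torsion_part R \<bb> T =
    {x \<in> carrier T. \<exists>n. \<forall>a \<in> (ideal_prod R \<bb> ^^ n) (carrier R). a \<odot>\<^bsub>T\<^esub> x = \<zero>\<^bsub>T\<^esub>}"

text \<open>The \<open>i\<close>-th right derived functor of \<open>\<Gamma>\<^sub>\<bb>\<close>, i.e. the \<open>i\<close>-th cohomology module of the complex
  \<open>\<Gamma>\<^sub>\<bb>(E 0) \<rightarrow> \<Gamma>\<^sub>\<bb>(E 1) \<rightarrow> \<dots>\<close> for a chosen injective resolution \<open>E\<close> of \<open>T\<close>; as usual, it is
  determined up to isomorphism only. The resolution lives in the type \<open>('a + 'b) list set\<close>, which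
  is large enough: its cardinality \<open>\<kappa>\<close> is \<open>2\<close> to the maximum of \<open>\<aleph>\<^sub>0\<close> and the cardinalities
  of \<open>'a\<close> and \<open>'b\<close>. So every module \<open>N\<close> with at most \<open>\<kappa>\<close> elements embeds into a divisible abelian
  group \<open>D\<close> with at most \<open>\<kappa>\<close> elements, hence into the injective module of additive maps
  \<open>R \<rightarrow> D\<close>, which again has at most \<open>\<kappa>\<close> elements. Iterating on cokernels gives a resolution.\<close>

definition local_cohomology ::
    "('a, 'r) ring_scheme \<Rightarrow> 'a set \<Rightarrow> nat \<Rightarrow> ('a, 'b, 'm) module_scheme \<Rightarrow>
     ('a, ('a + 'b) list set set) module"
  where "local_cohomology R \<bb> i T =
    (let (\<epsilon>, E, d) = (SOME (\<epsilon> :: 'b \<Rightarrow> ('a + 'b) list set, E, d). injective_resolution R T \<epsilon> E d);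
         cocycles = {x \<in> torsion_part R \<bb> (E i). d i x = \<zero>\<^bsub>E (Suc i)\<^esub>};
         coboundaries = (case i of 0 \<Rightarrow> {\<zero>\<^bsub>E 0\<^esub>} | Suc j \<Rightarrow> d j ` torsion_part R \<bb> (E j))
     in quotient_module ((E i)\<lparr>carrier := cocycles\<rparr>) coboundaries)"

text \<open>In \<open>enat\<close>, the infimum of the empty set is \<open>\<infinity>\<close>.\<close>

definition finiteness_dimension ::
    "('a, 'r) ring_scheme \<Rightarrow> 'a set \<Rightarrow> ('a, 'b, 'm) module_scheme \<Rightarrow> enat"
  where "finiteness_dimension R \<bb> T =
    Inf {enat i | i. \<not> finitely_generated_module R (local_cohomology R \<bb> i T)}"

text \<open>The supremum is the largest such \<open>i\<close> whenever this set of numbers is nonempty and bounded;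
  it is \<open>\<infinity>\<close> for unbounded sets and \<open>0\<close> for the empty set.\<close>

definition cohomological_dimension ::
    "('a, 'r) ring_scheme \<Rightarrow> 'a set \<Rightarrow> ('a, 'b, 'm) module_scheme \<Rightarrow> enat"
  where "cohomological_dimension R \<bb> T =
    Sup {enat i | i. carrier (local_cohomology R \<bb> i T) \<noteq> {\<zero>\<^bsub>local_cohomology R \<bb> i T\<^esub>}}"

end

theory Submission
  imports Defs
begin

text \<open>Instead of a spectral sequence, the proof uses mapping cones. Let \<open>E\<close> be an injective resolution of \<open>M\<close>;
  then \<open>\<Gamma>(E)\<close> for \<open>\<Gamma> = \<Gamma>\<^bsub>R\<^sub>+\<^esub>\<close> is a complex of injective modules with cohomology modules
  \<open>H\<^sup>j = H\<^sup>j\<^bsub>R\<^sub>+\<^esub>(M)\<close>. If \<open>H\<^sup>j\<close> is the lowest cohomology module of a complex of injective modules,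
  it can be killed: an injective resolution of \<open>H\<^sup>j\<close> maps to the complex, and the mapping cone of this map is again a
  complex of injective modules, with the same cohomology in all higher degrees. The functor \<open>\<Gamma>\<^sub>0\<close> of
  \<open>\<mm>\<^sub>0R\<close>-torsion commutes with cones, so each step gives a long exact sequence that involves
  the modules \<open>H\<^sup>n\<^bsub>\<mm>\<^sub>0R\<^esub>(H\<^sup>j)\<close>.

  As \<open>R/(\<mm>\<^sub>0R + R\<^sub>+)\<close> is a field, local cohomology of finitely generated modules with support in
  \<open>\<mm>\<^sub>0R + R\<^sub>+\<close> is Artinian. So \<open>\<Gamma>\<^sub>0\<Gamma>(E)\<close> has Artinian cohomology, and so have
  the resolutions of the finitely generated, \<open>R\<^sub>+\<close>-torsion modules \<open>H\<^sup>j\<close> with \<open>j < f\<close>. Killing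
  these leads to a complex \<open>X\<close> such that \<open>\<Gamma>\<^sub>0(X)\<close> still has Artinian cohomology. Only \<open>H\<^sup>f\<close> and
  \<open>H\<^sup>f\<^sup>+\<^sup>1\<close> are left; killing both yields an acyclic complex of injective modules, on which \<open>\<Gamma>\<^sub>0\<close> stays
  acyclic. Up to Artinian modules, the two long exact sequences therefore identify
  \<open>H\<^sup>i\<^bsub>\<mm>\<^sub>0R\<^esub>(H\<^sup>f\<^sup>+\<^sup>1)\<close> with \<open>H\<^sup>i\<^sup>+\<^sup>2\<^bsub>\<mm>\<^sub>0R\<^esub>(H\<^sup>f)\<close>.\<close>

section \<open>Modules, submodules and homomorphisms\<close>

text \<open>The shift by two has two sources: the connecting map of the last cone raises the degree
  by one, and the resolution of the lower cohomology module starts one degree below that of the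
  upper one. Torsion functors keep the last cone acyclic because an exact complex of injective
  modules that begins in degree 0 splits: there are homomorphisms \<open>s\<close> with
  \<open>d s d = d\<close>, and homomorphisms preserve torsion.

  Artinianness is tested on submodules between coboundaries and cocycles, so every step along a long
  exact sequence is an instance of one statement on chains, \<open>exact_chain_cond\<close>.

  The obstacle is the type discipline. The resolution of \<open>M\<close> and those of its local
  cohomology modules live in different types, while infinitely many quotients and repeated cones
  must stay within one type. Hence quotients are realised on representatives, pairs are formed by
  coding functions, and injectivity becomes Baer's criterion, which mentions ideals only.

  Artinian local cohomology of finitely generated modules is reached by passing from
  \<open>T\<close> to \<open>T/xT\<close>, with Melkersson's criterion lifting the result from the
  kernel of \<open>x\<close>.\<close>

context cring
begin

lemma mod_group: "module R M \<Longrightarrow> abelian_group M"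
  by (simp add: module_def)

lemma mod_zero [simp]: "module R M \<Longrightarrow> \<zero>\<^bsub>M\<^esub> \<in> carrier M"
  by (meson abelian_groupE(2) mod_group)

lemma mod_add [simp]: "module R M \<Longrightarrow> x \<in> carrier M \<Longrightarrow> y \<in> carrier M \<Longrightarrow> x \<oplus>\<^bsub>M\<^esub> y \<in> carrier M"
  by (meson abelian_groupE(1) mod_group)

lemma mod_neg [simp]: "module R M \<Longrightarrow> x \<in> carrier M \<Longrightarrow> \<ominus>\<^bsub>M\<^esub> x \<in> carrier M"
  by (meson abelian_group.a_inv_closed mod_group)

lemma mod_minus [simp]: "module R M \<Longrightarrow> x \<in> carrier M \<Longrightarrow> y \<in> carrier M \<Longrightarrow> x \<ominus>\<^bsub>M\<^esub> y \<in> carrier M"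
  by (simp add: a_minus_def)

lemma mod_smult [simp]: "module R M \<Longrightarrow> a \<in> carrier R \<Longrightarrow> x \<in> carrier M \<Longrightarrow> a \<odot>\<^bsub>M\<^esub> x \<in> carrier M"
  by (meson module.smult_closed)

lemma mod_assoc: "module R M \<Longrightarrow> x \<in> carrier M \<Longrightarrow> y \<in> carrier M \<Longrightarrow> z \<in> carrier M \<Longrightarrow>
    x \<oplus>\<^bsub>M\<^esub> y \<oplus>\<^bsub>M\<^esub> z = x \<oplus>\<^bsub>M\<^esub> (y \<oplus>\<^bsub>M\<^esub> z)"
  by (meson abelian_groupE(3) mod_group)

lemma mod_comm: "module R M \<Longrightarrow> x \<in> carrier M \<Longrightarrow> y \<in> carrier M \<Longrightarrow> x \<oplus>\<^bsub>M\<^esub> y = y \<oplus>\<^bsub>M\<^esub> x"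
  by (meson abelian_groupE(4) mod_group)

lemma mod_lcomm: "module R M \<Longrightarrow> x \<in> carrier M \<Longrightarrow> y \<in> carrier M \<Longrightarrow> z \<in> carrier M \<Longrightarrow>
    x \<oplus>\<^bsub>M\<^esub> (y \<oplus>\<^bsub>M\<^esub> z) = y \<oplus>\<^bsub>M\<^esub> (x \<oplus>\<^bsub>M\<^esub> z)"
  by (metis mod_assoc mod_comm)

lemmas mod_ac = mod_assoc mod_comm mod_lcomm

lemma mod_l_zero [simp]: "module R M \<Longrightarrow> x \<in> carrier M \<Longrightarrow> \<zero>\<^bsub>M\<^esub> \<oplus>\<^bsub>M\<^esub> x = x"
  by (meson abelian_groupE(5) mod_group)

lemma mod_r_zero [simp]: "module R M \<Longrightarrow> x \<in> carrier M \<Longrightarrow> x \<oplus>\<^bsub>M\<^esub> \<zero>\<^bsub>M\<^esub> = x"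
  by (metis mod_comm mod_l_zero mod_zero)

lemma mod_l_neg [simp]: "module R M \<Longrightarrow> x \<in> carrier M \<Longrightarrow> \<ominus>\<^bsub>M\<^esub> x \<oplus>\<^bsub>M\<^esub> x = \<zero>\<^bsub>M\<^esub>"
  by (meson abelian_group.l_neg mod_group)

lemma mod_r_neg [simp]: "module R M \<Longrightarrow> x \<in> carrier M \<Longrightarrow> x \<oplus>\<^bsub>M\<^esub> \<ominus>\<^bsub>M\<^esub> x = \<zero>\<^bsub>M\<^esub>"
  by (meson abelian_group.r_neg mod_group)

lemma mod_neg_cancel [simp]:
  assumes "module R M" "x \<in> carrier M" "y \<in> carrier M"
  shows "x \<oplus>\<^bsub>M\<^esub> (\<ominus>\<^bsub>M\<^esub> x \<oplus>\<^bsub>M\<^esub> y) = y" "\<ominus>\<^bsub>M\<^esub> x \<oplus>\<^bsub>M\<^esub> (x \<oplus>\<^bsub>M\<^esub> y) = y"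
  using assms by (simp_all flip: mod_assoc)

lemma mod_neg_neg [simp]: "module R M \<Longrightarrow> x \<in> carrier M \<Longrightarrow> \<ominus>\<^bsub>M\<^esub> (\<ominus>\<^bsub>M\<^esub> x) = x"
  by (meson abelian_group.minus_minus mod_group)

lemma mod_neg_add: "module R M \<Longrightarrow> x \<in> carrier M \<Longrightarrow> y \<in> carrier M \<Longrightarrow>
    \<ominus>\<^bsub>M\<^esub> (x \<oplus>\<^bsub>M\<^esub> y) = \<ominus>\<^bsub>M\<^esub> x \<oplus>\<^bsub>M\<^esub> \<ominus>\<^bsub>M\<^esub> y"
  by (meson abelian_group.minus_add mod_group)

lemma mod_neg_zero [simp]: "module R M \<Longrightarrow> \<ominus>\<^bsub>M\<^esub> \<zero>\<^bsub>M\<^esub> = \<zero>\<^bsub>M\<^esub>"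
  by (metis mod_l_neg mod_neg mod_r_zero mod_zero)

lemma mod_minus_zero [simp]: "module R M \<Longrightarrow> x \<in> carrier M \<Longrightarrow> x \<ominus>\<^bsub>M\<^esub> \<zero>\<^bsub>M\<^esub> = x"
  by (simp add: a_minus_def)

lemma mod_minus_self [simp]: "module R M \<Longrightarrow> x \<in> carrier M \<Longrightarrow> x \<ominus>\<^bsub>M\<^esub> x = \<zero>\<^bsub>M\<^esub>"
  by (simp add: a_minus_def)

lemma mod_minus_add [simp]: "module R M \<Longrightarrow> x \<in> carrier M \<Longrightarrow> y \<in> carrier M \<Longrightarrow>
    x \<ominus>\<^bsub>M\<^esub> y \<oplus>\<^bsub>M\<^esub> y = x"
  by (simp add: a_minus_def mod_assoc)

lemma mod_add_minus [simp]: "module R M \<Longrightarrow> x \<in> carrier M \<Longrightarrow> y \<in> carrier M \<Longrightarrow>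
    x \<oplus>\<^bsub>M\<^esub> y \<ominus>\<^bsub>M\<^esub> y = x"
  by (simp add: a_minus_def mod_assoc)

lemma mod_add_minus' [simp]: "module R M \<Longrightarrow> x \<in> carrier M \<Longrightarrow> y \<in> carrier M \<Longrightarrow>
    y \<oplus>\<^bsub>M\<^esub> (x \<ominus>\<^bsub>M\<^esub> y) = x"
  by (metis mod_comm mod_minus mod_minus_add)

lemma mod_minus_eq_zero: "module R M \<Longrightarrow> x \<in> carrier M \<Longrightarrow> y \<in> carrier M \<Longrightarrow>
    x \<ominus>\<^bsub>M\<^esub> y = \<zero>\<^bsub>M\<^esub> \<longleftrightarrow> x = y"
  by (metis mod_l_zero mod_minus_add mod_minus_self)

lemma mod_add_eq_zero: "module R M \<Longrightarrow> x \<in> carrier M \<Longrightarrow> y \<in> carrier M \<Longrightarrow>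
    x \<oplus>\<^bsub>M\<^esub> y = \<zero>\<^bsub>M\<^esub> \<longleftrightarrow> x = \<ominus>\<^bsub>M\<^esub> y"
  by (metis mod_add_minus mod_l_neg mod_l_zero a_minus_def mod_neg)

lemma mod_add_left_cancel: "module R M \<Longrightarrow> x \<in> carrier M \<Longrightarrow> y \<in> carrier M \<Longrightarrow> z \<in> carrier M \<Longrightarrow>
    x \<oplus>\<^bsub>M\<^esub> y = x \<oplus>\<^bsub>M\<^esub> z \<longleftrightarrow> y = z"
  by (metis mod_neg_cancel(2))

lemma smult_l_add: "module R M \<Longrightarrow> a \<in> carrier R \<Longrightarrow> b \<in> carrier R \<Longrightarrow> x \<in> carrier M \<Longrightarrow>
    (a \<oplus> b) \<odot>\<^bsub>M\<^esub> x = a \<odot>\<^bsub>M\<^esub> x \<oplus>\<^bsub>M\<^esub> b \<odot>\<^bsub>M\<^esub> x"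
  by (meson module.smult_l_distr)

lemma smult_r_add: "module R M \<Longrightarrow> a \<in> carrier R \<Longrightarrow> x \<in> carrier M \<Longrightarrow> y \<in> carrier M \<Longrightarrow>
    a \<odot>\<^bsub>M\<^esub> (x \<oplus>\<^bsub>M\<^esub> y) = a \<odot>\<^bsub>M\<^esub> x \<oplus>\<^bsub>M\<^esub> a \<odot>\<^bsub>M\<^esub> y"
  by (meson module.smult_r_distr)

lemma smult_mult: "module R M \<Longrightarrow> a \<in> carrier R \<Longrightarrow> b \<in> carrier R \<Longrightarrow> x \<in> carrier M \<Longrightarrow>
    (a \<otimes> b) \<odot>\<^bsub>M\<^esub> x = a \<odot>\<^bsub>M\<^esub> (b \<odot>\<^bsub>M\<^esub> x)"
  by (meson module.smult_assoc1)

lemma smult_one' [simp]: "module R M \<Longrightarrow> x \<in> carrier M \<Longrightarrow> \<one> \<odot>\<^bsub>M\<^esub> x = x"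
  by (meson module.smult_one)

lemma smult_zero_l [simp]: "module R M \<Longrightarrow> x \<in> carrier M \<Longrightarrow> \<zero> \<odot>\<^bsub>M\<^esub> x = \<zero>\<^bsub>M\<^esub>"
  by (meson module.smult_l_null)

lemma smult_zero_r [simp]: "module R M \<Longrightarrow> a \<in> carrier R \<Longrightarrow> a \<odot>\<^bsub>M\<^esub> \<zero>\<^bsub>M\<^esub> = \<zero>\<^bsub>M\<^esub>"
  by (meson module.smult_r_null)

lemma smult_neg_l: "module R M \<Longrightarrow> a \<in> carrier R \<Longrightarrow> x \<in> carrier M \<Longrightarrow> (\<ominus> a) \<odot>\<^bsub>M\<^esub> x = \<ominus>\<^bsub>M\<^esub> (a \<odot>\<^bsub>M\<^esub> x)"
  by (meson module.smult_l_minus)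

lemma smult_neg_r: "module R M \<Longrightarrow> a \<in> carrier R \<Longrightarrow> x \<in> carrier M \<Longrightarrow> a \<odot>\<^bsub>M\<^esub> (\<ominus>\<^bsub>M\<^esub> x) = \<ominus>\<^bsub>M\<^esub> (a \<odot>\<^bsub>M\<^esub> x)"
  by (meson module.smult_r_minus)

lemma smult_minus_r: "module R M \<Longrightarrow> a \<in> carrier R \<Longrightarrow> x \<in> carrier M \<Longrightarrow> y \<in> carrier M \<Longrightarrow>
    a \<odot>\<^bsub>M\<^esub> (x \<ominus>\<^bsub>M\<^esub> y) = a \<odot>\<^bsub>M\<^esub> x \<ominus>\<^bsub>M\<^esub> a \<odot>\<^bsub>M\<^esub> y"
  by (simp add: a_minus_def smult_r_add smult_neg_r)

lemma smult_lcomm: "module R M \<Longrightarrow> a \<in> carrier R \<Longrightarrow> b \<in> carrier R \<Longrightarrow> x \<in> carrier M \<Longrightarrow>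
    a \<odot>\<^bsub>M\<^esub> (b \<odot>\<^bsub>M\<^esub> x) = b \<odot>\<^bsub>M\<^esub> (a \<odot>\<^bsub>M\<^esub> x)"
  by (metis m_comm smult_mult)

text \<open>The scalar \<open>\<ominus> \<one>\<close> produces additive inverses, so no existence
  statement is left to check, only equations.\<close>

lemma moduleI':
  assumes "\<And>x y. x \<in> carrier M \<Longrightarrow> y \<in> carrier M \<Longrightarrow> x \<oplus>\<^bsub>M\<^esub> y \<in> carrier M"
    and "\<zero>\<^bsub>M\<^esub> \<in> carrier M"
    and "\<And>a x. a \<in> carrier R \<Longrightarrow> x \<in> carrier M \<Longrightarrow> a \<odot>\<^bsub>M\<^esub> x \<in> carrier M"
    and "\<And>x y z. x \<in> carrier M \<Longrightarrow> y \<in> carrier M \<Longrightarrow> z \<in> carrier M \<Longrightarrow>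
      x \<oplus>\<^bsub>M\<^esub> y \<oplus>\<^bsub>M\<^esub> z = x \<oplus>\<^bsub>M\<^esub> (y \<oplus>\<^bsub>M\<^esub> z)"
    and "\<And>x y. x \<in> carrier M \<Longrightarrow> y \<in> carrier M \<Longrightarrow> x \<oplus>\<^bsub>M\<^esub> y = y \<oplus>\<^bsub>M\<^esub> x"
    and "\<And>x. x \<in> carrier M \<Longrightarrow> \<zero>\<^bsub>M\<^esub> \<oplus>\<^bsub>M\<^esub> x = x"
    and "\<And>x. x \<in> carrier M \<Longrightarrow> (\<ominus> \<one>) \<odot>\<^bsub>M\<^esub> x \<oplus>\<^bsub>M\<^esub> x = \<zero>\<^bsub>M\<^esub>"
    and "\<And>a b x. a \<in> carrier R \<Longrightarrow> b \<in> carrier R \<Longrightarrow> x \<in> carrier M \<Longrightarrow>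
      (a \<oplus> b) \<odot>\<^bsub>M\<^esub> x = a \<odot>\<^bsub>M\<^esub> x \<oplus>\<^bsub>M\<^esub> b \<odot>\<^bsub>M\<^esub> x"
    and "\<And>a x y. a \<in> carrier R \<Longrightarrow> x \<in> carrier M \<Longrightarrow> y \<in> carrier M \<Longrightarrow>
      a \<odot>\<^bsub>M\<^esub> (x \<oplus>\<^bsub>M\<^esub> y) = a \<odot>\<^bsub>M\<^esub> x \<oplus>\<^bsub>M\<^esub> a \<odot>\<^bsub>M\<^esub> y"
    and "\<And>a b x. a \<in> carrier R \<Longrightarrow> b \<in> carrier R \<Longrightarrow> x \<in> carrier M \<Longrightarrow>
      (a \<otimes> b) \<odot>\<^bsub>M\<^esub> x = a \<odot>\<^bsub>M\<^esub> (b \<odot>\<^bsub>M\<^esub> x)"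
    and "\<And>x. x \<in> carrier M \<Longrightarrow> \<one> \<odot>\<^bsub>M\<^esub> x = x"
  shows "module R M"
proof (rule moduleI)
  show "abelian_group M"
  proof (rule abelian_groupI)
    fix x assume "x \<in> carrier M"
    then show "\<exists>y\<in>carrier M. y \<oplus>\<^bsub>M\<^esub> x = \<zero>\<^bsub>M\<^esub>"
      using assms(3)[of "\<ominus> \<one>" x] assms(7)[of x] by auto
  qed (use assms in auto)
qed (use assms is_cring in auto)

end

text \<open>Closure under negatives comes from the scalar -1. Over a module this agrees with
  \<open>submodule\<close> (see \<open>submodule_iff_submod\<close>) but is quicker to
  verify.\<close>

definition submod :: "('a, 'r) ring_scheme \<Rightarrow> ('a, 'b, 'm) module_scheme \<Rightarrow> 'b set \<Rightarrow> bool"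
  where "submod R M N \<longleftrightarrow> N \<subseteq> carrier M \<and> \<zero>\<^bsub>M\<^esub> \<in> N \<and>
    (\<forall>x\<in>N. \<forall>y\<in>N. x \<oplus>\<^bsub>M\<^esub> y \<in> N) \<and> (\<forall>a\<in>carrier R. \<forall>x\<in>N. a \<odot>\<^bsub>M\<^esub> x \<in> N)"

lemma submodD:
  assumes "submod R M N"
  shows "N \<subseteq> carrier M" "x \<in> N \<Longrightarrow> x \<in> carrier M" "\<zero>\<^bsub>M\<^esub> \<in> N"
    "x \<in> N \<Longrightarrow> y \<in> N \<Longrightarrow> x \<oplus>\<^bsub>M\<^esub> y \<in> N" "a \<in> carrier R \<Longrightarrow> x \<in> N \<Longrightarrow> a \<odot>\<^bsub>M\<^esub> x \<in> N"
  using assms by (auto simp: submod_def)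

lemma submodI:
  assumes "N \<subseteq> carrier M" "\<zero>\<^bsub>M\<^esub> \<in> N" "\<And>x y. x \<in> N \<Longrightarrow> y \<in> N \<Longrightarrow> x \<oplus>\<^bsub>M\<^esub> y \<in> N"
    "\<And>a x. a \<in> carrier R \<Longrightarrow> x \<in> N \<Longrightarrow> a \<odot>\<^bsub>M\<^esub> x \<in> N"
  shows "submod R M N"
  using assms by (auto simp: submod_def)

lemma module_homD:
  assumes "h \<in> module_hom R M N"
  shows "x \<in> carrier M \<Longrightarrow> h x \<in> carrier N"
    "x \<in> carrier M \<Longrightarrow> y \<in> carrier M \<Longrightarrow> h (x \<oplus>\<^bsub>M\<^esub> y) = h x \<oplus>\<^bsub>N\<^esub> h y"
    "a \<in> carrier R \<Longrightarrow> x \<in> carrier M \<Longrightarrow> h (a \<odot>\<^bsub>M\<^esub> x) = a \<odot>\<^bsub>N\<^esub> h x"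
  using assms by (auto simp: module_hom_def)

lemma module_homI:
  assumes "\<And>x. x \<in> carrier M \<Longrightarrow> h x \<in> carrier N"
    "\<And>x y. x \<in> carrier M \<Longrightarrow> y \<in> carrier M \<Longrightarrow> h (x \<oplus>\<^bsub>M\<^esub> y) = h x \<oplus>\<^bsub>N\<^esub> h y"
    "\<And>a x. a \<in> carrier R \<Longrightarrow> x \<in> carrier M \<Longrightarrow> h (a \<odot>\<^bsub>M\<^esub> x) = a \<odot>\<^bsub>N\<^esub> h x"
  shows "h \<in> module_hom R M N"
  using assms by (auto simp: module_hom_def)

lemma module_hom_comp:
  "g \<in> module_hom R M N \<Longrightarrow> h \<in> module_hom R N L \<Longrightarrow> (\<lambda>x. h (g x)) \<in> module_hom R M L"
  by (auto simp: module_hom_def Pi_iff)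

lemma module_hom_restrict_dom:
  "h \<in> module_hom R M N \<Longrightarrow> C \<subseteq> carrier M \<Longrightarrow> h \<in> module_hom R (M\<lparr>carrier := C\<rparr>) N"
  by (auto simp: module_hom_def Pi_iff subset_eq)

lemma module_hom_restrict_cod:
  "h \<in> module_hom R M N \<Longrightarrow> h ` carrier M \<subseteq> C \<Longrightarrow> h \<in> module_hom R M (N\<lparr>carrier := C\<rparr>)"
  by (auto simp: module_hom_def Pi_iff subset_eq)

context cring
begin

lemma hom_zero: 
  assumes "module R M" "module R N" "h \<in> module_hom R M N"
  shows "h \<zero>\<^bsub>M\<^esub> = \<zero>\<^bsub>N\<^esub>"
  using module_homD(3)[OF assms(3), of \<zero> "\<zero>\<^bsub>M\<^esub>"] assms module_homD(1)[OF assms(3)] by simp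

lemma hom_neg:
  assumes "module R M" "module R N" "h \<in> module_hom R M N" "x \<in> carrier M"
  shows "h (\<ominus>\<^bsub>M\<^esub> x) = \<ominus>\<^bsub>N\<^esub> h x"
  using module_homD(3)[OF assms(3), of "\<ominus> \<one>" x] assms module_homD(1)[OF assms(3)]
  by (simp add: smult_neg_l)

lemma hom_minus:
  assumes "module R M" "module R N" "h \<in> module_hom R M N" "x \<in> carrier M" "y \<in> carrier M"
  shows "h (x \<ominus>\<^bsub>M\<^esub> y) = h x \<ominus>\<^bsub>N\<^esub> h y"
  using assms by (simp add: a_minus_def module_homD[OF assms(3)] hom_neg)

lemma submod_neg: "module R M \<Longrightarrow> submod R M N \<Longrightarrow> x \<in> N \<Longrightarrow> \<ominus>\<^bsub>M\<^esub> x \<in> N"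
  using submodD(5)[of R M N "\<ominus> \<one>" x] submodD(2)[of R M N x] by (simp add: smult_neg_l)

lemma submod_minus: "module R M \<Longrightarrow> submod R M N \<Longrightarrow> x \<in> N \<Longrightarrow> y \<in> N \<Longrightarrow> x \<ominus>\<^bsub>M\<^esub> y \<in> N"
  by (simp add: a_minus_def submodD submod_neg)

lemma submodule_iff_submod:
  assumes "module R M" shows "submodule N R M \<longleftrightarrow> submod R M N"
proof
  assume N: "submodule N R M"
  have "\<exists>x. x \<in> N" using module.submoduleE(2)[OF assms N] by auto
  then have "\<zero>\<^bsub>M\<^esub> \<in> N"
    using module.submoduleE(1,4)[OF assms N] assms by (metis smult_zero_l subsetD zero_closed)
  then show "submod R M N"
    using module.submoduleE[OF assms N] by (intro submodI) auto
next
  assume N: "submod R M N"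
  show "submodule N R M"
    using submodD[OF N] submod_neg[OF assms N] by (intro module.submoduleI[OF assms]) auto
qed

lemma submod_module:
  assumes "module R M" "submod R M N" shows "module R (M\<lparr>carrier := N\<rparr>)"
  using assms submodule.submodule_is_module submodule_iff_submod by blast

lemma submod_carrier: "module R M \<Longrightarrow> submod R M (carrier M)"
  by (auto intro: submodI)

lemma submod_trivial: "module R M \<Longrightarrow> submod R M {\<zero>\<^bsub>M\<^esub>}"
  by (auto intro!: submodI)

lemma submod_image:
  assumes "module R M" "module R N" "h \<in> module_hom R M N" "submod R M A"
  shows "submod R N (h ` A)"
proof (rule submodI)
  note h = module_homD[OF assms(3)] and A = submodD[OF assms(4)]
  show "h ` A \<subseteq> carrier N" using h A by auto
  show "\<zero>\<^bsub>N\<^esub> \<in> h ` A" using hom_zero[OF assms(1,2,3)] A by force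
  fix x y assume "x \<in> h ` A" "y \<in> h ` A"
  then obtain u v where "u \<in> A" "v \<in> A" "x = h u" "y = h v" by auto
  then show "x \<oplus>\<^bsub>N\<^esub> y \<in> h ` A"
    using h(2)[of u v] A(2,4) by (metis imageI)
next
  note h = module_homD[OF assms(3)] and A = submodD[OF assms(4)]
  fix a x assume "a \<in> carrier R" "x \<in> h ` A"
  then obtain u where "u \<in> A" "x = h u" by auto
  then show "a \<odot>\<^bsub>N\<^esub> x \<in> h ` A"
    using h(3)[of a u] A \<open>a \<in> carrier R\<close> by (metis imageI)
qed

lemma submod_vimage:
  assumes "module R M" "module R N" "h \<in> module_hom R M N" "submod R M A" "submod R N B"
  shows "submod R M {x \<in> A. h x \<in> B}"
  using assms(1,2) submodD[OF assms(4)] submodD[OF assms(5)]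
  by (intro submodI) (auto simp: hom_zero[OF assms(1-3)] module_homD[OF assms(3)])

lemma submod_sum:
  assumes "module R M" "submod R M A" "submod R M B"
  shows "submod R M {a \<oplus>\<^bsub>M\<^esub> b | a b. a \<in> A \<and> b \<in> B}"
proof (rule submodI)
  note A = submodD[OF assms(2)] and B = submodD[OF assms(3)]
  show "{a \<oplus>\<^bsub>M\<^esub> b |a b. a \<in> A \<and> b \<in> B} \<subseteq> carrier M" using A B assms(1) by auto
  show "\<zero>\<^bsub>M\<^esub> \<in> {a \<oplus>\<^bsub>M\<^esub> b |a b. a \<in> A \<and> b \<in> B}" using A(3) B(3) assms(1)
    by (auto intro!: exI[of _ "\<zero>\<^bsub>M\<^esub>"])
  fix x y assume "x \<in> {a \<oplus>\<^bsub>M\<^esub> b |a b. a \<in> A \<and> b \<in> B}" "y \<in> {a \<oplus>\<^bsub>M\<^esub> b |a b. a \<in> A \<and> b \<in> B}"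
  then obtain a b a' b' where ab: "a \<in> A" "b \<in> B" "a' \<in> A" "b' \<in> B" and xy: "x = a \<oplus>\<^bsub>M\<^esub> b" "y = a' \<oplus>\<^bsub>M\<^esub> b'"
    by auto
  have "x \<oplus>\<^bsub>M\<^esub> y = (a \<oplus>\<^bsub>M\<^esub> a') \<oplus>\<^bsub>M\<^esub> (b \<oplus>\<^bsub>M\<^esub> b')"
    using ab A B assms(1) by (simp add: xy mod_ac)
  then show "x \<oplus>\<^bsub>M\<^esub> y \<in> {a \<oplus>\<^bsub>M\<^esub> b |a b. a \<in> A \<and> b \<in> B}" using A(4)[OF ab(1,3)] B(4)[OF ab(2,4)] by blast
next
  note A = submodD[OF assms(2)] and B = submodD[OF assms(3)]
  fix r x assume r: "r \<in> carrier R" and "x \<in> {a \<oplus>\<^bsub>M\<^esub> b |a b. a \<in> A \<and> b \<in> B}"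
  then obtain a b where ab: "a \<in> A" "b \<in> B" and x: "x = a \<oplus>\<^bsub>M\<^esub> b" by auto
  have "r \<odot>\<^bsub>M\<^esub> x = r \<odot>\<^bsub>M\<^esub> a \<oplus>\<^bsub>M\<^esub> r \<odot>\<^bsub>M\<^esub> b"
    using r ab A B assms(1) by (simp add: x smult_r_add)
  then show "r \<odot>\<^bsub>M\<^esub> x \<in> {a \<oplus>\<^bsub>M\<^esub> b |a b. a \<in> A \<and> b \<in> B}" using A(5)[OF r ab(1)] B(5)[OF r ab(2)] by blast
qed

end

section \<open>Chain conditions on subquotients\<close>

text \<open>Ascending (\<open>asc\<close>) or descending chains of submodules between \<open>B\<close> and \<open>Z\<close> become stationary:
  a chain condition on the subquotient \<open>Z/B\<close> that does not mention the quotient.\<close>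

definition chain_cond ::
    "bool \<Rightarrow> ('a, 'r) ring_scheme \<Rightarrow> ('a, 'b, 'm) module_scheme \<Rightarrow> 'b set \<Rightarrow> 'b set \<Rightarrow> bool"
  where "chain_cond asc R M B Z \<longleftrightarrow>
    (\<forall>N. (\<forall>n. submod R M (N n) \<and> B \<subseteq> N n \<and> N n \<subseteq> Z \<and> (if asc then N n \<subseteq> N (Suc n) else N (Suc n) \<subseteq> N n))
      \<longrightarrow> (\<exists>k. \<forall>n\<ge>k. N n = N k))"

lemma chain_le:
  fixes N :: "nat \<Rightarrow> 'b set"
  assumes "\<And>n. if asc then N n \<subseteq> N (Suc n) else N (Suc n) \<subseteq> N n" "m \<le> n"
  shows "if asc then N m \<subseteq> N n else N n \<subseteq> N m"
proof (cases asc)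
  case True
  then show ?thesis using assms lift_Suc_mono_le[of N m n] by auto
next
  case False
  then show ?thesis using assms lift_Suc_antimono_le[of N m n] by auto
qed

context cring
begin

text \<open>Concerns the middle term of \<open>Z1/B1 -> Z2/B2 -> Z3/B3\<close>. A chain in the
  middle is controlled by its preimages in \<open>Z1\<close> and its images in \<open>Z3\<close>,
  and both become stationary. With a trivial subquotient at one end, the lemma transfers chain
  conditions along injections or surjections.\<close>

lemma exact_chain_cond:
  assumes mods: "module R L" "module R M" "module R V"
    and f: "f \<in> module_hom R L M" and g: "g \<in> module_hom R M V"
    and subs: "submod R L B1" "submod R L Z1" "submod R V B3" "submod R V Z3"
    and incl: "B1 \<subseteq> Z1" "B3 \<subseteq> Z3" "f ` B1 \<subseteq> B2" "g ` Z2 \<subseteq> Z3" 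
    and exact: "\<And>y. y \<in> Z2 \<Longrightarrow> g y \<in> B3 \<Longrightarrow> \<exists>x\<in>Z1. \<exists>b\<in>B2. y = f x \<oplus>\<^bsub>M\<^esub> b"
    and cc: "chain_cond asc R L B1 Z1" "chain_cond asc R V B3 Z3"
  shows "chain_cond asc R M B2 Z2"
  unfolding chain_cond_def
proof (intro allI impI)
  fix N :: "nat \<Rightarrow> _"
  assume N: "\<forall>n. submod R M (N n) \<and> B2 \<subseteq> N n \<and> N n \<subseteq> Z2 \<and> (if asc then N n \<subseteq> N (Suc n) else N (Suc n) \<subseteq> N n)"
  define P where "P n = {x \<in> Z1. f x \<in> N n}" for n
  define Q where "Q n = {u \<oplus>\<^bsub>V\<^esub> b | u b. u \<in> g ` N n \<and> b \<in> B3}" for n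
  have mono: "if asc then N m \<subseteq> N n else N n \<subseteq> N m" if "m \<le> n" for m n
    by (rule chain_le) (use N that in auto)
  have "\<exists>k. \<forall>n\<ge>k. P n = P k"
  proof (rule cc(1)[unfolded chain_cond_def, rule_format], intro allI conjI)
    fix n
    show "submod R L (P n)" unfolding P_def using N by (intro submod_vimage[OF mods(1,2) f subs(2)]) auto
    show "B1 \<subseteq> P n" unfolding P_def using N incl by blast
    show "P n \<subseteq> Z1" unfolding P_def by auto
    show "if asc then P n \<subseteq> P (Suc n) else P (Suc n) \<subseteq> P n" using N unfolding P_def by (cases asc) (simp_all, blast+)
  qed
  then obtain k1 where k1: "\<And>n. n \<ge> k1 \<Longrightarrow> P n = P k1" by auto
  have "\<exists>k. \<forall>n\<ge>k. Q n = Q k"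
  proof (rule cc(2)[unfolded chain_cond_def, rule_format], intro allI conjI)
    fix n
    have gN: "submod R V (g ` N n)" using N by (intro submod_image[OF mods(2,3) g]) auto
    then show "submod R V (Q n)" unfolding Q_def using subs(3) by (intro submod_sum[OF mods(3)]) auto
    show "B3 \<subseteq> Q n"
    proof
      fix b assume b: "b \<in> B3"
      then have "b = \<zero>\<^bsub>V\<^esub> \<oplus>\<^bsub>V\<^esub> b" using mods(3) submodD(2)[OF subs(3) b] by simp
      then show "b \<in> Q n" unfolding Q_def using b submodD(3)[OF gN] by blast
    qed
    show "Q n \<subseteq> Z3"
    proof
      fix q assume "q \<in> Q n"
      then obtain y b where "y \<in> N n" "b \<in> B3" "q = g y \<oplus>\<^bsub>V\<^esub> b" unfolding Q_def by auto
      then show "q \<in> Z3" using N incl submodD(4)[OF subs(4)] by blast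
    qed
    show "if asc then Q n \<subseteq> Q (Suc n) else Q (Suc n) \<subseteq> Q n"
    proof (cases asc)
      case True
      then have "N n \<subseteq> N (Suc n)" using N by auto
      then show ?thesis using True unfolding Q_def by auto
    next
      case False
      then have "N (Suc n) \<subseteq> N n" using N by auto
      then show ?thesis using False unfolding Q_def by auto
    qed
  qed
  then obtain k2 where k2: "\<And>n. n \<ge> k2 \<Longrightarrow> Q n = Q k2" by auto
  \<comment> \<open>Nested submodules with equal preimage and equal image coincide: an element of
    the larger one differs from an element of the smaller one by something that \<open>g\<close>
    sends to \<open>B3\<close>, and by exactness this comes from \<open>Z1\<close>.\<close>
  have key: "N m \<subseteq> N n" if le: "N n \<subseteq> N m" and P: "P m = P n" and Q: "Q m = Q n" for m n
  proof
    fix y assume y: "y \<in> N m"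
    have subN: "submod R M (N m)" "submod R M (N n)" using N by auto
    have yc: "y \<in> carrier M" using submodD(2)[OF subN(1) y] .
    have gy: "g y \<in> carrier V" using module_homD(1)[OF g yc] .
    have "g y \<oplus>\<^bsub>V\<^esub> \<zero>\<^bsub>V\<^esub> \<in> Q m" unfolding Q_def using y submodD(3)[OF subs(3)] by blast
    then have "g y \<in> Q n" using gy mods(3) Q by simp
    then obtain y' b where y': "y' \<in> N n" "b \<in> B3" "g y = g y' \<oplus>\<^bsub>V\<^esub> b" unfolding Q_def by auto
    have y'c: "y' \<in> carrier M" using submodD(2)[OF subN(2) y'(1)] .
    have gy': "g y' \<in> carrier V" using module_homD(1)[OF g y'c] .
    have bc: "b \<in> carrier V" using submodD(2)[OF subs(3) y'(2)] .
    have "g (y \<ominus>\<^bsub>M\<^esub> y') = b"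
      using hom_minus[OF mods(2,3) g yc y'c] y'(3) gy' bc mods(3) by (metis mod_add_minus mod_comm)
    moreover have dif: "y \<ominus>\<^bsub>M\<^esub> y' \<in> N m" using submod_minus[OF mods(2) subN(1) y] le y'(1) by blast
    moreover have "N m \<subseteq> Z2" using N by blast
    ultimately obtain x c where x: "x \<in> Z1" "c \<in> B2" "y \<ominus>\<^bsub>M\<^esub> y' = f x \<oplus>\<^bsub>M\<^esub> c"
      using exact[of "y \<ominus>\<^bsub>M\<^esub> y'"] y'(2) by blast
    have cN: "c \<in> N n" using x(2) N by auto
    have cc: "c \<in> carrier M" using submodD(2)[OF subN(2) cN] .
    have xc: "x \<in> carrier L" using submodD(2)[OF subs(2) x(1)] .
    have fxc: "f x \<in> carrier M" using module_homD(1)[OF f xc] .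
    have "f x = (y \<ominus>\<^bsub>M\<^esub> y') \<ominus>\<^bsub>M\<^esub> c" using x(3) mods(2) fxc cc by simp
    then have "f x \<in> N m" using submod_minus[OF mods(2) subN(1) dif] cN le by auto
    then have "x \<in> P n" using x(1) P unfolding P_def by auto
    then have "f x \<in> N n" unfolding P_def by auto
    then have "y \<ominus>\<^bsub>M\<^esub> y' \<in> N n" using x(3) cN submodD(4)[OF subN(2)] by simp
    then have "y \<ominus>\<^bsub>M\<^esub> y' \<oplus>\<^bsub>M\<^esub> y' \<in> N n" using y'(1) submodD(4)[OF subN(2)] by simp
    then show "y \<in> N n" using yc y'c mods(2) by simp
  qed
  have "N n = N (max k1 k2)" if "n \<ge> max k1 k2" for n
  proof -
    have "P n = P (max k1 k2)" "Q n = Q (max k1 k2)"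
      using that k1[of n] k1[of "max k1 k2"] k2[of n] k2[of "max k1 k2"] by auto
    then have "N n \<subseteq> N (max k1 k2) \<Longrightarrow> N (max k1 k2) \<subseteq> N n" "N (max k1 k2) \<subseteq> N n \<Longrightarrow> N n \<subseteq> N (max k1 k2)"
      using key[of "max k1 k2" n] key[of n "max k1 k2"] by simp_all
    then show ?thesis
      using mono[OF that] by (metis subset_antisym)
  qed
  then show "\<exists>k. \<forall>n\<ge>k. N n = N k" by blast
qed

section \<open>Quotients and transported modules\<close>

lemma image_module:
  assumes M: "module R M" and carr: "carrier N = h ` carrier M" and zero: "\<zero>\<^bsub>N\<^esub> = h \<zero>\<^bsub>M\<^esub>"
    and add: "\<And>x y. x \<in> carrier M \<Longrightarrow> y \<in> carrier M \<Longrightarrow> h x \<oplus>\<^bsub>N\<^esub> h y = h (x \<oplus>\<^bsub>M\<^esub> y)"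
    and smult: "\<And>a x. a \<in> carrier R \<Longrightarrow> x \<in> carrier M \<Longrightarrow> a \<odot>\<^bsub>N\<^esub> h x = h (a \<odot>\<^bsub>M\<^esub> x)"
  shows "module R N" "h \<in> module_hom R M N"
proof -
  show "module R N"
    by (rule moduleI')
      (auto simp: carr zero add smult M mod_assoc smult_l_add smult_r_add smult_mult smult_neg_l
        mod_comm[OF M] intro: arg_cong[of _ _ h])
  show "h \<in> module_hom R M N"
    by (rule module_homI) (auto simp: carr add smult)
qed

end

text \<open>Used in two ways. If \<open>h\<close> is injective, this renames the elements of
  \<open>M\<close>; if the fibres of \<open>h\<close> are the cosets of a submodule, it is the
  quotient. The operations are computed on preimages chosen by \<open>inv_into\<close>.\<close>

definition induced_module ::
    "('b \<Rightarrow> 'c) \<Rightarrow> ('a, 'b, 'm) module_scheme \<Rightarrow> ('a, 'c) module"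
  where "induced_module h M =
    \<lparr>carrier = h ` carrier M, monoid.mult = (\<lambda>_ _. h \<zero>\<^bsub>M\<^esub>), one = h \<zero>\<^bsub>M\<^esub>, ring.zero = h \<zero>\<^bsub>M\<^esub>,
     add = (\<lambda>u v. h (inv_into (carrier M) h u \<oplus>\<^bsub>M\<^esub> inv_into (carrier M) h v)),
     smult = (\<lambda>a u. h (a \<odot>\<^bsub>M\<^esub> inv_into (carrier M) h u))\<rparr>"

lemma carrier_induced_module [simp]: "carrier (induced_module h M) = h ` carrier M"
  and zero_induced_module [simp]: "\<zero>\<^bsub>induced_module h M\<^esub> = h \<zero>\<^bsub>M\<^esub>"
  by (simp_all add: induced_module_def)

context cring
begin

lemma induced_module:
  assumes M: "module R M" and N: "submod R M N"
    and h: "\<And>x y. x \<in> carrier M \<Longrightarrow> y \<in> carrier M \<Longrightarrow> h x = h y \<longleftrightarrow> x \<ominus>\<^bsub>M\<^esub> y \<in> N"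
  shows "module R (induced_module h M)" "h \<in> module_hom R M (induced_module h M)"
proof -
  let ?s = "\<lambda>x. inv_into (carrier M) h (h x)"
  have s: "?s x \<in> carrier M" "?s x \<ominus>\<^bsub>M\<^esub> x \<in> N" if "x \<in> carrier M" for x
  proof -
    show "?s x \<in> carrier M" using that by (simp add: inv_into_into)
    moreover have "h (?s x) = h x" using that by (simp add: f_inv_into_f)
    ultimately show "?s x \<ominus>\<^bsub>M\<^esub> x \<in> N" using h that by blast
  qed
  have add: "h x \<oplus>\<^bsub>induced_module h M\<^esub> h y = h (x \<oplus>\<^bsub>M\<^esub> y)" if "x \<in> carrier M" "y \<in> carrier M" for x y
  proof -
    have "(?s x \<oplus>\<^bsub>M\<^esub> ?s y) \<ominus>\<^bsub>M\<^esub> (x \<oplus>\<^bsub>M\<^esub> y) = (?s x \<ominus>\<^bsub>M\<^esub> x) \<oplus>\<^bsub>M\<^esub> (?s y \<ominus>\<^bsub>M\<^esub> y)"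
      using that s M by (simp add: a_minus_def mod_neg_add mod_ac)
    then show ?thesis
      using that s submodD(4)[OF N] h[of "?s x \<oplus>\<^bsub>M\<^esub> ?s y" "x \<oplus>\<^bsub>M\<^esub> y"] M
      by (simp add: induced_module_def)
  qed
  have smult: "a \<odot>\<^bsub>induced_module h M\<^esub> h x = h (a \<odot>\<^bsub>M\<^esub> x)" if "a \<in> carrier R" "x \<in> carrier M" for a x
  proof -
    have "a \<odot>\<^bsub>M\<^esub> ?s x \<ominus>\<^bsub>M\<^esub> a \<odot>\<^bsub>M\<^esub> x = a \<odot>\<^bsub>M\<^esub> (?s x \<ominus>\<^bsub>M\<^esub> x)"
      using that s M by (simp add: smult_minus_r)
    then show ?thesis
      using that s submodD(5)[OF N] h[of "a \<odot>\<^bsub>M\<^esub> ?s x" "a \<odot>\<^bsub>M\<^esub> x"] M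
      by (simp add: induced_module_def)
  qed
  show "module R (induced_module h M)" "h \<in> module_hom R M (induced_module h M)"
    using image_module[OF M carrier_induced_module zero_induced_module add smult] by auto
qed

lemma induced_module_inj:
  assumes M: "module R M" and h: "inj_on h (carrier M)"
  shows "module R (induced_module h M)" "h \<in> module_hom R M (induced_module h M)"
    "inv_into (carrier M) h \<in> module_hom R (induced_module h M) M"
proof -
  have *: "h x = h y \<longleftrightarrow> x \<ominus>\<^bsub>M\<^esub> y \<in> {\<zero>\<^bsub>M\<^esub>}" if "x \<in> carrier M" "y \<in> carrier M" for x y
    using that inj_onD[OF h] by (auto simp: mod_minus_eq_zero[OF M])
  show "module R (induced_module h M)" "h \<in> module_hom R M (induced_module h M)"
    using induced_module[OF M submod_trivial[OF M] *] by auto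
  show "inv_into (carrier M) h \<in> module_hom R (induced_module h M) M"
    by (rule module_homI) (auto simp: induced_module_def h M)
qed

text \<open>Each coset is replaced by a chosen representative, so the quotient stays in the type of
  \<open>M\<close>. A resolution takes infinitely many successive cokernels, and sets of cosets
  would raise the type each time.\<close>

lemma ex_quotient:
  fixes M :: "('a, 'x, 'm) module_scheme"
  assumes M: "module R M" and N: "submod R M N"
  obtains Q :: "('a, 'x) module" and q where "module R Q" "q \<in> module_hom R M Q"
    "q ` carrier M = carrier Q" "\<And>x. x \<in> carrier M \<Longrightarrow> q x = \<zero>\<^bsub>Q\<^esub> \<longleftrightarrow> x \<in> N"
proof -
  define rel where "rel x y \<longleftrightarrow> y \<in> carrier M \<and> x \<ominus>\<^bsub>M\<^esub> y \<in> N" for x y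
  define q where "q x = (SOME y. rel x y)" for x
  have q: "rel x (q x)" if "x \<in> carrier M" for x
    unfolding q_def by (rule someI[of _ x]) (use that M submodD(3)[OF N] in \<open>simp add: rel_def\<close>)
  have diff: "x \<ominus>\<^bsub>M\<^esub> z = (x \<ominus>\<^bsub>M\<^esub> y) \<oplus>\<^bsub>M\<^esub> (y \<ominus>\<^bsub>M\<^esub> z)" "y \<ominus>\<^bsub>M\<^esub> x = \<ominus>\<^bsub>M\<^esub> (x \<ominus>\<^bsub>M\<^esub> y)"
    if "x \<in> carrier M" "y \<in> carrier M" "z \<in> carrier M" for x y z
    using that M mod_comm[OF M, of y "\<ominus>\<^bsub>M\<^esub> x"] by (simp_all add: a_minus_def mod_assoc mod_neg_add)
  have iff: "q x = q y \<longleftrightarrow> x \<ominus>\<^bsub>M\<^esub> y \<in> N" if "x \<in> carrier M" "y \<in> carrier M" for x y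
  proof
    assume e: "q x = q y"
    have "x \<ominus>\<^bsub>M\<^esub> q x \<in> N" "y \<ominus>\<^bsub>M\<^esub> q x \<in> N" "q x \<in> carrier M"
      using q[OF that(1)] q[OF that(2)] e by (auto simp: rel_def)
    then show "x \<ominus>\<^bsub>M\<^esub> y \<in> N"
      using that diff[of x "q x" y] diff[of y "q x" x] submodD(4)[OF N] submod_neg[OF M N] by metis
  next
    assume d: "x \<ominus>\<^bsub>M\<^esub> y \<in> N"
    then have "y \<ominus>\<^bsub>M\<^esub> x \<in> N" using diff(2)[of x y x] that submod_neg[OF M N] by simp
    \<comment> \<open>Congruent elements define the same predicate, hence \<open>SOME\<close> picks
      the same representative for both.\<close>
    then have "rel x = rel y"
      using d that diff(1) submodD(4)[OF N] by (intro ext) (metis rel_def)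
    then show "q x = q y" by (simp add: q_def)
  qed
  show ?thesis
  proof (rule that)
    show "module R (induced_module q M)" "q \<in> module_hom R M (induced_module q M)"
      using induced_module[OF M N iff] by auto
    show "q ` carrier M = carrier (induced_module q M)" by simp
    show "q x = \<zero>\<^bsub>induced_module q M\<^esub> \<longleftrightarrow> x \<in> N" if "x \<in> carrier M" for x
      using iff[of x "\<zero>\<^bsub>M\<^esub>"] that M by simp
  qed
qed

lemma quotient_module:
  assumes M: "module R M" and N: "submod R M N"
  shows "module R (quotient_module M N)"
    "(\<lambda>x. N +>\<^bsub>M\<^esub> x) \<in> module_hom R M (quotient_module M N)"
    "(\<lambda>x. N +>\<^bsub>M\<^esub> x) ` carrier M = carrier (quotient_module M N)"
    "\<And>x. x \<in> carrier M \<Longrightarrow> N +>\<^bsub>M\<^esub> x = \<zero>\<^bsub>quotient_module M N\<^esub> \<longleftrightarrow> x \<in> N"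
proof -
  interpret M: abelian_group M by (rule mod_group[OF M])
  interpret N: abelian_subgroup N M
  proof (rule abelian_subgroupI3)
    show "additive_subgroup N M"
      using submodule.axioms(1) N submodule_iff_submod[OF M] by (auto simp: additive_subgroup_def)
  qed (rule M.abelian_group_axioms)
  have car: "carrier (quotient_module M N) = (\<lambda>x. N +>\<^bsub>M\<^esub> x) ` carrier M"
    by (auto simp: quotient_module_def A_RCOSETS_def' a_r_coset_def)
  have zero: "\<zero>\<^bsub>quotient_module M N\<^esub> = N +>\<^bsub>M\<^esub> \<zero>\<^bsub>M\<^esub>"
    using M.a_coset_add_zero[OF submodD(1)[OF N]] by (simp add: quotient_module_def)
  have add: "(N +>\<^bsub>M\<^esub> x) \<oplus>\<^bsub>quotient_module M N\<^esub> (N +>\<^bsub>M\<^esub> y) = N +>\<^bsub>M\<^esub> (x \<oplus>\<^bsub>M\<^esub> y)"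
    if "x \<in> carrier M" "y \<in> carrier M" for x y
    using that N.a_rcos_sum by (simp add: quotient_module_def)
  have smult: "a \<odot>\<^bsub>quotient_module M N\<^esub> (N +>\<^bsub>M\<^esub> x) = N +>\<^bsub>M\<^esub> (a \<odot>\<^bsub>M\<^esub> x)"
    if a: "a \<in> carrier R" and x: "x \<in> carrier M" for a x
  proof -
    \<comment> \<open>The scalar multiple of a coset is defined as a union over its members; every
      member contributes the same coset.\<close>
    have const: "N +>\<^bsub>M\<^esub> (a \<odot>\<^bsub>M\<^esub> y) = N +>\<^bsub>M\<^esub> (a \<odot>\<^bsub>M\<^esub> x)" if y: "y \<in> N +>\<^bsub>M\<^esub> x" for y
    proof -
      obtain n where n: "n \<in> N" "y = n \<oplus>\<^bsub>M\<^esub> x" using y by (auto simp: a_r_coset_def')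
      have nc: "n \<in> carrier M" using submodD(2)[OF N n(1)] .
      have "a \<odot>\<^bsub>M\<^esub> y = a \<odot>\<^bsub>M\<^esub> n \<oplus>\<^bsub>M\<^esub> a \<odot>\<^bsub>M\<^esub> x"
        using n nc a x M by (simp add: smult_r_add)
      then have "a \<odot>\<^bsub>M\<^esub> y \<in> N +>\<^bsub>M\<^esub> (a \<odot>\<^bsub>M\<^esub> x)"
        using submodD(5)[OF N a n(1)] by (auto simp: a_r_coset_def')
      then show ?thesis using N.a_repr_independence'[of "a \<odot>\<^bsub>M\<^esub> y" "a \<odot>\<^bsub>M\<^esub> x"] a x M by simp
    qed
    have "N +>\<^bsub>M\<^esub> x \<noteq> {}" using x N.a_rcos_self by blast
    then have "(\<Union>y\<in>N +>\<^bsub>M\<^esub> x. N +>\<^bsub>M\<^esub> (a \<odot>\<^bsub>M\<^esub> y)) = N +>\<^bsub>M\<^esub> (a \<odot>\<^bsub>M\<^esub> x)"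
      by (rule SUP_eq_const[OF _ const])
    then show ?thesis by (simp add: quotient_module_def)
  qed
  show "module R (quotient_module M N)" "(\<lambda>x. N +>\<^bsub>M\<^esub> x) \<in> module_hom R M (quotient_module M N)"
    using image_module[OF M car zero add smult] by auto
  show "(\<lambda>x. N +>\<^bsub>M\<^esub> x) ` carrier M = carrier (quotient_module M N)" by (simp add: car)
  show "N +>\<^bsub>M\<^esub> x = \<zero>\<^bsub>quotient_module M N\<^esub> \<longleftrightarrow> x \<in> N" if "x \<in> carrier M" for x
    using that by (metis N.a_rcos_const N.a_rcos_self quotient_module_def ring.simps(1))
qed

section \<open>Noetherian and Artinian modules\<close>

lemma smult_hom: "module R M \<Longrightarrow> a \<in> carrier R \<Longrightarrow> (\<lambda>x. a \<odot>\<^bsub>M\<^esub> x) \<in> module_hom R M M"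
  by (rule module_homI) (simp_all add: smult_r_add smult_lcomm)

lemma id_hom: "(\<lambda>x. x) \<in> module_hom R M M"
  by (rule module_homI) simp_all

lemma zero_hom: "module R N \<Longrightarrow> (\<lambda>x. \<zero>\<^bsub>N\<^esub>) \<in> module_hom R M N"
  by (rule module_homI) simp_all

end

definition regular_module :: "('a, 'r) ring_scheme \<Rightarrow> ('a, 'a) module"
  where "regular_module R = \<lparr>carrier = carrier R, monoid.mult = monoid.mult R, one = \<one>\<^bsub>R\<^esub>, ring.zero = \<zero>\<^bsub>R\<^esub>,
    add = add R, smult = monoid.mult R\<rparr>"

lemma regular_module_simps [simp]:
  "carrier (regular_module R) = carrier R" "\<zero>\<^bsub>regular_module R\<^esub> = \<zero>\<^bsub>R\<^esub>"
  "a \<oplus>\<^bsub>regular_module R\<^esub> b = a \<oplus>\<^bsub>R\<^esub> b" "a \<odot>\<^bsub>regular_module R\<^esub> b = a \<otimes>\<^bsub>R\<^esub> b"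
  by (simp_all add: regular_module_def)

context cring
begin

lemma regular_module [simp]: "module R (regular_module R)"
  by (rule moduleI') (auto simp: a_ac m_assoc l_distr r_distr l_minus r_neg)

lemma smult_hom': "module R M \<Longrightarrow> x \<in> carrier M \<Longrightarrow> (\<lambda>a. a \<odot>\<^bsub>M\<^esub> x) \<in> module_hom R (regular_module R) M"
  by (rule module_homI) (simp_all add: smult_l_add smult_mult)

lemma submod_regular: "submod R (regular_module R) I \<longleftrightarrow> ideal I R"
proof
  assume I: "submod R (regular_module R) I"
  show "ideal I R"
  proof (rule idealI)
    show "subgroup I (add_monoid R)"
    proof (rule add.subgroupI)
      show "I \<subseteq> carrier R" using submodD(1)[OF I] by simp
      then show "\<ominus> a \<in> I" if "a \<in> I" for a using submodD(5)[OF I, of "\<ominus> \<one>" a] that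
        by (auto simp: l_minus)
    qed (use submodD(3,4)[OF I] in auto)
    fix a x assume "a \<in> I" "x \<in> carrier R"
    then show "x \<otimes> a \<in> I" "a \<otimes> x \<in> I"
      using submodD(2,5)[OF I] m_comm[of a x] by simp_all
  qed (rule ring_axioms)
next
  assume I: "ideal I R"
  interpret ideal I R by (rule I)
  show "submod R (regular_module R) I"
    by (rule submodI) (auto simp: I_l_closed)
qed

lemma noetherian_chain_cond:
  assumes "noetherian_ring R"
  shows "chain_cond True R (regular_module R) {\<zero>} (carrier R)"
  unfolding chain_cond_def
proof (intro allI impI)
  fix N assume N: "\<forall>n. submod R (regular_module R) (N n) \<and> {\<zero>} \<subseteq> N n \<and> N n \<subseteq> carrier R \<and>
    (if True then N n \<subseteq> N (Suc n) else N (Suc n) \<subseteq> N n)"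
  have mono: "N m \<subseteq> N n" if "m \<le> n" for m n using lift_Suc_mono_le[of N m n] N that by auto
  have "\<Union>(range N) \<in> range N"
  proof (rule noetherian_ring.ideal_chain_is_trivial[OF assms])
    show "subset.chain {I. ideal I R} (range N)"
      unfolding subset_chain_def using N mono by (auto simp: submod_regular) (metis nle_le subsetD)
  qed simp
  then obtain k where "\<Union>(range N) = N k" by blast
  then have "\<forall>n\<ge>k. N n = N k" using mono by blast
  then show "\<exists>k. \<forall>n\<ge>k. N n = N k" by blast
qed

lemma chain_cond_trivial: "chain_cond asc R M B B"
  unfolding chain_cond_def by (metis subset_antisym)

lemma chain_cond_extension:
  assumes M: "module R M" and N: "submod R M N" "submod R M Z" "submod R M Z'" "N \<subseteq> Z" "Z \<subseteq> Z'"
    and cc: "chain_cond asc R M N Z" "chain_cond asc R M Z Z'"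
  shows "chain_cond asc R M N Z'"
proof (rule exact_chain_cond[OF M M M id_hom id_hom _ _ _ _ _ _ _ _ _ cc])
  fix y assume "y \<in> Z'" "y \<in> Z"
  then show "\<exists>x\<in>Z. \<exists>b\<in>N. y = x \<oplus>\<^bsub>M\<^esub> b"
    using M submodD(2)[OF N(2)] submodD(3)[OF N(1)] by (metis mod_r_zero)
qed (use N in auto)

text \<open>Generators are added one at a time: for a new generator \<open>x\<close>, the map
  \<open>a \<mapsto> a x\<close> sends \<open>R/J\<close> onto the quotient of the enlarged
  submodule by the old one.\<close>

lemma chain_cond_fin_gen:
  assumes M: "module R M" and N: "submod R M N" and J: "ideal J R"
    and cc: "chain_cond asc R (regular_module R) J (carrier R)"
    and "finite S" "S \<subseteq> carrier M" "\<And>a x. a \<in> J \<Longrightarrow> x \<in> S \<Longrightarrow> a \<odot>\<^bsub>M\<^esub> x \<in> N"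
  shows "\<exists>Z. submod R M Z \<and> N \<subseteq> Z \<and> S \<subseteq> Z \<and> chain_cond asc R M N Z"
  using assms(5-7)
proof (induction S rule: finite_induct)
  case empty
  then show ?case using N chain_cond_trivial by auto
next
  case (insert x S)
  then obtain Z where Z: "submod R M Z" "N \<subseteq> Z" "S \<subseteq> Z" "chain_cond asc R M N Z" by auto
  have x: "x \<in> carrier M" using insert by auto
  let ?R = "regular_module R"
  define Rx where "Rx = (\<lambda>a. a \<odot>\<^bsub>M\<^esub> x) ` carrier R"
  have Rx: "submod R M Rx"
    unfolding Rx_def using submod_image[OF _ M smult_hom'[OF M x] submod_carrier] by simp
  define Z' where "Z' = {u \<oplus>\<^bsub>M\<^esub> z | u z. u \<in> Rx \<and> z \<in> Z}"
  have Z': "submod R M Z'" unfolding Z'_def using submod_sum[OF M Rx Z(1)] .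
  have "Z \<subseteq> Z'"
  proof
    fix z assume "z \<in> Z"
    then have "z = \<zero>\<^bsub>M\<^esub> \<oplus>\<^bsub>M\<^esub> z" using submodD(2)[OF Z(1)] M by simp
    then show "z \<in> Z'" unfolding Z'_def using submodD(3)[OF Rx] \<open>z \<in> Z\<close> by blast
  qed
  moreover have "x \<in> Z'"
  proof -
    have "x = \<one> \<odot>\<^bsub>M\<^esub> x \<oplus>\<^bsub>M\<^esub> \<zero>\<^bsub>M\<^esub>" using x M by simp
    then show ?thesis unfolding Z'_def Rx_def using submodD(3)[OF Z(1)] by blast
  qed
  moreover have "chain_cond asc R M N Z'"
  proof (rule chain_cond_extension[OF M N Z(1) Z' Z(2) \<open>Z \<subseteq> Z'\<close> Z(4)])
    show "chain_cond asc R M Z Z'"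
    proof (rule exact_chain_cond[OF _ M M smult_hom'[OF M x] zero_hom[OF M] _ _ submod_trivial[OF M]
          submod_trivial[OF M] _ _ _ _ _ cc chain_cond_trivial])
      show "(\<lambda>a. a \<odot>\<^bsub>M\<^esub> x) ` J \<subseteq> Z" using insert.prems(2)[of _ x] Z(2) by auto
      fix y assume "y \<in> Z'"
      then show "\<exists>a\<in>carrier R. \<exists>b\<in>Z. y = a \<odot>\<^bsub>M\<^esub> x \<oplus>\<^bsub>M\<^esub> b"
        unfolding Z'_def Rx_def by blast
    qed (use J ideal.Icarr[OF J] submod_carrier[OF regular_module] in \<open>auto simp: submod_regular\<close>)
  qed
  ultimately show ?case using Z' Z by blast
qed

text \<open>The quotient \<open>M/N\<close> is a finitely generated module over \<open>R/J\<close>.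
  With \<open>J\<close> zero and ascending chains this says that finitely generated modules over a
  Noetherian ring are Noetherian; with descending chains it yields Artinian quotients.\<close>

lemma chain_cond_finitely_generated:
  assumes M: "finitely_generated_module R M" and N: "submod R M N" and J: "ideal J R"
    and cc: "chain_cond asc R (regular_module R) J (carrier R)"
    and ann: "\<And>a x. a \<in> J \<Longrightarrow> x \<in> carrier M \<Longrightarrow> a \<odot>\<^bsub>M\<^esub> x \<in> N"
  shows "chain_cond asc R M N (carrier M)"
proof -
  have M': "module R M" using M by (simp add: finitely_generated_module_def)
  obtain S where S: "finite S" "S \<subseteq> carrier M" "\<Inter>{N. submodule N R M \<and> S \<subseteq> N} = carrier M"
    using M by (auto simp: finitely_generated_module_def)
  obtain Z where Z: "submod R M Z" "N \<subseteq> Z" "S \<subseteq> Z" "chain_cond asc R M N Z"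
    using chain_cond_fin_gen[OF M' N J cc S(1,2)] ann S(2) by blast
  have "carrier M \<subseteq> Z" using S(3) Z(1,3) submodule_iff_submod[OF M'] by blast
  then have "Z = carrier M" using submodD(1)[OF Z(1)] by auto
  then show ?thesis using Z by simp
qed

text \<open>The shape of the ascending chain condition that drives Noetherian induction: strictly
  larger submodules count as smaller.\<close>

lemma submod_wf:
  assumes "module R M" "chain_cond True R M {\<zero>\<^bsub>M\<^esub>} (carrier M)"
  shows "wf {(N', N). submod R M N' \<and> submod R M N \<and> N \<subset> N'}"
proof (rule ccontr)
  assume "\<not> ?thesis"
  then obtain N where "\<forall>n. (N (Suc n), N n) \<in> {(N', N). submod R M N' \<and> submod R M N \<and> N \<subset> N'}"
    unfolding wf_iff_no_infinite_down_chain by blast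
  then have N: "submod R M (N (Suc n)) \<and> submod R M (N n) \<and> N n \<subset> N (Suc n)" for n by auto
  then have "\<forall>n. submod R M (N n) \<and> {\<zero>\<^bsub>M\<^esub>} \<subseteq> N n \<and> N n \<subseteq> carrier M \<and>
      (if True then N n \<subseteq> N (Suc n) else N (Suc n) \<subseteq> N n)"
    using submodD(1,3)[of R M "N _"] by auto
  then obtain k where "\<forall>n\<ge>k. N n = N k" using assms(2) unfolding chain_cond_def by blast
  then show False using N[of k] by (metis le_add2 plus_1_eq_Suc psubset_eq)
qed

text \<open>The case of a principal ideal of a theorem of Melkersson. The chains
  \<open>x\<^sup>m N\<^sub>k \<inter> (0 :\<^sub>Z x)\<close> (relative to \<open>B\<close>) control the chain \<open>N\<^sub>k\<close>.\<close>

lemma torsion_artinian: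
  assumes M: "module R M" and B: "submod R M B" and Z: "submod R M Z" and x: "x \<in> carrier R"
    and tors: "\<And>z. z \<in> Z \<Longrightarrow> \<exists>n::nat. (x [^] n) \<odot>\<^bsub>M\<^esub> z \<in> B"
    and cc: "chain_cond False R M B {z \<in> Z. x \<odot>\<^bsub>M\<^esub> z \<in> B}"
  shows "chain_cond False R M B Z"
  unfolding chain_cond_def
proof (intro allI impI)
  fix N :: "nat \<Rightarrow> _"
  assume N: "\<forall>n. submod R M (N n) \<and> B \<subseteq> N n \<and> N n \<subseteq> Z \<and> (if False then N n \<subseteq> N (Suc n) else N (Suc n) \<subseteq> N n)"
  have anti: "N n \<subseteq> N m" if "m \<le> n" for m n using chain_le[of False N m n] N that by auto
  have pow: "x [^] n \<in> carrier R" for n :: nat using x by simp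
  have NS: "submod R M (N n)" "B \<subseteq> N n" "N n \<subseteq> Z" "N n \<subseteq> carrier M" for n using N submodD(1)[of R M "N n"] by auto
  have Bc: "B \<subseteq> carrier M" using submodD(1)[OF B] .
  \<comment> \<open>\<open>A k m\<close> consists, up to \<open>B\<close>, of the multiples
    \<open>x^m y\<close> with \<open>y\<close> in \<open>N k\<close> and \<open>x^(m+1) y\<close> in
    \<open>B\<close>. It decreases in \<open>k\<close> and in \<open>m\<close>, and it lies in the
    subquotient to which \<open>cc\<close> applies.\<close>
  define C where "C k m = {y \<in> N k. (x [^] Suc m) \<odot>\<^bsub>M\<^esub> y \<in> B}" for k m
  define A where "A k m = {u \<oplus>\<^bsub>M\<^esub> b | u b. u \<in> (\<lambda>y. (x [^] m) \<odot>\<^bsub>M\<^esub> y) ` C k m \<and> b \<in> B}" for k m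
  have subC: "submod R M (C k m)" for k m
    unfolding C_def using N by (intro submod_vimage[OF M M smult_hom[OF M pow] _ B]) auto
  have subA: "submod R M (A k m)" for k m
    unfolding A_def by (rule submod_sum[OF M submod_image[OF M M smult_hom[OF M pow] subC] B])
  have A1: "A k' m \<subseteq> A k m" if "k \<le> k'" for k k' m
  proof -
    have "C k' m \<subseteq> C k m" using anti[OF that] by (auto simp: C_def)
    then show ?thesis unfolding A_def by blast
  qed
  have A2': "A k (Suc m) \<subseteq> A k m" for k m
  proof
    fix v assume "v \<in> A k (Suc m)"
    then obtain y b where y: "y \<in> N k" "(x [^] Suc (Suc m)) \<odot>\<^bsub>M\<^esub> y \<in> B" "b \<in> B"
        "v = (x [^] Suc m) \<odot>\<^bsub>M\<^esub> y \<oplus>\<^bsub>M\<^esub> b" by (auto simp: A_def C_def)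
    have yc: "y \<in> carrier M" using y(1) NS(4) by blast
    have xy: "x \<odot>\<^bsub>M\<^esub> y \<in> N k" using submodD(5)[OF NS(1) x y(1)] .
    have e: "(x [^] Suc n) \<odot>\<^bsub>M\<^esub> y = (x [^] n) \<odot>\<^bsub>M\<^esub> (x \<odot>\<^bsub>M\<^esub> y)" for n
      using smult_mult[OF M pow x yc] by simp
    then have "v = (x [^] m) \<odot>\<^bsub>M\<^esub> (x \<odot>\<^bsub>M\<^esub> y) \<oplus>\<^bsub>M\<^esub> b" "x \<odot>\<^bsub>M\<^esub> y \<in> C k m"
      using y(2)[unfolded e] y(4)[unfolded e] xy unfolding C_def by blast+
    then show "v \<in> A k m" unfolding A_def using y(3) by blast
  qed
  have A2: "A k m' \<subseteq> A k m" if "m \<le> m'" for k m m'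
    using lift_Suc_antimono_le[of "A k", OF A2' that] .
  have stab: "\<exists>k. \<forall>n\<ge>k. D n = D k" if D: "\<And>n. \<exists>k m. D n = A k m" "\<And>n. D (Suc n) \<subseteq> D n" for D
  proof (rule cc[unfolded chain_cond_def, rule_format], intro allI conjI)
    fix n
    obtain k m where D': "D n = A k m" using D(1) by blast
    show "submod R M (D n)" using subA D' by simp
    show "B \<subseteq> D n"
    proof
      fix b assume b: "b \<in> B"
      have "\<zero>\<^bsub>M\<^esub> = (x [^] m) \<odot>\<^bsub>M\<^esub> \<zero>\<^bsub>M\<^esub>" using M pow by simp
      moreover have "b = \<zero>\<^bsub>M\<^esub> \<oplus>\<^bsub>M\<^esub> b" using b submodD(2)[OF B] M by simp
      moreover have "\<zero>\<^bsub>M\<^esub> \<in> C k m" using submodD(3)[OF subC] .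
      ultimately show "b \<in> D n" unfolding D' A_def using b by blast
    qed
    show "D n \<subseteq> {z \<in> Z. x \<odot>\<^bsub>M\<^esub> z \<in> B}"
    proof
      fix v assume "v \<in> D n"
      then obtain y b where y: "y \<in> N k" "(x [^] Suc m) \<odot>\<^bsub>M\<^esub> y \<in> B" "b \<in> B"
        "v = (x [^] m) \<odot>\<^bsub>M\<^esub> y \<oplus>\<^bsub>M\<^esub> b" unfolding D' by (auto simp: A_def C_def)
      have yc: "y \<in> carrier M" and bc: "b \<in> carrier M" using y(1,3) NS(4) Bc by blast+
      have "x \<odot>\<^bsub>M\<^esub> v = (x [^] Suc m) \<odot>\<^bsub>M\<^esub> y \<oplus>\<^bsub>M\<^esub> x \<odot>\<^bsub>M\<^esub> b"
        using y yc bc x pow M by (simp add: smult_r_add smult_mult smult_lcomm)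
      then have 1: "x \<odot>\<^bsub>M\<^esub> v \<in> B" using y(2,3) submodD(4,5)[OF B] x by simp
      have "(x [^] m) \<odot>\<^bsub>M\<^esub> y \<in> N k" "b \<in> N k" using submodD(5)[OF NS(1) pow y(1)] y(3) NS(2) by blast+
      then have "v \<in> N k" using y(4) submodD(4)[OF NS(1)] by simp
      then show "v \<in> {z \<in> Z. x \<odot>\<^bsub>M\<^esub> z \<in> B}" using 1 NS(3) by blast
    qed
    show "if False then D n \<subseteq> D (Suc n) else D (Suc n) \<subseteq> D n" using D(2) by simp
  qed
  \<comment> \<open>The diagonal settles all pairs of indices from \<open>t\<close> on; the finitely
    many \<open>m < t\<close> are settled separately in \<open>k\<close>. Together they give a bound
    \<open>K\<close> that is uniform in \<open>m\<close>.\<close>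
  have "\<exists>t. \<forall>n\<ge>t. A n n = A t t"
  proof (rule stab)
    show "\<exists>k m. A n n = A k m" for n by blast
    show "A (Suc n) (Suc n) \<subseteq> A n n" for n using A1[of n "Suc n" "Suc n"] A2'[of n n] by auto
  qed
  then obtain t where t: "\<And>n. n \<ge> t \<Longrightarrow> A n n = A t t" by blast
  have "\<exists>k. \<forall>n\<ge>k. A n m = A k m" for m
  proof (rule stab)
    show "\<exists>k m'. A n m = A k m'" for n by blast
    show "A (Suc n) m \<subseteq> A n m" for n using A1[of n "Suc n" m] by simp
  qed
  then obtain \<kappa> where \<kappa>: "\<And>m n. n \<ge> \<kappa> m \<Longrightarrow> A n m = A (\<kappa> m) m" by metis
  define K where "K = Max (insert t (\<kappa> ` {..<t}))"
  have K: "K \<ge> t" "\<And>m. m < t \<Longrightarrow> \<kappa> m \<le> K" unfolding K_def by auto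
  have AK: "A k m = A K m" if k: "k \<ge> K" for k m
  proof (cases "m < t")
    case True
    then show ?thesis using \<kappa>[of m k] \<kappa>[of m K] K(2)[OF True] k by simp
  next
    case False
    have "A l m = A t t" if l: "l \<ge> t" for l
    proof
      let ?n = "max l m"
      have "A ?n ?n \<subseteq> A l m" using A1[of l ?n ?n] A2[of m ?n l] by auto
      then show "A t t \<subseteq> A l m" using t[of ?n] l by simp
      show "A l m \<subseteq> A t t" using A1[of t l m] A2[of t m t] l False by auto
    qed
    then show ?thesis using K(1) k by simp
  qed
  \<comment> \<open>Induction on the exponent that moves \<open>y\<close> into \<open>B\<close>:
    since \<open>A K m = A k m\<close>, subtracting a suitable element of \<open>N k\<close> lowers
    this exponent by one.\<close>
  have main: "y \<in> N k" if k: "k \<ge> K" and y: "y \<in> N K" "(x [^] m) \<odot>\<^bsub>M\<^esub> y \<in> B" for k y and m :: nat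
    using y
  proof (induction m arbitrary: y)
    case 0
    have "y \<in> carrier M" using 0 NS(4) by blast
    then have "y \<in> B" using 0 M by simp
    then show ?case using NS(2) by blast
  next
    case (Suc m)
    have yc: "y \<in> carrier M" using Suc.prems(1) NS(4) by blast
    have "(x [^] m) \<odot>\<^bsub>M\<^esub> y \<oplus>\<^bsub>M\<^esub> \<zero>\<^bsub>M\<^esub> \<in> A K m"
      unfolding A_def C_def using Suc.prems submodD(3)[OF B] by blast
    then have "(x [^] m) \<odot>\<^bsub>M\<^esub> y \<in> A k m" using AK[OF k] yc M pow by simp
    then obtain y' b where y': "y' \<in> N k" "b \<in> B" "(x [^] m) \<odot>\<^bsub>M\<^esub> y = (x [^] m) \<odot>\<^bsub>M\<^esub> y' \<oplus>\<^bsub>M\<^esub> b"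
      unfolding A_def C_def by blast
    have y'c: "y' \<in> carrier M" and bc: "b \<in> carrier M" using y'(1,2) NS(4) Bc by blast+
    have "(x [^] m) \<odot>\<^bsub>M\<^esub> (y \<ominus>\<^bsub>M\<^esub> y') = b \<oplus>\<^bsub>M\<^esub> (x [^] m) \<odot>\<^bsub>M\<^esub> y' \<ominus>\<^bsub>M\<^esub> (x [^] m) \<odot>\<^bsub>M\<^esub> y'"
      using y' y'c yc bc M pow by (simp add: smult_minus_r mod_comm)
    then have "(x [^] m) \<odot>\<^bsub>M\<^esub> (y \<ominus>\<^bsub>M\<^esub> y') = b" using y'c bc M pow by simp
    moreover have "y \<ominus>\<^bsub>M\<^esub> y' \<in> N K"
      using submod_minus[OF M NS(1) Suc.prems(1)] y'(1) anti[OF k] by blast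
    ultimately have "y \<ominus>\<^bsub>M\<^esub> y' \<in> N k" using Suc.IH y'(2) by simp
    then have "y \<ominus>\<^bsub>M\<^esub> y' \<oplus>\<^bsub>M\<^esub> y' \<in> N k" using y'(1) submodD(4)[OF NS(1)] by simp
    then show ?case using yc y'c M by simp
  qed
  have "N k = N K" if k: "k \<ge> K" for k
  proof
    show "N k \<subseteq> N K" using anti[OF k] .
    show "N K \<subseteq> N k"
    proof
      fix y assume y: "y \<in> N K"
      then obtain n :: nat where "(x [^] n) \<odot>\<^bsub>M\<^esub> y \<in> B" using tors NS(3) by blast
      then show "y \<in> N k" using main[OF k y] by blast
    qed
  qed
  then show "\<exists>k. \<forall>n\<ge>k. N n = N k" by blast
qed

end

section \<open>Torsion\<close>

text \<open>Torsion with respect to an arbitrary subset \<open>S\<close> of the ring: then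
  \<open>\<Gamma>\<^sub>S \<inter> \<Gamma>\<^sub>T = \<Gamma>\<^bsub>S \<union> T\<^esub>\<close> holds trivially, and sums of ideals are not needed.\<close>

definition torsion :: "('a, 'r) ring_scheme \<Rightarrow> 'a set \<Rightarrow> ('a, 'b, 'm) module_scheme \<Rightarrow> 'b set"
  where "torsion R S M = {x \<in> carrier M. \<forall>a\<in>S. \<exists>n::nat. (a [^]\<^bsub>R\<^esub> n) \<odot>\<^bsub>M\<^esub> x = \<zero>\<^bsub>M\<^esub>}"

context cring
begin

lemma torsion_empty [simp]: "torsion R {} M = carrier M"
  by (simp add: torsion_def)

lemma torsion_subset: "torsion R S M \<subseteq> carrier M"
  by (auto simp: torsion_def)

lemma torsion_carrier: "x \<in> torsion R S M \<Longrightarrow> x \<in> carrier M"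
  by (simp add: torsion_def)

lemma torsion_restrict: "torsion R S (M\<lparr>carrier := torsion R T M\<rparr>) = torsion R (S \<union> T) M"
  by (auto simp: torsion_def)

lemma pow_smult_zero_mono:
  assumes "module R M" "x \<in> carrier M" "a \<in> carrier R" "(a [^] (n::nat)) \<odot>\<^bsub>M\<^esub> x = \<zero>\<^bsub>M\<^esub>" "n \<le> m"
  shows "(a [^] m) \<odot>\<^bsub>M\<^esub> x = \<zero>\<^bsub>M\<^esub>"
proof -
  have "a [^] m = a [^] (m - n) \<otimes> a [^] n"
    using assms(3,5) by (simp add: nat_pow_mult)
  then show ?thesis using assms by (simp add: smult_mult)
qed

lemma submod_torsion:
  assumes "module R M" "S \<subseteq> carrier R"
  shows "submod R M (torsion R S M)"
proof (rule submodI)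
  show "\<zero>\<^bsub>M\<^esub> \<in> torsion R S M" using assms by (auto simp: torsion_def intro!: exI[of _ 0])
next
  fix x y assume x: "x \<in> torsion R S M" and y: "y \<in> torsion R S M"
  show "x \<oplus>\<^bsub>M\<^esub> y \<in> torsion R S M"
    unfolding torsion_def
  proof (intro CollectI conjI ballI)
    show "x \<oplus>\<^bsub>M\<^esub> y \<in> carrier M" using x y assms by (simp add: torsion_def)
    fix a assume a: "a \<in> S"
    then have a': "a \<in> carrier R" using assms by auto
    obtain n m :: nat where "(a [^] n) \<odot>\<^bsub>M\<^esub> x = \<zero>\<^bsub>M\<^esub>" "(a [^] m) \<odot>\<^bsub>M\<^esub> y = \<zero>\<^bsub>M\<^esub>"
      using x y a unfolding torsion_def by blast
    then have "(a [^] max n m) \<odot>\<^bsub>M\<^esub> x = \<zero>\<^bsub>M\<^esub>" "(a [^] max n m) \<odot>\<^bsub>M\<^esub> y = \<zero>\<^bsub>M\<^esub>"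
      using pow_smult_zero_mono[OF assms(1) _ a'] x y by (auto simp: torsion_def)
    then have "(a [^] max n m) \<odot>\<^bsub>M\<^esub> (x \<oplus>\<^bsub>M\<^esub> y) = \<zero>\<^bsub>M\<^esub>"
      using x y assms a' by (simp add: torsion_def smult_r_add)
    then show "\<exists>n::nat. (a [^] n) \<odot>\<^bsub>M\<^esub> (x \<oplus>\<^bsub>M\<^esub> y) = \<zero>\<^bsub>M\<^esub>" by blast
  qed
next
  fix r x assume r: "r \<in> carrier R" and x: "x \<in> torsion R S M"
  show "r \<odot>\<^bsub>M\<^esub> x \<in> torsion R S M"
    unfolding torsion_def
  proof (intro CollectI conjI ballI)
    show "r \<odot>\<^bsub>M\<^esub> x \<in> carrier M" using x r assms by (simp add: torsion_def)
    fix a assume a: "a \<in> S"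
    then have a': "a \<in> carrier R" using assms by auto
    obtain n :: nat where "(a [^] n) \<odot>\<^bsub>M\<^esub> x = \<zero>\<^bsub>M\<^esub>"
      using x a unfolding torsion_def by blast
    then have "(a [^] n) \<odot>\<^bsub>M\<^esub> (r \<odot>\<^bsub>M\<^esub> x) = \<zero>\<^bsub>M\<^esub>"
      using smult_lcomm[OF assms(1), of "a [^] n" r x] x r assms(1) a' by (simp add: torsion_def)
    then show "\<exists>n::nat. (a [^] n) \<odot>\<^bsub>M\<^esub> (r \<odot>\<^bsub>M\<^esub> x) = \<zero>\<^bsub>M\<^esub>" by blast
  qed
qed (auto simp: torsion_def)

lemma hom_torsion:
  assumes "module R M" "module R N" "h \<in> module_hom R M N" "S \<subseteq> carrier R" "x \<in> torsion R S M"
  shows "h x \<in> torsion R S N"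
  unfolding torsion_def
proof (intro CollectI conjI ballI)
  have x: "x \<in> carrier M" using assms(5) by (simp add: torsion_def)
  show "h x \<in> carrier N" using module_homD(1)[OF assms(3) x] .
  fix a assume a: "a \<in> S"
  then have a': "a \<in> carrier R" using assms(4) by auto
  obtain n :: nat where "(a [^] n) \<odot>\<^bsub>M\<^esub> x = \<zero>\<^bsub>M\<^esub>" using assms(5) a by (auto simp: torsion_def)
  then have "(a [^] n) \<odot>\<^bsub>N\<^esub> h x = \<zero>\<^bsub>N\<^esub>"
    using module_homD(3)[OF assms(3), of "a [^] n" x] a' x hom_zero[OF assms(1-3)] by simp
  then show "\<exists>n::nat. (a [^] n) \<odot>\<^bsub>N\<^esub> h x = \<zero>\<^bsub>N\<^esub>" by blast
qed

section \<open>Powers of ideals, and the agreement of the two notions of torsion\<close>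

abbreviation regmod :: "('a, 'a) module" where "regmod \<equiv> regular_module R"

abbreviation ideal_power :: "'a set \<Rightarrow> nat \<Rightarrow> 'a set"
  where "ideal_power I n \<equiv> (ideal_prod R I ^^ n) (carrier R)"

lemma ideal_power_ideal: "ideal I R \<Longrightarrow> ideal (ideal_power I n) R"
  by (induction n) (auto simp: oneideal ideal_prod_is_ideal)

lemma ideal_power_antimono:
  assumes I: "ideal I R" and "m \<le> n"
  shows "ideal_power I n \<subseteq> ideal_power I m"
proof -
  have "ideal_power I (Suc n) \<subseteq> ideal_power I n" for n
    using ideal_prod_inter[OF I ideal_power_ideal[OF I, of n]] by simp
  from lift_Suc_antimono_le[of "ideal_power I", OF this \<open>m \<le> n\<close>] show ?thesis .
qed

lemma pow_in_ideal_power: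
  assumes "ideal I R" "a \<in> I" shows "a [^] n \<in> ideal_power I n"
proof (induction n)
  case 0
  show ?case by simp
next
  case (Suc n)
  have "a \<in> carrier R" using ideal.Icarr[OF assms] .
  then have "a [^] Suc n = a \<otimes> a [^] n" by (simp add: m_comm)
  then show ?case using ideal_prod.prod[OF assms(2) Suc] by simp
qed

text \<open>Noetherian induction on \<open>J\<close>, passing to the ideals \<open>J : a\<close>.\<close>

lemma ideal_power_subset:
  assumes noeth: "noetherian_ring R" and I: "ideal I R" and J: "ideal J R"
    and rad: "\<And>a. a \<in> I \<Longrightarrow> \<exists>n::nat. a [^] n \<in> J"
  shows "\<exists>n. ideal_power I n \<subseteq> J"
proof -
  have wf: "wf {(N', N). submod R regmod N' \<and> submod R regmod N \<and> N \<subset> N'}"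
    using submod_wf[OF regular_module] noetherian_chain_cond[OF noeth] by simp
  have "ideal J R \<longrightarrow> (\<forall>a\<in>I. \<exists>n::nat. a [^] n \<in> J) \<longrightarrow> (\<exists>n. ideal_power I n \<subseteq> J)" for J
  proof (induction J rule: wf_induct_rule[OF wf])
    case (1 J)
    show ?case
    proof (intro impI)
      assume J: "ideal J R" and rad: "\<forall>a\<in>I. \<exists>n::nat. a [^] n \<in> J"
      interpret J: ideal J R by (rule J)
      \<comment> \<open>If \<open>a\<close> is not in \<open>J\<close>, the last power of
        \<open>a\<close> outside \<open>J\<close> lies in \<open>J : a\<close>. This ideal is
        therefore strictly larger, and the induction hypothesis applies to it.\<close>
      have mult: "\<exists>n. \<forall>c\<in>ideal_power I n. a \<otimes> c \<in> J" if a: "a \<in> I" for a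
      proof (cases "a \<in> J")
        case True
        then show ?thesis by (intro exI[of _ 0]) (simp add: J.I_r_closed)
      next
        case False
        have ac: "a \<in> carrier R" using ideal.Icarr[OF I a] .
        define Q where "Q = {c \<in> carrier R. a \<otimes> c \<in> J}"
        have Q: "submod R regmod Q"
          unfolding Q_def
          by (rule submodI) (use ac in \<open>simp_all add: r_distr m_lcomm[of a] J.I_l_closed\<close>)
        have JQ: "J \<subseteq> Q" unfolding Q_def using ac J.I_l_closed by auto
        define n where "n = (LEAST n::nat. a [^] n \<in> J)"
        have n: "a [^] n \<in> J" unfolding n_def by (rule LeastI_ex) (use rad a in blast)
        have "n \<noteq> 0"
        proof
          assume "n = 0"
          then have "\<one> \<in> J" using n by simp
          then show False using False J.I_r_closed[of \<one> a] ac by simp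
        qed
        then obtain m where m: "n = Suc m" by (cases n) auto
        have "a [^] m \<notin> J" using not_less_Least[of m "\<lambda>n. a [^] n \<in> J"] m unfolding n_def by simp
        moreover have "a [^] m \<in> Q" using n ac unfolding m Q_def by (simp add: m_comm)
        ultimately have "J \<subset> Q" using JQ by blast
        moreover have "\<forall>b\<in>I. \<exists>n::nat. b [^] n \<in> Q" using rad JQ by blast
        ultimately obtain k where "ideal_power I k \<subseteq> Q"
          using 1[of Q] Q J by (auto simp: submod_regular)
        then show ?thesis unfolding Q_def by blast
      qed
      \<comment> \<open>Finitely many generators of \<open>I\<close> admit a common exponent
        \<open>K\<close> such that \<open>I\<close> times \<open>I^K\<close> is contained in
        \<open>J\<close>.\<close>
      obtain A where A: "A \<subseteq> carrier R" "finite A" "I = Idl A"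
        using noetherian_ring.finetely_gen[OF noeth I] by auto
      have AI: "A \<subseteq> I" using genideal_self[OF A(1)] A(3) by simp
      obtain k where k: "\<And>a c. a \<in> I \<Longrightarrow> c \<in> ideal_power I (k a) \<Longrightarrow> a \<otimes> c \<in> J" using mult by metis
      define K where "K = Max (insert 0 (k ` A))"
      define T where "T = {a \<in> carrier R. \<forall>c\<in>ideal_power I K. a \<otimes> c \<in> J}"
      have IK: "c \<in> carrier R" if "c \<in> ideal_power I K" for c
        using ideal.Icarr[OF ideal_power_ideal[OF I] that] .
      have "submod R regmod T"
        unfolding T_def by (rule submodI) (use IK in \<open>simp_all add: l_distr m_assoc J.I_l_closed\<close>)
      moreover have "A \<subseteq> T"
      proof
        fix a assume a: "a \<in> A"
        then have "k a \<le> K" unfolding K_def using A(2) by simp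
        then have "ideal_power I K \<subseteq> ideal_power I (k a)" by (rule ideal_power_antimono[OF I])
        then show "a \<in> T" unfolding T_def using k[of a] a AI A(1) by blast
      qed
      ultimately have "I \<subseteq> T" using genideal_minimal[of T A] A(3) submod_regular by blast
      have "ideal_power I (Suc K) \<subseteq> J"
      proof
        fix x assume "x \<in> ideal_power I (Suc K)"
        then have "x \<in> ideal_prod R I (ideal_power I K)" by simp
        then show "x \<in> J"
          by (induction rule: ideal_prod.induct) (use \<open>I \<subseteq> T\<close> in \<open>auto simp: T_def\<close>)
      qed
      then show "\<exists>n. ideal_power I n \<subseteq> J" by blast
    qed
  qed
  then show ?thesis using J rad by blast
qed

text \<open>If each element of \<open>I\<close> has a power killing \<open>x\<close>, the
  annihilator of \<open>x\<close> contains a power of each element of \<open>I\<close>, and by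
  \<open>ideal_power_subset\<close> a power of \<open>I\<close> itself.\<close>

lemma torsion_part_eq:
  assumes noeth: "noetherian_ring R" and I: "ideal I R" and M: "module R M"
  shows "torsion_part R I M = torsion R I M"
proof (intro Set.set_eqI iffI)
  fix x assume "x \<in> torsion_part R I M"
  then obtain n where x: "x \<in> carrier M" "\<And>a. a \<in> ideal_power I n \<Longrightarrow> a \<odot>\<^bsub>M\<^esub> x = \<zero>\<^bsub>M\<^esub>"
    by (auto simp: torsion_part_def)
  then show "x \<in> torsion R I M" using pow_in_ideal_power[OF I] by (auto simp: torsion_def)
next
  fix x assume x: "x \<in> torsion R I M"
  then have xc: "x \<in> carrier M" by (simp add: torsion_def)
  define J where "J = {a \<in> carrier R. a \<odot>\<^bsub>M\<^esub> x = \<zero>\<^bsub>M\<^esub>}"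
  have "submod R regmod J"
    unfolding J_def by (rule submodI) (use xc M in \<open>simp_all add: smult_l_add smult_mult\<close>)
  then have J: "ideal J R" by (simp add: submod_regular)
  have "\<exists>n::nat. a [^] n \<in> J" if "a \<in> I" for a
    using x that ideal.Icarr[OF I that] by (auto simp: torsion_def J_def)
  then obtain n where "ideal_power I n \<subseteq> J" using ideal_power_subset[OF noeth I J] by blast
  then show "x \<in> torsion_part R I M" unfolding torsion_part_def J_def using xc by blast
qed

end

section \<open>Baer's criterion\<close>

text \<open>Baer's criterion taken as the definition: the test maps start at ideals of
  \<open>R\<close>, so no type of test modules enters and maps into \<open>E\<close> can be extended
  from modules of any type.\<close>

definition baer_module :: "('a, 'r) ring_scheme \<Rightarrow> ('a, 'e, 'm) module_scheme \<Rightarrow> bool"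
  where "baer_module R E \<longleftrightarrow> module R E \<and>
    (\<forall>I. \<forall>f\<in>module_hom R ((regular_module R)\<lparr>carrier := I\<rparr>) E. ideal I R \<longrightarrow>
      (\<exists>e\<in>carrier E. \<forall>a\<in>I. f a = a \<odot>\<^bsub>E\<^esub> e))"

lemma baer_module_module: "baer_module R E \<Longrightarrow> module R E"
  by (simp add: baer_module_def)

lemma baer_moduleE:
  assumes "baer_module R E" "f \<in> module_hom R ((regular_module R)\<lparr>carrier := I\<rparr>) E" "ideal I R"
  obtains x where "x \<in> carrier E" "\<And>a. a \<in> I \<Longrightarrow> f a = a \<odot>\<^bsub>E\<^esub> x"
  using assms unfolding baer_module_def by blast

context cring
begin

text \<open>Zorn's lemma on partial homomorphisms from \<open>B\<close> to \<open>E\<close>. Asking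
  that the kernel of \<open>u\<close> lie in that of \<open>v\<close>, instead of injectivity of
  \<open>u\<close>, covers at once the factorisation of maps through a differential.\<close>

lemma baer_extend:
  assumes E: "baer_module R E" and A: "module R A" and B: "module R B"
    and u: "u \<in> module_hom R A B" and v: "v \<in> module_hom R A E"
    and ker: "\<And>x. x \<in> carrier A \<Longrightarrow> u x = \<zero>\<^bsub>B\<^esub> \<Longrightarrow> v x = \<zero>\<^bsub>E\<^esub>"
  obtains w where "w \<in> module_hom R B E" "\<And>x. x \<in> carrier A \<Longrightarrow> w (u x) = v x"
proof -
  note E' = baer_module_module[OF E]
  note uD = module_homD[OF u] and vD = module_homD[OF v]
  \<comment> \<open>Partial homomorphisms are graphs, i.e. submodules of the product; such a
    submodule is single-valued as soon as it contains no \<open>(0, e)\<close> with \<open>e\<close>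
    nonzero. \<open>G0\<close> is the forced part, \<open>u x\<close> going to
    \<open>v x\<close>.\<close>
  define G0 where "G0 = (\<lambda>x. (u x, v x)) ` carrier A"
  define graph where "graph G \<longleftrightarrow> G \<subseteq> carrier B \<times> carrier E \<and> G0 \<subseteq> G \<and>
      (\<forall>x e y f. (x, e) \<in> G \<longrightarrow> (y, f) \<in> G \<longrightarrow> (x \<oplus>\<^bsub>B\<^esub> y, e \<oplus>\<^bsub>E\<^esub> f) \<in> G) \<and>
      (\<forall>a x e. a \<in> carrier R \<longrightarrow> (x, e) \<in> G \<longrightarrow> (a \<odot>\<^bsub>B\<^esub> x, a \<odot>\<^bsub>E\<^esub> e) \<in> G) \<and>
      (\<forall>e. (\<zero>\<^bsub>B\<^esub>, e) \<in> G \<longrightarrow> e = \<zero>\<^bsub>E\<^esub>)" for G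
  have G0: "graph G0"
    unfolding graph_def
  proof (intro conjI allI impI)
    show "G0 \<subseteq> carrier B \<times> carrier E" unfolding G0_def using uD(1) vD(1) by auto
    show "e = \<zero>\<^bsub>E\<^esub>" if "(\<zero>\<^bsub>B\<^esub>, e) \<in> G0" for e using that ker unfolding G0_def by auto
  next
    fix x e y f assume "(x, e) \<in> G0" "(y, f) \<in> G0"
    then obtain s t where "s \<in> carrier A" "t \<in> carrier A" "x = u s" "e = v s" "y = u t" "f = v t"
      unfolding G0_def by auto
    then show "(x \<oplus>\<^bsub>B\<^esub> y, e \<oplus>\<^bsub>E\<^esub> f) \<in> G0"
      unfolding G0_def using uD(2) vD(2) A by (intro image_eqI[of _ _ "s \<oplus>\<^bsub>A\<^esub> t"]) auto
  next
    fix a x e assume a: "a \<in> carrier R" and "(x, e) \<in> G0"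
    then obtain s where "s \<in> carrier A" "x = u s" "e = v s" unfolding G0_def by auto
    then show "(a \<odot>\<^bsub>B\<^esub> x, a \<odot>\<^bsub>E\<^esub> e) \<in> G0"
      unfolding G0_def using uD(3) vD(3) A a by (intro image_eqI[of _ _ "a \<odot>\<^bsub>A\<^esub> s"]) auto
  qed simp
  have "\<exists>G\<in>Collect graph. \<forall>G'\<in>Collect graph. G \<subseteq> G' \<longrightarrow> G' = G"
  proof (rule subset_Zorn_nonempty)
    show "Collect graph \<noteq> {}" using G0 by blast
    fix \<C> assume ne: "\<C> \<noteq> {}" and chain: "subset.chain (Collect graph) \<C>"
    have cg: "graph G" if "G \<in> \<C>" for G using chain that by (auto simp: subset_chain_def)
    have two: "\<exists>G\<in>\<C>. p \<in> G \<and> q \<in> G" if pq: "p \<in> \<Union>\<C>" "q \<in> \<Union>\<C>" for p q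
    proof -
      obtain P Q where PQ: "P \<in> \<C>" "p \<in> P" "Q \<in> \<C>" "q \<in> Q" using pq by blast
      then have "P \<subseteq> Q \<or> Q \<subseteq> P" using chain by (auto simp: subset_chain_def)
      then show ?thesis using PQ by blast
    qed
    have "graph (\<Union>\<C>)"
      unfolding graph_def
    proof (intro conjI allI impI)
      show "\<Union>\<C> \<subseteq> carrier B \<times> carrier E" using cg unfolding graph_def by blast
      show "G0 \<subseteq> \<Union>\<C>" using cg ne unfolding graph_def by blast
      show "e = \<zero>\<^bsub>E\<^esub>" if "(\<zero>\<^bsub>B\<^esub>, e) \<in> \<Union>\<C>" for e using that cg unfolding graph_def by blast
    next
      fix x e y f assume "(x, e) \<in> \<Union>\<C>" "(y, f) \<in> \<Union>\<C>"
      then obtain G where G: "G \<in> \<C>" "(x, e) \<in> G" "(y, f) \<in> G" using two by blast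
      then have "(x \<oplus>\<^bsub>B\<^esub> y, e \<oplus>\<^bsub>E\<^esub> f) \<in> G" using cg[OF G(1)] unfolding graph_def by blast
      then show "(x \<oplus>\<^bsub>B\<^esub> y, e \<oplus>\<^bsub>E\<^esub> f) \<in> \<Union>\<C>" using G(1) by blast
    next
      fix a x e assume "a \<in> carrier R" "(x, e) \<in> \<Union>\<C>"
      then show "(a \<odot>\<^bsub>B\<^esub> x, a \<odot>\<^bsub>E\<^esub> e) \<in> \<Union>\<C>" using cg unfolding graph_def by blast
    qed
    then show "\<Union>\<C> \<in> Collect graph" by simp
  qed
  then obtain G where G: "graph G" and max: "\<And>G'. graph G' \<Longrightarrow> G \<subseteq> G' \<Longrightarrow> G' = G" by blast
  have Gc: "x \<in> carrier B" "e \<in> carrier E" if "(x, e) \<in> G" for x e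
    using that G unfolding graph_def by blast+
  have Gadd: "(x \<oplus>\<^bsub>B\<^esub> y, e \<oplus>\<^bsub>E\<^esub> f) \<in> G" if "(x, e) \<in> G" "(y, f) \<in> G" for x e y f
    using that G unfolding graph_def by blast
  have Gsm: "(a \<odot>\<^bsub>B\<^esub> x, a \<odot>\<^bsub>E\<^esub> e) \<in> G" if "a \<in> carrier R" "(x, e) \<in> G" for a x e
    using that G unfolding graph_def by blast
  have Gz: "e = \<zero>\<^bsub>E\<^esub>" if "(\<zero>\<^bsub>B\<^esub>, e) \<in> G" for e using that G unfolding graph_def by blast
  have GG0: "G0 \<subseteq> G" using G unfolding graph_def by blast
  have "(u \<zero>\<^bsub>A\<^esub>, v \<zero>\<^bsub>A\<^esub>) \<in> G" using GG0 A unfolding G0_def by auto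
  then have Gzz: "(\<zero>\<^bsub>B\<^esub>, \<zero>\<^bsub>E\<^esub>) \<in> G" using hom_zero[OF A B u] hom_zero[OF A E' v] by simp
  have Gneg: "(\<ominus>\<^bsub>B\<^esub> x, \<ominus>\<^bsub>E\<^esub> e) \<in> G" if "(x, e) \<in> G" for x e
    using Gsm[of "\<ominus> \<one>", OF _ that] Gc[OF that] B E' by (simp add: smult_neg_l)
  have Gfun: "e = f" if "(x, e) \<in> G" "(x, f) \<in> G" for x e f
    using Gz[of "e \<ominus>\<^bsub>E\<^esub> f"] Gadd[OF that(1) Gneg[OF that(2)]] Gc[OF that(1)] Gc[OF that(2)] B E'
    by (simp add: a_minus_def mod_add_eq_zero)
  \<comment> \<open>A maximal graph is total: for the ideal of all \<open>r\<close> with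
    \<open>r b\<close> in the domain, Baer's criterion supplies a value \<open>e\<close> for
    \<open>b\<close>, and adding the multiples of \<open>(b, e)\<close> extends the graph.\<close>
  have dom: "\<exists>e. (b, e) \<in> G" if b: "b \<in> carrier B" for b
  proof -
    define I where "I = {r \<in> carrier R. \<exists>e. (r \<odot>\<^bsub>B\<^esub> b, e) \<in> G}"
    define f where "f r = (SOME e. (r \<odot>\<^bsub>B\<^esub> b, e) \<in> G)" for r
    have f: "(r \<odot>\<^bsub>B\<^esub> b, f r) \<in> G" if "r \<in> I" for r
      using that someI_ex[of "\<lambda>e. (r \<odot>\<^bsub>B\<^esub> b, e) \<in> G"] unfolding I_def f_def by blast
    have Ic: "r \<in> carrier R" if "r \<in> I" for r using that unfolding I_def by blast
    have fadd: "((r \<oplus> s) \<odot>\<^bsub>B\<^esub> b, f r \<oplus>\<^bsub>E\<^esub> f s) \<in> G" if "r \<in> I" "s \<in> I" for r s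
      using Gadd[OF f[OF that(1)] f[OF that(2)]] that Ic b B by (simp add: smult_l_add)
    have fsm: "((r \<otimes> s) \<odot>\<^bsub>B\<^esub> b, r \<odot>\<^bsub>E\<^esub> f s) \<in> G" if "r \<in> carrier R" "s \<in> I" for r s
      using Gsm[OF that(1) f[OF that(2)]] that Ic b B by (simp add: smult_mult)
    have I: "submod R regmod I"
    proof (rule submodI)
      show "I \<subseteq> carrier regmod" unfolding I_def by auto
      show "\<zero>\<^bsub>regmod\<^esub> \<in> I" unfolding I_def using b B Gzz by auto
      show "r \<oplus>\<^bsub>regmod\<^esub> s \<in> I" if "r \<in> I" "s \<in> I" for r s
        using fadd[OF that] Ic[OF that(1)] Ic[OF that(2)] unfolding I_def by auto
      show "r \<odot>\<^bsub>regmod\<^esub> s \<in> I" if "r \<in> carrier R" "s \<in> I" for r s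
        using fsm[OF that] that(1) Ic[OF that(2)] unfolding I_def by auto
    qed
    have fI: "r \<oplus> s \<in> I" "f (r \<oplus> s) = f r \<oplus>\<^bsub>E\<^esub> f s" if "r \<in> I" "s \<in> I" for r s
    proof -
      show 1: "r \<oplus> s \<in> I" using submodD(4)[OF I that] by simp
      show "f (r \<oplus> s) = f r \<oplus>\<^bsub>E\<^esub> f s" using Gfun[OF f[OF 1] fadd[OF that]] .
    qed
    have fI': "f (r \<otimes> s) = r \<odot>\<^bsub>E\<^esub> f s" if "r \<in> carrier R" "s \<in> I" for r s
    proof -
      have 1: "r \<otimes> s \<in> I" using submodD(5)[OF I that] by simp
      show ?thesis using Gfun[OF f[OF 1] fsm[OF that]] .
    qed
    have "f \<in> module_hom R (regmod\<lparr>carrier := I\<rparr>) E"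
      by (rule module_homI) (use Gc(2)[OF f] fI fI' in \<open>auto simp: regular_module_def\<close>)
    then obtain e where e: "e \<in> carrier E" "\<And>r. r \<in> I \<Longrightarrow> f r = r \<odot>\<^bsub>E\<^esub> e"
      using E I unfolding baer_module_def submod_regular by blast
    define G' where "G' = {(x \<oplus>\<^bsub>B\<^esub> r \<odot>\<^bsub>B\<^esub> b, g \<oplus>\<^bsub>E\<^esub> r \<odot>\<^bsub>E\<^esub> e) | x g r. (x, g) \<in> G \<and> r \<in> carrier R}"
    have GG': "G \<subseteq> G'"
    proof
      fix p assume p: "p \<in> G"
      obtain x g where xg: "p = (x, g)" by (cases p)
      then have "x \<in> carrier B" "g \<in> carrier E" using p Gc[of x g] by simp_all
      then have "(x, g) = (x \<oplus>\<^bsub>B\<^esub> \<zero> \<odot>\<^bsub>B\<^esub> b, g \<oplus>\<^bsub>E\<^esub> \<zero> \<odot>\<^bsub>E\<^esub> e)" using b e(1) B E' by simp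
      then show "p \<in> G'" unfolding G'_def using p xg zero_closed by blast
    qed
    have "graph G'"
      unfolding graph_def
    proof (intro conjI allI impI)
      show "G' \<subseteq> carrier B \<times> carrier E" unfolding G'_def using Gc b e(1) B E' by auto
      show "G0 \<subseteq> G'" using GG0 GG' by blast
    next
      fix x g y h assume "(x, g) \<in> G'" "(y, h) \<in> G'"
      then obtain x' g' r y' h' s where p: "(x', g') \<in> G" "r \<in> carrier R" "x = x' \<oplus>\<^bsub>B\<^esub> r \<odot>\<^bsub>B\<^esub> b"
          "g = g' \<oplus>\<^bsub>E\<^esub> r \<odot>\<^bsub>E\<^esub> e" and q: "(y', h') \<in> G" "s \<in> carrier R" "y = y' \<oplus>\<^bsub>B\<^esub> s \<odot>\<^bsub>B\<^esub> b"
          "h = h' \<oplus>\<^bsub>E\<^esub> s \<odot>\<^bsub>E\<^esub> e"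
        unfolding G'_def by blast
      have "x \<oplus>\<^bsub>B\<^esub> y = (x' \<oplus>\<^bsub>B\<^esub> y') \<oplus>\<^bsub>B\<^esub> (r \<oplus> s) \<odot>\<^bsub>B\<^esub> b"
        using Gc(1)[OF p(1)] Gc(1)[OF q(1)] p(2,3) q(2,3) b B by (simp add: smult_l_add mod_ac)
      moreover have "g \<oplus>\<^bsub>E\<^esub> h = (g' \<oplus>\<^bsub>E\<^esub> h') \<oplus>\<^bsub>E\<^esub> (r \<oplus> s) \<odot>\<^bsub>E\<^esub> e"
        using Gc(2)[OF p(1)] Gc(2)[OF q(1)] p(2,4) q(2,4) e(1) E' by (simp add: smult_l_add mod_ac)
      moreover have "r \<oplus> s \<in> carrier R" using p(2) q(2) by simp
      ultimately show "(x \<oplus>\<^bsub>B\<^esub> y, g \<oplus>\<^bsub>E\<^esub> h) \<in> G'"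
        unfolding G'_def using Gadd[OF p(1) q(1)] by blast
    next
      fix a x g assume a: "a \<in> carrier R" and "(x, g) \<in> G'"
      then obtain x' g' r where p: "(x', g') \<in> G" "r \<in> carrier R" "x = x' \<oplus>\<^bsub>B\<^esub> r \<odot>\<^bsub>B\<^esub> b"
          "g = g' \<oplus>\<^bsub>E\<^esub> r \<odot>\<^bsub>E\<^esub> e" unfolding G'_def by blast
      have "a \<odot>\<^bsub>B\<^esub> x = a \<odot>\<^bsub>B\<^esub> x' \<oplus>\<^bsub>B\<^esub> (a \<otimes> r) \<odot>\<^bsub>B\<^esub> b"
        using Gc(1)[OF p(1)] p(2,3) a b B by (simp add: smult_r_add smult_mult)
      moreover have "a \<odot>\<^bsub>E\<^esub> g = a \<odot>\<^bsub>E\<^esub> g' \<oplus>\<^bsub>E\<^esub> (a \<otimes> r) \<odot>\<^bsub>E\<^esub> e"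
        using Gc(2)[OF p(1)] p(2,4) a e(1) E' by (simp add: smult_r_add smult_mult)
      moreover have "a \<otimes> r \<in> carrier R" using a p(2) by simp
      ultimately show "(a \<odot>\<^bsub>B\<^esub> x, a \<odot>\<^bsub>E\<^esub> g) \<in> G'"
        unfolding G'_def using Gsm[OF a p(1)] by blast
    next
      fix g assume "(\<zero>\<^bsub>B\<^esub>, g) \<in> G'"
      then obtain x' g' r where p: "(x', g') \<in> G" "r \<in> carrier R" "\<zero>\<^bsub>B\<^esub> = x' \<oplus>\<^bsub>B\<^esub> r \<odot>\<^bsub>B\<^esub> b"
          "g = g' \<oplus>\<^bsub>E\<^esub> r \<odot>\<^bsub>E\<^esub> e" unfolding G'_def by blast
      note x' = Gc[OF p(1)]
      have rb: "r \<odot>\<^bsub>B\<^esub> b \<in> carrier B" "r \<odot>\<^bsub>E\<^esub> e \<in> carrier E" using p(2) b e(1) B E' by simp_all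
      have "x' = \<ominus>\<^bsub>B\<^esub> (r \<odot>\<^bsub>B\<^esub> b)" using p(3) mod_add_eq_zero[OF B x'(1) rb(1)] by simp
      then have "(r \<odot>\<^bsub>B\<^esub> b, \<ominus>\<^bsub>E\<^esub> g') \<in> G" using Gneg[OF p(1)] rb B by simp
      moreover from this have rI: "r \<in> I" unfolding I_def using p(2) by blast
      ultimately have "\<ominus>\<^bsub>E\<^esub> g' = r \<odot>\<^bsub>E\<^esub> e" using Gfun f[OF rI] e(2)[OF rI] by metis
      then have "r \<odot>\<^bsub>E\<^esub> e = \<ominus>\<^bsub>E\<^esub> g'" by simp
      then show "g = \<zero>\<^bsub>E\<^esub>" using p(4) x' E' by simp
    qed
    then have "G' = G" using max GG' by blast
    moreover have "(\<zero>\<^bsub>B\<^esub> \<oplus>\<^bsub>B\<^esub> \<one> \<odot>\<^bsub>B\<^esub> b, \<zero>\<^bsub>E\<^esub> \<oplus>\<^bsub>E\<^esub> \<one> \<odot>\<^bsub>E\<^esub> e) \<in> G'"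
      unfolding G'_def using Gzz by blast
    ultimately show ?thesis using b B by auto
  qed
  define w where "w b = (SOME e. (b, e) \<in> G)" for b
  have w: "(b, w b) \<in> G" if "b \<in> carrier B" for b
    unfolding w_def using someI_ex[OF dom[OF that]] .
  show ?thesis
  proof (rule that[of w])
    show "w \<in> module_hom R B E"
    proof (rule module_homI)
      show "w x \<in> carrier E" if "x \<in> carrier B" for x using Gc(2)[OF w[OF that]] .
      show "w (x \<oplus>\<^bsub>B\<^esub> y) = w x \<oplus>\<^bsub>E\<^esub> w y" if "x \<in> carrier B" "y \<in> carrier B" for x y
        using Gfun[OF w[of "x \<oplus>\<^bsub>B\<^esub> y"] Gadd[OF w[OF that(1)] w[OF that(2)]]] that B by simp
      show "w (a \<odot>\<^bsub>B\<^esub> x) = a \<odot>\<^bsub>E\<^esub> w x" if "a \<in> carrier R" "x \<in> carrier B" for a x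
        using Gfun[OF w[of "a \<odot>\<^bsub>B\<^esub> x"] Gsm[OF that(1) w[OF that(2)]]] that B by simp
    qed
    show "w (u x) = v x" if "x \<in> carrier A" for x
    proof -
      have "(u x, v x) \<in> G" using GG0 that unfolding G0_def by blast
      then show ?thesis using Gfun[OF w[OF uD(1)[OF that]]] by blast
    qed
  qed
qed

text \<open>Forward, the inclusion of an ideal into \<open>R\<close> is copied by \<open>Inl\<close>
  into the test type, and the extension evaluated at one gives the required element. Backward,
  \<open>baer_extend\<close> applies.\<close>

lemma injective_module_iff_baer:
  fixes E :: "('a, 'e, 'm) module_scheme"
  shows "injective_module R E \<longleftrightarrow> baer_module R E"
proof
  assume inj: "injective_module R E"
  then have E: "module R E" by (simp add: injective_module_def)
  show "baer_module R E"
    unfolding baer_module_def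
  proof (intro conjI allI ballI impI E)
    fix I f assume f: "f \<in> module_hom R (regmod\<lparr>carrier := I\<rparr>) E" and I: "ideal I R"
    have I': "submod R regmod I" using I by (simp add: submod_regular)
    let ?I = "regmod\<lparr>carrier := I\<rparr>"
    let ?l = "Inl :: 'a \<Rightarrow> 'a + 'e"
    let ?A = "induced_module ?l ?I" and ?B = "induced_module ?l regmod"
    let ?k = "inv_into (carrier ?I) ?l"
    have mI: "module R ?I" using submod_module[OF regular_module I'] .
    note A = induced_module_inj[OF mI, of ?l, simplified] and B = induced_module_inj[OF regular_module, of ?l, simplified]
    have k: "?k (Inl a) = a" if "a \<in> I" for a using that by (simp add: inv_into_f_f)
    have incl: "(\<lambda>x. x) \<in> module_hom R ?I regmod" by (rule module_homI) (use submodD(1)[OF I'] in auto)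
    have g: "(\<lambda>x. ?l (?k x)) \<in> module_hom R ?A ?B"
      using module_hom_comp[OF module_hom_comp[OF A(3) incl] B(2)] by simp
    have "inj_on (\<lambda>x. ?l (?k x)) (carrier ?A)" using k by (auto simp: inj_on_def)
    moreover have "(\<lambda>x. f (?k x)) \<in> module_hom R ?A E" using module_hom_comp[OF A(3) f] by simp
    ultimately obtain h where h: "h \<in> module_hom R ?B E" "\<And>a. a \<in> I \<Longrightarrow> h (?l a) = f a"
      using inj[unfolded injective_module_def, THEN conjunct2, rule_format,
          of ?A ?B "\<lambda>x. ?l (?k x)" "\<lambda>x. f (?k x)"] A(1) B(1) g by auto
    have hl: "(\<lambda>a. h (?l a)) \<in> module_hom R regmod E" by (rule module_hom_comp[OF B(2) h(1)])
    show "\<exists>e\<in>carrier E. \<forall>a\<in>I. f a = a \<odot>\<^bsub>E\<^esub> e"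
    proof (intro bexI[of _ "h (?l \<one>)"] ballI)
      fix a assume a: "a \<in> I"
      then have ac: "a \<in> carrier R" using submodD(2)[OF I' a] by simp
      have "f a = h (?l a)" using h(2)[OF a] by simp
      also have "\<dots> = h (?l (a \<odot>\<^bsub>regmod\<^esub> \<one>))" using ac by simp
      also have "\<dots> = a \<odot>\<^bsub>E\<^esub> h (?l \<one>)" using module_homD(3)[OF hl ac, of \<one>] by simp
      finally show "f a = a \<odot>\<^bsub>E\<^esub> h (?l \<one>)" .
    qed (use module_homD(1)[OF hl] in simp)
  qed
next
  assume E: "baer_module R E"
  show "injective_module R E"
    unfolding injective_module_def
  proof (intro conjI allI impI)
    show "module R E" using baer_module_module[OF E] .
    fix A B :: "('a, 'a + 'e) module" and g f
    assume *: "module R A \<and> module R B \<and> g \<in> module_hom R A B \<and> inj_on g (carrier A) \<and> f \<in> module_hom R A E"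
    have "f x = \<zero>\<^bsub>E\<^esub>" if "x \<in> carrier A" "g x = \<zero>\<^bsub>B\<^esub>" for x
    proof -
      have "x = \<zero>\<^bsub>A\<^esub>"
        using * that hom_zero[of A B g] inj_onD[of g "carrier A" x "\<zero>\<^bsub>A\<^esub>"] by simp
      then show ?thesis using hom_zero[of A E f] * baer_module_module[OF E] by simp
    qed
    then show "\<exists>h\<in>module_hom R B E. \<forall>x\<in>carrier A. h (g x) = f x"
      using baer_extend[OF E, of A B g f] * by metis
  qed
qed

text \<open>Instead of the Artin--Rees lemma: choose an ideal \<open>L\<close> maximal subject to
  \<open>L \<inter> I = ker f\<close>; then \<open>L\<close> contains a power of every element of \<open>S\<close>, and \<open>f\<close>
  extends to a homomorphism that vanishes on \<open>L\<close>.\<close>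

lemma baer_torsion:
  assumes noeth: "noetherian_ring R" and E: "baer_module R E" and S: "S \<subseteq> carrier R"
  shows "baer_module R (E\<lparr>carrier := torsion R S E\<rparr>)"
  unfolding baer_module_def
proof (intro conjI allI ballI impI)
  let ?T = "E\<lparr>carrier := torsion R S E\<rparr>"
  note E' = baer_module_module[OF E]
  show "module R ?T" using submod_module[OF E' submod_torsion[OF E' S]] .
  fix I f assume f: "f \<in> module_hom R (regmod\<lparr>carrier := I\<rparr>) ?T" and I: "ideal I R"
  have I': "submod R regmod I" using I by (simp add: submod_regular)
  have mI: "module R (regmod\<lparr>carrier := I\<rparr>)" using submod_module[OF regular_module I'] .
  have fE: "f \<in> module_hom R (regmod\<lparr>carrier := I\<rparr>) E"
    by (rule module_homI) (use module_homD[OF f] subsetD[OF torsion_subset[of S E]] in auto)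
  have Ic: "r \<in> carrier R" if "r \<in> I" for r using submodD(2)[OF I' that] by simp
  have Im: "r \<otimes> s \<in> I" if "r \<in> carrier R" "s \<in> I" for r s using submodD(5)[OF I' that] by simp
  have ft: "f r \<in> torsion R S E" if "r \<in> I" for r using module_homD(1)[OF f] that by simp
  have fm: "f (r \<otimes> s) = r \<odot>\<^bsub>E\<^esub> f s" if "r \<in> carrier R" "s \<in> I" for r s
    using module_homD(3)[OF fE that(1)] that(2) by simp
  define K where "K = {r \<in> I. f r = \<zero>\<^bsub>E\<^esub>}"
  have fa: "f (r \<oplus> s) = f r \<oplus>\<^bsub>E\<^esub> f s" if "r \<in> I" "s \<in> I" for r s
    using module_homD(2)[OF fE, of r s] that by simp
  have f0: "f \<zero> = \<zero>\<^bsub>E\<^esub>" using hom_zero[OF mI E' fE] by simp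
  have K: "submod R regmod K"
    by (rule submodI)
      (use Ic Im fm fa f0 E' submodD(3)[OF I'] submodD(4)[OF I'] in \<open>simp_all add: K_def subset_eq\<close>)
  define \<L> where "\<L> = {L. submod R regmod L \<and> L \<inter> I = K}"
  have wf: "wf {(N', N). submod R regmod N' \<and> submod R regmod N \<and> N \<subset> N'}"
    using submod_wf[OF regular_module] noetherian_chain_cond[OF noeth] by simp
  have "K \<in> \<L>" unfolding \<L>_def using K by (auto simp: K_def)
  then obtain L where L: "L \<in> \<L>" "\<And>L'. (L', L) \<in> {(N', N). submod R regmod N' \<and> submod R regmod N \<and> N \<subset> N'} \<Longrightarrow> L' \<notin> \<L>"
    by (rule wfE_min[OF wf]) blast
  have Ls: "submod R regmod L" "L \<inter> I = K" using L(1) by (auto simp: \<L>_def)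
  have Lc: "r \<in> carrier R" if "r \<in> L" for r using submodD(2)[OF Ls(1) that] by simp
  have Lm: "r \<otimes> s \<in> L" if "r \<in> carrier R" "s \<in> L" for r s using submodD(5)[OF Ls(1) that] by simp
  have La: "r \<oplus> s \<in> L" if "r \<in> L" "s \<in> L" for r s using submodD(4)[OF Ls(1) that] by simp
  have Lneg: "\<ominus> r \<in> L" if "r \<in> L" for r using Lm[of "\<ominus> \<one>" r] Lc[OF that] that by (simp add: l_minus)
  have pow: "\<exists>m::nat. a [^] m \<in> L" if a: "a \<in> S" for a
  proof -
    have ac: "a \<in> carrier R" using a S by auto
    \<comment> \<open>The ideals \<open>L : a^m\<close> form an ascending chain; \<open>m\<close>
      below is an index from which it is constant.\<close>
    define C where "C m = {r \<in> carrier R. r \<otimes> a [^] m \<in> L}" for m :: nat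
    have "\<exists>k. \<forall>n\<ge>k. C n = C k"
    proof (rule noetherian_chain_cond[OF noeth, unfolded chain_cond_def, rule_format], intro allI conjI)
      fix n
      show "submod R regmod (C n)" unfolding C_def
        by (rule submodI) (use ac submodD(3)[OF Ls(1)] in \<open>simp_all add: l_distr m_assoc Lm La\<close>)
      then show "{\<zero>} \<subseteq> C n" "C n \<subseteq> carrier R" by (auto simp: submod_def)
      have "C n \<subseteq> C (Suc n)"
      proof
        fix r assume r: "r \<in> C n"
        then have "r \<otimes> a [^] Suc n = a \<otimes> (r \<otimes> a [^] n)" using ac by (simp add: C_def m_ac)
        then show "r \<in> C (Suc n)" using r Lm ac by (simp add: C_def del: nat_pow_Suc)
      qed
      then show "if True then C n \<subseteq> C (Suc n) else C (Suc n) \<subseteq> C n" by simp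
    qed
    then obtain m where m: "\<And>n. n \<ge> m \<Longrightarrow> C n = C m" by blast
    define L' where "L' = {l \<oplus>\<^bsub>regmod\<^esub> r | l r. l \<in> L \<and> r \<in> (\<lambda>r. r \<odot>\<^bsub>regmod\<^esub> a [^] m) ` carrier R}"
    have sub: "submod R regmod ((\<lambda>r. r \<odot>\<^bsub>regmod\<^esub> a [^] m) ` carrier R)"
      using submod_image[OF regular_module regular_module smult_hom'[OF regular_module] submod_carrier[OF regular_module], of "a [^] m"] ac by simp
    have L': "submod R regmod L'" unfolding L'_def by (rule submod_sum[OF regular_module Ls(1) sub])
    have LL': "L \<subseteq> L'"
    proof
      fix l assume l: "l \<in> L"
      then have "l = l \<oplus>\<^bsub>regmod\<^esub> \<zero>" using Lc by simp
      moreover have "\<zero> \<in> (\<lambda>r. r \<odot>\<^bsub>regmod\<^esub> a [^] m) ` carrier R" using submodD(3)[OF sub] by simp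
      ultimately show "l \<in> L'" unfolding L'_def using l by blast
    qed
    \<comment> \<open>Adding \<open>a^m\<close> to \<open>L\<close> creates no new elements of
      \<open>I\<close>: as \<open>f y\<close> is killed by some \<open>a^n\<close>, the product
      \<open>a^n y\<close> lies in \<open>L\<close>, hence \<open>r a^(m+n)\<close> does, and by
      stationarity already \<open>r a^m\<close>.\<close>
    have "L' \<inter> I \<subseteq> K"
    proof
      fix y assume y: "y \<in> L' \<inter> I"
      then obtain l r where lr: "l \<in> L" "r \<in> carrier R" "y = l \<oplus> r \<otimes> a [^] m" unfolding L'_def by auto
      obtain n :: nat where n: "(a [^] n) \<odot>\<^bsub>E\<^esub> f y = \<zero>\<^bsub>E\<^esub>" using ft[of y] y a by (auto simp: torsion_def)
      have "a [^] n \<otimes> y \<in> K" unfolding K_def using n fm[of "a [^] n" y] Im y ac by simp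
      then have "a [^] n \<otimes> y \<in> L" using Ls(2) by blast
      moreover have "a [^] n \<otimes> y = a [^] n \<otimes> l \<oplus> r \<otimes> a [^] (m + n)"
        using lr ac Lc[OF lr(1)] by (simp add: r_distr nat_pow_mult[symmetric] m_ac)
      moreover have "a [^] n \<otimes> l \<in> L" using Lm lr(1) ac by simp
      ultimately have "\<ominus> (a [^] n \<otimes> l) \<oplus> (a [^] n \<otimes> l \<oplus> r \<otimes> a [^] (m + n)) \<in> L" using La Lneg by simp
      then have "r \<otimes> a [^] (m + n) \<in> L" using lr ac Lc[OF lr(1)] by (simp add: r_neg1)
      then have "r \<in> C (m + n)" using lr(2) by (simp add: C_def)
      then have "r \<in> C m" using m[of "m + n"] by simp
      then have "r \<otimes> a [^] m \<in> L" by (simp add: C_def)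
      then show "y \<in> K" using lr(1,3) La y Ls(2) by blast
    qed
    moreover have "K \<subseteq> L' \<inter> I" using LL' Ls(2) by blast
    ultimately have "L' \<in> \<L>" unfolding \<L>_def using L' by blast
    then have "L' = L" using L(2)[of L'] LL' L' Ls(1) by auto
    moreover have "a [^] m \<in> L'"
    proof -
      have "a [^] m = \<zero> \<oplus>\<^bsub>regmod\<^esub> \<one> \<odot>\<^bsub>regmod\<^esub> a [^] m" using ac by simp
      moreover have "\<zero> \<in> L" using submodD(3)[OF Ls(1)] by simp
      ultimately show ?thesis unfolding L'_def by blast
    qed
    ultimately show ?thesis by blast
  qed
  obtain Q :: "('a, 'a) module" and q where Q: "module R Q" "q \<in> module_hom R regmod Q"
      "\<And>x. x \<in> carrier regmod \<Longrightarrow> q x = \<zero>\<^bsub>Q\<^esub> \<longleftrightarrow> x \<in> L"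
    by (rule ex_quotient[OF regular_module Ls(1)]) blast
  have qI: "q \<in> module_hom R (regmod\<lparr>carrier := I\<rparr>) Q"
    using module_hom_restrict_dom[OF Q(2)] Ic by auto
  have "f x = \<zero>\<^bsub>E\<^esub>" if "x \<in> carrier (regmod\<lparr>carrier := I\<rparr>)" "q x = \<zero>\<^bsub>Q\<^esub>" for x
    using that Q(3)[of x] Ic[of x] Ls(2) by (auto simp: K_def)
  from baer_extend[OF E mI Q(1) qI fE this]
  obtain w where w: "w \<in> module_hom R Q E" "\<And>x. x \<in> I \<Longrightarrow> w (q x) = f x" by auto
  \<comment> \<open>\<open>w\<close> is defined on \<open>R/L\<close>, so every element of
    \<open>L\<close> annihilates \<open>e\<close>; in particular a power of each \<open>a\<close> in
    \<open>S\<close> does.\<close>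
  define e where "e = w (q \<one>)"
  have wq: "(\<lambda>x. w (q x)) \<in> module_hom R regmod E" by (rule module_hom_comp[OF Q(2) w(1)])
  have we: "w (q r) = r \<odot>\<^bsub>E\<^esub> e" if "r \<in> carrier R" for r
    using module_homD(3)[OF wq that, of \<one>] that unfolding e_def by simp
  show "\<exists>e\<in>carrier ?T. \<forall>a\<in>I. f a = a \<odot>\<^bsub>?T\<^esub> e"
  proof (intro bexI[of _ e] ballI)
    show "f r = r \<odot>\<^bsub>?T\<^esub> e" if "r \<in> I" for r using w(2)[OF that] we[OF Ic[OF that]] by simp
    have "e \<in> torsion R S E"
      unfolding torsion_def
    proof (intro CollectI conjI ballI)
      show "e \<in> carrier E" unfolding e_def using module_homD(1)[OF wq, of \<one>] by simp
      fix a assume "a \<in> S"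
      then obtain m :: nat where m: "a [^] m \<in> L" using pow by blast
      then have "q (a [^] m) = \<zero>\<^bsub>Q\<^esub>" using Q(3) Lc by simp
      then have "(a [^] m) \<odot>\<^bsub>E\<^esub> e = \<zero>\<^bsub>E\<^esub>" using we[OF Lc[OF m]] hom_zero[OF Q(1) E' w(1)] by simp
      then show "\<exists>n::nat. (a [^] n) \<odot>\<^bsub>E\<^esub> e = \<zero>\<^bsub>E\<^esub>" by blast
    qed
    then show "e \<in> carrier ?T" by simp
  qed
qed

end

section \<open>Complexes\<close>

definition cochain :: "('a, 'r) ring_scheme \<Rightarrow> (nat \<Rightarrow> ('a, 'x) module) \<Rightarrow> (nat \<Rightarrow> 'x \<Rightarrow> 'x) \<Rightarrow> bool"
  where "cochain R C d \<longleftrightarrow> (\<forall>n. module R (C n) \<and> d n \<in> module_hom R (C n) (C (Suc n)) \<and>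
    (\<forall>x\<in>carrier (C n). d (Suc n) (d n x) = \<zero>\<^bsub>C (Suc (Suc n))\<^esub>))"

definition cocycles :: "(nat \<Rightarrow> ('a, 'x) module) \<Rightarrow> (nat \<Rightarrow> 'x \<Rightarrow> 'x) \<Rightarrow> nat \<Rightarrow> 'x set"
  where "cocycles C d n = {x \<in> carrier (C n). d n x = \<zero>\<^bsub>C (Suc n)\<^esub>}"

definition coboundaries :: "(nat \<Rightarrow> ('a, 'x) module) \<Rightarrow> (nat \<Rightarrow> 'x \<Rightarrow> 'x) \<Rightarrow> nat \<Rightarrow> 'x set"
  where "coboundaries C d n = (case n of 0 \<Rightarrow> {\<zero>\<^bsub>C 0\<^esub>} | Suc m \<Rightarrow> d m ` carrier (C m))"

lemma coboundaries_simps [simp]: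
  "coboundaries C d 0 = {\<zero>\<^bsub>C 0\<^esub>}" "coboundaries C d (Suc m) = d m ` carrier (C m)"
  by (simp_all add: coboundaries_def)

text \<open>In degree 0 the coboundaries are zero, so exactness there means that the first
  differential has trivial kernel.\<close>

definition exact_at :: "(nat \<Rightarrow> ('a, 'x) module) \<Rightarrow> (nat \<Rightarrow> 'x \<Rightarrow> 'x) \<Rightarrow> nat \<Rightarrow> bool"
  where "exact_at C d n \<longleftrightarrow> cocycles C d n \<subseteq> coboundaries C d n"

definition artinian_at ::
    "('a, 'r) ring_scheme \<Rightarrow> (nat \<Rightarrow> ('a, 'x) module) \<Rightarrow> (nat \<Rightarrow> 'x \<Rightarrow> 'x) \<Rightarrow> nat \<Rightarrow> bool"
  where "artinian_at R C d n \<longleftrightarrow> chain_cond False R (C n) (coboundaries C d n) (cocycles C d n)"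

definition torsion_complex ::
    "('a, 'r) ring_scheme \<Rightarrow> 'a set \<Rightarrow> (nat \<Rightarrow> ('a, 'x) module) \<Rightarrow> nat \<Rightarrow> ('a, 'x) module"
  where "torsion_complex R S C n = (C n)\<lparr>carrier := torsion R S (C n)\<rparr>"

lemma cochainD:
  assumes "cochain R C d"
  shows "module R (C n)" "d n \<in> module_hom R (C n) (C (Suc n))"
    "x \<in> carrier (C n) \<Longrightarrow> d n x \<in> carrier (C (Suc n))"
    "x \<in> carrier (C n) \<Longrightarrow> d (Suc n) (d n x) = \<zero>\<^bsub>C (Suc (Suc n))\<^esub>"
  using assms module_homD(1)[of "d n" R "C n" "C (Suc n)" x] by (auto simp: cochain_def)

lemma cocyclesD:
  assumes "x \<in> cocycles C d n" shows "x \<in> carrier (C n)" "d n x = \<zero>\<^bsub>C (Suc n)\<^esub>"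
  using assms by (auto simp: cocycles_def)

context cring
begin

lemma submod_cocycles: "cochain R C d \<Longrightarrow> submod R (C n) (cocycles C d n)"
  unfolding cocycles_def
  using submod_vimage[OF cochainD(1)[of R C d n] cochainD(1)[of R C d "Suc n"] cochainD(2)[of R C d n]
      submod_carrier submod_trivial] cochainD(1)[of R C d] by simp

lemma submod_coboundaries:
  assumes C: "cochain R C d" shows "submod R (C n) (coboundaries C d n)"
proof (cases n)
  case 0
  then show ?thesis using submod_trivial[OF cochainD(1)[OF C]] by simp
next
  case (Suc m)
  then show ?thesis
    using submod_image[OF cochainD(1)[OF C] cochainD(1)[OF C] cochainD(2)[OF C] submod_carrier[OF cochainD(1)[OF C]]]
    by simp
qed

lemma coboundaries_subset: 
  assumes "cochain R C d" shows "coboundaries C d n \<subseteq> cocycles C d n"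
proof (cases n)
  case 0
  then show ?thesis using cochainD(1)[OF assms] hom_zero[OF _ _ cochainD(2)[OF assms]] by (auto simp: cocycles_def)
next
  case (Suc m)
  then show ?thesis using cochainD(3,4)[OF assms] by (auto simp: cocycles_def)
qed

lemma exact_artinian_at:
  assumes "cochain R C d" "exact_at C d n" shows "artinian_at R C d n"
proof -
  have "cocycles C d n = coboundaries C d n"
    using assms coboundaries_subset unfolding exact_at_def by blast
  then show ?thesis unfolding artinian_at_def using chain_cond_trivial by simp
qed

lemma torsion_complex_simps [simp]:
  "carrier (torsion_complex R S C n) = torsion R S (C n)"
  "\<zero>\<^bsub>torsion_complex R S C n\<^esub> = \<zero>\<^bsub>C n\<^esub>"
  "x \<oplus>\<^bsub>torsion_complex R S C n\<^esub> y = x \<oplus>\<^bsub>C n\<^esub> y"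
  "a \<odot>\<^bsub>torsion_complex R S C n\<^esub> y = a \<odot>\<^bsub>C n\<^esub> y"
  by (simp_all add: torsion_complex_def)

lemma torsion_complex_torsion_complex:
  "torsion_complex R S (torsion_complex R T C) = torsion_complex R (S \<union> T) C"
  by (rule ext) (simp add: torsion_complex_def torsion_restrict)

lemma cochain_torsion:
  assumes C: "cochain R C d" and S: "S \<subseteq> carrier R"
  shows "cochain R (torsion_complex R S C) d"
  unfolding cochain_def
proof (intro allI conjI ballI)
  fix n
  note m = cochainD(1)[OF C]
  show "module R (torsion_complex R S C n)"
    unfolding torsion_complex_def using submod_module[OF m submod_torsion[OF m S]] .
  have tc: "x \<in> carrier (C n)" if "x \<in> torsion R S (C n)" for x
    using that by (rule torsion_carrier)
  show "d n \<in> module_hom R (torsion_complex R S C n) (torsion_complex R S C (Suc n))"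
    by (rule module_homI)
      (use tc hom_torsion[OF m m cochainD(2)[OF C] S] module_homD[OF cochainD(2)[OF C]] in auto)
  show "d (Suc n) (d n x) = \<zero>\<^bsub>torsion_complex R S C (Suc (Suc n))\<^esub>"
    if "x \<in> carrier (torsion_complex R S C n)" for x using cochainD(4)[OF C, of x n] tc that by simp
qed

text \<open>Inductive step: \<open>x - d (s x)\<close> vanishes on cocycles of the next degree,
  since they are coboundaries. By injectivity it factors through the next differential, and the
  factor is the next splitting.\<close>

lemma split_exact:
  assumes C: "cochain R C d" and baer: "\<And>n. baer_module R (C n)"
    and ex: "\<And>n. n \<le> N \<Longrightarrow> exact_at C d n"
  shows "\<exists>s\<in>module_hom R (C (Suc N)) (C N). \<forall>x\<in>carrier (C N). d N (s (d N x)) = d N x"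
  using ex
proof (induction N)
  case 0
  have "x = \<zero>\<^bsub>C 0\<^esub>" if "x \<in> carrier (C 0)" "d 0 x = \<zero>\<^bsub>C (Suc 0)\<^esub>" for x
    using 0[of 0] that by (auto simp: exact_at_def cocycles_def)
  from baer_extend[OF baer cochainD(1)[OF C] cochainD(1)[OF C] cochainD(2)[OF C] id_hom this]
  obtain s where "s \<in> module_hom R (C (Suc 0)) (C 0)" "\<And>x. x \<in> carrier (C 0) \<Longrightarrow> s (d 0 x) = x" by blast
  then show ?case by (intro bexI[of _ s]) auto
next
  case (Suc N)
  then obtain s where s: "s \<in> module_hom R (C (Suc N)) (C N)"
    "\<And>x. x \<in> carrier (C N) \<Longrightarrow> d N (s (d N x)) = d N x" by (metis le_SucI)
  note m = cochainD(1)[OF C] and dh = cochainD(2)[OF C]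
  have dsh: "(\<lambda>x. d N (s x)) \<in> module_hom R (C (Suc N)) (C (Suc N))" by (rule module_hom_comp[OF s(1) dh])
  have v: "(\<lambda>x. x \<ominus>\<^bsub>C (Suc N)\<^esub> d N (s x)) \<in> module_hom R (C (Suc N)) (C (Suc N))"
    by (rule module_homI)
      (use module_homD[OF dsh] m in \<open>simp_all add: a_minus_def mod_neg_add smult_r_add smult_neg_r mod_ac\<close>)
  have "x \<ominus>\<^bsub>C (Suc N)\<^esub> d N (s x) = \<zero>\<^bsub>C (Suc N)\<^esub>"
    if "x \<in> carrier (C (Suc N))" "d (Suc N) x = \<zero>\<^bsub>C (Suc (Suc N))\<^esub>" for x
  proof -
    have "x \<in> coboundaries C d (Suc N)"
      using that Suc.prems[of "Suc N"] by (auto simp: exact_at_def cocycles_def)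
    then show ?thesis using s(2) that(1) m by auto
  qed
  from baer_extend[OF baer m m dh v this]
  obtain t where t: "t \<in> module_hom R (C (Suc (Suc N))) (C (Suc N))"
    "\<And>x. x \<in> carrier (C (Suc N)) \<Longrightarrow> t (d (Suc N) x) = x \<ominus>\<^bsub>C (Suc N)\<^esub> d N (s x)" by blast
  show ?case
  proof (intro bexI[OF _ t(1)] ballI)
    fix x assume x: "x \<in> carrier (C (Suc N))"
    have sx: "s x \<in> carrier (C N)" using module_homD(1)[OF s(1) x] .
    have "d (Suc N) (t (d (Suc N) x)) = d (Suc N) x \<ominus>\<^bsub>C (Suc (Suc N))\<^esub> d (Suc N) (d N (s x))"
      using t(2)[OF x] hom_minus[OF m m dh x cochainD(3)[OF C sx]] by simp
    then show "d (Suc N) (t (d (Suc N) x)) = d (Suc N) x"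
      using cochainD(3)[OF C x] cochainD(4)[OF C sx] m by simp
  qed
qed

text \<open>A torsion cocycle \<open>x\<close> is a coboundary and so equals \<open>d (s x)\<close>
  for the splitting \<open>s\<close>. Being a homomorphism, \<open>s\<close> sends \<open>x\<close>
  to a torsion element.\<close>

lemma exact_torsion:
  assumes C: "cochain R C d" and baer: "\<And>n. baer_module R (C n)" and S: "S \<subseteq> carrier R"
    and ex: "\<And>n. n \<le> N \<Longrightarrow> exact_at C d n"
  shows "exact_at (torsion_complex R S C) d N"
  unfolding exact_at_def
proof
  fix x assume x: "x \<in> cocycles (torsion_complex R S C) d N"
  then have xt: "x \<in> torsion R S (C N)" "d N x = \<zero>\<^bsub>C (Suc N)\<^esub>" by (auto simp: cocycles_def)
  then have "x \<in> cocycles C d N" by (auto simp: cocycles_def torsion_carrier)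
  then have xb: "x \<in> coboundaries C d N" using ex by (auto simp: exact_at_def)
  show "x \<in> coboundaries (torsion_complex R S C) d N"
  proof (cases N)
    case 0
    then show ?thesis using xb by simp
  next
    case (Suc M)
    note m = cochainD(1)[OF C]
    have "\<exists>s\<in>module_hom R (C (Suc M)) (C M). \<forall>x\<in>carrier (C M). d M (s (d M x)) = d M x"
      by (rule split_exact[OF C baer]) (use ex Suc in simp)
    then obtain s where s: "s \<in> module_hom R (C N) (C M)"
      "\<And>x. x \<in> carrier (C M) \<Longrightarrow> d M (s (d M x)) = d M x" using Suc by blast
    have "x = d M (s x)" using xb s(2) Suc by auto
    moreover have "s x \<in> torsion R S (C M)" using hom_torsion[OF m m s(1) S xt(1)] .
    ultimately show ?thesis using Suc by auto
  qed
qed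

end

section \<open>Mapping cones\<close>

definition pair_module ::
    "('x \<Rightarrow> 'y \<Rightarrow> 'z) \<Rightarrow> ('z \<Rightarrow> 'x) \<Rightarrow> ('z \<Rightarrow> 'y) \<Rightarrow> ('a, 'x) module \<Rightarrow> ('a, 'y) module \<Rightarrow> ('a, 'z) module"
  where "pair_module pr p1 p2 M N =
    \<lparr>carrier = {pr x y | x y. x \<in> carrier M \<and> y \<in> carrier N},
     monoid.mult = (\<lambda>_ _. pr \<zero>\<^bsub>M\<^esub> \<zero>\<^bsub>N\<^esub>), one = pr \<zero>\<^bsub>M\<^esub> \<zero>\<^bsub>N\<^esub>, ring.zero = pr \<zero>\<^bsub>M\<^esub> \<zero>\<^bsub>N\<^esub>,
     add = (\<lambda>u v. pr (p1 u \<oplus>\<^bsub>M\<^esub> p1 v) (p2 u \<oplus>\<^bsub>N\<^esub> p2 v)),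
     smult = (\<lambda>a u. pr (a \<odot>\<^bsub>M\<^esub> p1 u) (a \<odot>\<^bsub>N\<^esub> p2 u))\<rparr>"

text \<open>Products are formed along an arbitrary pairing function \<open>pr\<close>, so that iterated cones
  can be kept in one type.\<close>

locale cring_pairing = cring R for R :: "('a, 'r) ring_scheme" (structure) +
  fixes pr :: "'x \<Rightarrow> 'y \<Rightarrow> 'z" and p1 :: "'z \<Rightarrow> 'x" and p2 :: "'z \<Rightarrow> 'y"
  assumes p1 [simp]: "p1 (pr x y) = x" and p2 [simp]: "p2 (pr x y) = y"
begin

abbreviation pairm where "pairm \<equiv> pair_module pr p1 p2"

lemma pr_eq [simp]: "pr x y = pr x' y' \<longleftrightarrow> x = x' \<and> y = y'"
  by (metis p1 p2)

lemma pairm_simps [simp]: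
  "pr x y \<in> carrier (pairm M N) \<longleftrightarrow> x \<in> carrier M \<and> y \<in> carrier N"
  "\<zero>\<^bsub>pairm M N\<^esub> = pr \<zero>\<^bsub>M\<^esub> \<zero>\<^bsub>N\<^esub>"
  "pr x y \<oplus>\<^bsub>pairm M N\<^esub> pr x' y' = pr (x \<oplus>\<^bsub>M\<^esub> x') (y \<oplus>\<^bsub>N\<^esub> y')"
  "a \<odot>\<^bsub>pairm M N\<^esub> pr x y = pr (a \<odot>\<^bsub>M\<^esub> x) (a \<odot>\<^bsub>N\<^esub> y)"
  by (auto simp: pair_module_def)

lemma pairm_carrierE:
  assumes "z \<in> carrier (pairm M N)"
  obtains x y where "z = pr x y" "x \<in> carrier M" "y \<in> carrier N"
  using assms by (auto simp: pair_module_def)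

lemma pairm_module:
  assumes "module R M" "module R N" shows "module R (pairm M N)"
proof (rule moduleI', goal_cases)
  case (1 u v) then show ?case using assms by (auto elim!: pairm_carrierE)
next
  case 2 then show ?case using assms by simp
next
  case (3 a u) then show ?case using assms by (auto elim!: pairm_carrierE)
next
  case (4 u v w) then show ?case using assms by (auto elim!: pairm_carrierE simp: mod_assoc)
next
  case (5 u v) then show ?case by (auto elim!: pairm_carrierE simp: mod_comm[OF assms(1)] mod_comm[OF assms(2)])
next
  case (6 u) then show ?case using assms by (auto elim!: pairm_carrierE)
next
  case (7 u) then show ?case using assms by (auto elim!: pairm_carrierE simp: smult_neg_l)
next
  case (8 a b u) then show ?case using assms by (auto elim!: pairm_carrierE simp: smult_l_add)
next
  case (9 a u v) then show ?case using assms by (auto elim!: pairm_carrierE simp: smult_r_add)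
next
  case (10 a b u) then show ?case using assms by (auto elim!: pairm_carrierE simp: smult_mult)
next
  case (11 u) then show ?case using assms by (auto elim!: pairm_carrierE)
qed

lemma p1_hom: "p1 \<in> module_hom R (pairm M N) M" and p2_hom: "p2 \<in> module_hom R (pairm M N) N"
  by (rule module_homI; auto elim!: pairm_carrierE)+

lemma inl_hom: "module R M \<Longrightarrow> module R N \<Longrightarrow> (\<lambda>x. pr x \<zero>\<^bsub>N\<^esub>) \<in> module_hom R M (pairm M N)"
  by (rule module_homI) simp_all

lemma baer_pairm:
  assumes "baer_module R M" "baer_module R N" shows "baer_module R (pairm M N)"
  unfolding baer_module_def
proof (intro conjI allI ballI impI)
  show "module R (pairm M N)" using assms by (simp add: pairm_module baer_module_def)
  fix I f assume f: "f \<in> module_hom R (regmod\<lparr>carrier := I\<rparr>) (pairm M N)" and I: "ideal I R"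
  obtain x where x: "x \<in> carrier M" "\<And>a. a \<in> I \<Longrightarrow> p1 (f a) = a \<odot>\<^bsub>M\<^esub> x"
    by (rule baer_moduleE[OF assms(1) module_hom_comp[OF f p1_hom] I]) auto
  obtain y where y: "y \<in> carrier N" "\<And>a. a \<in> I \<Longrightarrow> p2 (f a) = a \<odot>\<^bsub>N\<^esub> y"
    by (rule baer_moduleE[OF assms(2) module_hom_comp[OF f p2_hom] I]) auto
  show "\<exists>e\<in>carrier (pairm M N). \<forall>a\<in>I. f a = a \<odot>\<^bsub>pairm M N\<^esub> e"
  proof (intro bexI[of _ "pr x y"] ballI)
    fix a assume a: "a \<in> I"
    have "f a \<in> carrier (pairm M N)" using module_homD(1)[OF f, of a] a by simp
    then obtain u v where "f a = pr u v" by (rule pairm_carrierE)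
    then show "f a = a \<odot>\<^bsub>pairm M N\<^esub> pr x y" using x(2)[OF a] y(2)[OF a] by simp
  qed (use x y in simp)
qed

lemma torsion_pairm:
  assumes "module R M" "module R N" "S \<subseteq> carrier R"
  shows "torsion R S (pairm M N) = {pr x y | x y. x \<in> torsion R S M \<and> y \<in> torsion R S N}"
proof (intro subset_antisym subsetI)
  fix z assume z: "z \<in> torsion R S (pairm M N)"
  then have "z \<in> carrier (pairm M N)" by (rule torsion_carrier)
  then obtain x y where xy: "z = pr x y" by (rule pairm_carrierE)
  have "p1 z \<in> torsion R S M" "p2 z \<in> torsion R S N"
    using hom_torsion[OF pairm_module[OF assms(1,2)] assms(1) p1_hom assms(3) z]
      hom_torsion[OF pairm_module[OF assms(1,2)] assms(2) p2_hom assms(3) z] by auto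
  then show "z \<in> {pr x y | x y. x \<in> torsion R S M \<and> y \<in> torsion R S N}" using xy by auto
next
  fix z assume "z \<in> {pr x y | x y. x \<in> torsion R S M \<and> y \<in> torsion R S N}"
  then obtain x y where z: "z = pr x y" and xy: "x \<in> torsion R S M" "y \<in> torsion R S N" by blast
  have xyc: "x \<in> carrier M" "y \<in> carrier N" using xy by (auto intro: torsion_carrier)
  show "z \<in> torsion R S (pairm M N)"
    unfolding torsion_def z
  proof (intro CollectI conjI ballI)
    fix a assume a: "a \<in> S"
    then have ac: "a \<in> carrier R" using assms(3) by blast
    obtain n m :: nat where nm: "(a [^] n) \<odot>\<^bsub>M\<^esub> x = \<zero>\<^bsub>M\<^esub>" "(a [^] m) \<odot>\<^bsub>N\<^esub> y = \<zero>\<^bsub>N\<^esub>"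
      using xy a unfolding torsion_def by blast
    have "(a [^] max n m) \<odot>\<^bsub>M\<^esub> x = \<zero>\<^bsub>M\<^esub>" "(a [^] max n m) \<odot>\<^bsub>N\<^esub> y = \<zero>\<^bsub>N\<^esub>"
      using pow_smult_zero_mono[OF assms(1) xyc(1) ac nm(1)] pow_smult_zero_mono[OF assms(2) xyc(2) ac nm(2)]
      by simp_all
    then have "(a [^] max n m) \<odot>\<^bsub>pairm M N\<^esub> pr x y = \<zero>\<^bsub>pairm M N\<^esub>" by simp
    then show "\<exists>n::nat. (a [^] n) \<odot>\<^bsub>pairm M N\<^esub> pr x y = \<zero>\<^bsub>pairm M N\<^esub>" by blast
  qed (use xyc in simp)
qed

end

text \<open>The signs are put into the maps \<open>\<Phi>\<close>, which anticommute with the differentials.\<close>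

definition twisting ::
    "('a, 'r) ring_scheme \<Rightarrow> (nat \<Rightarrow> ('a, 'x) module) \<Rightarrow> (nat \<Rightarrow> 'x \<Rightarrow> 'x) \<Rightarrow>
     (nat \<Rightarrow> ('a, 'y) module) \<Rightarrow> (nat \<Rightarrow> 'y \<Rightarrow> 'y) \<Rightarrow> (nat \<Rightarrow> 'y \<Rightarrow> 'x) \<Rightarrow> bool"
  where "twisting R C d K e \<Phi> \<longleftrightarrow> (\<forall>n. \<Phi> n \<in> module_hom R (K n) (C (Suc n)) \<and>
    (\<forall>k\<in>carrier (K n). d (Suc n) (\<Phi> n k) \<oplus>\<^bsub>C (Suc (Suc n))\<^esub> \<Phi> (Suc n) (e n k) = \<zero>\<^bsub>C (Suc (Suc n))\<^esub>))"

lemma twistingD: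
  assumes "twisting R C d K e \<Phi>"
  shows "\<Phi> n \<in> module_hom R (K n) (C (Suc n))"
    "k \<in> carrier (K n) \<Longrightarrow> \<Phi> n k \<in> carrier (C (Suc n))"
    "k \<in> carrier (K n) \<Longrightarrow> d (Suc n) (\<Phi> n k) \<oplus>\<^bsub>C (Suc (Suc n))\<^esub> \<Phi> (Suc n) (e n k) = \<zero>\<^bsub>C (Suc (Suc n))\<^esub>"
  using assms module_homD(1)[of "\<Phi> n" R "K n" "C (Suc n)" k] by (auto simp: twisting_def)

locale mapping_cone = cring_pairing R pr p1 p2
  for R :: "('a, 'r) ring_scheme" (structure)
  and pr :: "'x \<Rightarrow> 'y \<Rightarrow> 'z" and p1 :: "'z \<Rightarrow> 'x" and p2 :: "'z \<Rightarrow> 'y" +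
  fixes C :: "nat \<Rightarrow> ('a, 'x) module" and d :: "nat \<Rightarrow> 'x \<Rightarrow> 'x"
  and K :: "nat \<Rightarrow> ('a, 'y) module" and e :: "nat \<Rightarrow> 'y \<Rightarrow> 'y" and \<Phi> :: "nat \<Rightarrow> 'y \<Rightarrow> 'x"
  assumes C: "cochain R C d" and K: "cochain R K e" and \<Phi>: "twisting R C d K e \<Phi>"
begin

text \<open>As \<open>\<Phi>\<close> itself raises the degree by one, no shift of \<open>K\<close>
  appears. The long exact sequence reads \<open>H^n(C) -> H^n(cone) -> H^n(K) -> H^(n+1)(C)\<close>,
  with connecting map induced by \<open>\<Phi>\<close>.\<close>

definition cone :: "nat \<Rightarrow> ('a, 'z) module"
  where "cone n = pairm (C n) (K n)"

definition cone_d :: "nat \<Rightarrow> 'z \<Rightarrow> 'z"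
  where "cone_d n z = pr (d n (p1 z) \<oplus>\<^bsub>C (Suc n)\<^esub> \<Phi> n (p2 z)) (e n (p2 z))"

lemma cone_d_pr [simp]: "cone_d n (pr x k) = pr (d n x \<oplus>\<^bsub>C (Suc n)\<^esub> \<Phi> n k) (e n k)"
  by (simp add: cone_d_def)

lemmas mC = cochainD(1)[OF C] and dC = cochainD(2)[OF C] and mK = cochainD(1)[OF K] and eK = cochainD(2)[OF K]
lemmas dx = cochainD(3)[OF C] and ek = cochainD(3)[OF K] and ddx = cochainD(4)[OF C] and eek = cochainD(4)[OF K]
lemmas Ph = twistingD(1)[OF \<Phi>] and Pk = twistingD(2)[OF \<Phi>]

lemma cochain_cone: "cochain R cone cone_d"
  unfolding cochain_def
proof (intro allI conjI ballI)
  fix n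
  show "module R (cone n)" unfolding cone_def using pairm_module mC mK .
  show "cone_d n \<in> module_hom R (cone n) (cone (Suc n))"
    unfolding cone_def
  proof (rule module_homI)
    fix z assume "z \<in> carrier (pairm (C n) (K n))"
    then show "cone_d n z \<in> carrier (pairm (C (Suc n)) (K (Suc n)))"
      using dx Pk ek mC by (auto elim!: pairm_carrierE)
  next
    fix z w assume "z \<in> carrier (pairm (C n) (K n))" "w \<in> carrier (pairm (C n) (K n))"
    then show "cone_d n (z \<oplus>\<^bsub>pairm (C n) (K n)\<^esub> w) = cone_d n z \<oplus>\<^bsub>pairm (C (Suc n)) (K (Suc n))\<^esub> cone_d n w"
      using dx Pk ek mC module_homD(2)[OF dC] module_homD(2)[OF eK] module_homD(2)[OF Ph]
      by (auto elim!: pairm_carrierE simp: mod_ac)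
  next
    fix a z assume "a \<in> carrier R" "z \<in> carrier (pairm (C n) (K n))"
    then show "cone_d n (a \<odot>\<^bsub>pairm (C n) (K n)\<^esub> z) = a \<odot>\<^bsub>pairm (C (Suc n)) (K (Suc n))\<^esub> cone_d n z"
      using dx Pk ek mC module_homD(3)[OF dC] module_homD(3)[OF eK] module_homD(3)[OF Ph]
      by (auto elim!: pairm_carrierE simp: smult_r_add)
  qed
  fix z assume "z \<in> carrier (cone n)"
  then obtain x k where z: "z = pr x k" and x: "x \<in> carrier (C n)" and k: "k \<in> carrier (K n)"
    unfolding cone_def by (rule pairm_carrierE)
  have "d (Suc n) (d n x \<oplus>\<^bsub>C (Suc n)\<^esub> \<Phi> n k) = d (Suc n) (\<Phi> n k)"
    using module_homD(2)[OF dC dx[OF x] Pk[OF k]] ddx[OF x] dx[OF Pk[OF k]] mC by simp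
  then show "cone_d (Suc n) (cone_d n z) = \<zero>\<^bsub>cone (Suc (Suc n))\<^esub>"
    unfolding z cone_def using twistingD(3)[OF \<Phi> k] eek[OF k] by simp
qed

lemma cocycles_cone:
  "pr x k \<in> cocycles cone cone_d n \<longleftrightarrow> x \<in> carrier (C n) \<and> k \<in> cocycles K e n \<and>
    d n x \<oplus>\<^bsub>C (Suc n)\<^esub> \<Phi> n k = \<zero>\<^bsub>C (Suc n)\<^esub>"
  by (auto simp: cocycles_def cone_def)

lemma cocycles_coneE:
  assumes "z \<in> cocycles cone cone_d n"
  obtains x k where "z = pr x k" "x \<in> carrier (C n)" "k \<in> cocycles K e n"
    "d n x \<oplus>\<^bsub>C (Suc n)\<^esub> \<Phi> n k = \<zero>\<^bsub>C (Suc n)\<^esub>"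
proof -
  have "z \<in> carrier (pairm (C n) (K n))" using assms by (simp add: cocycles_def cone_def)
  then obtain x k where "z = pr x k" by (rule pairm_carrierE)
  then show ?thesis using that assms cocycles_cone by blast
qed

lemma p2_cone_hom: "p2 \<in> module_hom R (cone n) (K n)"
  unfolding cone_def by (rule p2_hom)

lemma inl_cone_hom: "(\<lambda>x. pr x \<zero>\<^bsub>K n\<^esub>) \<in> module_hom R (C n) (cone n)"
  unfolding cone_def using inl_hom[OF mC mK] .

lemma e_zero: "e n \<zero>\<^bsub>K n\<^esub> = \<zero>\<^bsub>K (Suc n)\<^esub>" and d_zero: "d n \<zero>\<^bsub>C n\<^esub> = \<zero>\<^bsub>C (Suc n)\<^esub>"
  and \<Phi>_zero: "\<Phi> n \<zero>\<^bsub>K n\<^esub> = \<zero>\<^bsub>C (Suc n)\<^esub>"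
  using hom_zero[OF mK mK eK] hom_zero[OF mC mC dC] hom_zero[OF mK mC Ph] by auto

lemma inl_cocycle:
  assumes "x \<in> cocycles C d n" shows "pr x \<zero>\<^bsub>K n\<^esub> \<in> cocycles cone cone_d n"
  using assms mC mK by (simp add: cocycles_cone) (simp add: cocycles_def e_zero \<Phi>_zero)

lemma inl_coboundary:
  assumes "x \<in> coboundaries C d n" shows "pr x \<zero>\<^bsub>K n\<^esub> \<in> coboundaries cone cone_d n"
proof (cases n)
  case 0
  then show ?thesis using assms by (simp add: cone_def)
next
  case (Suc m)
  then obtain y where y: "y \<in> carrier (C m)" "x = d m y" using assms by auto
  then have "pr x \<zero>\<^bsub>K n\<^esub> = cone_d m (pr y \<zero>\<^bsub>K m\<^esub>)" using Suc dx[OF y(1)] mC by (simp add: e_zero \<Phi>_zero)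
  moreover have "pr y \<zero>\<^bsub>K m\<^esub> \<in> carrier (cone m)" using y mK by (simp add: cone_def)
  ultimately show ?thesis using Suc by (metis coboundaries_simps(2) imageI)
qed

lemma p2_coboundary:
  assumes "z \<in> coboundaries cone cone_d n" shows "p2 z \<in> coboundaries K e n"
proof (cases n)
  case 0
  then show ?thesis using assms by (simp add: cone_def)
next
  case (Suc m)
  then obtain w where w: "w \<in> carrier (pairm (C m) (K m))" "z = cone_d m w" using assms by (auto simp: cone_def)
  then obtain y k where "w = pr y k" "k \<in> carrier (K m)" by (metis pairm_carrierE)
  then show ?thesis using w Suc by simp
qed

lemma p2_cocycle: "z \<in> cocycles cone cone_d n \<Longrightarrow> p2 z \<in> cocycles K e n"
  by (erule cocycles_coneE) simp

text \<open>Together with \<open>\<Phi>_coboundary\<close>, this makes the connecting map well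
  defined on cohomology.\<close>

lemma \<Phi>_cocycle:
  assumes "k \<in> cocycles K e n" shows "\<Phi> n k \<in> cocycles C d (Suc n)"
proof -
  have k: "k \<in> carrier (K n)" "e n k = \<zero>\<^bsub>K (Suc n)\<^esub>" using cocyclesD[OF assms] .
  then show ?thesis
    using twistingD(3)[OF \<Phi> k(1)] Pk[OF k(1)] dx[OF Pk[OF k(1)]] mC by (simp add: cocycles_def \<Phi>_zero)
qed

lemma \<Phi>_coboundary:
  assumes "k \<in> coboundaries K e n" shows "\<Phi> n k \<in> coboundaries C d (Suc n)"
proof (cases n)
  case 0
  then show ?thesis using assms mC[of 0] d_zero[of 0] by (auto simp: \<Phi>_zero intro!: image_eqI[of _ _ "\<zero>\<^bsub>C 0\<^esub>"])
next
  case (Suc m)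
  then obtain l where l: "l \<in> carrier (K m)" "k = e m l" using assms by auto
  have "\<Phi> (Suc m) (e m l) = \<ominus>\<^bsub>C (Suc (Suc m))\<^esub> d (Suc m) (\<Phi> m l)"
    using twistingD(3)[OF \<Phi> l(1)] dx[OF Pk[OF l(1)]] Pk[OF ek[OF l(1)]] mC
    by (metis mod_add_eq_zero mod_comm)
  have "\<Phi> n k = d (Suc m) (\<ominus>\<^bsub>C (Suc m)\<^esub> \<Phi> m l)"
    using \<open>\<Phi> (Suc m) (e m l) = _\<close> Suc l hom_neg[OF mC mC dC Pk[OF l(1)]] by simp
  then show ?thesis using Suc Pk[OF l(1)] mC by auto
qed

text \<open>Exactness at \<open>H^n(K)\<close>: if \<open>\<Phi> n k = d n y\<close>, then
  \<open>- y\<close> completes \<open>k\<close> to a cocycle of the cone.\<close>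

lemma cocycle_lift:
  assumes k: "k \<in> cocycles K e n" and "\<Phi> n k \<in> coboundaries C d (Suc n)"
  obtains x where "x \<in> carrier (C n)" "pr x k \<in> cocycles cone cone_d n"
proof -
  obtain y where y: "y \<in> carrier (C n)" "\<Phi> n k = d n y" using assms by auto
  have "d n (\<ominus>\<^bsub>C n\<^esub> y) \<oplus>\<^bsub>C (Suc n)\<^esub> \<Phi> n k = \<zero>\<^bsub>C (Suc n)\<^esub>"
    using y hom_neg[OF mC mC dC y(1)] dx[OF y(1)] mC by simp
  then show ?thesis using that[of "\<ominus>\<^bsub>C n\<^esub> y"] k y mC by (simp add: cocycles_cone)
qed

text \<open>The term \<open>H^n(cone)\<close> lies between \<open>H^n(C)\<close> and
  \<open>H^n(K)\<close>. If the second component of a cocycle is \<open>e m l\<close>, subtracting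
  the coboundary of \<open>(0, l)\<close> moves the cocycle into \<open>C\<close>.\<close>

lemma artinian_at_cone:
  assumes "artinian_at R C d n" "artinian_at R K e n" shows "artinian_at R cone cone_d n"
  unfolding artinian_at_def
proof (rule exact_chain_cond[OF mC cochainD(1)[OF cochain_cone] mK inl_cone_hom p2_cone_hom
      submod_coboundaries[OF C] submod_cocycles[OF C] submod_coboundaries[OF K] submod_cocycles[OF K]
      coboundaries_subset[OF C] coboundaries_subset[OF K] _ _ _
      assms[unfolded artinian_at_def]])
  show "(\<lambda>x. pr x \<zero>\<^bsub>K n\<^esub>) ` coboundaries C d n \<subseteq> coboundaries cone cone_d n" using inl_coboundary by blast
  show "p2 ` cocycles cone cone_d n \<subseteq> cocycles K e n" using p2_cocycle by blast
  fix z assume z: "z \<in> cocycles cone cone_d n" "p2 z \<in> coboundaries K e n"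
  then obtain x k where xk: "z = pr x k" "x \<in> carrier (C n)" "k \<in> cocycles K e n"
      "d n x \<oplus>\<^bsub>C (Suc n)\<^esub> \<Phi> n k = \<zero>\<^bsub>C (Suc n)\<^esub>" by (metis cocycles_coneE)
  show "\<exists>x\<in>cocycles C d n. \<exists>b\<in>coboundaries cone cone_d n. z = pr x \<zero>\<^bsub>K n\<^esub> \<oplus>\<^bsub>cone n\<^esub> b"
  proof (cases n)
    case 0
    then have "k = \<zero>\<^bsub>K 0\<^esub>" using z xk by simp
    then have "x \<in> cocycles C d n" "z = pr x \<zero>\<^bsub>K n\<^esub> \<oplus>\<^bsub>cone n\<^esub> \<zero>\<^bsub>cone n\<^esub>"
      using xk 0 dx[OF xk(2)] mC mK by (simp_all add: cocycles_def \<Phi>_zero cone_def)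
    then show ?thesis using 0 by auto
  next
    case (Suc m)
    then obtain l where l: "l \<in> carrier (K m)" "k = e m l" using z xk by auto
    have Pl: "\<Phi> m l \<in> carrier (C n)" using Pk[OF l(1)] Suc by simp
    have "d n (x \<ominus>\<^bsub>C n\<^esub> \<Phi> m l) = d n x \<ominus>\<^bsub>C (Suc n)\<^esub> d n (\<Phi> m l)"
      using hom_minus[OF mC mC dC xk(2) Pl] .
    also have "d n (\<Phi> m l) = d n x"
      using twistingD(3)[OF \<Phi> l(1)] xk(4) l(2) Suc dx[OF Pl] dx[OF xk(2)] Pk[OF ek[OF l(1)]] mC
      by (simp add: mod_add_eq_zero)
    finally have "x \<ominus>\<^bsub>C n\<^esub> \<Phi> m l \<in> cocycles C d n"
      using xk(2) Pl dx[OF xk(2)] mC by (simp add: cocycles_def)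
    moreover have "cone_d m (pr \<zero>\<^bsub>C m\<^esub> l) = pr (\<Phi> m l) k"
      using l Pl mC Suc by (simp add: d_zero)
    moreover have "pr \<zero>\<^bsub>C m\<^esub> l \<in> carrier (cone m)" using l mC by (simp add: cone_def)
    moreover have "z = pr (x \<ominus>\<^bsub>C n\<^esub> \<Phi> m l) \<zero>\<^bsub>K n\<^esub> \<oplus>\<^bsub>cone n\<^esub> pr (\<Phi> m l) k"
      using xk(1,2) Pl mC mK cocyclesD(1)[OF xk(3)] by (simp add: cone_def)
    ultimately show ?thesis using Suc by (metis coboundaries_simps(2) imageI)
  qed
qed

text \<open>The kernel of the connecting map is the image of \<open>H^n(cone)\<close>. Later the
  connecting map will be multiplication by a ring element up to sign, and
  \<open>torsion_artinian\<close> starts from exactly this kernel.\<close>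

lemma artinian_kernel:
  assumes "artinian_at R cone cone_d n"
  shows "chain_cond False R (K n) (coboundaries K e n) {k \<in> cocycles K e n. \<Phi> n k \<in> coboundaries C d (Suc n)}"
proof (rule exact_chain_cond[OF cochainD(1)[OF cochain_cone] mK mC p2_cone_hom zero_hom[OF mC]
      submod_coboundaries[OF cochain_cone] submod_cocycles[OF cochain_cone] submod_trivial[OF mC] submod_trivial[OF mC]
      coboundaries_subset[OF cochain_cone] _ _ _ _ assms[unfolded artinian_at_def] chain_cond_trivial])
  show "p2 ` coboundaries cone cone_d n \<subseteq> coboundaries K e n" using p2_coboundary by blast
  fix k assume k: "k \<in> {k \<in> cocycles K e n. \<Phi> n k \<in> coboundaries C d (Suc n)}"
  then obtain x where "x \<in> carrier (C n)" "pr x k \<in> cocycles cone cone_d n" by (blast elim: cocycle_lift)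
  moreover have "k = p2 (pr x k) \<oplus>\<^bsub>K n\<^esub> \<zero>\<^bsub>K n\<^esub>" using k mK by (simp add: cocycles_def)
  ultimately show "\<exists>z\<in>cocycles cone cone_d n. \<exists>b\<in>coboundaries K e n. k = p2 z \<oplus>\<^bsub>K n\<^esub> b"
    using submodD(3)[OF submod_coboundaries[OF K]] by blast
qed auto

text \<open>The term \<open>H^n(K)\<close> lies between \<open>H^n(cone)\<close> and
  \<open>H^(n+1)(C)\<close>.\<close>

lemma artinian_at_K:
  assumes "artinian_at R cone cone_d n" "artinian_at R C d (Suc n)" shows "artinian_at R K e n"
  unfolding artinian_at_def
proof (rule exact_chain_cond[OF cochainD(1)[OF cochain_cone] mK mC p2_cone_hom Ph
      submod_coboundaries[OF cochain_cone] submod_cocycles[OF cochain_cone]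
      submod_coboundaries[OF C] submod_cocycles[OF C] coboundaries_subset[OF cochain_cone]
      coboundaries_subset[OF C] _ _ _ assms[unfolded artinian_at_def]])
  show "p2 ` coboundaries cone cone_d n \<subseteq> coboundaries K e n" using p2_coboundary by blast
  show "\<Phi> n ` cocycles K e n \<subseteq> cocycles C d (Suc n)" using \<Phi>_cocycle by blast
  fix k assume k: "k \<in> cocycles K e n" "\<Phi> n k \<in> coboundaries C d (Suc n)"
  then obtain x where "x \<in> carrier (C n)" "pr x k \<in> cocycles cone cone_d n" by (blast elim: cocycle_lift)
  moreover have "k = p2 (pr x k) \<oplus>\<^bsub>K n\<^esub> \<zero>\<^bsub>K n\<^esub>" using k mK by (simp add: cocycles_def)
  ultimately show "\<exists>z\<in>cocycles cone cone_d n. \<exists>b\<in>coboundaries K e n. k = p2 z \<oplus>\<^bsub>K n\<^esub> b"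
    using submodD(3)[OF submod_coboundaries[OF K]] by blast
qed

text \<open>The term \<open>H^(n+1)(C)\<close> lies between \<open>H^n(K)\<close> and
  \<open>H^(n+1)(cone)\<close>.\<close>

lemma artinian_at_C:
  assumes "artinian_at R K e n" "artinian_at R cone cone_d (Suc n)" shows "artinian_at R C d (Suc n)"
  unfolding artinian_at_def
proof (rule exact_chain_cond[OF mK mC cochainD(1)[OF cochain_cone] Ph inl_cone_hom
      submod_coboundaries[OF K] submod_cocycles[OF K]
      submod_coboundaries[OF cochain_cone] submod_cocycles[OF cochain_cone]
      coboundaries_subset[OF K] coboundaries_subset[OF cochain_cone] _ _ _ assms[unfolded artinian_at_def]])
  show "\<Phi> n ` coboundaries K e n \<subseteq> coboundaries C d (Suc n)" using \<Phi>_coboundary by blast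
  show "(\<lambda>x. pr x \<zero>\<^bsub>K (Suc n)\<^esub>) ` cocycles C d (Suc n) \<subseteq> cocycles cone cone_d (Suc n)"
    using inl_cocycle by blast
  fix y assume y: "y \<in> cocycles C d (Suc n)" "pr y \<zero>\<^bsub>K (Suc n)\<^esub> \<in> coboundaries cone cone_d (Suc n)"
  then obtain w where "w \<in> carrier (pairm (C n) (K n))" "pr y \<zero>\<^bsub>K (Suc n)\<^esub> = cone_d n w" by (auto simp: cone_def)
  then obtain x k where x: "x \<in> carrier (C n)" and k: "k \<in> carrier (K n)"
    and xk: "y = d n x \<oplus>\<^bsub>C (Suc n)\<^esub> \<Phi> n k" "e n k = \<zero>\<^bsub>K (Suc n)\<^esub>" by (auto elim!: pairm_carrierE)
  have "k \<in> cocycles K e n" using k xk by (simp add: cocycles_def)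
  moreover have "y = \<Phi> n k \<oplus>\<^bsub>C (Suc n)\<^esub> d n x" using xk(1) dx[OF x] Pk[OF k] mC by (simp add: mod_comm)
  ultimately show "\<exists>k\<in>cocycles K e n. \<exists>b\<in>coboundaries C d (Suc n). y = \<Phi> n k \<oplus>\<^bsub>C (Suc n)\<^esub> b"
    using x by auto
qed

lemma exact_at_cone_0:
  assumes "cocycles C d 0 \<subseteq> {\<zero>\<^bsub>C 0\<^esub>}"
    and "\<And>k. k \<in> cocycles K e 0 \<Longrightarrow> \<Phi> 0 k \<in> coboundaries C d (Suc 0) \<Longrightarrow> k = \<zero>\<^bsub>K 0\<^esub>"
  shows "exact_at cone cone_d 0"
  unfolding exact_at_def
proof
  fix z assume "z \<in> cocycles cone cone_d 0"
  then obtain x k where xk: "z = pr x k" "x \<in> carrier (C 0)" "k \<in> cocycles K e 0"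
    "d 0 x \<oplus>\<^bsub>C (Suc 0)\<^esub> \<Phi> 0 k = \<zero>\<^bsub>C (Suc 0)\<^esub>" by (rule cocycles_coneE)
  have kc: "k \<in> carrier (K 0)" using cocyclesD(1)[OF xk(3)] .
  have "\<Phi> 0 k = d 0 (\<ominus>\<^bsub>C 0\<^esub> x)"
    using xk(4) dx[OF xk(2)] Pk[OF kc] mC hom_neg[OF mC mC dC xk(2)] by (metis mod_add_eq_zero mod_comm)
  then have "k = \<zero>\<^bsub>K 0\<^esub>" using assms(2)[OF xk(3)] xk(2) mC by simp
  moreover from this have "x \<in> cocycles C d 0"
    using xk dx[OF xk(2)] mC by (simp add: cocycles_def \<Phi>_zero)
  ultimately show "z \<in> coboundaries cone cone_d 0" using assms(1) xk(1) by (auto simp: cone_def)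
qed

text \<open>\<open>inj\<close> and \<open>surj\<close> concern two consecutive connecting maps:
  injectivity on \<open>H^(n+1)(K)\<close> and surjectivity onto \<open>H^(n+1)(C)\<close>. The
  cohomology of the cone squeezed between them vanishes.\<close>

lemma exact_at_cone_Suc:
  assumes inj: "\<And>k. k \<in> cocycles K e (Suc n) \<Longrightarrow> \<Phi> (Suc n) k \<in> coboundaries C d (Suc (Suc n)) \<Longrightarrow>
      k \<in> coboundaries K e (Suc n)"
    and surj: "\<And>x. x \<in> cocycles C d (Suc n) \<Longrightarrow>
      \<exists>y\<in>carrier (C n). \<exists>k\<in>cocycles K e n. x = d n y \<oplus>\<^bsub>C (Suc n)\<^esub> \<Phi> n k"
  shows "exact_at cone cone_d (Suc n)"
  unfolding exact_at_def
proof
  fix z assume "z \<in> cocycles cone cone_d (Suc n)"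
  then obtain x k where xk: "z = pr x k" "x \<in> carrier (C (Suc n))" "k \<in> cocycles K e (Suc n)"
    "d (Suc n) x \<oplus>\<^bsub>C (Suc (Suc n))\<^esub> \<Phi> (Suc n) k = \<zero>\<^bsub>C (Suc (Suc n))\<^esub>" by (rule cocycles_coneE)
  have kc: "k \<in> carrier (K (Suc n))" using cocyclesD(1)[OF xk(3)] .
  have "\<Phi> (Suc n) k = d (Suc n) (\<ominus>\<^bsub>C (Suc n)\<^esub> x)"
    using xk(4) dx[OF xk(2)] Pk[OF kc] mC hom_neg[OF mC mC dC xk(2)] by (metis mod_add_eq_zero mod_comm)
  then have "k \<in> coboundaries K e (Suc n)" using inj[OF xk(3)] xk(2) mC by simp
  then obtain l where l: "l \<in> carrier (K n)" "k = e n l" by auto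
  have Pl: "\<Phi> n l \<in> carrier (C (Suc n))" using Pk[OF l(1)] .
  have "d (Suc n) (\<Phi> n l) = d (Suc n) x"
    using twistingD(3)[OF \<Phi> l(1)] xk(4) l(2) dx[OF Pl] dx[OF xk(2)] Pk[OF kc] mC
    by (simp add: mod_add_eq_zero)
  then have "x \<ominus>\<^bsub>C (Suc n)\<^esub> \<Phi> n l \<in> cocycles C d (Suc n)"
    using xk(2) Pl dx[OF xk(2)] mC hom_minus[OF mC mC dC xk(2) Pl] by (simp add: cocycles_def)
  then obtain y k1 where y: "y \<in> carrier (C n)" "k1 \<in> cocycles K e n"
    "x \<ominus>\<^bsub>C (Suc n)\<^esub> \<Phi> n l = d n y \<oplus>\<^bsub>C (Suc n)\<^esub> \<Phi> n k1" using surj by blast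
  have k1: "k1 \<in> carrier (K n)" "e n k1 = \<zero>\<^bsub>K (Suc n)\<^esub>" using cocyclesD[OF y(2)] .
  have Pk1: "\<Phi> n k1 \<in> carrier (C (Suc n))" using Pk[OF k1(1)] .
  have "x = (x \<ominus>\<^bsub>C (Suc n)\<^esub> \<Phi> n l) \<oplus>\<^bsub>C (Suc n)\<^esub> \<Phi> n l" using xk(2) Pl mC by simp
  also have "\<dots> = d n y \<oplus>\<^bsub>C (Suc n)\<^esub> \<Phi> n (k1 \<oplus>\<^bsub>K n\<^esub> l)"
    unfolding y(3) using dx[OF y(1)] Pk1 Pl module_homD(2)[OF Ph k1(1) l(1)] mC by (simp add: mod_assoc)
  finally have "z = cone_d n (pr y (k1 \<oplus>\<^bsub>K n\<^esub> l))"
    using xk(1) l(2) module_homD(2)[OF eK k1(1) l(1)] k1(2) kc mK by simp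
  moreover have "pr y (k1 \<oplus>\<^bsub>K n\<^esub> l) \<in> carrier (cone n)" using y(1) k1(1) l(1) mK by (simp add: cone_def)
  ultimately show "z \<in> coboundaries cone cone_d (Suc n)" by (metis coboundaries_simps(2) imageI)
qed

lemma baer_cone: "baer_module R (C n) \<Longrightarrow> baer_module R (K n) \<Longrightarrow> baer_module R (cone n)"
  unfolding cone_def by (rule baer_pairm)

end

lemma (in cring) twisting_torsion:
  assumes C: "cochain R C d" and K: "cochain R K e" and \<Phi>: "twisting R C d K e \<Phi>" and S: "S \<subseteq> carrier R"
  shows "twisting R (torsion_complex R S C) d (torsion_complex R S K) e \<Phi>"
  unfolding twisting_def
proof (intro allI conjI ballI)
  fix n
  have tc: "x \<in> carrier (K n)" if "x \<in> torsion R S (K n)" for x using that by (rule torsion_carrier)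
  show "\<Phi> n \<in> module_hom R (torsion_complex R S K n) (torsion_complex R S C (Suc n))"
    by (rule module_homI)
      (use tc hom_torsion[OF cochainD(1)[OF K] cochainD(1)[OF C] twistingD(1)[OF \<Phi>] S]
        module_homD[OF twistingD(1)[OF \<Phi>]] in auto)
  show "d (Suc n) (\<Phi> n k) \<oplus>\<^bsub>torsion_complex R S C (Suc (Suc n))\<^esub> \<Phi> (Suc n) (e n k) =
      \<zero>\<^bsub>torsion_complex R S C (Suc (Suc n))\<^esub>" if "k \<in> carrier (torsion_complex R S K n)" for k
    using twistingD(3)[OF \<Phi>, of k n] tc that by simp
qed

context mapping_cone
begin

lemma cone_torsion: "S \<subseteq> carrier R \<Longrightarrow>
    mapping_cone R pr p1 p2 (torsion_complex R S C) d (torsion_complex R S K) e \<Phi>"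
  by (simp add: mapping_cone_def mapping_cone_axioms_def cring_pairing_axioms cochain_torsion C K twisting_torsion \<Phi>)

text \<open>Torsion commutes with products of two modules, and restricting carriers does not change
  the formula for the differential. So every statement on cones also applies after a torsion
  functor.\<close>

lemma torsion_cone:
  assumes S: "S \<subseteq> carrier R"
  shows "torsion_complex R S cone = mapping_cone.cone pr p1 p2 (torsion_complex R S C) (torsion_complex R S K)"
    "mapping_cone.cone_d pr p1 p2 (torsion_complex R S C) d e \<Phi> = cone_d"
proof -
  interpret T: mapping_cone R pr p1 p2 "torsion_complex R S C" d "torsion_complex R S K" e \<Phi>
    by (rule cone_torsion[OF S])
  show "torsion_complex R S cone = T.cone"
    by (rule ext) (simp add: torsion_complex_def T.cone_def cone_def torsion_pairm[OF mC mK S], 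
        simp add: pair_module_def)
  show "T.cone_d = cone_d" by (intro ext) (simp add: T.cone_d_def cone_d_def)
qed

end

section \<open>Killing cohomology\<close>

text \<open>\<open>K\<close> is an injective resolution of \<open>T\<close> placed in the degrees \<open>\<ge> j\<close>.\<close>

definition resolves ::
    "('a, 'r) ring_scheme \<Rightarrow> nat \<Rightarrow> ('a, 't, 'm) module_scheme \<Rightarrow> ('t \<Rightarrow> 'x) \<Rightarrow>
     (nat \<Rightarrow> ('a, 'x) module) \<Rightarrow> (nat \<Rightarrow> 'x \<Rightarrow> 'x) \<Rightarrow> bool"
  where "resolves R j T \<epsilon> K e \<longleftrightarrow> module R T \<and> cochain R K e \<and> (\<forall>n. baer_module R (K n)) \<and>
    (\<forall>n<j. carrier (K n) = {\<zero>\<^bsub>K n\<^esub>}) \<and> \<epsilon> \<in> module_hom R T (K j) \<and> inj_on \<epsilon> (carrier T) \<and>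
    cocycles K e j = \<epsilon> ` carrier T \<and> (\<forall>n>j. exact_at K e n)"

text \<open>The cohomology of \<open>C\<close> in degree \<open>n\<close> is identified with \<open>T\<close> by \<open>[\<alpha> p] \<mapsto> \<beta> p\<close>.\<close>

definition represents ::
    "('a, 'r) ring_scheme \<Rightarrow> (nat \<Rightarrow> ('a, 'x) module) \<Rightarrow> (nat \<Rightarrow> 'x \<Rightarrow> 'x) \<Rightarrow> nat \<Rightarrow>
     ('a, 'p, 'k) module_scheme \<Rightarrow> ('p \<Rightarrow> 'x) \<Rightarrow> ('p \<Rightarrow> 't) \<Rightarrow> ('a, 't, 'm) module_scheme \<Rightarrow> bool"
  where "represents R C d n P \<alpha> \<beta> T \<longleftrightarrow> module R P \<and> module R T \<and>
    \<alpha> \<in> module_hom R P (C n) \<and> \<beta> \<in> module_hom R P T \<and> \<beta> ` carrier P = carrier T \<and>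
    \<alpha> ` carrier P \<subseteq> cocycles C d n \<and>
    (\<forall>z\<in>cocycles C d n. \<exists>p\<in>carrier P. \<exists>b\<in>coboundaries C d n. z = \<alpha> p \<oplus>\<^bsub>C n\<^esub> b) \<and>
    (\<forall>p\<in>carrier P. \<alpha> p \<in> coboundaries C d n \<longleftrightarrow> \<beta> p = \<zero>\<^bsub>T\<^esub>)"

lemma resolvesD:
  assumes "resolves R j T \<epsilon> K e"
  shows "module R T" "cochain R K e" "baer_module R (K n)" "n < j \<Longrightarrow> carrier (K n) = {\<zero>\<^bsub>K n\<^esub>}"
    "\<epsilon> \<in> module_hom R T (K j)" "inj_on \<epsilon> (carrier T)" "cocycles K e j = \<epsilon> ` carrier T"
    "n > j \<Longrightarrow> exact_at K e n"
  using assms by (auto simp: resolves_def)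

lemma representsD:
  assumes "represents R C d n P \<alpha> \<beta> T"
  shows "module R P" "module R T" "\<alpha> \<in> module_hom R P (C n)" "\<beta> \<in> module_hom R P T"
    "\<beta> ` carrier P = carrier T" "p \<in> carrier P \<Longrightarrow> \<alpha> p \<in> cocycles C d n"
    "z \<in> cocycles C d n \<Longrightarrow> \<exists>p\<in>carrier P. \<exists>b\<in>coboundaries C d n. z = \<alpha> p \<oplus>\<^bsub>C n\<^esub> b"
    "p \<in> carrier P \<Longrightarrow> \<alpha> p \<in> coboundaries C d n \<longleftrightarrow> \<beta> p = \<zero>\<^bsub>T\<^esub>"
  using assms by (auto simp: represents_def)

text \<open>The zero module in degree 0 makes room: a resolution that kills cohomology in degree
  \<open>j + 1\<close> starts in degree \<open>j\<close>, so cohomology in the original degree 0 has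
  to move up first.\<close>

definition shift_complex :: "(nat \<Rightarrow> ('a, 'x) module) \<Rightarrow> nat \<Rightarrow> ('a, 'x) module"
  where "shift_complex C n = (case n of 0 \<Rightarrow> (C 0)\<lparr>carrier := {\<zero>\<^bsub>C 0\<^esub>}\<rparr> | Suc m \<Rightarrow> C m)"

definition shift_d :: "(nat \<Rightarrow> ('a, 'x) module) \<Rightarrow> (nat \<Rightarrow> 'x \<Rightarrow> 'x) \<Rightarrow> nat \<Rightarrow> 'x \<Rightarrow> 'x"
  where "shift_d C d n = (case n of 0 \<Rightarrow> (\<lambda>_. \<zero>\<^bsub>C 0\<^esub>) | Suc m \<Rightarrow> d m)"

lemma shift_simps [simp]:
  "shift_complex C (Suc m) = C m" "shift_d C d (Suc m) = d m" "shift_d C d 0 = (\<lambda>_. \<zero>\<^bsub>C 0\<^esub>)"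
  "carrier (shift_complex C 0) = {\<zero>\<^bsub>C 0\<^esub>}" "\<zero>\<^bsub>shift_complex C 0\<^esub> = \<zero>\<^bsub>C 0\<^esub>"
  by (simp_all add: shift_complex_def shift_d_def)

lemma cocycles_shift [simp]:
  "cocycles (shift_complex C) (shift_d C d) (Suc n) = cocycles C d n"
  "cocycles (shift_complex C) (shift_d C d) 0 = {\<zero>\<^bsub>C 0\<^esub>}"
  by (auto simp: cocycles_def)

lemma coboundaries_shift [simp]:
  "coboundaries (shift_complex C) (shift_d C d) (Suc n) = coboundaries C d n"
  by (cases n) simp_all

lemma exact_at_shift: "exact_at C d n \<Longrightarrow> exact_at (shift_complex C) (shift_d C d) (Suc n)"
  "exact_at (shift_complex C) (shift_d C d) 0"
  by (simp_all add: exact_at_def del: coboundaries_simps(2))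

lemma artinian_at_shift [simp]:
  "artinian_at R (shift_complex C) (shift_d C d) (Suc n) \<longleftrightarrow> artinian_at R C d n"
  by (simp add: artinian_at_def del: coboundaries_simps(2))

context cring
begin

lemma cochain_shift:
  assumes "cochain R C d" shows "cochain R (shift_complex C) (shift_d C d)"
  unfolding cochain_def
proof (intro allI conjI ballI)
  fix n
  note m = cochainD(1)[OF assms]
  have "module R ((C 0)\<lparr>carrier := {\<zero>\<^bsub>C 0\<^esub>}\<rparr>)" using submod_module[OF m submod_trivial[OF m]] .
  then show "module R (shift_complex C n)" using m by (simp add: shift_complex_def split: nat.split)
  show "shift_d C d n \<in> module_hom R (shift_complex C n) (shift_complex C (Suc n))"
  proof (cases n)
    case 0
    show ?thesis unfolding 0 shift_simps using zero_hom[OF m] .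
  next
    case (Suc k)
    then show ?thesis using cochainD(2)[OF assms] by simp
  qed
  show "shift_d C d (Suc n) (shift_d C d n x) = \<zero>\<^bsub>shift_complex C (Suc (Suc n))\<^esub>"
    if "x \<in> carrier (shift_complex C n)" for x
  proof (cases n)
    case 0
    then show ?thesis using hom_zero[OF m m cochainD(2)[OF assms]] by simp
  next
    case (Suc k)
    then show ?thesis using cochainD(4)[OF assms] that by simp
  qed
qed

lemma baer_zero:
  assumes "module R M" "carrier M = {\<zero>\<^bsub>M\<^esub>}" shows "baer_module R M"
  unfolding baer_module_def
proof (intro conjI assms(1) allI ballI impI)
  fix I f assume f: "f \<in> module_hom R (regmod\<lparr>carrier := I\<rparr>) M" and I: "ideal I R"
  have "f a = a \<odot>\<^bsub>M\<^esub> \<zero>\<^bsub>M\<^esub>" if a: "a \<in> I" for a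
    using module_homD(1)[OF f, of a] a assms ideal.Icarr[OF I a] by simp
  then show "\<exists>e\<in>carrier M. \<forall>a\<in>I. f a = a \<odot>\<^bsub>M\<^esub> e" using assms(2) by blast
qed

lemma baer_shift:
  assumes "\<And>n. baer_module R (C n)" shows "baer_module R (shift_complex C n)"
proof (cases n)
  case 0
  have m: "module R (C 0)" using baer_module_module[OF assms] .
  have "module R (shift_complex C 0)"
    using submod_module[OF m submod_trivial[OF m]] by (simp add: shift_complex_def)
  then show ?thesis unfolding 0 by (rule baer_zero) simp
next
  case (Suc m)
  then show ?thesis using assms by simp
qed

lemma torsion_shift:
  assumes "cochain R C d" "S \<subseteq> carrier R"
  shows "torsion_complex R S (shift_complex C) = shift_complex (torsion_complex R S C)"
proof
  fix n
  show "torsion_complex R S (shift_complex C) n = shift_complex (torsion_complex R S C) n"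
  proof (cases n)
    case 0
    have "torsion R S ((C 0)\<lparr>carrier := {\<zero>\<^bsub>C 0\<^esub>}\<rparr>) = {\<zero>\<^bsub>C 0\<^esub>}"
      using cochainD(1)[OF assms(1), of 0] assms(2) by (auto simp: torsion_def intro!: exI[of _ 0])
    then show ?thesis unfolding 0 by (simp add: torsion_complex_def shift_complex_def)
  qed (simp add: torsion_complex_def)
qed

lemma shift_d_torsion: "shift_d (torsion_complex R S C) d = shift_d C d"
  by (rule ext) (simp add: shift_d_def split: nat.split)

lemma artinian_at_torsion_shift:
  assumes "cochain R C d" "S \<subseteq> carrier R"
  shows "artinian_at R (torsion_complex R S (shift_complex C)) (shift_d C d) (Suc n) \<longleftrightarrow>
    artinian_at R (torsion_complex R S C) d n"
  by (metis artinian_at_shift assms shift_d_torsion torsion_shift)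

lemma artinian_at_torsion_shift_0:
  assumes "cochain R C d" "S \<subseteq> carrier R"
  shows "artinian_at R (torsion_complex R S (shift_complex C)) (shift_d C d) 0"
proof -
  have "exact_at (torsion_complex R S (shift_complex C)) (shift_d C d) 0"
    unfolding torsion_shift[OF assms] using exact_at_shift(2)[of "torsion_complex R S C" d] by (simp add: shift_d_torsion)
  then show ?thesis
    using exact_artinian_at[OF cochain_torsion[OF cochain_shift[OF assms(1)] assms(2)]] by blast
qed

lemma resolves_shift:
  assumes K: "resolves R j T \<epsilon> K e"
  shows "resolves R (Suc j) T \<epsilon> (shift_complex K) (shift_d K e)"
  unfolding resolves_def
proof (intro conjI allI impI)
  fix n
  show "carrier (shift_complex K n) = {\<zero>\<^bsub>shift_complex K n\<^esub>}" if "n < Suc j"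
    using that resolvesD(4)[OF K] by (cases n) auto
  show "exact_at (shift_complex K) (shift_d K e) n" if "Suc j < n"
    using that resolvesD(8)[OF K] exact_at_shift by (cases n) auto
qed (use resolvesD[OF K] cochain_shift[OF resolvesD(2)[OF K]] baer_shift[OF resolvesD(3)[OF K]] in auto)

text \<open>The comparison theorem for a target with injective terms. \<open>\<Phi>\<close> is zero
  below degree \<open>j\<close>, where \<open>K\<close> vanishes, and \<open>u\<close> in degree
  \<open>j\<close>. From there on, the negative of \<open>d\<close> after \<open>\<phi>\<close>
  kills the cocycles of \<open>K\<close>, hence factors through the differential of
  \<open>K\<close>.\<close>

lemma lift_twisting:
  assumes C: "cochain R C d" and baer: "\<And>n. baer_module R (C n)" and K: "resolves R j T \<epsilon> K e"
    and u: "u \<in> module_hom R (K j) (C (Suc j))"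
    and du: "\<And>t. t \<in> carrier T \<Longrightarrow> d (Suc j) (u (\<epsilon> t)) = \<zero>\<^bsub>C (Suc (Suc j))\<^esub>"
  obtains \<Phi> where "twisting R C d K e \<Phi>" "\<Phi> j = u"
proof -
  note mC = cochainD(1)[OF C] and dC = cochainD(2)[OF C] and KC = resolvesD(2)[OF K]
  note mK = cochainD(1)[OF KC] and eK = cochainD(2)[OF KC]
  \<comment> \<open>\<open>P\<close> keeps the invariant that cocycles go to cocycles, which permits
    the next extension. In degree \<open>j\<close> it is the hypothesis \<open>du\<close>; above, it
    follows from exactness of \<open>K\<close>. \<open>Q\<close> is the anticommutation
    rule.\<close>
  define P where "P m \<phi> \<longleftrightarrow> \<phi> \<in> module_hom R (K (j + m)) (C (Suc (j + m))) \<and>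
      (\<forall>k\<in>cocycles K e (j + m). d (Suc (j + m)) (\<phi> k) = \<zero>\<^bsub>C (Suc (Suc (j + m)))\<^esub>) \<and> (m = 0 \<longrightarrow> \<phi> = u)" for m \<phi>
  define Q where "Q m \<phi> \<psi> \<longleftrightarrow> (\<forall>k\<in>carrier (K (j + m)). \<psi> (e (j + m) k) =
      \<ominus>\<^bsub>C (Suc (Suc (j + m)))\<^esub> d (Suc (j + m)) (\<phi> k))" for m \<phi> \<psi>
  have "\<exists>f. \<forall>m. P m (f m) \<and> Q m (f m) (f (Suc m))"
  proof (rule dependent_nat_choice)
    show "\<exists>\<phi>. P 0 \<phi>" unfolding P_def using u du resolvesD(7)[OF K] by auto
    fix \<phi> m assume \<phi>: "P m \<phi>"
    let ?n = "j + m"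
    have \<phi>h: "\<phi> \<in> module_hom R (K ?n) (C (Suc ?n))" using \<phi> by (simp add: P_def)
    have v0: "(\<lambda>k. d (Suc ?n) (\<phi> k)) \<in> module_hom R (K ?n) (C (Suc (Suc ?n)))"
      by (rule module_hom_comp[OF \<phi>h dC])
    have v: "(\<lambda>k. \<ominus>\<^bsub>C (Suc (Suc ?n))\<^esub> d (Suc ?n) (\<phi> k)) \<in> module_hom R (K ?n) (C (Suc (Suc ?n)))"
      by (rule module_homI) (use module_homD[OF v0] mC in \<open>simp_all add: mod_neg_add smult_neg_r\<close>)
    have "\<ominus>\<^bsub>C (Suc (Suc ?n))\<^esub> d (Suc ?n) (\<phi> k) = \<zero>\<^bsub>C (Suc (Suc ?n))\<^esub>"
      if "k \<in> carrier (K ?n)" "e ?n k = \<zero>\<^bsub>K (Suc ?n)\<^esub>" for k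
      using that \<phi> mC by (simp add: P_def cocycles_def)
    from baer_extend[OF baer mK mK eK v this]
    obtain \<psi> where \<psi>: "\<psi> \<in> module_hom R (K (Suc ?n)) (C (Suc (Suc ?n)))"
      "\<And>k. k \<in> carrier (K ?n) \<Longrightarrow> \<psi> (e ?n k) = \<ominus>\<^bsub>C (Suc (Suc ?n))\<^esub> d (Suc ?n) (\<phi> k)" by blast
    have "d (Suc (Suc ?n)) (\<psi> k) = \<zero>\<^bsub>C (Suc (Suc (Suc ?n)))\<^esub>" if "k \<in> cocycles K e (Suc ?n)" for k
    proof -
      have "k \<in> coboundaries K e (Suc ?n)" using resolvesD(8)[OF K, of "Suc ?n"] that by (auto simp: exact_at_def)
      then obtain l where l: "l \<in> carrier (K ?n)" "k = e ?n l" by auto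
      have c: "\<phi> l \<in> carrier (C (Suc ?n))" using module_homD(1)[OF \<phi>h l(1)] .
      show ?thesis
        using l \<psi>(2) hom_neg[OF mC mC dC cochainD(3)[OF C c]] cochainD(4)[OF C c] mC by simp
    qed
    then show "\<exists>\<psi>. P (Suc m) \<psi> \<and> Q m \<phi> \<psi>"
      unfolding P_def Q_def using \<psi> by (intro exI[of _ \<psi>]) simp
  qed
  then obtain f where f: "\<And>m. P m (f m)" "\<And>m. Q m (f m) (f (Suc m))" by blast
  define \<Phi> where "\<Phi> n = (if n < j then (\<lambda>_. \<zero>\<^bsub>C (Suc n)\<^esub>) else f (n - j))" for n
  have hom: "\<Phi> n \<in> module_hom R (K n) (C (Suc n))" for n
  proof (cases "n < j")
    case True
    then show ?thesis using zero_hom[OF mC] by (simp add: \<Phi>_def)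
  next
    case False
    then have "j + (n - j) = n" by simp
    then have "f (n - j) \<in> module_hom R (K n) (C (Suc n))" using f(1)[of "n - j"] unfolding P_def by metis
    then show ?thesis using False by (simp add: \<Phi>_def)
  qed
  show ?thesis
  proof (rule that[of \<Phi>])
    show "\<Phi> j = u" using f(1)[of 0] by (simp add: \<Phi>_def P_def)
    show "twisting R C d K e \<Phi>"
      unfolding twisting_def
    proof (intro allI conjI ballI hom)
      fix n k assume k: "k \<in> carrier (K n)"
      show "d (Suc n) (\<Phi> n k) \<oplus>\<^bsub>C (Suc (Suc n))\<^esub> \<Phi> (Suc n) (e n k) = \<zero>\<^bsub>C (Suc (Suc n))\<^esub>"
      proof (cases "n < j")
        case True
        then have "k = \<zero>\<^bsub>K n\<^esub>" using k resolvesD(4)[OF K] by auto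
        then show ?thesis
          using hom_zero[OF mK mC hom] hom_zero[OF mC mC dC] hom_zero[OF mK mK eK] mC by simp
      next
        case False
        then have "\<Phi> (Suc n) (e n k) = \<ominus>\<^bsub>C (Suc (Suc n))\<^esub> d (Suc n) (\<Phi> n k)"
          using f(2)[of "n - j"] k by (simp add: Q_def \<Phi>_def Suc_diff_le)
        then show ?thesis using cochainD(3)[OF C module_homD(1)[OF hom k]] mC by simp
      qed
    qed
  qed
qed

end

section \<open>Cones under torsion functors\<close>

context mapping_cone
begin

lemma torsion_artinian_at_cone:
  assumes "S \<subseteq> carrier R" "artinian_at R (torsion_complex R S C) d n" "artinian_at R (torsion_complex R S K) e n"
  shows "artinian_at R (torsion_complex R S cone) cone_d n"
  using mapping_cone.artinian_at_cone[OF cone_torsion[OF assms(1)] assms(2,3)] torsion_cone[OF assms(1)] by simp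

lemma torsion_artinian_at_K:
  assumes "S \<subseteq> carrier R" "artinian_at R (torsion_complex R S cone) cone_d n"
    "artinian_at R (torsion_complex R S C) d (Suc n)"
  shows "artinian_at R (torsion_complex R S K) e n"
  using mapping_cone.artinian_at_K[OF cone_torsion[OF assms(1)] _ assms(3)] assms(2) torsion_cone[OF assms(1)] by simp

lemma torsion_artinian_at_C:
  assumes "S \<subseteq> carrier R" "artinian_at R (torsion_complex R S K) e n"
    "artinian_at R (torsion_complex R S cone) cone_d (Suc n)"
  shows "artinian_at R (torsion_complex R S C) d (Suc n)"
  using mapping_cone.artinian_at_C[OF cone_torsion[OF assms(1)] assms(2)] assms(3) torsion_cone[OF assms(1)] by simp

lemma torsion_artinian_kernel:
  assumes "S \<subseteq> carrier R" "artinian_at R (torsion_complex R S cone) cone_d n"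
  shows "chain_cond False R (torsion_complex R S K n) (coboundaries (torsion_complex R S K) e n)
    {k \<in> cocycles (torsion_complex R S K) e n. \<Phi> n k \<in> coboundaries (torsion_complex R S C) d (Suc n)}"
  using mapping_cone.artinian_kernel[OF cone_torsion[OF assms(1)]] assms(2) torsion_cone[OF assms(1)] by simp

text \<open>The cone consists of injective modules, so its torsion is acyclic as well, and its two
  neighbours in the long exact sequence control each other.\<close>

lemma artinian_at_acyclic_cone:
  assumes "\<And>n. baer_module R (C n)" "\<And>n. baer_module R (K n)" "\<And>n. exact_at cone cone_d n"
    and S: "S \<subseteq> carrier R"
  shows "artinian_at R (torsion_complex R S K) e n \<longleftrightarrow> artinian_at R (torsion_complex R S C) d (Suc n)"
proof -
  have "exact_at (torsion_complex R S cone) cone_d n" for n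
    by (rule exact_torsion[OF cochain_cone baer_cone S]) (use assms in auto)
  then have "artinian_at R (torsion_complex R S cone) cone_d n" for n
    by (rule exact_artinian_at[OF cochain_torsion[OF cochain_cone S]])
  then show ?thesis using torsion_artinian_at_K[OF S] torsion_artinian_at_C[OF S] by blast
qed

text \<open>If \<open>K\<close> has no cohomology in degrees \<open>n - 1\<close> and \<open>n\<close>, then \<open>C\<close> and the cone
  have the same cohomology in degree \<open>n\<close>.\<close>

lemma represents_cone:
  assumes ex: "exact_at K e m" "exact_at K e (Suc m)" and rep: "represents R C d (Suc m) P \<alpha> \<beta> T"
  shows "represents R cone cone_d (Suc m) P (\<lambda>p. pr (\<alpha> p) \<zero>\<^bsub>K (Suc m)\<^esub>) \<beta> T"
  unfolding represents_def
proof (intro conjI ballI)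
  note r = representsD[OF rep]
  show "module R P" "module R T" "\<beta> \<in> module_hom R P T" "\<beta> ` carrier P = carrier T" using r by auto
  show "(\<lambda>p. pr (\<alpha> p) \<zero>\<^bsub>K (Suc m)\<^esub>) \<in> module_hom R P (cone (Suc m))"
    by (rule module_hom_comp[OF r(3) inl_cone_hom])
  show "(\<lambda>p. pr (\<alpha> p) \<zero>\<^bsub>K (Suc m)\<^esub>) ` carrier P \<subseteq> cocycles cone cone_d (Suc m)"
    using r(6) inl_cocycle by blast
next
  note r = representsD[OF rep]
  fix z assume "z \<in> cocycles cone cone_d (Suc m)"
  then obtain x k where xk: "z = pr x k" "x \<in> carrier (C (Suc m))" "k \<in> cocycles K e (Suc m)"
    "d (Suc m) x \<oplus>\<^bsub>C (Suc (Suc m))\<^esub> \<Phi> (Suc m) k = \<zero>\<^bsub>C (Suc (Suc m))\<^esub>" by (rule cocycles_coneE)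
  have kc: "k \<in> carrier (K (Suc m))" using cocyclesD(1)[OF xk(3)] .
  have "k \<in> coboundaries K e (Suc m)" using ex(2) xk(3) by (auto simp: exact_at_def)
  then obtain l where l: "l \<in> carrier (K m)" "k = e m l" by auto
  have Pl: "\<Phi> m l \<in> carrier (C (Suc m))" using Pk[OF l(1)] .
  have "d (Suc m) (\<Phi> m l) = d (Suc m) x"
    using twistingD(3)[OF \<Phi> l(1)] xk(4) l(2) dx[OF Pl] dx[OF xk(2)] Pk[OF kc] mC
    by (simp add: mod_add_eq_zero)
  then have "x \<ominus>\<^bsub>C (Suc m)\<^esub> \<Phi> m l \<in> cocycles C d (Suc m)"
    using xk(2) Pl dx[OF xk(2)] mC hom_minus[OF mC mC dC xk(2) Pl] by (simp add: cocycles_def)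
  then obtain p b where p: "p \<in> carrier P" "b \<in> coboundaries C d (Suc m)"
    "x \<ominus>\<^bsub>C (Suc m)\<^esub> \<Phi> m l = \<alpha> p \<oplus>\<^bsub>C (Suc m)\<^esub> b" using r(7) by blast
  have \<alpha>p: "\<alpha> p \<in> carrier (C (Suc m))" and bc: "b \<in> carrier (C (Suc m))"
    using module_homD(1)[OF r(3) p(1)] submodD(2)[OF submod_coboundaries[OF C] p(2)] by auto
  have "x = (x \<ominus>\<^bsub>C (Suc m)\<^esub> \<Phi> m l) \<oplus>\<^bsub>C (Suc m)\<^esub> \<Phi> m l" using xk(2) Pl mC by simp
  then have "z = pr (\<alpha> p) \<zero>\<^bsub>K (Suc m)\<^esub> \<oplus>\<^bsub>cone (Suc m)\<^esub> (pr b \<zero>\<^bsub>K (Suc m)\<^esub> \<oplus>\<^bsub>cone (Suc m)\<^esub> pr (\<Phi> m l) k)"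
    unfolding p(3) using xk(1) \<alpha>p bc Pl kc mC mK by (simp add: cone_def mod_assoc)
  moreover have "pr (\<Phi> m l) k = cone_d m (pr \<zero>\<^bsub>C m\<^esub> l)" using l(2) Pl mC by (simp add: d_zero)
  moreover have "pr \<zero>\<^bsub>C m\<^esub> l \<in> carrier (cone m)" using l(1) mC by (simp add: cone_def)
  then have "cone_d m (pr \<zero>\<^bsub>C m\<^esub> l) \<in> coboundaries cone cone_d (Suc m)"
    unfolding coboundaries_simps by (rule imageI)
  moreover have "pr b \<zero>\<^bsub>K (Suc m)\<^esub> \<in> coboundaries cone cone_d (Suc m)" by (rule inl_coboundary[OF p(2)])
  ultimately show "\<exists>p\<in>carrier P. \<exists>b\<in>coboundaries cone cone_d (Suc m).
      z = pr (\<alpha> p) \<zero>\<^bsub>K (Suc m)\<^esub> \<oplus>\<^bsub>cone (Suc m)\<^esub> b"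
    using submodD(4)[OF submod_coboundaries[OF cochain_cone]] p(1) by metis
next
  note r = representsD[OF rep]
  fix p assume p: "p \<in> carrier P"
  have "\<alpha> p \<in> coboundaries C d (Suc m)" if cob: "pr (\<alpha> p) \<zero>\<^bsub>K (Suc m)\<^esub> \<in> coboundaries cone cone_d (Suc m)"
  proof -
    obtain w where w: "w \<in> carrier (pairm (C m) (K m))" "pr (\<alpha> p) \<zero>\<^bsub>K (Suc m)\<^esub> = cone_d m w"
      using cob by (auto simp: cone_def)
    obtain y k where "w = pr y k" and y: "y \<in> carrier (C m)" and k: "k \<in> carrier (K m)"
      using w(1) by (rule pairm_carrierE)
    then have yk: "\<alpha> p = d m y \<oplus>\<^bsub>C (Suc m)\<^esub> \<Phi> m k" "e m k = \<zero>\<^bsub>K (Suc m)\<^esub>" using w(2) by simp_all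
    then have "k \<in> coboundaries K e m" using ex(1) k by (auto simp: exact_at_def cocycles_def)
    then have "\<Phi> m k \<in> coboundaries C d (Suc m)" by (rule \<Phi>_coboundary)
    moreover have "d m y \<in> coboundaries C d (Suc m)" using y by simp
    ultimately show ?thesis using yk(1) submodD(4)[OF submod_coboundaries[OF C]] by metis
  qed
  then show "pr (\<alpha> p) \<zero>\<^bsub>K (Suc m)\<^esub> \<in> coboundaries cone cone_d (Suc m) \<longleftrightarrow> \<beta> p = \<zero>\<^bsub>T\<^esub>"
    using inl_coboundary[of "\<alpha> p" "Suc m"] r(8)[OF p] by blast
qed

lemma exact_at_cone_exact:
  assumes "exact_at K e (Suc n)" "exact_at C d (Suc n)" shows "exact_at cone cone_d (Suc n)"
proof (rule exact_at_cone_Suc)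
  fix x assume "x \<in> cocycles C d (Suc n)"
  then obtain y where y: "y \<in> carrier (C n)" "x = d n y" using assms(2) by (auto simp: exact_at_def)
  then have "x = d n y \<oplus>\<^bsub>C (Suc n)\<^esub> \<Phi> n \<zero>\<^bsub>K n\<^esub>" using dx[OF y(1)] mC by (simp add: \<Phi>_zero)
  then show "\<exists>y\<in>carrier (C n). \<exists>k\<in>cocycles K e n. x = d n y \<oplus>\<^bsub>C (Suc n)\<^esub> \<Phi> n k"
    using y(1) submodD(3)[OF submod_cocycles[OF K]] by blast
qed (use assms in \<open>auto simp: exact_at_def\<close>)

end

context cring_pairing
begin

text \<open>The lowest cohomology of a complex of injective modules is a direct summand up to
  homotopy: the exactness below provides a projection \<open>r\<close> along the coboundaries.\<close>

lemma kill_cohomology: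
  assumes C: "cochain R C d" and baer: "\<And>n. baer_module R (C n)" and ex: "\<And>n. n \<le> j \<Longrightarrow> exact_at C d n"
    and rep: "represents R C d (Suc j) P \<alpha> \<beta> T" and res: "resolves R j T \<epsilon> K e"
  obtains \<Phi> where "mapping_cone R pr p1 p2 C d K e \<Phi>"
    "\<And>n. n \<le> Suc j \<Longrightarrow> exact_at (mapping_cone.cone pr p1 p2 C K) (mapping_cone.cone_d pr p1 p2 C d e \<Phi>) n"
proof -
  note mC = cochainD(1)[OF C] and dC = cochainD(2)[OF C] and KC = resolvesD(2)[OF res] and r = representsD[OF rep]
  note mK = cochainD(1)[OF KC] and eK = cochainD(2)[OF KC] and \<epsilon> = resolvesD(5)[OF res] and mT = resolvesD(1)[OF res]
  let ?j = "Suc j"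
  obtain s where s: "s \<in> module_hom R (C ?j) (C j)" "\<And>x. x \<in> carrier (C j) \<Longrightarrow> d j (s (d j x)) = d j x"
    using split_exact[OF C baer ex] by blast
  \<comment> \<open>\<open>\<rho>\<close> alters an element by a coboundary and kills all
    coboundaries. It is thus a linear choice of representatives for the cohomology classes in degree
    \<open>j + 1\<close>.\<close>
  define \<rho> where "\<rho> x = x \<ominus>\<^bsub>C ?j\<^esub> d j (s x)" for x
  have dsh: "(\<lambda>x. d j (s x)) \<in> module_hom R (C ?j) (C ?j)" by (rule module_hom_comp[OF s(1) dC])
  have \<rho>: "\<rho> \<in> module_hom R (C ?j) (C ?j)"
    unfolding \<rho>_def by (rule module_homI)
      (use module_homD[OF dsh] mC in \<open>simp_all add: a_minus_def mod_neg_add smult_r_add smult_neg_r mod_ac\<close>)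
  have \<rho>cob: "\<rho> x = \<zero>\<^bsub>C ?j\<^esub>" if "x \<in> coboundaries C d ?j" for x
    using that s(2) cochainD(3)[OF C] mC by (auto simp: \<rho>_def)
  have d\<rho>: "d ?j (\<rho> x) = d ?j x" if x: "x \<in> carrier (C ?j)" for x
    using hom_minus[OF mC mC dC x module_homD(1)[OF dsh x]] cochainD(4)[OF C module_homD(1)[OF s(1) x]]
      cochainD(3)[OF C x] mC by (simp add: \<rho>_def)
  have split: "x = d j (s x) \<oplus>\<^bsub>C ?j\<^esub> \<rho> x" if x: "x \<in> carrier (C ?j)" for x
    using x module_homD(1)[OF dsh x] mC by (simp add: \<rho>_def)
  have \<epsilon>\<beta>: "(\<lambda>p. \<epsilon> (\<beta> p)) \<in> module_hom R P (K j)" by (rule module_hom_comp[OF r(4) \<epsilon>])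
  have \<rho>\<alpha>: "(\<lambda>p. \<rho> (\<alpha> p)) \<in> module_hom R P (C ?j)" by (rule module_hom_comp[OF r(3) \<rho>])
  have \<epsilon>0: "t = \<zero>\<^bsub>T\<^esub>" if "t \<in> carrier T" "\<epsilon> t = \<zero>\<^bsub>K j\<^esub>" for t
    using that hom_zero[OF mT mK \<epsilon>] inj_onD[OF resolvesD(6)[OF res], of t "\<zero>\<^bsub>T\<^esub>"] mT by simp
  have "\<rho> (\<alpha> p) = \<zero>\<^bsub>C ?j\<^esub>" if "p \<in> carrier P" "\<epsilon> (\<beta> p) = \<zero>\<^bsub>K j\<^esub>" for p
    using that \<epsilon>0[of "\<beta> p"] module_homD(1)[OF r(4) that(1)] r(8)[OF that(1)] \<rho>cob by simp
  \<comment> \<open>On the copy of \<open>T\<close> inside \<open>K j\<close>, the map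
    \<open>u\<close> sends a class to its representative chosen by \<open>\<rho>\<close>;
    injectivity of the target extends it to all of \<open>K j\<close>.\<close>
  from baer_extend[OF baer r(1) mK \<epsilon>\<beta> \<rho>\<alpha> this]
  obtain u where u: "u \<in> module_hom R (K j) (C ?j)" "\<And>p. p \<in> carrier P \<Longrightarrow> u (\<epsilon> (\<beta> p)) = \<rho> (\<alpha> p)" by blast
  have "d ?j (u (\<epsilon> t)) = \<zero>\<^bsub>C (Suc ?j)\<^esub>" if t: "t \<in> carrier T" for t
  proof -
    obtain p where p: "p \<in> carrier P" "t = \<beta> p" using t r(5) by auto
    then show ?thesis using u(2)[OF p(1)] d\<rho> module_homD(1)[OF r(3) p(1)] cocyclesD(2)[OF r(6)[OF p(1)]] by simp
  qed
  from lift_twisting[OF C baer res u(1) this]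
  obtain \<Phi> where tw: "twisting R C d K e \<Phi>" "\<Phi> j = u" by blast
  interpret mapping_cone R pr p1 p2 C d K e \<Phi> by unfold_locales (rule C KC tw)+
  \<comment> \<open>Below degree \<open>j\<close> the complex \<open>K\<close> is zero. In degree
    \<open>j\<close> the connecting map is the identification of \<open>T\<close> with the
    cohomology of \<open>C\<close>.\<close>
  have inj: "k = \<zero>\<^bsub>K n\<^esub>" if n: "n \<le> j" and k: "k \<in> cocycles K e n" and \<Phi>k: "\<Phi> n k \<in> coboundaries C d (Suc n)" for n k
  proof (cases "n = j")
    case True
    then obtain t where t: "t \<in> carrier T" "k = \<epsilon> t" using k resolvesD(7)[OF res] by auto
    then obtain p where p: "p \<in> carrier P" "t = \<beta> p" using r(5) by auto
    have \<alpha>p: "\<alpha> p \<in> carrier (C ?j)" using module_homD(1)[OF r(3) p(1)] .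
    have "\<rho> (\<alpha> p) \<in> coboundaries C d ?j" using \<Phi>k u(2)[OF p(1)] t p tw(2) True by simp
    moreover have "d j (s (\<alpha> p)) \<in> coboundaries C d ?j" using module_homD(1)[OF s(1) \<alpha>p] by simp
    ultimately have "\<alpha> p \<in> coboundaries C d ?j"
      using split[OF \<alpha>p] submodD(4)[OF submod_coboundaries[OF C]] by metis
    then have "t = \<zero>\<^bsub>T\<^esub>" using r(8)[OF p(1)] p(2) by simp
    then show ?thesis using t True hom_zero[OF mT mK \<epsilon>] by simp
  next
    case False
    then show ?thesis using n k resolvesD(4)[OF res, of n] by (auto simp: cocycles_def)
  qed
  show ?thesis
  proof (rule that[OF mapping_cone_axioms])
    fix n assume n: "n \<le> ?j"
    show "exact_at cone cone_d n"
    proof (cases n)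
      case 0
      have "cocycles C d 0 \<subseteq> {\<zero>\<^bsub>C 0\<^esub>}" using ex[of 0] by (simp add: exact_at_def)
      then show ?thesis unfolding 0 by (rule exact_at_cone_0) (rule inj, auto)
    next
      case (Suc m)
      show ?thesis
        unfolding Suc
      proof (rule exact_at_cone_Suc)
        fix k assume k: "k \<in> cocycles K e (Suc m)" "\<Phi> (Suc m) k \<in> coboundaries C d (Suc (Suc m))"
        show "k \<in> coboundaries K e (Suc m)"
        proof (cases "Suc m \<le> j")
          case True
          then show ?thesis using inj[OF True k] submodD(3)[OF submod_coboundaries[OF KC]] by metis
        next
          case False
          then show ?thesis using resolvesD(8)[OF res, of "Suc m"] k(1) by (auto simp: exact_at_def)
        qed
      next
        fix x assume x: "x \<in> cocycles C d (Suc m)"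
        show "\<exists>y\<in>carrier (C m). \<exists>k\<in>cocycles K e m. x = d m y \<oplus>\<^bsub>C (Suc m)\<^esub> \<Phi> m k"
        proof (cases "Suc m \<le> j")
          case True
          then obtain y where y: "y \<in> carrier (C m)" "x = d m y" using ex[of "Suc m"] x by (auto simp: exact_at_def)
          then have "x = d m y \<oplus>\<^bsub>C (Suc m)\<^esub> \<Phi> m \<zero>\<^bsub>K m\<^esub>" using dx[OF y(1)] mC by (simp add: \<Phi>_zero)
          then show ?thesis using y(1) submodD(3)[OF submod_cocycles[OF KC]] by blast
        next
          case False
          then have m: "m = j" using n Suc by simp
          obtain p b where p: "p \<in> carrier P" "b \<in> coboundaries C d ?j" "x = \<alpha> p \<oplus>\<^bsub>C ?j\<^esub> b"
            using r(7) x m by blast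
          obtain y where y: "y \<in> carrier (C j)" "b = d j y" using p(2) by auto
          have \<alpha>p: "\<alpha> p \<in> carrier (C ?j)" using module_homD(1)[OF r(3) p(1)] .
          have sp: "s (\<alpha> p) \<in> carrier (C j)" using module_homD(1)[OF s(1) \<alpha>p] .
          have "x = d j (s (\<alpha> p)) \<oplus>\<^bsub>C ?j\<^esub> \<rho> (\<alpha> p) \<oplus>\<^bsub>C ?j\<^esub> d j y" using p(3) split[OF \<alpha>p] y(2) by metis
          also have "\<dots> = d j (s (\<alpha> p) \<oplus>\<^bsub>C j\<^esub> y) \<oplus>\<^bsub>C ?j\<^esub> \<Phi> j (\<epsilon> (\<beta> p))"
            using module_homD(2)[OF dC sp y(1)] dx[OF sp] dx[OF y(1)] module_homD(1)[OF \<rho> \<alpha>p] u(2)[OF p(1)] tw(2) mC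
            by (simp add: mod_ac)
          finally have "x = d j (s (\<alpha> p) \<oplus>\<^bsub>C j\<^esub> y) \<oplus>\<^bsub>C ?j\<^esub> \<Phi> j (\<epsilon> (\<beta> p))" .
          moreover have "s (\<alpha> p) \<oplus>\<^bsub>C j\<^esub> y \<in> carrier (C j)" using sp y(1) mC by simp
          moreover have "\<epsilon> (\<beta> p) \<in> cocycles K e j" using resolvesD(7)[OF res] module_homD(1)[OF r(4) p(1)] by blast
          ultimately show ?thesis using m by blast
        qed
      qed
    qed
  qed
qed

end

section \<open>Comparison of resolutions\<close>

context cring
begin

sublocale prod: cring_pairing R Pair fst snd
  by unfold_locales auto

text \<open>\<open>T\<close> is the only cohomology of \<open>C\<close>, so killing it leaves an
  acyclic cone. The cohomology sits in degree 1, which accounts for the \<open>Suc n\<close> on the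
  right. \<open>C\<close> and \<open>K\<close> may live in different types.\<close>

lemma artinian_at_resolution:
  assumes C: "cochain R C d" and baer: "\<And>n. baer_module R (C n)"
    and ex: "exact_at C d 0" "\<And>n. exact_at C d (Suc (Suc n))"
    and rep: "represents R C d (Suc 0) P \<alpha> \<beta> T" and res: "resolves R 0 T \<epsilon> K e" and S: "S \<subseteq> carrier R"
  shows "artinian_at R (torsion_complex R S K) e n \<longleftrightarrow> artinian_at R (torsion_complex R S C) d (Suc n)"
proof -
  obtain \<Phi> where tw: "mapping_cone R Pair fst snd C d K e \<Phi>"
    "\<And>n. n \<le> Suc 0 \<Longrightarrow> exact_at (mapping_cone.cone Pair fst snd C K) (mapping_cone.cone_d Pair fst snd C d e \<Phi>) n"
    using prod.kill_cohomology[OF C baer _ rep res] ex(1) by blast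
  interpret mapping_cone R Pair fst snd C d K e \<Phi> by (rule tw)
  have "exact_at cone cone_d n" for n
  proof (cases "n \<le> Suc 0")
    case False
    then obtain m where m: "n = Suc (Suc m)" by (metis Suc_le_D not_less_eq_eq)
    show ?thesis unfolding m using exact_at_cone_exact resolvesD(8)[OF res] ex(2) by blast
  qed (rule tw)
  from artinian_at_acyclic_cone[OF baer resolvesD(3)[OF res] this S] show ?thesis .
qed

text \<open>Independence of the resolution, also across types: the shifted complex \<open>L\<close>
  has \<open>T\<close> as its only cohomology, in degree 1, and is compared with
  \<open>K\<close>.\<close>

lemma artinian_at_unique:
  assumes K: "resolves R 0 T \<epsilon> K e" and L: "resolves R 0 T \<epsilon>' L e'" and S: "S \<subseteq> carrier R"
  shows "artinian_at R (torsion_complex R S K) e n \<longleftrightarrow> artinian_at R (torsion_complex R S L) e' n"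
proof -
  note LC = resolvesD(2)[OF L] and mL = cochainD(1)[OF resolvesD(2)[OF L]]
  have "represents R (shift_complex L) (shift_d L e') (Suc 0) T \<epsilon>' (\<lambda>t. t) T"
    unfolding represents_def
  proof (intro conjI ballI)
    show "module R T" "module R T" using resolvesD(1)[OF L] by auto
    show "(\<lambda>t. t) \<in> module_hom R T T" by (rule id_hom)
    show "\<epsilon>' t \<in> coboundaries (shift_complex L) (shift_d L e') (Suc 0) \<longleftrightarrow> t = \<zero>\<^bsub>T\<^esub>" if "t \<in> carrier T" for t
      using that hom_zero[OF resolvesD(1)[OF L] mL resolvesD(5)[OF L]] resolvesD(1)[OF L]
        inj_onD[OF resolvesD(6)[OF L], of t "\<zero>\<^bsub>T\<^esub>"] by auto
    fix z assume "z \<in> cocycles (shift_complex L) (shift_d L e') (Suc 0)"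
    then obtain t where t: "t \<in> carrier T" "z = \<epsilon>' t" using resolvesD(7)[OF L] by auto
    then have "z = \<epsilon>' t \<oplus>\<^bsub>shift_complex L (Suc 0)\<^esub> \<zero>\<^bsub>L 0\<^esub>"
      using module_homD(1)[OF resolvesD(5)[OF L] t(1)] mL by simp
    then show "\<exists>t\<in>carrier T. \<exists>b\<in>coboundaries (shift_complex L) (shift_d L e') (Suc 0).
        z = \<epsilon>' t \<oplus>\<^bsub>shift_complex L (Suc 0)\<^esub> b" using t(1) by auto
  qed (use resolvesD[OF L] in auto)
  from artinian_at_resolution[OF cochain_shift[OF LC] baer_shift[OF resolvesD(3)[OF L]] exact_at_shift(2)
      exact_at_shift(1)[OF resolvesD(8)[OF L]] this K S]
  show ?thesis using artinian_at_torsion_shift[OF LC S] by simp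
qed

text \<open>The map of resolutions induced by \<open>q\<close> has a cone that resolves the kernel
  \<open>A\<close>. Its long exact sequence relates the three modules, and
  \<open>artinian_at_unique\<close> replaces the cone by the given resolution of
  \<open>A\<close>.\<close>

lemma artinian_at_extension:
  assumes T: "resolves R 0 T \<epsilon> K e" and Q: "resolves R 0 Q \<epsilon>' L e'" and A: "resolves R 0 (T\<lparr>carrier := A\<rparr>) \<epsilon>'' N e''"
    and q: "q \<in> module_hom R T Q" "q ` carrier T = carrier Q" "\<And>t. t \<in> carrier T \<Longrightarrow> q t = \<zero>\<^bsub>Q\<^esub> \<longleftrightarrow> t \<in> A"
    and S: "S \<subseteq> carrier R" and AT: "A \<subseteq> carrier T"
    and art: "artinian_at R (torsion_complex R S N) e'' n" "artinian_at R (torsion_complex R S L) e' n"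
  shows "artinian_at R (torsion_complex R S K) e n"
proof -
  note KC = resolvesD(2)[OF T] and LC = resolvesD(2)[OF Q] and mT = resolvesD(1)[OF T] and mQ = resolvesD(1)[OF Q]
  note mK = cochainD(1)[OF resolvesD(2)[OF T]] and mL = cochainD(1)[OF resolvesD(2)[OF Q]]
  note \<epsilon> = resolvesD(5)[OF T] and \<epsilon>' = resolvesD(5)[OF Q]
  have \<epsilon>0: "t = \<zero>\<^bsub>T\<^esub>" if "t \<in> carrier T" "\<epsilon> t = \<zero>\<^bsub>K 0\<^esub>" for t
    using that hom_zero[OF mT mK \<epsilon>] inj_onD[OF resolvesD(6)[OF T], of t "\<zero>\<^bsub>T\<^esub>"] mT by simp
  have \<epsilon>'0: "t = \<zero>\<^bsub>Q\<^esub>" if "t \<in> carrier Q" "\<epsilon>' t = \<zero>\<^bsub>L 0\<^esub>" for t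
    using that hom_zero[OF mQ mL \<epsilon>'] inj_onD[OF resolvesD(6)[OF Q], of t "\<zero>\<^bsub>Q\<^esub>"] mQ by simp
  have \<epsilon>'q: "(\<lambda>t. \<epsilon>' (q t)) \<in> module_hom R T (L 0)" by (rule module_hom_comp[OF q(1) \<epsilon>'])
  have "\<epsilon>' (q t) = \<zero>\<^bsub>L 0\<^esub>" if "t \<in> carrier T" "\<epsilon> t = \<zero>\<^bsub>K 0\<^esub>" for t
    using \<epsilon>0[OF that] hom_zero[OF mT mL \<epsilon>'q] by simp
  from baer_extend[OF resolvesD(3)[OF Q] mT mK \<epsilon> \<epsilon>'q this]
  obtain u where u: "u \<in> module_hom R (K 0) (L 0)" "\<And>t. t \<in> carrier T \<Longrightarrow> u (\<epsilon> t) = \<epsilon>' (q t)" by blast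
  let ?L = "shift_complex L" and ?e = "shift_d L e'"
  have u': "u \<in> module_hom R (K 0) (?L (Suc 0))" using u(1) by simp
  have "?e (Suc 0) (u (\<epsilon> t)) = \<zero>\<^bsub>?L (Suc (Suc 0))\<^esub>" if t: "t \<in> carrier T" for t
  proof -
    have "\<epsilon>' (q t) \<in> cocycles L e' 0" using resolvesD(7)[OF Q] module_homD(1)[OF q(1) t] by blast
    then show ?thesis using u(2)[OF t] by (simp add: cocycles_def)
  qed
  from lift_twisting[OF cochain_shift[OF LC] baer_shift[OF resolvesD(3)[OF Q]] T u' this]
  obtain \<Phi> where tw: "twisting R ?L ?e K e \<Phi>" "\<Phi> 0 = u" by blast
  interpret mapping_cone R Pair fst snd ?L ?e K e \<Phi>
    by unfold_locales (rule cochain_shift[OF LC] KC tw)+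
  let ?A = "T\<lparr>carrier := A\<rparr>"
  have A0: "cocycles cone cone_d 0 = (\<lambda>t. (\<zero>\<^bsub>L 0\<^esub>, \<epsilon> t)) ` A"
  proof (intro subset_antisym subsetI)
    fix z assume "z \<in> cocycles cone cone_d 0"
    then obtain x k where xk: "z = (x, k)" "x \<in> carrier (?L 0)" "k \<in> cocycles K e 0"
      "?e 0 x \<oplus>\<^bsub>?L (Suc 0)\<^esub> \<Phi> 0 k = \<zero>\<^bsub>?L (Suc 0)\<^esub>" by (rule cocycles_coneE)
    obtain t where t: "t \<in> carrier T" "k = \<epsilon> t" using xk(3) resolvesD(7)[OF T] by auto
    have "\<epsilon>' (q t) = \<zero>\<^bsub>L 0\<^esub>" using xk t u(2) tw(2) module_homD(1)[OF \<epsilon>'q t(1)] mL by simp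
    then have "t \<in> A" using \<epsilon>'0[OF module_homD(1)[OF q(1) t(1)]] q(3)[OF t(1)] by blast
    then show "z \<in> (\<lambda>t. (\<zero>\<^bsub>L 0\<^esub>, \<epsilon> t)) ` A" using xk(1,2) t by simp
  next
    fix z assume "z \<in> (\<lambda>t. (\<zero>\<^bsub>L 0\<^esub>, \<epsilon> t)) ` A"
    then obtain t where t: "t \<in> A" "z = (\<zero>\<^bsub>L 0\<^esub>, \<epsilon> t)" by auto
    have tT: "t \<in> carrier T" using t AT by auto
    have "\<epsilon> t \<in> cocycles K e 0" using resolvesD(7)[OF T] tT by blast
    then show "z \<in> cocycles cone cone_d 0"
      unfolding t(2) using u(2)[OF tT] q(3)[OF tT] t(1) hom_zero[OF mQ mL \<epsilon>'] tw(2) mL by (simp add: cocycles_cone)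
  qed
  have "resolves R 0 ?A (\<lambda>t. (\<zero>\<^bsub>L 0\<^esub>, \<epsilon> t)) cone cone_d"
    unfolding resolves_def
  proof (intro conjI allI impI)
    show "module R ?A" using resolvesD(1)[OF A] .
    show "cochain R cone cone_d" by (rule cochain_cone)
    show "baer_module R (cone n)" for n
      by (rule baer_cone[OF baer_shift[OF resolvesD(3)[OF Q]] resolvesD(3)[OF T]])
    show "(\<lambda>t. (\<zero>\<^bsub>L 0\<^esub>, \<epsilon> t)) \<in> module_hom R ?A (cone 0)"
      unfolding cone_def
      by (rule module_homI) (use subsetD[OF AT] module_homD[OF \<epsilon>] mL in \<open>auto simp: shift_complex_def\<close>)
    show "inj_on (\<lambda>t. (\<zero>\<^bsub>L 0\<^esub>, \<epsilon> t)) (carrier ?A)"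
      using resolvesD(6)[OF T] AT by (auto simp: inj_on_def)
    show "cocycles cone cone_d 0 = (\<lambda>t. (\<zero>\<^bsub>L 0\<^esub>, \<epsilon> t)) ` carrier ?A" using A0 by simp
    show "exact_at cone cone_d n" if n: "0 < n" for n
    proof -
      obtain m where m: "n = Suc m" using n by (cases n) auto
      show ?thesis
      proof (cases m)
        case 0
        show ?thesis
          unfolding m 0
        proof (rule exact_at_cone_Suc)
          fix x assume "x \<in> cocycles ?L ?e (Suc 0)"
          then obtain y where y: "y \<in> carrier Q" "x = \<epsilon>' y" using resolvesD(7)[OF Q] by auto
          then obtain t where t: "t \<in> carrier T" "y = q t" using q(2) by auto
          have "x = ?e 0 \<zero>\<^bsub>L 0\<^esub> \<oplus>\<^bsub>?L (Suc 0)\<^esub> \<Phi> 0 (\<epsilon> t)"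
            using u(2)[OF t(1)] tw(2) y(2) t(2) module_homD(1)[OF \<epsilon>'q t(1)] mL by simp
          moreover have "\<epsilon> t \<in> cocycles K e 0" using resolvesD(7)[OF T] t(1) by blast
          ultimately show "\<exists>y\<in>carrier (?L 0). \<exists>k\<in>cocycles K e 0. x = ?e 0 y \<oplus>\<^bsub>?L (Suc 0)\<^esub> \<Phi> 0 k"
            by auto
        qed (use resolvesD(8)[OF T, of "Suc 0"] in \<open>auto simp: exact_at_def\<close>)
      next
        case (Suc l)
        show ?thesis
          unfolding m using Suc exact_at_cone_exact resolvesD(8)[OF T] exact_at_shift(1)[OF resolvesD(8)[OF Q]] by blast
      qed
    qed
  qed simp
  then have "artinian_at R (torsion_complex R S cone) cone_d n"
    using artinian_at_unique[OF A _ S] art(1) by blast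
  then show ?thesis
    using torsion_artinian_at_K[OF S] art(2) artinian_at_torsion_shift[OF LC S] by blast
qed

text \<open>The cone of multiplication by \<open>x\<close> on \<open>K\<close> has the single
  cohomology module \<open>T/xT\<close>, in degree 1. So the kernel of \<open>x\<close> on the local
  cohomology of \<open>T\<close> in degree \<open>n + 1\<close> is an image of that of
  \<open>T/xT\<close> in degree \<open>n\<close>. As \<open>x\<close> is in \<open>S\<close>,
  everything is \<open>x\<close>-torsion and \<open>torsion_artinian\<close> applies.\<close>

lemma artinian_at_regular:
  assumes T: "resolves R 0 T \<epsilon> K e" and Q: "resolves R 0 Q \<epsilon>' L e'"
    and q: "q \<in> module_hom R T Q" "q ` carrier T = carrier Q"
      "\<And>t. t \<in> carrier T \<Longrightarrow> q t = \<zero>\<^bsub>Q\<^esub> \<longleftrightarrow> t \<in> (\<lambda>t. x \<odot>\<^bsub>T\<^esub> t) ` carrier T"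
    and S: "S \<subseteq> carrier R" and x: "x \<in> S" and regular: "\<And>t. t \<in> carrier T \<Longrightarrow> x \<odot>\<^bsub>T\<^esub> t = \<zero>\<^bsub>T\<^esub> \<Longrightarrow> t = \<zero>\<^bsub>T\<^esub>"
    and art: "artinian_at R (torsion_complex R S L) e' n"
  shows "artinian_at R (torsion_complex R S K) e (Suc n)"
proof -
  note KC = resolvesD(2)[OF T] and mT = resolvesD(1)[OF T]
  note mK = cochainD(1)[OF resolvesD(2)[OF T]] and eK = cochainD(2)[OF resolvesD(2)[OF T]]
  note \<epsilon> = resolvesD(5)[OF T]
  have xR: "x \<in> carrier R" using x S by auto
  let ?K = "shift_complex K" and ?e = "shift_d K e"
  \<comment> \<open>Multiplication by \<open>x\<close> commutes with the differentials; the
    alternating sign turns it into a twisting, which anticommutes.\<close>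
  define \<Phi> where "\<Phi> n k = (if even n then x \<odot>\<^bsub>K n\<^esub> k else \<ominus>\<^bsub>K n\<^esub> (x \<odot>\<^bsub>K n\<^esub> k))" for n k
  have "twisting R ?K ?e K e \<Phi>"
    unfolding twisting_def
  proof (intro allI conjI ballI)
    fix n
    show "\<Phi> n \<in> module_hom R (K n) (?K (Suc n))"
      by (rule module_homI) (use mK xR in \<open>simp_all add: \<Phi>_def smult_r_add mod_neg_add smult_neg_r smult_lcomm\<close>)
    show "?e (Suc n) (\<Phi> n k) \<oplus>\<^bsub>?K (Suc (Suc n))\<^esub> \<Phi> (Suc n) (e n k) = \<zero>\<^bsub>?K (Suc (Suc n))\<^esub>"
      if k: "k \<in> carrier (K n)" for k
      using module_homD(3)[OF eK xR k] hom_neg[OF mK mK eK, of "x \<odot>\<^bsub>K n\<^esub> k" n] cochainD(3)[OF KC k] mK xR k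
      by (simp add: \<Phi>_def)
  qed
  then interpret mapping_cone R Pair fst snd ?K ?e K e \<Phi>
    by unfold_locales (rule cochain_shift[OF KC] KC | assumption)+
  have \<epsilon>0: "t = \<zero>\<^bsub>T\<^esub>" if "t \<in> carrier T" "\<epsilon> t = \<zero>\<^bsub>K 0\<^esub>" for t
    using that hom_zero[OF mT mK \<epsilon>] inj_onD[OF resolvesD(6)[OF T], of t "\<zero>\<^bsub>T\<^esub>"] mT by simp
  have \<epsilon>x: "x \<odot>\<^bsub>K 0\<^esub> \<epsilon> t = \<epsilon> (x \<odot>\<^bsub>T\<^esub> t)" if "t \<in> carrier T" for t
    using module_homD(3)[OF \<epsilon> xR that] by simp
  have exact0: "exact_at cone cone_d 0"
  proof (rule exact_at_cone_0)
    fix k assume k: "k \<in> cocycles K e 0" "\<Phi> 0 k \<in> coboundaries ?K ?e (Suc 0)"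
    then obtain t where t: "t \<in> carrier T" "k = \<epsilon> t" using resolvesD(7)[OF T] by auto
    then have "x \<odot>\<^bsub>T\<^esub> t = \<zero>\<^bsub>T\<^esub>" using k(2) \<epsilon>x[OF t(1)] \<epsilon>0[of "x \<odot>\<^bsub>T\<^esub> t"] mT xR by (simp add: \<Phi>_def)
    then show "k = \<zero>\<^bsub>K 0\<^esub>" using regular[OF t(1)] t(2) hom_zero[OF mT mK \<epsilon>] by simp
  qed simp
  have exact2: "exact_at cone cone_d (Suc (Suc n))" for n
    using exact_at_cone_exact resolvesD(8)[OF T] exact_at_shift(1)[OF resolvesD(8)[OF T]] by blast
  have "represents R cone cone_d (Suc 0) T (\<lambda>t. (\<epsilon> t, \<zero>\<^bsub>K (Suc 0)\<^esub>)) q Q"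
    unfolding represents_def
  proof (intro conjI ballI)
    show "module R T" "module R Q" using mT resolvesD(1)[OF Q] by auto
    show "q \<in> module_hom R T Q" "q ` carrier T = carrier Q" by (rule q)+
    have \<epsilon>': "\<epsilon> \<in> module_hom R T (?K (Suc 0))" using \<epsilon> by simp
    show "(\<lambda>t. (\<epsilon> t, \<zero>\<^bsub>K (Suc 0)\<^esub>)) \<in> module_hom R T (cone (Suc 0))"
      by (rule module_hom_comp[OF \<epsilon>' inl_cone_hom])
    show "(\<lambda>t. (\<epsilon> t, \<zero>\<^bsub>K (Suc 0)\<^esub>)) ` carrier T \<subseteq> cocycles cone cone_d (Suc 0)"
      using inl_cocycle[of _ "Suc 0"] resolvesD(7)[OF T] by auto
  next
    fix z assume "z \<in> cocycles cone cone_d (Suc 0)"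
    then obtain a b where ab: "z = (a, b)" "a \<in> carrier (?K (Suc 0))" "b \<in> cocycles K e (Suc 0)"
      "?e (Suc 0) a \<oplus>\<^bsub>?K (Suc (Suc 0))\<^esub> \<Phi> (Suc 0) b = \<zero>\<^bsub>?K (Suc (Suc 0))\<^esub>" by (rule cocycles_coneE)
    have bc: "b \<in> carrier (K (Suc 0))" using cocyclesD(1)[OF ab(3)] .
    obtain l where l: "l \<in> carrier (K 0)" "b = e 0 l"
      using resolvesD(8)[OF T, of "Suc 0"] ab(3) by (auto simp: exact_at_def)
    have Pl: "\<Phi> 0 l \<in> carrier (K 0)" using Pk[OF l(1)] by simp
    have a: "a \<in> carrier (K 0)" "e 0 a \<oplus>\<^bsub>K (Suc 0)\<^esub> \<Phi> (Suc 0) b = \<zero>\<^bsub>K (Suc 0)\<^esub>" using ab by simp_all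
    have "e 0 (\<Phi> 0 l) = e 0 a"
      using twistingD(3)[OF \<Phi> l(1)] a l(2) cochainD(3)[OF KC Pl] cochainD(3)[OF KC a(1)] Pk[OF bc] mK
      by (simp add: mod_add_eq_zero)
    then have "a \<ominus>\<^bsub>K 0\<^esub> \<Phi> 0 l \<in> cocycles K e 0"
      using a(1) Pl cochainD(3)[OF KC a(1)] mK hom_minus[OF mK mK eK a(1) Pl] by (simp add: cocycles_def)
    then obtain t where t: "t \<in> carrier T" "a \<ominus>\<^bsub>K 0\<^esub> \<Phi> 0 l = \<epsilon> t" using resolvesD(7)[OF T] by auto
    have "a = \<epsilon> t \<oplus>\<^bsub>K 0\<^esub> \<Phi> 0 l" using t(2) a(1) Pl mK by (metis mod_minus_add)
    then have "z = (\<epsilon> t, \<zero>\<^bsub>K (Suc 0)\<^esub>) \<oplus>\<^bsub>cone (Suc 0)\<^esub> cone_d 0 (\<zero>\<^bsub>K 0\<^esub>, l)"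
      using ab(1) bc l Pl mK by (simp add: cone_def)
    moreover have "(\<zero>\<^bsub>K 0\<^esub>, l) \<in> carrier (cone 0)" using l(1) by (simp add: cone_def)
    then have "cone_d 0 (\<zero>\<^bsub>K 0\<^esub>, l) \<in> coboundaries cone cone_d (Suc 0)"
      unfolding coboundaries_simps by (rule imageI)
    ultimately show "\<exists>t\<in>carrier T. \<exists>b\<in>coboundaries cone cone_d (Suc 0).
        z = (\<epsilon> t, \<zero>\<^bsub>K (Suc 0)\<^esub>) \<oplus>\<^bsub>cone (Suc 0)\<^esub> b" using t(1) by blast
  next
    fix t assume t: "t \<in> carrier T"
    have "(\<epsilon> t, \<zero>\<^bsub>K (Suc 0)\<^esub>) \<in> coboundaries cone cone_d (Suc 0) \<longleftrightarrow>
        (\<exists>k\<in>carrier (K 0). e 0 k = \<zero>\<^bsub>K (Suc 0)\<^esub> \<and> \<epsilon> t = \<Phi> 0 k)"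
    proof -
      have eq: "cone_d 0 (\<zero>\<^bsub>K 0\<^esub>, k) = (\<Phi> 0 k, e 0 k)" if "k \<in> carrier (K 0)" for k
        using Pk[OF that] mK by simp
      have "carrier (cone 0) = {(\<zero>\<^bsub>K 0\<^esub>, k) | k. k \<in> carrier (K 0)}" by (auto simp: cone_def pair_module_def)
      then have "coboundaries cone cone_d (Suc 0) = {(\<Phi> 0 k, e 0 k) | k. k \<in> carrier (K 0)}"
        using eq by (auto simp: image_iff) (metis eq)+
      then show ?thesis by auto
    qed
    also have "\<dots> \<longleftrightarrow> (\<exists>t'\<in>carrier T. \<epsilon> t = \<epsilon> (x \<odot>\<^bsub>T\<^esub> t'))"
    proof -
      have "{k \<in> carrier (K 0). e 0 k = \<zero>\<^bsub>K (Suc 0)\<^esub>} = \<epsilon> ` carrier T"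
        using resolvesD(7)[OF T] by (simp add: cocycles_def)
      then have "(\<exists>k\<in>carrier (K 0). e 0 k = \<zero>\<^bsub>K (Suc 0)\<^esub> \<and> \<epsilon> t = \<Phi> 0 k) \<longleftrightarrow> (\<exists>k\<in>\<epsilon> ` carrier T. \<epsilon> t = \<Phi> 0 k)"
        by blast
      then show ?thesis using \<epsilon>x by (auto simp: \<Phi>_def)
    qed
    also have "\<dots> \<longleftrightarrow> q t = \<zero>\<^bsub>Q\<^esub>"
      using q(3)[OF t] inj_on_eq_iff[OF resolvesD(6)[OF T] t] mT xR by auto
    finally show "(\<epsilon> t, \<zero>\<^bsub>K (Suc 0)\<^esub>) \<in> coboundaries cone cone_d (Suc 0) \<longleftrightarrow> q t = \<zero>\<^bsub>Q\<^esub>" .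
  qed
  from artinian_at_resolution[OF cochain_cone baer_cone[OF baer_shift[OF resolvesD(3)[OF T]] resolvesD(3)[OF T]]
      exact0 exact2 this Q S]
  have "artinian_at R (torsion_complex R S cone) cone_d (Suc n)" using art by blast
  from torsion_artinian_kernel[OF S this]
  have ker: "chain_cond False R (torsion_complex R S K (Suc n)) (coboundaries (torsion_complex R S K) e (Suc n))
    {k \<in> cocycles (torsion_complex R S K) e (Suc n).
      \<Phi> (Suc n) k \<in> coboundaries (torsion_complex R S K) e (Suc n)}"
    using torsion_shift[OF KC S] shift_d_torsion[of S K e] coboundaries_shift[of "torsion_complex R S K" e "Suc n"]
    by (simp del: coboundaries_simps(2))
  let ?TK = "torsion_complex R S K"
  have TC: "cochain R ?TK e" by (rule cochain_torsion[OF KC S])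
  note mTK = cochainD(1)[OF TC] and sub = submod_coboundaries[OF TC]
  \<comment> \<open>Coboundaries are closed under negation, so the sign in \<open>\<Phi>\<close>
    disappears.\<close>
  have "{k \<in> cocycles ?TK e (Suc n). \<Phi> (Suc n) k \<in> coboundaries ?TK e (Suc n)} =
      {k \<in> cocycles ?TK e (Suc n). x \<odot>\<^bsub>?TK (Suc n)\<^esub> k \<in> coboundaries ?TK e (Suc n)}"
  proof (rule Collect_cong, rule conj_cong, rule refl)
    fix k assume "k \<in> cocycles ?TK e (Suc n)"
    then have k: "k \<in> carrier (?TK (Suc n))" by (simp add: cocycles_def)
    then have kc: "x \<odot>\<^bsub>K (Suc n)\<^esub> k \<in> carrier (K (Suc n))" using mK xR torsion_carrier[of k S "K (Suc n)"] by simp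
    have "\<ominus>\<^bsub>K (Suc n)\<^esub> y \<in> coboundaries ?TK e (Suc n)" if "y \<in> coboundaries ?TK e (Suc n)" for y
    proof -
      have "y \<in> carrier (K (Suc n))" using submodD(2)[OF sub that] torsion_carrier by simp
      then show ?thesis using submodD(5)[OF sub, of "\<ominus> \<one>" y "Suc n"] that mK
        by (simp add: smult_neg_l del: coboundaries_simps(2))
    qed
    from this[of "x \<odot>\<^bsub>K (Suc n)\<^esub> k"] this[of "\<ominus>\<^bsub>K (Suc n)\<^esub> (x \<odot>\<^bsub>K (Suc n)\<^esub> k)"]
    show "\<Phi> (Suc n) k \<in> coboundaries ?TK e (Suc n) \<longleftrightarrow> x \<odot>\<^bsub>?TK (Suc n)\<^esub> k \<in> coboundaries ?TK e (Suc n)"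
      using kc mK by (auto simp: \<Phi>_def)
  qed
  then have ker': "chain_cond False R (?TK (Suc n)) (coboundaries ?TK e (Suc n))
    {k \<in> cocycles ?TK e (Suc n). x \<odot>\<^bsub>?TK (Suc n)\<^esub> k \<in> coboundaries ?TK e (Suc n)}" using ker by simp
  show ?thesis
    unfolding artinian_at_def
  proof (rule torsion_artinian[OF mTK sub submod_cocycles[OF TC] xR _ ker'])
    fix z assume "z \<in> cocycles ?TK e (Suc n)"
    then obtain m :: nat where "(x [^] m) \<odot>\<^bsub>K (Suc n)\<^esub> z = \<zero>\<^bsub>K (Suc n)\<^esub>"
      using x by (auto simp: cocycles_def torsion_def)
    then have "(x [^] m) \<odot>\<^bsub>?TK (Suc n)\<^esub> z \<in> coboundaries ?TK e (Suc n)" using submodD(3)[OF sub, of "Suc n"] by (simp del: coboundaries_simps(2))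
    then show "\<exists>m::nat. (x [^] m) \<odot>\<^bsub>?TK (Suc n)\<^esub> z \<in> coboundaries ?TK e (Suc n)" by blast
  qed
qed

end

section \<open>Divisible abelian groups\<close>

text \<open>An abelian group as a module over the integers; the module theory above,
  \<open>baer_extend\<close> in particular, then also serves for groups.\<close>

abbreviation int_mod :: "('a, 'm) ring_scheme \<Rightarrow> (int, 'a) module"
  where "int_mod M \<equiv> \<lparr>carrier = carrier M, monoid.mult = (\<lambda>_ _. \<zero>\<^bsub>M\<^esub>), one = \<zero>\<^bsub>M\<^esub>, ring.zero = \<zero>\<^bsub>M\<^esub>,
    add = add M, smult = (\<lambda>k x. add_pow M k x)\<rparr>"

lemma int_neg_one [simp]: "\<ominus>\<^bsub>\<Z>\<^esub> 1 = -1"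
  by (rule abelian_group.minus_equality[OF ring.is_abelian_group[OF cring.axioms(1)[OF int_is_cring]]]) simp_all

context abelian_group
begin

abbreviation imul :: "int \<Rightarrow> 'a \<Rightarrow> 'a"
  where "imul k x \<equiv> add_pow G k x"

lemma imul_0 [simp]: "imul 0 x = \<zero>"
  by (simp add: add_pow_def)

lemma finsum_imul:
  fixes h :: "'a \<Rightarrow> int"
  assumes "finite B" "B \<subseteq> carrier G"
  shows "(\<Oplus>x\<in>B. imul k (imul (h x) x)) = imul k (\<Oplus>x\<in>B. imul (h x) x)"
  using assms
proof (induction B rule: finite_induct)
  case (insert y B)
  have 1: "(\<lambda>x. imul (h x) x) \<in> B \<rightarrow> carrier G" "(\<lambda>x. imul k (imul (h x) x)) \<in> B \<rightarrow> carrier G"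
    "y \<in> carrier G" "B \<subseteq> carrier G" using insert.prems by auto
  then show ?case using insert.IH insert.hyps
    by (simp add: add.finprod_insert add.int_pow_distrib add.finprod_closed)
qed simp

lemma int_mod_module: "module \<Z> (int_mod G)"
proof (rule cring.moduleI'[OF int_is_cring], goal_cases)
  case (7 x)
  then show ?case using add.int_pow_neg[of x 1] by (simp add: l_neg)
next
  case (8 a b x)
  then show ?case using add.int_pow_mult[of x a b] by simp
next
  case (9 a x y)
  then show ?case using add.int_pow_distrib[of x y a] by simp
next
  case (10 a b x)
  then show ?case using add.int_pow_pow[of x a b] by (simp add: mult.commute)
qed (simp_all add: a_ac)

lemma additive_int_hom:
  assumes D: "module \<Z> D" and h: "\<And>x. x \<in> carrier G \<Longrightarrow> h x \<in> carrier D"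
    "\<And>x y. x \<in> carrier G \<Longrightarrow> y \<in> carrier G \<Longrightarrow> h (x \<oplus> y) = h x \<oplus>\<^bsub>D\<^esub> h y"
  shows "h \<in> module_hom \<Z> (int_mod G) D"
proof (rule module_homI, simp_all add: h)
  fix k :: int and x assume x: "x \<in> carrier G"
  have pm: "h (imul ((k + 1)) x) = h (imul k x) \<oplus>\<^bsub>D\<^esub> h x" for k :: int
    using h x add.int_pow_mult[OF x, of k 1] by simp
  have sm: "(k + 1) \<odot>\<^bsub>D\<^esub> h x = k \<odot>\<^bsub>D\<^esub> h x \<oplus>\<^bsub>D\<^esub> h x" for k :: int
    using cring.smult_l_add[OF int_is_cring D, of k 1 "h x"] h(1)[OF x] cring.smult_one'[OF int_is_cring D h(1)[OF x]] by simp
  have c: "h (imul k x) \<in> carrier D" "k \<odot>\<^bsub>D\<^esub> h x \<in> carrier D" for k :: int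
    using h(1) x cring.mod_smult[OF int_is_cring D] by simp_all
  show "h (imul k x) = k \<odot>\<^bsub>D\<^esub> h x"
  proof (induction k rule: int_induct[of _ 0])
    case base
    have "h \<zero> = h \<zero> \<oplus>\<^bsub>D\<^esub> h \<zero>" using h(2)[of \<zero> \<zero>] by simp
    then have "h \<zero> = \<zero>\<^bsub>D\<^esub>" using cring.mod_add_left_cancel[OF int_is_cring D, of "h \<zero>" "h \<zero>" "\<zero>\<^bsub>D\<^esub>"] h(1)[of \<zero>] D by simp
    then show ?case using cring.smult_zero_l[OF int_is_cring D h(1)[OF x]] by simp
  next
    case (step1 i)
    then show ?case using pm[of i] sm[of i] by simp
  next
    case (step2 i)
    have "h (imul ((i - 1)) x) \<oplus>\<^bsub>D\<^esub> h x = (i - 1) \<odot>\<^bsub>D\<^esub> h x \<oplus>\<^bsub>D\<^esub> h x"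
      using pm[of "i - 1"] sm[of "i - 1"] step2 by simp
    then show ?case using cring.mod_add_minus[OF int_is_cring D c(1)[of "i - 1"] h(1)[OF x]]
        cring.mod_add_minus[OF int_is_cring D c(2)[of "i - 1"] h(1)[OF x]] by metis
  qed
qed

end

text \<open>A nonzero ideal of the integers consists of the multiples of its least positive element
  \<open>m\<close>; a solution \<open>e\<close> of \<open>m e = f m\<close> then works on the whole
  ideal.\<close>

lemma baer_divisible:
  assumes D: "module \<Z> D" and div: "\<And>k y. k \<noteq> 0 \<Longrightarrow> y \<in> carrier D \<Longrightarrow> \<exists>z\<in>carrier D. k \<odot>\<^bsub>D\<^esub> z = y"
  shows "baer_module \<Z> D"
  unfolding baer_module_def
proof (intro conjI allI ballI impI D)
  fix I f assume f: "f \<in> module_hom \<Z> ((regular_module \<Z>)\<lparr>carrier := I\<rparr>) D" and "ideal I \<Z>"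
  then have I: "submod \<Z> (regular_module \<Z>) I" using cring.submod_regular[OF int_is_cring] by blast
  have I0: "0 \<in> I" and Iadd: "a + b \<in> I" and Imul: "k * a \<in> I" if "a \<in> I" "b \<in> I" for a b k
    using submodD(3-5)[OF I] that by auto
  have I0: "0 \<in> I" using submodD(3)[OF I] by simp
  have fm: "f (k * a) = k \<odot>\<^bsub>D\<^esub> f a" if "a \<in> I" for k a using module_homD(3)[OF f, of k a] that by simp
  show "\<exists>e\<in>carrier D. \<forall>a\<in>I. f a = a \<odot>\<^bsub>D\<^esub> e"
  proof (cases "I = {0}")
    case True
    have "f 0 = \<zero>\<^bsub>D\<^esub>" using fm[OF I0, of 0] cring.smult_zero_l[OF int_is_cring D] module_homD(1)[OF f, of 0] I0 by simp
    then show ?thesis using True D by (intro bexI[of _ "\<zero>\<^bsub>D\<^esub>"]) auto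
  next
    case False
    then obtain a where a: "a \<in> I" "a \<noteq> 0" using I0 by auto
    have "\<bar>a\<bar> \<in> I" using a Imul[OF a(1) a(1), of "-1"] by (cases "a > 0") auto
    then have ex: "\<exists>n>0. int n \<in> I" using a(2) by (intro exI[of _ "nat \<bar>a\<bar>"]) auto
    define m where "m = (LEAST n. n > 0 \<and> int n \<in> I)"
    have m: "m > 0" "int m \<in> I" using LeastI_ex[OF ex] unfolding m_def by auto
    have dvd: "int m dvd b" if b: "b \<in> I" for b
    proof (rule ccontr)
      assume nd: "\<not> int m dvd b"
      have "b + (- (b div int m)) * int m \<in> I" using Iadd[OF b Imul[OF m(2) m(2)]] .
      then have "b mod int m \<in> I" by (simp add: minus_div_mult_eq_mod)
      moreover have "b mod int m \<noteq> 0" using nd by (simp add: dvd_eq_mod_eq_0)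
      moreover have "0 \<le> b mod int m" "b mod int m < int m" using m(1) by simp_all
      ultimately have "nat (b mod int m) > 0 \<and> int (nat (b mod int m)) \<in> I" "nat (b mod int m) < m" by simp_all
      then show False using not_less_Least[of "nat (b mod int m)" "\<lambda>n. n > 0 \<and> int n \<in> I"] unfolding m_def by simp
    qed
    obtain e where e: "e \<in> carrier D" "int m \<odot>\<^bsub>D\<^esub> e = f (int m)"
      using div[of "int m" "f (int m)"] m module_homD(1)[OF f, of "int m"] by auto
    have "f b = b \<odot>\<^bsub>D\<^esub> e" if b: "b \<in> I" for b
    proof -
      obtain k where k: "b = k * int m" using dvd[OF b] by (metis dvd_def mult.commute)
      then show ?thesis using fm[OF m(2), of k] e cring.smult_mult[OF int_is_cring D, of k "int m" e] by simp
    qed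
    then show ?thesis using e(1) by blast
  qed
qed

text \<open>An abelian group \<open>G = \<Z>\<^bsup>(G)\<^esup>/K\<close> embeds in the divisible group \<open>\<rat>\<^bsup>(G)\<^esup>/K\<close>. The inverse \<open>s\<close> of
  the projection shows that the latter is not too large.\<close>

lemma (in abelian_group) divisible_embedding:
  shows "\<exists>(D :: (int, 'a \<Rightarrow> rat) module) (\<iota> :: 'a \<Rightarrow> 'a \<Rightarrow> rat) (s :: ('a \<Rightarrow> rat) \<Rightarrow> 'a \<Rightarrow> rat).
    baer_module \<Z> D \<and> (\<forall>x\<in>carrier G. \<iota> x \<in> carrier D) \<and>
    (\<forall>x\<in>carrier G. \<forall>y\<in>carrier G. \<iota> (x \<oplus> y) = \<iota> x \<oplus>\<^bsub>D\<^esub> \<iota> y) \<and>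
    (\<forall>x\<in>carrier G. \<iota> x = \<zero>\<^bsub>D\<^esub> \<longrightarrow> x = \<zero>) \<and>
    inj_on s (carrier D) \<and> (\<forall>y\<in>carrier D. finite {x. s y x \<noteq> 0})"
proof -
  \<comment> \<open>The rational vector space with basis \<open>carrier G\<close>, viewed as a
    module over the integers.\<close>
  define Fr :: "(int, 'a \<Rightarrow> rat) module" where "Fr =
    \<lparr>carrier = {f. finite {x. f x \<noteq> 0} \<and> {x. f x \<noteq> 0} \<subseteq> carrier G}, monoid.mult = (\<lambda>_ _ _. 0), one = (\<lambda>_. 0),
     ring.zero = (\<lambda>_. 0), add = (\<lambda>f g x. f x + g x), smult = (\<lambda>k f x. of_int k * f x)\<rparr>"
  have Fr_simps: "\<zero>\<^bsub>Fr\<^esub> = (\<lambda>_. 0)" "f \<oplus>\<^bsub>Fr\<^esub> g = (\<lambda>x. f x + g x)" "k \<odot>\<^bsub>Fr\<^esub> f = (\<lambda>x. of_int k * f x)"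
    "f \<in> carrier Fr \<longleftrightarrow> finite {x. f x \<noteq> 0} \<and> {x. f x \<noteq> 0} \<subseteq> carrier G" for f g k
    by (simp_all add: Fr_def)
  have cl: "(\<lambda>x. f x + g x) \<in> carrier Fr" if "f \<in> carrier Fr" "g \<in> carrier Fr" for f g
  proof -
    have "{x. f x + g x \<noteq> 0} \<subseteq> {x. f x \<noteq> 0} \<union> {x. g x \<noteq> 0}" by auto
    then show ?thesis using that unfolding Fr_simps by (meson finite_UnI finite_subset subset_trans Un_least)
  qed
  have cm: "(\<lambda>x. q * f x) \<in> carrier Fr" if "f \<in> carrier Fr" for f and q :: rat
  proof -
    have "{x. q * f x \<noteq> 0} \<subseteq> {x. f x \<noteq> 0}" by auto
    then show ?thesis using that unfolding Fr_simps by (meson finite_subset subset_trans)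
  qed
  have c0: "(\<lambda>_. 0) \<in> carrier Fr" by (simp add: Fr_simps)
  have Fr: "module \<Z> Fr"
    by (rule cring.moduleI'[OF int_is_cring], simp_all add: Fr_simps(1-3) cl cm c0)
      (auto simp: algebra_simps)
  have mG: "module \<Z> (int_mod G)" by (rule int_mod_module)
  define ZFr where "ZFr = {f \<in> carrier Fr. \<forall>x. f x \<in> \<int>}"
  have ZFr: "submod \<Z> Fr ZFr"
    by (rule submodI) (auto simp: ZFr_def Fr_simps(1-3) cl cm c0)
  define ev where "ev f = (\<Oplus>x\<in>{x. f x \<noteq> 0}. imul (\<lfloor>f x\<rfloor>) x)" for f :: "'a \<Rightarrow> rat"
  have ev_eq: "ev f = (\<Oplus>x\<in>A. imul (\<lfloor>f x\<rfloor>) x)"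
    if "finite A" "A \<subseteq> carrier G" "{x. f x \<noteq> 0} \<subseteq> A" for f :: "'a \<Rightarrow> rat" and A
    unfolding ev_def
  proof (rule add.finprod_mono_neutral_cong_left[OF that(1,3)])
    show "imul (\<lfloor>f x\<rfloor>) x = \<zero>" if "x \<in> A - {x. f x \<noteq> 0}" for x using that by simp
  qed (use that in auto)
  have ev_c: "ev f \<in> carrier G" if "f \<in> carrier Fr" for f
    unfolding ev_def by (rule add.finprod_closed) (use that in \<open>auto simp: Fr_simps\<close>)
  have fl_add: "\<lfloor>a + b\<rfloor> = \<lfloor>a\<rfloor> + \<lfloor>b\<rfloor>" if "a \<in> \<int>" for a b :: rat using that by (auto elim!: Ints_cases)
  have ev_add: "ev (\<lambda>x. f x + g x) = ev f \<oplus> ev g" if f: "f \<in> ZFr" and g: "g \<in> ZFr" for f g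
  proof -
    let ?A = "{x. f x \<noteq> 0} \<union> {x. g x \<noteq> 0}"
    have A: "finite ?A" "?A \<subseteq> carrier G" using f g by (auto simp: ZFr_def Fr_simps)
    have "ev (\<lambda>x. f x + g x) = (\<Oplus>x\<in>?A. imul (\<lfloor>f x + g x\<rfloor>) x)" by (rule ev_eq[OF A]) auto
    also have "\<dots> = (\<Oplus>x\<in>?A. imul (\<lfloor>f x\<rfloor>) x \<oplus> imul (\<lfloor>g x\<rfloor>) x)"
      by (rule add.finprod_cong') (use A f in \<open>auto simp: ZFr_def fl_add add.int_pow_mult\<close>)
    also have "\<dots> = (\<Oplus>x\<in>?A. imul (\<lfloor>f x\<rfloor>) x) \<oplus> (\<Oplus>x\<in>?A. imul (\<lfloor>g x\<rfloor>) x)"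
      by (rule add.finprod_multf) (use A in auto)
    finally show ?thesis using ev_eq[OF A, of f] ev_eq[OF A, of g] by simp
  qed
  have ev_mul: "ev (\<lambda>x. of_int k * f x) = imul k (ev f)" if f: "f \<in> ZFr" for f and k :: int
  proof -
    let ?A = "{x. f x \<noteq> 0}"
    have A: "finite ?A" "?A \<subseteq> carrier G" using f by (auto simp: ZFr_def Fr_simps)
    have "ev (\<lambda>x. of_int k * f x) = (\<Oplus>x\<in>?A. imul (\<lfloor>of_int k * f x\<rfloor>) x)" by (rule ev_eq[OF A]) auto
    also have "\<dots> = (\<Oplus>x\<in>?A. imul k (imul (\<lfloor>f x\<rfloor>) x))"
    proof (rule add.finprod_cong')
      fix x assume "x \<in> ?A"
      moreover obtain l where l: "f x = of_int l" using f by (auto simp: ZFr_def elim: Ints_cases)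
      then have "\<lfloor>of_int k * f x\<rfloor> = \<lfloor>f x\<rfloor> * k" by (simp flip: of_int_mult)
      ultimately show "imul (\<lfloor>of_int k * f x\<rfloor>) x = imul k (imul (\<lfloor>f x\<rfloor>) x)"
        using A add.int_pow_pow[of x k "\<lfloor>f x\<rfloor>"] by auto
    qed (use A in auto)
    also have "\<dots> = imul k (\<Oplus>x\<in>?A. imul (\<lfloor>f x\<rfloor>) x)"
      by (rule finsum_imul[OF A])
    finally show ?thesis by (simp add: ev_def)
  qed
  have mInt: "module \<Z> (Fr\<lparr>carrier := ZFr\<rparr>)" by (rule cring.submod_module[OF int_is_cring Fr ZFr])
  have evh: "ev \<in> module_hom \<Z> (Fr\<lparr>carrier := ZFr\<rparr>) (int_mod G)"
    by (rule module_homI) (use ev_add ev_mul ev_c in \<open>auto simp: Fr_simps(1-3) ZFr_def\<close>)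
  define K where "K = {f \<in> ZFr. ev f = \<zero>}"
  have "submod \<Z> (Fr\<lparr>carrier := ZFr\<rparr>) K"
    using cring.submod_vimage[OF int_is_cring mInt mG evh cring.submod_carrier[OF int_is_cring mInt] cring.submod_trivial[OF int_is_cring mG]] by (simp add: K_def)
  then have K: "submod \<Z> Fr K" using submodD(1)[OF ZFr] by (auto simp: submod_def)
  \<comment> \<open>Relations are imposed on integral functions, but the quotient is taken of all
    rational ones, so division by nonzero integers remains possible.\<close>
  obtain D :: "(int, 'a \<Rightarrow> rat) module" and q where D: "module \<Z> D" and q: "q \<in> module_hom \<Z> Fr D"
      "q ` carrier Fr = carrier D" "\<And>f. f \<in> carrier Fr \<Longrightarrow> q f = \<zero>\<^bsub>D\<^esub> \<longleftrightarrow> f \<in> K"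
    using cring.ex_quotient[OF int_is_cring Fr K] by blast
  define \<delta> where "\<delta> n = (\<lambda>x. if x = n then 1 else 0 :: rat)" for n :: 'a
  have supp: "{x. \<delta> n x \<noteq> 0} = {n}" for n by (auto simp: \<delta>_def)
  have \<delta>: "\<delta> n \<in> carrier Fr" "\<delta> n \<in> ZFr" if "n \<in> carrier G" for n
    using that supp[of n] by (auto simp: ZFr_def Fr_simps) (auto simp: \<delta>_def)
  have ev\<delta>: "ev (\<delta> n) = n" if "n \<in> carrier G" for n
    using that unfolding ev_def supp by (simp add: \<delta>_def)
  show ?thesis
  proof (rule exI[of _ D], rule exI[of _ "\<lambda>n. q (\<delta> n)"], rule exI[of _ "inv_into (carrier Fr) q"],
      intro conjI ballI impI)
    show "baer_module \<Z> D"
    proof (rule baer_divisible[OF D])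
      fix k :: int and y assume k: "k \<noteq> 0" and y: "y \<in> carrier D"
      then obtain f where f: "f \<in> carrier Fr" "y = q f" using q(2) by auto
      let ?g = "\<lambda>x. (1 / of_int k) * f x"
      have g: "?g \<in> carrier Fr" by (rule cm[OF f(1)])
      have "k \<odot>\<^bsub>Fr\<^esub> ?g = f" using k by (auto simp: Fr_simps)
      then have "k \<odot>\<^bsub>D\<^esub> q ?g = y" using module_homD(3)[OF q(1), of k ?g] g f(2) by simp
      then show "\<exists>z\<in>carrier D. k \<odot>\<^bsub>D\<^esub> z = y" using module_homD(1)[OF q(1) g] by blast
    qed
    show "q (\<delta> x) \<in> carrier D" if "x \<in> carrier G" for x using module_homD(1)[OF q(1) \<delta>(1)[OF that]] .
    show "q (\<delta> (x \<oplus> y)) = q (\<delta> x) \<oplus>\<^bsub>D\<^esub> q (\<delta> y)" if x: "x \<in> carrier G" and y: "y \<in> carrier G" for x y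
    proof -
      let ?I = "Fr\<lparr>carrier := ZFr\<rparr>" and ?s = "\<delta> x \<oplus>\<^bsub>Fr\<^esub> \<delta> y"
      have xy: "x \<oplus> y \<in> carrier G" using x y by simp
      have s: "?s \<in> ZFr" "ev ?s = x \<oplus> y"
        using submodD(4)[OF ZFr \<delta>(2)[OF x] \<delta>(2)[OF y]] module_homD(2)[OF evh, of "\<delta> x" "\<delta> y"] \<delta>(2) x y ev\<delta> by simp_all
      have sF: "?s \<in> carrier Fr" using submodD(2)[OF ZFr s(1)] .
      have neg: "\<ominus>\<^bsub>?I\<^esub> ?s = \<ominus>\<^bsub>Fr\<^esub> ?s"
        using cring.smult_neg_l[OF int_is_cring mInt, of 1 ?s] cring.smult_neg_l[OF int_is_cring Fr, of 1 ?s] s(1) sF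
          cring.smult_one'[OF int_is_cring mInt, of ?s] cring.smult_one'[OF int_is_cring Fr sF] by simp
      have "ev (\<delta> (x \<oplus> y) \<ominus>\<^bsub>?I\<^esub> ?s) = (x \<oplus> y) \<ominus>\<^bsub>int_mod G\<^esub> (x \<oplus> y)"
        using cring.hom_minus[OF int_is_cring mInt mG evh, of "\<delta> (x \<oplus> y)" ?s] \<delta>(2)[OF xy] s ev\<delta>[OF xy] by simp
      also have "\<dots> = \<zero>" using cring.mod_minus_self[OF int_is_cring mG, of "x \<oplus> y"] xy by simp
      finally have "ev (\<delta> (x \<oplus> y) \<ominus>\<^bsub>Fr\<^esub> ?s) = \<zero>" using neg by (simp add: a_minus_def)
      then have "\<delta> (x \<oplus> y) \<ominus>\<^bsub>Fr\<^esub> ?s \<in> K"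
        using cring.submod_minus[OF int_is_cring Fr ZFr \<delta>(2)[OF xy] s(1)] by (simp add: K_def)
      then have "q (\<delta> (x \<oplus> y) \<ominus>\<^bsub>Fr\<^esub> ?s) = \<zero>\<^bsub>D\<^esub>" using q(3) submodD(2)[OF K] by blast
      then have "q (\<delta> (x \<oplus> y)) \<ominus>\<^bsub>D\<^esub> q ?s = \<zero>\<^bsub>D\<^esub>" using cring.hom_minus[OF int_is_cring Fr D q(1) \<delta>(1)[OF xy] sF] by simp
      then have "q (\<delta> (x \<oplus> y)) = q ?s"
        using cring.mod_minus_eq_zero[OF int_is_cring D] module_homD(1)[OF q(1)] \<delta>(1)[OF xy] sF by blast
      then show ?thesis using module_homD(2)[OF q(1) \<delta>(1)[OF x] \<delta>(1)[OF y]] by simp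
    qed
    show "x = \<zero>" if x: "x \<in> carrier G" and x0: "q (\<delta> x) = \<zero>\<^bsub>D\<^esub>" for x
      using x0 q(3)[OF \<delta>(1)[OF x]] ev\<delta>[OF x] by (simp add: K_def)
    show "inj_on (inv_into (carrier Fr) q) (carrier D)" using q(2) by (metis inj_on_inv_into order_refl)
    show "finite {x. inv_into (carrier Fr) q y x \<noteq> 0}" if "y \<in> carrier D" for y
      using inv_into_into[of y q "carrier Fr"] that q(2) by (simp add: Fr_simps)
  qed
qed

section \<open>Enough injective modules\<close>

context cring
begin

text \<open>The group of additive maps from \<open>R\<close> to \<open>D\<close>, the right adjoint
  of forgetting the \<open>R\<close>-module structure. The fixed value outside
  \<open>carrier R\<close> makes equality of functions the same as equality on the ring.\<close>

definition coinduced :: "(int, 'd) module \<Rightarrow> ('a, 'a \<Rightarrow> 'd) module"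
  where "coinduced D = \<lparr>carrier = {f. (\<forall>r\<in>carrier R. f r \<in> carrier D) \<and> (\<forall>r. r \<notin> carrier R \<longrightarrow> f r = \<zero>\<^bsub>D\<^esub>) \<and>
      (\<forall>r\<in>carrier R. \<forall>s\<in>carrier R. f (r \<oplus> s) = f r \<oplus>\<^bsub>D\<^esub> f s)},
     monoid.mult = (\<lambda>_ _ _. \<zero>\<^bsub>D\<^esub>), one = (\<lambda>_. \<zero>\<^bsub>D\<^esub>), ring.zero = (\<lambda>_. \<zero>\<^bsub>D\<^esub>),
     add = (\<lambda>f g r. if r \<in> carrier R then f r \<oplus>\<^bsub>D\<^esub> g r else \<zero>\<^bsub>D\<^esub>),
     smult = (\<lambda>a f r. if r \<in> carrier R then f (r \<otimes> a) else \<zero>\<^bsub>D\<^esub>)\<rparr>"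

lemma coinduced_simps:
  "f \<in> carrier (coinduced D) \<longleftrightarrow> (\<forall>r\<in>carrier R. f r \<in> carrier D) \<and> (\<forall>r. r \<notin> carrier R \<longrightarrow> f r = \<zero>\<^bsub>D\<^esub>) \<and>
      (\<forall>r\<in>carrier R. \<forall>s\<in>carrier R. f (r \<oplus> s) = f r \<oplus>\<^bsub>D\<^esub> f s)"
  "\<zero>\<^bsub>coinduced D\<^esub> = (\<lambda>_. \<zero>\<^bsub>D\<^esub>)"
  "f \<oplus>\<^bsub>coinduced D\<^esub> g = (\<lambda>r. if r \<in> carrier R then f r \<oplus>\<^bsub>D\<^esub> g r else \<zero>\<^bsub>D\<^esub>)"
  "a \<odot>\<^bsub>coinduced D\<^esub> f = (\<lambda>r. if r \<in> carrier R then f (r \<otimes> a) else \<zero>\<^bsub>D\<^esub>)"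
  by (simp_all add: coinduced_def)

lemma coinduced_module:
  assumes D: "module \<Z> D" shows "module R (coinduced D)"
proof -
  show ?thesis
  proof (rule moduleI', goal_cases)
    case (1 f g) then show ?case using D by (auto simp: coinduced_simps cring.mod_ac[OF int_is_cring])
  next
    case 2 then show ?case using D by (auto simp: coinduced_simps)
  next
    case (3 a f) then show ?case by (auto simp: coinduced_simps l_distr)
  next
    case (4 f g h) then show ?case using D by (auto simp: coinduced_simps cring.mod_assoc[OF int_is_cring])
  next
    case (5 f g) then show ?case using D cring.mod_comm[OF int_is_cring D] by (auto simp: coinduced_simps)
  next
    case (6 f) then show ?case using D by (auto simp: coinduced_simps)
  next
    case (7 f)
    have "f (r \<otimes> \<ominus> \<one>) \<oplus>\<^bsub>D\<^esub> f r = \<zero>\<^bsub>D\<^esub>" if r: "r \<in> carrier R" for r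
    proof -
      have "f (\<zero> \<oplus> \<zero>) = f \<zero> \<oplus>\<^bsub>D\<^esub> f \<zero>" using 7 unfolding coinduced_simps by blast
      moreover have f0: "f \<zero> \<in> carrier D" using 7 by (simp add: coinduced_simps)
      ultimately have "f \<zero> = \<zero>\<^bsub>D\<^esub>" using cring.mod_add_left_cancel[OF int_is_cring D f0 f0, of "\<zero>\<^bsub>D\<^esub>"] D by simp
      moreover have "f (r \<otimes> \<ominus> \<one> \<oplus> r) = f (r \<otimes> \<ominus> \<one>) \<oplus>\<^bsub>D\<^esub> f r"
        using 7 r unfolding coinduced_simps by simp
      moreover have "r \<otimes> \<ominus> \<one> \<oplus> r = \<zero>" using r by (simp add: r_minus l_neg)
      ultimately show ?thesis by simp
    qed
    then show ?case by (auto simp: coinduced_simps)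
  next
    case (8 a b f) then show ?case by (auto simp: coinduced_simps r_distr)
  next
    case (9 a f g) then show ?case by (auto simp: coinduced_simps)
  next
    case (10 a b f) then show ?case by (intro ext) (auto simp: coinduced_simps m_assoc)
  next
    case (11 f) then show ?case by (auto simp: coinduced_simps)
  qed
qed

text \<open>Adjunction: a linear map \<open>f\<close> into the coinduced module is determined by the
  additive map \<open>a \<mapsto> f a \<one>\<close>, and this extends from the ideal to
  \<open>R\<close> because \<open>D\<close> is injective over the integers.\<close>

lemma baer_coinduced:
  assumes B: "baer_module \<Z> D" shows "baer_module R (coinduced D)"
  unfolding baer_module_def
proof (intro conjI allI ballI impI)
  note D = baer_module_module[OF B]
  show "module R (coinduced D)" using coinduced_module[OF D] .
  fix I f assume f: "f \<in> module_hom R (regmod\<lparr>carrier := I\<rparr>) (coinduced D)" and I: "ideal I R"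
  have I': "submod R regmod I" using I by (simp add: submod_regular)
  let ?I = "regmod\<lparr>carrier := I\<rparr>"
  have gI: "abelian_group ?I" using mod_group[OF submod_module[OF regular_module I']] .
  have gR: "abelian_group regmod" using mod_group[OF regular_module] .
  have Ic: "a \<in> carrier R" if "a \<in> I" for a using submodD(2)[OF I' that] by simp
  have fa: "f a \<in> carrier (coinduced D)" if "a \<in> I" for a using module_homD(1)[OF f, of a] that by simp
  have u: "(\<lambda>a. a) \<in> module_hom \<Z> (int_mod ?I) (int_mod regmod)"
    by (rule abelian_group.additive_int_hom[OF gI abelian_group.int_mod_module[OF gR]]) (use Ic in auto)
  have v: "(\<lambda>a. f a \<one>) \<in> module_hom \<Z> (int_mod ?I) D"
  proof (rule abelian_group.additive_int_hom[OF gI D])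
    show "f a \<one> \<in> carrier D" if "a \<in> carrier ?I" for a using fa[of a] that by (simp add: coinduced_simps)
    show "f (a \<oplus>\<^bsub>?I\<^esub> b) \<one> = f a \<one> \<oplus>\<^bsub>D\<^esub> f b \<one>" if "a \<in> carrier ?I" "b \<in> carrier ?I" for a b
      using module_homD(2)[OF f that] by (simp add: coinduced_simps)
  qed
  have "f a \<one> = \<zero>\<^bsub>D\<^esub>" if "a \<in> carrier (int_mod ?I)" "a = \<zero>\<^bsub>int_mod regmod\<^esub>" for a
    using cring.hom_zero[OF int_is_cring abelian_group.int_mod_module[OF gI] D v] that by simp
  from cring.baer_extend[OF int_is_cring B abelian_group.int_mod_module[OF gI] abelian_group.int_mod_module[OF gR] u v this]
  obtain h where h: "h \<in> module_hom \<Z> (int_mod regmod) D" "\<And>a. a \<in> I \<Longrightarrow> h a = f a \<one>" by auto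
  define e where "e r = (if r \<in> carrier R then h r else \<zero>\<^bsub>D\<^esub>)" for r
  have "e \<in> carrier (coinduced D)"
    using module_homD(1,2)[OF h(1)] by (simp add: coinduced_simps e_def)
  moreover have "f a = a \<odot>\<^bsub>coinduced D\<^esub> e" if a: "a \<in> I" for a
  proof
    fix r
    show "f a r = (a \<odot>\<^bsub>coinduced D\<^esub> e) r"
    proof (cases "r \<in> carrier R")
      case True
      have ra: "r \<otimes> a \<in> I" using submodD(5)[OF I' True a] by simp
      have "f (r \<otimes> a) = r \<odot>\<^bsub>coinduced D\<^esub> f a" using module_homD(3)[OF f True, of a] a by simp
      then have "f (r \<otimes> a) \<one> = f a r" using True by (simp add: coinduced_simps)
      then show ?thesis using True ra h(2)[OF ra] Ic[OF a] by (simp add: coinduced_simps e_def)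
    next
      case False
      then show ?thesis using fa[OF a] by (simp add: coinduced_simps)
    qed
  qed
  ultimately show "\<exists>e\<in>carrier (coinduced D). \<forall>a\<in>I. f a = a \<odot>\<^bsub>coinduced D\<^esub> e" by blast
qed

lemma baer_induced:
  assumes E: "baer_module R E" and h: "inj_on h (carrier E)"
  shows "baer_module R (induced_module h E)"
  unfolding baer_module_def
proof (intro conjI allI ballI impI)
  note t = induced_module_inj[OF baer_module_module[OF E] h]
  show "module R (induced_module h E)" by (rule t)
  fix I f assume f: "f \<in> module_hom R (regmod\<lparr>carrier := I\<rparr>) (induced_module h E)" and I: "ideal I R"
  obtain e where e: "e \<in> carrier E" "\<And>a. a \<in> I \<Longrightarrow> inv_into (carrier E) h (f a) = a \<odot>\<^bsub>E\<^esub> e"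
    using baer_moduleE[OF E module_hom_comp[OF f t(3)] I] by blast
  have "f a = a \<odot>\<^bsub>induced_module h E\<^esub> h e" if a: "a \<in> I" for a
  proof -
    have "f a \<in> h ` carrier E" using module_homD(1)[OF f, of a] a by simp
    then have "f a = h (a \<odot>\<^bsub>E\<^esub> e)" using e(2)[OF a] f_inv_into_f by metis
    then show ?thesis using module_homD(3)[OF t(2) ideal.Icarr[OF I a] e(1)] by simp
  qed
  then show "\<exists>e\<in>carrier (induced_module h E). \<forall>a\<in>I. f a = a \<odot>\<^bsub>induced_module h E\<^esub> e"
    using e(1) by auto
qed

end

text \<open>Modules constructed from a module in the type \<open>('a + 't) list set\<close> are coded back into this type, so that
  the construction of a resolution can go on.\<close>

definition pair_code :: "('a + 't) list set \<Rightarrow> ('a + 't) list set \<Rightarrow> ('a + 't) list set"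
  where "pair_code A B = (#) (Inl undefined) ` A \<union> (#) (Inr undefined) ` B"

lemma pair_code_eq [simp]: "pair_code A B = pair_code A' B' \<longleftrightarrow> A = A' \<and> B = B'"
proof -
  have "A = {l. Inl undefined # l \<in> pair_code A B}" "B = {l. Inr undefined # l \<in> pair_code A B}"
    for A B :: "('a + 't) list set" by (auto simp: pair_code_def)
  then show ?thesis by metis
qed

text \<open>No pair code contains the empty word, so inserting it separates codes of non-empty lists
  from the code of the empty list and still lets both components be recovered.\<close>

primrec list_code :: "('a + 't) list set list \<Rightarrow> ('a + 't) list set"
  where "list_code [] = {}"
  | "list_code (A # L) = insert [] (pair_code A (list_code L))"

lemma insert_pair_code_eq: "insert [] (pair_code A B) = insert [] (pair_code A' B') \<longleftrightarrow> A = A' \<and> B = B'"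
proof -
  have "[] \<notin> pair_code A B" for A B :: "('a + 't) list set" by (auto simp: pair_code_def)
  then show ?thesis by (metis Diff_insert_absorb pair_code_eq)
qed

lemma list_code_inj: "list_code L = list_code L' \<Longrightarrow> L = L'"
proof (induction L arbitrary: L')
  case Nil
  then show ?case by (cases L') auto
next
  case (Cons A L)
  then obtain B M where L': "L' = B # M" by (cases L') auto
  then have "A = B" "list_code L = list_code M" using Cons.prems by (simp_all add: insert_pair_code_eq)
  then show ?case using Cons.IH L' by simp
qed

text \<open>The rationals are countable; the length of the single word is the index of
  \<open>q\<close>.\<close>

definition rat_code :: "rat \<Rightarrow> ('a + 't) list set"
  where "rat_code q = {replicate (to_nat q) (Inl undefined)}"

lemma rat_code_inj:
  assumes "rat_code q = (rat_code q' :: ('a + 't) list set)" shows "q = q'"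
proof -
  have "replicate (to_nat q) (Inl undefined :: 'a + 't) = replicate (to_nat q') (Inl undefined)"
    using assms by (simp add: rat_code_def)
  from arg_cong[OF this, of length] show ?thesis by simp
qed

text \<open>The enumeration of the support depends on the support alone. Equal codes therefore give
  equal lists of arguments and equal lists of values.\<close>

definition finsupp_code :: "(('a + 't) list set \<Rightarrow> rat) \<Rightarrow> ('a + 't) list set"
  where "finsupp_code f = (let xs = (SOME xs. set xs = {x. f x \<noteq> 0}) in
    pair_code (list_code xs) (list_code (map (\<lambda>x. rat_code (f x)) xs)))"

lemma finsupp_code_inj:
  fixes f g :: "('a + 't) list set \<Rightarrow> rat"
  assumes f: "finite {x. f x \<noteq> 0}" and g: "finite {x. g x \<noteq> 0}" and eq: "finsupp_code f = finsupp_code g"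
  shows "f = g"
proof -
  define xs where "xs f = (SOME xs. set xs = {x. f x \<noteq> 0})" for f :: "('a + 't) list set \<Rightarrow> rat"
  have code: "finsupp_code f = pair_code (list_code (xs f)) (list_code (map (\<lambda>x. rat_code (f x)) (xs f)))" for f
    by (simp add: finsupp_code_def xs_def Let_def)
  have xs: "set (xs f) = {x. f x \<noteq> 0}" "set (xs g) = {x. g x \<noteq> 0}"
    unfolding xs_def using someI_ex[OF finite_list[OF f]] someI_ex[OF finite_list[OF g]] by auto
  have e: "xs f = xs g" "map (\<lambda>x. rat_code (f x) :: ('a + 't) list set) (xs f) = map (\<lambda>x. rat_code (g x)) (xs g)"
    using eq unfolding code pair_code_eq by (auto dest: list_code_inj)
  show ?thesis
  proof
    fix x
    show "f x = g x"
    proof (cases "x \<in> set (xs f)")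
      case True
      then have "rat_code (f x) = (rat_code (g x) :: ('a + 't) list set)" using e by (metis map_eq_conv)
      then show ?thesis by (rule rat_code_inj)
    next
      case False
      then have "x \<notin> set (xs g)" using e(1) by simp
      then show ?thesis using False xs by simp
    qed
  qed
qed

text \<open>The disjoint union of all values, the first letter recording the argument.\<close>

definition fun_code :: "('a \<Rightarrow> ('a + 't) list set) \<Rightarrow> ('a + 't) list set"
  where "fun_code f = {Inl a # l | a l. l \<in> f a}"

lemma fun_code_inj: "fun_code f = fun_code g \<Longrightarrow> f = g"
proof
  fix a assume eq: "fun_code f = fun_code g"
  have "f a = {l. Inl a # l \<in> fun_code f}" for f :: "'a \<Rightarrow> ('a + 't) list set" by (auto simp: fun_code_def)
  then show "f a = g a" using eq by metis
qed

section \<open>Injective embeddings and torsion resolutions\<close>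

context cring
begin

text \<open>\<open>n\<close> goes to the additive map \<open>r \<mapsto> j (r n)\<close>, whose
  value at one is \<open>j n\<close>. The coinduced module consists of functions into a group coded
  by finitely supported rational functions, so \<open>h\<close> brings it back to the type of
  \<open>N\<close>.\<close>

lemma ex_baer_embedding:
  fixes N :: "('a, ('a + 't) list set) module"
  assumes N: "module R N"
  obtains E :: "('a, ('a + 't) list set) module" and \<iota>
  where "baer_module R E" "\<iota> \<in> module_hom R N E" "inj_on \<iota> (carrier N)"
proof -
  obtain D :: "(int, ('a + 't) list set \<Rightarrow> rat) module" and j :: "('a + 't) list set \<Rightarrow> ('a + 't) list set \<Rightarrow> rat"
    and s :: "(('a + 't) list set \<Rightarrow> rat) \<Rightarrow> ('a + 't) list set \<Rightarrow> rat"
    where *: "baer_module \<Z> D \<and> (\<forall>x\<in>carrier N. j x \<in> carrier D) \<and>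
    (\<forall>x\<in>carrier N. \<forall>y\<in>carrier N. j (x \<oplus>\<^bsub>N\<^esub> y) = j x \<oplus>\<^bsub>D\<^esub> j y) \<and>
    (\<forall>x\<in>carrier N. j x = \<zero>\<^bsub>D\<^esub> \<longrightarrow> x = \<zero>\<^bsub>N\<^esub>) \<and>
    inj_on s (carrier D) \<and> (\<forall>y\<in>carrier D. finite {x. s y x \<noteq> 0})"
    using abelian_group.divisible_embedding[OF mod_group[OF N]] by (elim exE) (rule that, assumption)
  then have D: "baer_module \<Z> D" and s: "inj_on s (carrier D)" by simp_all
  have j: "j x \<in> carrier D" if "x \<in> carrier N" for x using * that by simp
  have j_add: "j (x \<oplus>\<^bsub>N\<^esub> y) = j x \<oplus>\<^bsub>D\<^esub> j y" if "x \<in> carrier N" "y \<in> carrier N" for x y using * that by simp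
  have j_zero: "x = \<zero>\<^bsub>N\<^esub>" if "x \<in> carrier N" "j x = \<zero>\<^bsub>D\<^esub>" for x using * that by simp
  have s_fin: "finite {x. s y x \<noteq> 0}" if "y \<in> carrier D" for y using * that by simp
  note mD = baer_module_module[OF D]
  define h where "h f = fun_code (\<lambda>a. finsupp_code (s (f a)) :: ('a + 't) list set)" for f
  have h: "inj_on h (carrier (coinduced D))"
  proof (rule inj_onI)
    fix f g assume f: "f \<in> carrier (coinduced D)" and g: "g \<in> carrier (coinduced D)" and eq: "h f = h g"
    have c: "f a \<in> carrier D" "g a \<in> carrier D" for a
      using f g mD by (cases "a \<in> carrier R"; simp add: coinduced_simps)+
    show "f = g"
    proof
      fix a
      have "finsupp_code (s (f a)) = (finsupp_code (s (g a)) :: ('a + 't) list set)"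
        using fun_code_inj[OF eq[unfolded h_def]] by metis
      then have "s (f a) = s (g a)" using finsupp_code_inj[OF s_fin[OF c(1)] s_fin[OF c(2)]] by blast
      then show "f a = g a" using inj_onD[OF s] c by blast
    qed
  qed
  then have E: "baer_module R (induced_module h (coinduced D))"
    "h \<in> module_hom R (coinduced D) (induced_module h (coinduced D))"
    using baer_induced[OF baer_coinduced[OF D]] induced_module_inj(2)[OF coinduced_module[OF mD]] by auto
  define k where "k n = (\<lambda>r. if r \<in> carrier R then j (r \<odot>\<^bsub>N\<^esub> n) else \<zero>\<^bsub>D\<^esub>)" for n
  have k: "k \<in> module_hom R N (coinduced D)"
  proof (rule module_homI)
    show "k n \<in> carrier (coinduced D)" if "n \<in> carrier N" for n
      using that N j j_add by (simp add: coinduced_simps k_def smult_l_add)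
    show "k (n \<oplus>\<^bsub>N\<^esub> m) = k n \<oplus>\<^bsub>coinduced D\<^esub> k m" if "n \<in> carrier N" "m \<in> carrier N" for n m
      using that N j j_add by (auto simp: coinduced_simps k_def smult_r_add)
    show "k (a \<odot>\<^bsub>N\<^esub> n) = a \<odot>\<^bsub>coinduced D\<^esub> k n" if "a \<in> carrier R" "n \<in> carrier N" for a n
      using that N by (auto simp: coinduced_simps k_def smult_mult)
  qed
  have k_inj: "inj_on k (carrier N)"
  proof (rule inj_onI)
    fix n m assume n: "n \<in> carrier N" and m: "m \<in> carrier N" and "k n = k m"
    then have "k n \<one> = k m \<one>" by simp
    then have jn: "j n = j m" using n m N by (simp add: k_def)
    have d: "n \<ominus>\<^bsub>N\<^esub> m \<in> carrier N" using n m N by simp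
    have "j (n \<ominus>\<^bsub>N\<^esub> m) \<oplus>\<^bsub>D\<^esub> j m = \<zero>\<^bsub>D\<^esub> \<oplus>\<^bsub>D\<^esub> j m"
      using j_add[OF d m] jn n m N j[OF m] cring.mod_l_zero[OF int_is_cring mD j[OF m]] by simp
    then have "j (n \<ominus>\<^bsub>N\<^esub> m) = \<zero>\<^bsub>D\<^esub>"
      using cring.mod_add_minus[OF int_is_cring mD j[OF d] j[OF m]]
        cring.mod_add_minus[OF int_is_cring mD cring.mod_zero[OF int_is_cring mD] j[OF m]] by metis
    then show "n = m" using j_zero[OF d] mod_minus_eq_zero[OF N n m] by simp
  qed
  have "k ` carrier N \<subseteq> carrier (coinduced D)" using module_homD(1)[OF k] by blast
  then have "inj_on (\<lambda>n. h (k n)) (carrier N)"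
    using comp_inj_on[OF k_inj inj_on_subset[OF h]] by (simp add: o_def)
  then show ?thesis using that[OF E(1) module_hom_comp[OF k E(2)]] by blast
qed

lemma torsion_image:
  assumes "module R M" "module R N" "g \<in> module_hom R M N" "g ` carrier M = carrier N"
    "torsion R S M = carrier M" "S \<subseteq> carrier R"
  shows "torsion R S N = carrier N"
proof
  show "carrier N \<subseteq> torsion R S N"
  proof
    fix y assume "y \<in> carrier N"
    then obtain x where x: "x \<in> torsion R S M" "y = g x" using assms(4,5) by auto
    then show "y \<in> torsion R S N" using hom_torsion[OF assms(1-3,6) x(1)] by simp
  qed
qed (rule torsion_subset)

text \<open>A torsion module embeds into the torsion part of any injective module containing it, and
  by \<open>baer_torsion\<close> this part is injective.\<close>

lemma ex_baer_torsion_embedding: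
  fixes N :: "('a, ('a + 't) list set) module"
  assumes noeth: "noetherian_ring R" and N: "module R N" and S: "S \<subseteq> carrier R" and tors: "torsion R S N = carrier N"
  obtains E :: "('a, ('a + 't) list set) module" and \<iota>
  where "baer_module R E" "torsion R S E = carrier E" "\<iota> \<in> module_hom R N E" "inj_on \<iota> (carrier N)"
proof -
  obtain E :: "('a, ('a + 't) list set) module" and \<iota>
    where E: "baer_module R E" "\<iota> \<in> module_hom R N E" "inj_on \<iota> (carrier N)" by (rule ex_baer_embedding[OF N])
  show ?thesis
  proof (rule that[of "E\<lparr>carrier := torsion R S E\<rparr>" \<iota>])
    show "baer_module R (E\<lparr>carrier := torsion R S E\<rparr>)" by (rule baer_torsion[OF noeth E(1) S])
    show "torsion R S (E\<lparr>carrier := torsion R S E\<rparr>) = carrier (E\<lparr>carrier := torsion R S E\<rparr>)"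
      by (simp add: torsion_restrict)
    show "\<iota> \<in> module_hom R N (E\<lparr>carrier := torsion R S E\<rparr>)"
      by (rule module_hom_restrict_cod[OF E(2)])
        (use hom_torsion[OF N baer_module_module[OF E(1)] E(2) S] tors in auto)
  qed (rule E(3))
qed

text \<open>Alternates embeddings and cokernels. The torsion terms matter because the torsion
  functor leaves such a resolution unchanged; the choice \<open>S = {}\<close> yields resolutions of
  arbitrary modules.\<close>

lemma ex_resolution:
  fixes T :: "('a, 't, 'm) module_scheme"
  assumes noeth: "noetherian_ring R" and T: "module R T" and S: "S \<subseteq> carrier R" and tors: "torsion R S T = carrier T"
  obtains \<epsilon> and K :: "nat \<Rightarrow> ('a, ('a + 't) list set) module" and e
  where "resolves R 0 T \<epsilon> K e" "\<And>n. torsion R S (K n) = carrier (K n)"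
proof -
  let ?h = "\<lambda>t::'t. {[Inr t :: 'a + 't]}"
  let ?T = "induced_module ?h T"
  have inj: "inj_on ?h (carrier T)" by (auto simp: inj_on_def)
  note T' = induced_module_inj[OF T inj]
  have T't: "torsion R S ?T = carrier ?T" by (rule torsion_image[OF T T'(1,2) _ tors S]) simp
  \<comment> \<open>A state holds the current term \<open>E\<close>, the cokernel \<open>C\<close>
    still to be resolved, and the projection \<open>q\<close>. \<open>Q\<close> embeds this cokernel
    into the next term as a kernel; the clause for \<open>n = 0\<close> does the same for the module
    itself.\<close>
  define P where "P n p \<longleftrightarrow> (case p of (E, C, q) \<Rightarrow> baer_module R E \<and> torsion R S E = carrier E \<and> module R C \<and>
      torsion R S C = carrier C \<and> q \<in> module_hom R E C \<and> q ` carrier E = carrier C \<and>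
      (n = 0 \<longrightarrow> (\<exists>\<iota>\<in>module_hom R ?T E. inj_on \<iota> (carrier ?T) \<and> {x \<in> carrier E. q x = \<zero>\<^bsub>C\<^esub>} = \<iota> ` carrier ?T)))"
    for n :: nat and p :: "('a, ('a + 't) list set) module \<times> ('a, ('a + 't) list set) module \<times> (('a + 't) list set \<Rightarrow> ('a + 't) list set)"
  define Q where "Q n p p' \<longleftrightarrow> (case p of (E, C, q) \<Rightarrow> case p' of (E', C', q') \<Rightarrow>
      (\<exists>\<iota>\<in>module_hom R C E'. inj_on \<iota> (carrier C) \<and> {x \<in> carrier E'. q' x = \<zero>\<^bsub>C'\<^esub>} = \<iota> ` carrier C))"
    for n :: nat and p p' :: "('a, ('a + 't) list set) module \<times> ('a, ('a + 't) list set) module \<times> (('a + 't) list set \<Rightarrow> ('a + 't) list set)"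
  have step: "\<exists>(E :: ('a, ('a + 't) list set) module) (C :: ('a, ('a + 't) list set) module) q. baer_module R E \<and> torsion R S E = carrier E \<and> module R C \<and>
      torsion R S C = carrier C \<and> q \<in> module_hom R E C \<and> q ` carrier E = carrier C \<and>
      (\<exists>\<iota>\<in>module_hom R N E. inj_on \<iota> (carrier N) \<and> {x \<in> carrier E. q x = \<zero>\<^bsub>C\<^esub>} = \<iota> ` carrier N)"
    if N: "module R N" "torsion R S N = carrier N" for N :: "('a, ('a + 't) list set) module"
  proof -
    obtain E :: "('a, ('a + 't) list set) module" and \<iota> where E: "baer_module R E" "torsion R S E = carrier E"
      "\<iota> \<in> module_hom R N E" "inj_on \<iota> (carrier N)" by (rule ex_baer_torsion_embedding[OF noeth N(1) S N(2)])
    note mE = baer_module_module[OF E(1)]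
    have sub: "submod R E (\<iota> ` carrier N)" by (rule submod_image[OF N(1) mE E(3) submod_carrier[OF N(1)]])
    obtain C :: "('a, ('a + 't) list set) module" and q where C: "module R C" "q \<in> module_hom R E C"
      "q ` carrier E = carrier C" "\<And>x. x \<in> carrier E \<Longrightarrow> q x = \<zero>\<^bsub>C\<^esub> \<longleftrightarrow> x \<in> \<iota> ` carrier N"
      by (rule ex_quotient[OF mE sub]) blast
    have 1: "torsion R S C = carrier C" by (rule torsion_image[OF mE C(1-3) E(2) S])
    have 2: "{x \<in> carrier E. q x = \<zero>\<^bsub>C\<^esub>} = \<iota> ` carrier N" using C(4) submodD(1)[OF sub] by auto
    show ?thesis
      by (rule exI[of _ E], rule exI[of _ C], rule exI[of _ q])
        (intro conjI bexI[OF _ E(3)] E(1,2,4) C(1-3) 1 2)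
  qed
  have "\<exists>f. \<forall>n. P n (f n) \<and> Q n (f n) (f (Suc n))"
  proof (rule dependent_nat_choice)
    show "\<exists>p. P 0 p" 
    proof -
      obtain E C :: "('a, ('a + 't) list set) module" and q where "baer_module R E \<and> torsion R S E = carrier E \<and> module R C \<and>
        torsion R S C = carrier C \<and> q \<in> module_hom R E C \<and> q ` carrier E = carrier C \<and>
        (\<exists>\<iota>\<in>module_hom R ?T E. inj_on \<iota> (carrier ?T) \<and> {x \<in> carrier E. q x = \<zero>\<^bsub>C\<^esub>} = \<iota> ` carrier ?T)"
        using step[OF T'(1) T't] by (elim exE) (rule that, assumption)
      then have "P 0 (E, C, q)" unfolding P_def by simp
      then show ?thesis by blast
    qed
    fix p n assume p: "P n p"
    obtain E0 C0 q0 where p0: "p = (E0, C0, q0)" by (cases p)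
    then have C0: "module R C0" "torsion R S C0 = carrier C0" using p by (simp_all add: P_def)
    obtain E C :: "('a, ('a + 't) list set) module" and q where "baer_module R E \<and> torsion R S E = carrier E \<and> module R C \<and>
      torsion R S C = carrier C \<and> q \<in> module_hom R E C \<and> q ` carrier E = carrier C \<and>
      (\<exists>\<iota>\<in>module_hom R C0 E. inj_on \<iota> (carrier C0) \<and> {x \<in> carrier E. q x = \<zero>\<^bsub>C\<^esub>} = \<iota> ` carrier C0)"
      using step[OF C0] by (elim exE) (rule that, assumption)
    then have "P (Suc n) (E, C, q) \<and> Q n p (E, C, q)" unfolding P_def Q_def p0 by simp
    then show "\<exists>p'. P (Suc n) p' \<and> Q n p p'" by blast
  qed
  then obtain f where f: "\<And>n. P n (f n)" "\<And>n. Q n (f n) (f (Suc n))" by blast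
  define K C q where "K n = fst (f n)" and "C n = fst (snd (f n))" and "q n = snd (snd (f n))" for n
  have fn: "f n = (K n, C n, q n)" for n by (simp add: K_def C_def q_def)
  have K: "baer_module R (K n)" "torsion R S (K n) = carrier (K n)" "module R (C n)"
    "q n \<in> module_hom R (K n) (C n)" "q n ` carrier (K n) = carrier (C n)" for n
    using f(1)[of n] unfolding fn P_def by auto
  note mK = baer_module_module[OF K(1)]
  obtain \<iota>0 where \<iota>0: "\<iota>0 \<in> module_hom R ?T (K 0)" "inj_on \<iota>0 (carrier ?T)"
    "{x \<in> carrier (K 0). q 0 x = \<zero>\<^bsub>C 0\<^esub>} = \<iota>0 ` carrier ?T"
    using f(1)[of 0] unfolding fn P_def by auto
  have "\<forall>n. \<exists>\<iota>. \<iota> \<in> module_hom R (C n) (K (Suc n)) \<and> inj_on \<iota> (carrier (C n)) \<and>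
      {x \<in> carrier (K (Suc n)). q (Suc n) x = \<zero>\<^bsub>C (Suc n)\<^esub>} = \<iota> ` carrier (C n)"
    using f(2) unfolding fn Q_def Bex_def by simp
  then obtain \<iota> where \<iota>: "\<And>n. \<iota> n \<in> module_hom R (C n) (K (Suc n))" "\<And>n. inj_on (\<iota> n) (carrier (C n))"
    "\<And>n. {x \<in> carrier (K (Suc n)). q (Suc n) x = \<zero>\<^bsub>C (Suc n)\<^esub>} = \<iota> n ` carrier (C n)" by metis
  define d where "d n x = \<iota> n (q n x)" for n x
  have dh: "d n \<in> module_hom R (K n) (K (Suc n))" for n
    unfolding d_def by (rule module_hom_comp[OF K(4) \<iota>(1)])
  have ker: "d n x = \<zero>\<^bsub>K (Suc n)\<^esub> \<longleftrightarrow> q n x = \<zero>\<^bsub>C n\<^esub>" if x: "x \<in> carrier (K n)" for n x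
    using hom_zero[OF K(3) mK \<iota>(1)] inj_onD[OF \<iota>(2), of n "q n x" "\<zero>\<^bsub>C n\<^esub>"] module_homD(1)[OF K(4) x] K(3)
    unfolding d_def by auto
  have cocyc: "cocycles K d n = {x \<in> carrier (K n). q n x = \<zero>\<^bsub>C n\<^esub>}" for n
    unfolding cocycles_def using ker by auto
  have cobound: "cocycles K d (Suc n) = d n ` carrier (K n)" for n
    unfolding cocyc \<iota>(3) d_def using K(5)[of n] by (metis image_image)
  show ?thesis
  proof (rule that[of "\<lambda>t. \<iota>0 (?h t)" K d])
    show "torsion R S (K n) = carrier (K n)" for n by (rule K)
    show "resolves R 0 T (\<lambda>t. \<iota>0 (?h t)) K d"
      unfolding resolves_def
    proof (intro conjI allI impI)
      show "cochain R K d"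
        unfolding cochain_def
      proof (intro allI conjI ballI mK dh)
        fix n x assume "x \<in> carrier (K n)"
        then have "d n x \<in> cocycles K d (Suc n)" using cobound by blast
        then show "d (Suc n) (d n x) = \<zero>\<^bsub>K (Suc (Suc n))\<^esub>" by (simp add: cocycles_def)
      qed
      show "(\<lambda>t. \<iota>0 (?h t)) \<in> module_hom R T (K 0)" by (rule module_hom_comp[OF T'(2) \<iota>0(1)])
      show "inj_on (\<lambda>t. \<iota>0 (?h t)) (carrier T)"
        using \<iota>0(2) by (auto simp: inj_on_def)
      show "cocycles K d 0 = (\<lambda>t. \<iota>0 (?h t)) ` carrier T" unfolding cocyc \<iota>0(3) by (simp add: image_image)
      show "exact_at K d n" if "0 < n" for n
        using that cobound by (cases n) (auto simp: exact_at_def)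
    qed (use K T in auto)
  qed
qed

lemma injective_resolution_iff: "module R T \<Longrightarrow> injective_resolution R T \<epsilon> K e \<longleftrightarrow> resolves R 0 T \<epsilon> K e"
proof
  assume T: "module R T" and *: "injective_resolution R T \<epsilon> K e"
  have K: "baer_module R (K n)" "e n \<in> module_hom R (K n) (K (Suc n))" for n
    using * unfolding injective_resolution_def injective_module_iff_baer by blast+
  have cocyc: "cocycles K e n = a_kernel (K n) (K (Suc n)) (e n)" for n
    by (simp add: cocycles_def a_kernel_def')
  have cobound: "cocycles K e (Suc n) = e n ` carrier (K n)" for n
    using * unfolding cocyc injective_resolution_def by simp
  show "resolves R 0 T \<epsilon> K e"
    unfolding resolves_def
  proof (intro conjI allI impI T K)
    show "cochain R K e"
      unfolding cochain_def
    proof (intro allI conjI ballI baer_module_module[OF K(1)] K(2))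
      fix n x assume "x \<in> carrier (K n)"
      then have "e n x \<in> cocycles K e (Suc n)" using cobound by blast
      then show "e (Suc n) (e n x) = \<zero>\<^bsub>K (Suc (Suc n))\<^esub>" by (simp add: cocycles_def)
    qed
    show "exact_at K e n" if "0 < n" for n using that cobound by (cases n) (auto simp: exact_at_def)
    show "cocycles K e 0 = \<epsilon> ` carrier T" unfolding cocyc using * by (simp add: injective_resolution_def)
  qed (use * in \<open>auto simp: injective_resolution_def\<close>)
next
  assume *: "resolves R 0 T \<epsilon> K e"
  have cocyc: "cocycles K e n = a_kernel (K n) (K (Suc n)) (e n)" for n
    by (simp add: cocycles_def a_kernel_def')
  have "e n ` carrier (K n) = a_kernel (K (Suc n)) (K (Suc (Suc n))) (e (Suc n))" for n
    using resolvesD(8)[OF *, of "Suc n"] coboundaries_subset[OF resolvesD(2)[OF *], of "Suc n"]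
    unfolding cocyc[symmetric] exact_at_def by auto
  then show "injective_resolution R T \<epsilon> K e"
    unfolding injective_resolution_def using resolvesD[OF *] cochainD(2)[OF resolvesD(2)[OF *]] cocyc[of 0]
    by (simp add: injective_module_iff_baer)
qed

section \<open>Artinian local cohomology\<close>

lemma torsion_complex_self:
  assumes "\<And>n. torsion R S (K n) = carrier (K n)" shows "torsion_complex R S K = K"
  by (rule ext) (simp add: torsion_complex_def assms)

lemma ex_plain_resolution:
  fixes T :: "('a, 't, 'm) module_scheme"
  assumes "noetherian_ring R" "module R T"
  obtains \<epsilon> and K :: "nat \<Rightarrow> ('a, ('a + 't) list set) module" and e where "resolves R 0 T \<epsilon> K e"
  by (rule ex_resolution[OF assms empty_subsetI torsion_empty])

lemma resolves_iso:
  assumes K: "resolves R 0 T' \<epsilon> K e" and T: "module R T" and q: "q \<in> module_hom R T T'" "q ` carrier T = carrier T'"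
    "inj_on q (carrier T)"
  shows "resolves R 0 T (\<lambda>t. \<epsilon> (q t)) K e"
  unfolding resolves_def
proof (intro conjI allI impI)
  show "(\<lambda>t. \<epsilon> (q t)) \<in> module_hom R T (K 0)" by (rule module_hom_comp[OF q(1) resolvesD(5)[OF K]])
  show "inj_on (\<lambda>t. \<epsilon> (q t)) (carrier T)"
    using comp_inj_on[OF q(3)] resolvesD(6)[OF K] q(2) by (simp add: o_def)
  show "cocycles K e 0 = (\<lambda>t. \<epsilon> (q t)) ` carrier T"
    using resolvesD(7)[OF K] q(2) by (metis image_image)
qed (use resolvesD[OF K] T in auto)

text \<open>Induction on \<open>n\<close> and Noetherian induction on the kernel \<open>N\<close> of \<open>T\<^sub>0 \<rightarrow> T\<close>: if \<open>S\<close> does not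
  annihilate \<open>T\<close>, then either some \<open>x \<in> S\<close> is regular on \<open>T\<close>, and \<open>T/xT\<close> controls the kernel of
  multiplication by \<open>x\<close> on the cohomology, or \<open>xT\<close> and \<open>T/xT\<close> are proper quotients of \<open>T\<close>.\<close>

lemma artinian_at_quotient:
  fixes T0 :: "('a, 't, 'm) module_scheme" and T :: "('a, 't) module"
    and K :: "nat \<Rightarrow> ('a, ('a + 't) list set) module"
  assumes noeth: "noetherian_ring R" and S: "S \<subseteq> carrier R"
    and dcc: "chain_cond False R (regular_module R) (Idl S) (carrier R)"
    and fg: "finitely_generated_module R T0"
    and N: "submod R T0 N" and q: "q \<in> module_hom R T0 T" "q ` carrier T0 = carrier T"
      "\<And>x. x \<in> carrier T0 \<Longrightarrow> q x = \<zero>\<^bsub>T\<^esub> \<longleftrightarrow> x \<in> N"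
    and K: "resolves R 0 T \<epsilon> K e"
  shows "artinian_at R (torsion_complex R S K) e n"
proof -
  have T0: "module R T0" using fg by (simp add: finitely_generated_module_def)
  have acc: "chain_cond True R T0 {\<zero>\<^bsub>T0\<^esub>} (carrier T0)"
    by (rule chain_cond_finitely_generated[OF fg submod_trivial[OF T0] zeroideal noetherian_chain_cond[OF noeth]])
      (use T0 in auto)
  note wf = submod_wf[OF T0 acc]
  \<comment> \<open>All quotients of \<open>T0\<close> stay in the type of \<open>T0\<close>, and
    their resolutions in one further type. This makes it possible to quantify over them inside the
    induction.\<close>
  define claim where "claim n N \<longleftrightarrow> (\<forall>(T :: ('a, 't) module) q \<epsilon> (K :: nat \<Rightarrow> ('a, ('a + 't) list set) module) e.
      submod R T0 N \<longrightarrow> q \<in> module_hom R T0 T \<longrightarrow> q ` carrier T0 = carrier T \<longrightarrow>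
      (\<forall>x\<in>carrier T0. q x = \<zero>\<^bsub>T\<^esub> \<longleftrightarrow> x \<in> N) \<longrightarrow> resolves R 0 T \<epsilon> K e \<longrightarrow>
      artinian_at R (torsion_complex R S K) e n)" for n N
  have claimD: "artinian_at R (torsion_complex R S K) e n"
    if "claim n N" "submod R T0 N" "q \<in> module_hom R T0 T" "q ` carrier T0 = carrier T"
      "\<And>x. x \<in> carrier T0 \<Longrightarrow> q x = \<zero>\<^bsub>T\<^esub> \<longleftrightarrow> x \<in> N" "resolves R 0 T \<epsilon> K e"
    for n N and T :: "('a, 't) module" and q \<epsilon> and K :: "nat \<Rightarrow> ('a, ('a + 't) list set) module" and e
    using that unfolding claim_def by simp
  have "claim n N" for n N
  proof (induction n arbitrary: N rule: less_induct)
    case (less n)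
    show ?case
    proof (induction N rule: wf_induct_rule[OF wf])
      case (1 N)
      show ?case
        unfolding claim_def
      proof (intro allI impI)
        fix T :: "('a, 't) module" and q \<epsilon> and K :: "nat \<Rightarrow> ('a, ('a + 't) list set) module" and e
        assume N: "submod R T0 N" and q: "q \<in> module_hom R T0 T" "q ` carrier T0 = carrier T"
          and "\<forall>x\<in>carrier T0. q x = \<zero>\<^bsub>T\<^esub> \<longleftrightarrow> x \<in> N" and K: "resolves R 0 T \<epsilon> K e"
        then have qN: "q x = \<zero>\<^bsub>T\<^esub> \<longleftrightarrow> x \<in> N" if "x \<in> carrier T0" for x using that by simp
        note T = resolvesD(1)[OF K] and KC = resolvesD(2)[OF K]
        show "artinian_at R (torsion_complex R S K) e n"
        proof (cases "\<forall>x\<in>S. \<forall>t\<in>carrier T. x \<odot>\<^bsub>T\<^esub> t = \<zero>\<^bsub>T\<^esub>")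
          \<comment> \<open>If \<open>S\<close> kills \<open>T\<close>, some resolution of
            \<open>T\<close> consists of torsion modules and equals its own torsion. Its cohomology
            is \<open>T\<close> in degree 0, a quotient of \<open>T0\<close> that is finitely
            generated over \<open>R / Idl S\<close>.\<close>
          case True
          have "torsion R S T = carrier T"
          proof (rule subset_antisym[OF torsion_subset], rule subsetI)
            fix t assume t: "t \<in> carrier T"
            have "(x [^] (1::nat)) \<odot>\<^bsub>T\<^esub> t = \<zero>\<^bsub>T\<^esub>" if "x \<in> S" for x using True t that S by auto
            then show "t \<in> torsion R S T" unfolding torsion_def using t by blast
          qed
          then obtain \<epsilon>' and L :: "nat \<Rightarrow> ('a, ('a + 't) list set) module" and e'
            where L: "resolves R 0 T \<epsilon>' L e'" "\<And>n. torsion R S (L n) = carrier (L n)"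
            using ex_resolution[OF noeth T S] by blast
          note LC = resolvesD(2)[OF L(1)] and mL = cochainD(1)[OF resolvesD(2)[OF L(1)]]
          have "artinian_at R L e' n"
          proof (cases n)
            case 0
            have "ideal {a \<in> carrier R. \<forall>t\<in>carrier T. a \<odot>\<^bsub>T\<^esub> t = \<zero>\<^bsub>T\<^esub>} R"
              unfolding submod_regular[symmetric]
              by (rule submodI) (use T in \<open>auto simp: smult_l_add smult_mult\<close>)
            then have "Idl S \<subseteq> {a \<in> carrier R. \<forall>t\<in>carrier T. a \<odot>\<^bsub>T\<^esub> t = \<zero>\<^bsub>T\<^esub>}"
              by (rule genideal_minimal) (use True S in auto)
            then have ann: "a \<odot>\<^bsub>T0\<^esub> x \<in> N" if "a \<in> Idl S" "x \<in> carrier T0" for a x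
            proof -
              have a: "a \<in> carrier R" "\<forall>t\<in>carrier T. a \<odot>\<^bsub>T\<^esub> t = \<zero>\<^bsub>T\<^esub>"
                using that(1) \<open>Idl S \<subseteq> _\<close> by blast+
              then have "q (a \<odot>\<^bsub>T0\<^esub> x) = \<zero>\<^bsub>T\<^esub>" using module_homD(1,3)[OF q(1)] that(2) by simp
              then show ?thesis using qN a(1) that(2) T0 by simp
            qed
            have cc: "chain_cond False R T0 N (carrier T0)"
              by (rule chain_cond_finitely_generated[OF fg N genideal_ideal[OF S] dcc ann])
            have \<epsilon>q: "(\<lambda>x. \<epsilon>' (q x)) \<in> module_hom R T0 (L 0)"
              by (rule module_hom_comp[OF q(1) resolvesD(5)[OF L(1)]])
            show ?thesis
              unfolding artinian_at_def 0
            proof (rule exact_chain_cond[OF T0 mL mL \<epsilon>q zero_hom[OF mL] N submod_carrier[OF T0]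
                  submod_trivial[OF mL] submod_trivial[OF mL] submodD(1)[OF N] order_refl _ _ _ cc chain_cond_trivial])
              have "\<epsilon>' (q x) = \<zero>\<^bsub>L 0\<^esub>" if "x \<in> N" for x
                using hom_zero[OF T mL resolvesD(5)[OF L(1)]] qN[OF submodD(2)[OF N that]] that by simp
              then show "(\<lambda>x. \<epsilon>' (q x)) ` N \<subseteq> coboundaries L e' 0" by auto
              fix y assume "y \<in> cocycles L e' 0"
              then obtain t where t: "t \<in> carrier T" "y = \<epsilon>' t" using resolvesD(7)[OF L(1)] by auto
              then obtain x where x: "x \<in> carrier T0" "t = q x" using q(2) by auto
              then have "y = \<epsilon>' (q x) \<oplus>\<^bsub>L 0\<^esub> \<zero>\<^bsub>L 0\<^esub>" using t(2) module_homD(1)[OF \<epsilon>q x(1)] mL by simp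
              then show "\<exists>x\<in>carrier T0. \<exists>b\<in>coboundaries L e' 0. y = \<epsilon>' (q x) \<oplus>\<^bsub>L 0\<^esub> b" using x(1) by auto
            qed auto
          next
            case (Suc m)
            then show ?thesis using exact_artinian_at[OF LC] resolvesD(8)[OF L(1)] by simp
          qed
          then have "artinian_at R (torsion_complex R S L) e' n" using torsion_complex_self[of S L] L(2) by simp
          then show ?thesis using artinian_at_unique[OF K L(1) S] by blast
        next
          case False
          then obtain x t1 where x: "x \<in> S" and t1: "t1 \<in> carrier T" "x \<odot>\<^bsub>T\<^esub> t1 \<noteq> \<zero>\<^bsub>T\<^esub>" by blast
          have xR: "x \<in> carrier R" using x S by auto
          note xh = smult_hom[OF T xR]
          define A where "A = (\<lambda>t. x \<odot>\<^bsub>T\<^esub> t) ` carrier T"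
          have A: "submod R T A" unfolding A_def by (rule submod_image[OF T T xh submod_carrier[OF T]])
          obtain Q :: "('a, 't) module" and r where Q: "module R Q" "r \<in> module_hom R T Q"
            "r ` carrier T = carrier Q" "\<And>t. t \<in> carrier T \<Longrightarrow> r t = \<zero>\<^bsub>Q\<^esub> \<longleftrightarrow> t \<in> A"
            by (rule ex_quotient[OF T A]) blast
          obtain \<epsilon>' and L :: "nat \<Rightarrow> ('a, ('a + 't) list set) module" and e' where L: "resolves R 0 Q \<epsilon>' L e'"
            by (rule ex_plain_resolution[OF noeth Q(1)])
          \<comment> \<open>\<open>T/xT\<close> is \<open>T0/N1\<close>, and \<open>N1\<close> is
            strictly larger than \<open>N\<close> because \<open>x\<close> does not kill
            \<open>T\<close>.\<close>
          define N1 where "N1 = {y \<in> carrier T0. q y \<in> A}"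
          have N1: "submod R T0 N1" unfolding N1_def by (rule submod_vimage[OF T0 T q(1) submod_carrier[OF T0] A])
          have rq: "(\<lambda>y. r (q y)) \<in> module_hom R T0 Q" by (rule module_hom_comp[OF q(1) Q(2)])
          have rq': "(\<lambda>y. r (q y)) ` carrier T0 = carrier Q" using q(2) Q(3) by (metis image_image)
          have rqN: "r (q y) = \<zero>\<^bsub>Q\<^esub> \<longleftrightarrow> y \<in> N1" if "y \<in> carrier T0" for y
            using Q(4)[OF module_homD(1)[OF q(1) that]] that by (simp add: N1_def)
          have "N \<subset> N1"
          proof
            show "N \<subseteq> N1"
            proof
              fix y assume y: "y \<in> N"
              show "y \<in> N1"
                unfolding N1_def using submodD(2)[OF N y] submodD(3)[OF A] qN[OF submodD(2)[OF N y]] y by simp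
            qed
            obtain y where y: "y \<in> carrier T0" "q y = t1" using t1(1) unfolding q(2)[symmetric] by blast
            have "q (x \<odot>\<^bsub>T0\<^esub> y) = x \<odot>\<^bsub>T\<^esub> t1" using module_homD(3)[OF q(1) xR y(1)] y(2) by simp
            then have "x \<odot>\<^bsub>T0\<^esub> y \<in> N1" "x \<odot>\<^bsub>T0\<^esub> y \<notin> N"
              using qN[of "x \<odot>\<^bsub>T0\<^esub> y"] t1 y(1) T0 xR by (simp_all add: N1_def A_def)
            then show "N \<noteq> N1" by blast
          qed
          then have lt1: "(N1, N) \<in> {(N', N). submod R T0 N' \<and> submod R T0 N \<and> N \<subset> N'}" using N N1 by simp
          show ?thesis
          proof (cases "\<forall>t\<in>carrier T. x \<odot>\<^bsub>T\<^esub> t = \<zero>\<^bsub>T\<^esub> \<longrightarrow> t = \<zero>\<^bsub>T\<^esub>")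
            case True
            show ?thesis
            proof (cases n)
              case 0
              \<comment> \<open>A regular element of \<open>S\<close> leaves no
                \<open>S\<close>-torsion in \<open>T\<close>, so the cohomology in degree 0
                vanishes.\<close>
              have "exact_at (torsion_complex R S K) e 0"
                unfolding exact_at_def
              proof
                fix z assume z: "z \<in> cocycles (torsion_complex R S K) e 0"
                then have zt: "z \<in> torsion R S (K 0)" "e 0 z = \<zero>\<^bsub>K (Suc 0)\<^esub>" by (auto simp: cocycles_def)
                then have "z \<in> cocycles K e 0" using torsion_carrier[of z S "K 0"] by (simp add: cocycles_def)
                then obtain t where t: "t \<in> carrier T" "z = \<epsilon> t" using resolvesD(7)[OF K] by auto
                obtain k :: nat where k: "(x [^] k) \<odot>\<^bsub>K 0\<^esub> z = \<zero>\<^bsub>K 0\<^esub>" using zt(1) x by (auto simp: torsion_def)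
                note \<epsilon> = resolvesD(5)[OF K]
                have \<epsilon>z: "\<epsilon> \<zero>\<^bsub>T\<^esub> = \<zero>\<^bsub>K 0\<^esub>" using hom_zero[OF T cochainD(1)[OF KC] \<epsilon>] .
                have "\<epsilon> ((x [^] k) \<odot>\<^bsub>T\<^esub> t) = \<epsilon> \<zero>\<^bsub>T\<^esub>" using module_homD(3)[OF \<epsilon>, of "x [^] k" t] xR t k \<epsilon>z by simp
                then have xt: "(x [^] k) \<odot>\<^bsub>T\<^esub> t = \<zero>\<^bsub>T\<^esub>"
                  using inj_onD[OF resolvesD(6)[OF K], of "(x [^] k) \<odot>\<^bsub>T\<^esub> t" "\<zero>\<^bsub>T\<^esub>"] T t(1) xR by simp
                have "t = \<zero>\<^bsub>T\<^esub>" if "(x [^] k) \<odot>\<^bsub>T\<^esub> t = \<zero>\<^bsub>T\<^esub>" for k :: nat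
                  using that
                proof (induction k)
                  case 0
                  then show ?case using t(1) T by simp
                next
                  case (Suc k)
                  have "x \<odot>\<^bsub>T\<^esub> ((x [^] k) \<odot>\<^bsub>T\<^esub> t) = (x [^] Suc k) \<odot>\<^bsub>T\<^esub> t"
                    using smult_mult[OF T xR, of "x [^] k" t] xR t(1) by (simp add: m_comm)
                  then have "x \<odot>\<^bsub>T\<^esub> ((x [^] k) \<odot>\<^bsub>T\<^esub> t) = \<zero>\<^bsub>T\<^esub>" using Suc.prems by simp
                  then show ?case using True[rule_format, of "(x [^] k) \<odot>\<^bsub>T\<^esub> t"] T xR t(1) Suc.IH by simp
                qed
                from this[OF xt] show "z \<in> coboundaries (torsion_complex R S K) e 0" using t(2) \<epsilon>z by simp
              qed
              then show ?thesis using exact_artinian_at[OF cochain_torsion[OF KC S]] 0 by simp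
            next
              case (Suc m)
              \<comment> \<open>The degree has dropped, so the outer induction hypothesis covers
                \<open>T/xT\<close>.\<close>
              have "artinian_at R (torsion_complex R S L) e' m"
                by (rule claimD[OF _ N1 rq rq' rqN L]) (use less Suc in simp)
              then have "artinian_at R (torsion_complex R S K) e (Suc m)"
                by (intro artinian_at_regular[OF K L Q(2,3) Q(4)[unfolded A_def] S x]) (use True in simp_all)
              then show ?thesis using Suc by simp
            qed
          next
            case False
            then obtain t2 where t2: "t2 \<in> carrier T" "x \<odot>\<^bsub>T\<^esub> t2 = \<zero>\<^bsub>T\<^esub>" "t2 \<noteq> \<zero>\<^bsub>T\<^esub>" by blast
            let ?A = "T\<lparr>carrier := A\<rparr>"
            have mA: "module R ?A" by (rule submod_module[OF T A])
            obtain \<epsilon>'' and B :: "nat \<Rightarrow> ('a, ('a + 't) list set) module" and e'' where B: "resolves R 0 ?A \<epsilon>'' B e''"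
              by (rule ex_plain_resolution[OF noeth mA])
            \<comment> \<open>\<open>xT\<close> is the image of \<open>T0\<close> under
              \<open>y \<mapsto> x (q y)\<close>, hence \<open>T0/N2\<close>; it is a proper
              quotient of \<open>T\<close> because \<open>x\<close> is not regular.\<close>
            define N2 where "N2 = {y \<in> carrier T0. x \<odot>\<^bsub>T\<^esub> q y = \<zero>\<^bsub>T\<^esub>}"
            have xq: "(\<lambda>y. x \<odot>\<^bsub>T\<^esub> q y) \<in> module_hom R T0 T" by (rule module_hom_comp[OF q(1) xh])
            have N2: "submod R T0 N2"
              using submod_vimage[OF T0 T xq submod_carrier[OF T0] submod_trivial[OF T]] by (simp add: N2_def)
            have xqA: "(\<lambda>y. x \<odot>\<^bsub>T\<^esub> q y) \<in> module_hom R T0 ?A"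
              by (rule module_hom_restrict_cod[OF xq]) (use module_homD(1)[OF q(1)] in \<open>auto simp: A_def\<close>)
            have xqA': "(\<lambda>y. x \<odot>\<^bsub>T\<^esub> q y) ` carrier T0 = carrier ?A"
              unfolding A_def by (simp flip: q(2) add: image_image)
            have "N \<subset> N2"
            proof
              show "N \<subseteq> N2"
              proof
                fix y assume y: "y \<in> N"
                then show "y \<in> N2" using submodD(2)[OF N y] qN[OF submodD(2)[OF N y]] T xR by (simp add: N2_def)
              qed
              obtain y where y: "y \<in> carrier T0" "q y = t2" using t2(1) unfolding q(2)[symmetric] by blast
              then have "y \<in> N2" "y \<notin> N" using t2 qN[OF y(1)] by (simp_all add: N2_def)
              then show "N \<noteq> N2" by blast
            qed
            then have lt2: "(N2, N) \<in> {(N', N). submod R T0 N' \<and> submod R T0 N \<and> N \<subset> N'}" using N N2 by simp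
            have a1: "artinian_at R (torsion_complex R S B) e'' n"
              by (rule claimD[OF 1[OF lt2] N2 xqA xqA' _ B]) (simp add: N2_def)
            have a2: "artinian_at R (torsion_complex R S L) e' n"
              by (rule claimD[OF 1[OF lt1] N1 rq rq' rqN L])
            show ?thesis
              by (rule artinian_at_extension[OF K L B Q(2-4) S submodD(1)[OF A] a1 a2])
          qed
        qed
      qed
    qed
  qed
  then show ?thesis by (rule claimD[OF _ N q K])
qed

text \<open>Removes the type restrictions of the induction: \<open>T\<close> is replaced by its
  isomorphic copy \<open>T/0\<close>, and \<open>artinian_at_unique\<close> admits a resolution in
  any type.\<close>

lemma artinian_at_finitely_generated:
  fixes T :: "('a, 't, 'm) module_scheme" and K :: "nat \<Rightarrow> ('a, 'x) module"
  assumes noeth: "noetherian_ring R" and S: "S \<subseteq> carrier R"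
    and dcc: "chain_cond False R (regular_module R) (Idl S) (carrier R)"
    and fg: "finitely_generated_module R T" and K: "resolves R 0 T \<epsilon> K e"
  shows "artinian_at R (torsion_complex R S K) e n"
proof -
  note T = resolvesD(1)[OF K]
  obtain Q :: "('a, 't) module" and q where Q: "module R Q" "q \<in> module_hom R T Q"
    "q ` carrier T = carrier Q" "\<And>t. t \<in> carrier T \<Longrightarrow> q t = \<zero>\<^bsub>Q\<^esub> \<longleftrightarrow> t \<in> {\<zero>\<^bsub>T\<^esub>}"
    by (rule ex_quotient[OF T submod_trivial[OF T]]) blast
  obtain \<epsilon>' and L :: "nat \<Rightarrow> ('a, ('a + 't) list set) module" and e' where L: "resolves R 0 Q \<epsilon>' L e'"
    by (rule ex_plain_resolution[OF noeth Q(1)])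
  have "inj_on q (carrier T)"
  proof (rule inj_onI)
    fix s t assume s: "s \<in> carrier T" and t: "t \<in> carrier T" and eq: "q s = q t"
    have "q (s \<ominus>\<^bsub>T\<^esub> t) = \<zero>\<^bsub>Q\<^esub>"
      using hom_minus[OF T Q(1,2) s t] eq module_homD(1)[OF Q(2) t] Q(1) by simp
    then show "s = t" using Q(4)[of "s \<ominus>\<^bsub>T\<^esub> t"] s t T mod_minus_eq_zero[OF T s t] by simp
  qed
  from resolves_iso[OF L T Q(2,3) this] have "resolves R 0 T (\<lambda>t. \<epsilon>' (q t)) L e'" .
  moreover have "artinian_at R (torsion_complex R S L) e' n"
    by (rule artinian_at_quotient[OF noeth S dcc fg submod_trivial[OF T] Q(2,3,4) L])
  ultimately show ?thesis using artinian_at_unique[OF K _ S] by blast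
qed

text \<open>A resolution by \<open>S'\<close>-torsion modules does not see the difference between
  torsion for \<open>S\<close> and torsion for \<open>S \<union> S'\<close>, and the latter is
  covered by \<open>artinian_at_finitely_generated\<close>.\<close>

lemma artinian_at_torsion_module:
  fixes T :: "('a, 't, 'm) module_scheme" and K :: "nat \<Rightarrow> ('a, 'x) module"
  assumes noeth: "noetherian_ring R" and S: "S \<subseteq> carrier R" "S' \<subseteq> carrier R"
    and dcc: "chain_cond False R (regular_module R) (Idl (S \<union> S')) (carrier R)"
    and fg: "finitely_generated_module R T" and tors: "torsion R S' T = carrier T" and K: "resolves R 0 T \<epsilon> K e"
  shows "artinian_at R (torsion_complex R S K) e n"
proof -
  obtain \<epsilon>' and L :: "nat \<Rightarrow> ('a, ('a + 't) list set) module" and e'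
    where L: "resolves R 0 T \<epsilon>' L e'" "\<And>n. torsion R S' (L n) = carrier (L n)"
    by (rule ex_resolution[OF noeth resolvesD(1)[OF K] S(2) tors]) blast
  have "torsion_complex R (S \<union> S') L = torsion_complex R S L"
    using torsion_complex_torsion_complex[of S S' L] torsion_complex_self[of S' L] L(2) by simp
  then have "artinian_at R (torsion_complex R S L) e' n"
    using artinian_at_finitely_generated[OF noeth _ dcc fg L(1), of n] S by simp
  then show ?thesis using artinian_at_unique[OF K L(1) S(1)] by blast
qed

section \<open>From local cohomology modules to complexes\<close>

lemma artinian_module_iff:
  assumes "module R M" shows "artinian_module R M \<longleftrightarrow> chain_cond False R M {\<zero>\<^bsub>M\<^esub>} (carrier M)"
proof -
  have "submod R M N \<and> {\<zero>\<^bsub>M\<^esub>} \<subseteq> N \<and> N \<subseteq> carrier M \<and> Y \<longleftrightarrow> submod R M N \<and> Y" for N Y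
    by (auto simp: submod_def)
  then show ?thesis
    unfolding artinian_module_def chain_cond_def submodule_iff_submod[OF assms] using assms by simp
qed

text \<open>Both directions are \<open>exact_chain_cond\<close> for the projection onto the
  quotient, with a trivial subquotient at one end.\<close>

lemma artinian_quotient_module:
  assumes M: "module R M" and B: "submod R M B" and Z: "submod R M Z" and BZ: "B \<subseteq> Z"
  shows "artinian_module R (quotient_module (M\<lparr>carrier := Z\<rparr>) B) \<longleftrightarrow> chain_cond False R M B Z"
proof -
  let ?Z = "M\<lparr>carrier := Z\<rparr>"
  have mZ: "module R ?Z" by (rule submod_module[OF M Z])
  have B': "submod R ?Z B" using B BZ by (simp add: submod_def)
  note q = quotient_module[OF mZ B']
  let ?Q = "quotient_module ?Z B" and ?q = "\<lambda>x. B +>\<^bsub>?Z\<^esub> x"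
  have cc: "chain_cond False R ?Z B Z \<longleftrightarrow> chain_cond False R M B Z"
  proof -
    have "submod R ?Z N \<and> B \<subseteq> N \<and> N \<subseteq> Z \<and> Y \<longleftrightarrow> submod R M N \<and> B \<subseteq> N \<and> N \<subseteq> Z \<and> Y" for N Y
      using submodD(1)[OF Z] by (auto simp: submod_def)
    then show ?thesis unfolding chain_cond_def by (simp only:)
  qed
  have "chain_cond False R ?Q {\<zero>\<^bsub>?Q\<^esub>} (carrier ?Q)" if c: "chain_cond False R ?Z B Z"
  proof (rule exact_chain_cond[OF mZ q(1) q(1) q(2) zero_hom[OF q(1)] B' _ submod_trivial[OF q(1)] submod_trivial[OF q(1)]
        BZ order_refl _ _ _ c chain_cond_trivial])
    show "submod R ?Z Z" using submod_carrier[OF mZ] by simp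
    show "?q ` B \<subseteq> {\<zero>\<^bsub>?Q\<^esub>}" using q(4) BZ by auto
    fix y assume y: "y \<in> carrier ?Q"
    then obtain x where x: "x \<in> Z" "y = ?q x" using q(3) by auto
    then have "y = ?q x \<oplus>\<^bsub>?Q\<^esub> \<zero>\<^bsub>?Q\<^esub>" using y q(1) by simp
    then show "\<exists>x\<in>Z. \<exists>b\<in>{\<zero>\<^bsub>?Q\<^esub>}. y = ?q x \<oplus>\<^bsub>?Q\<^esub> b" using x(1) by blast
  qed auto
  moreover have "chain_cond False R ?Z B Z" if c: "chain_cond False R ?Q {\<zero>\<^bsub>?Q\<^esub>} (carrier ?Q)"
  proof (rule exact_chain_cond[OF mZ mZ q(1) zero_hom[OF mZ] q(2) submod_trivial[OF mZ] submod_trivial[OF mZ]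
        submod_trivial[OF q(1)] submod_carrier[OF q(1)] order_refl _ _ _ _ chain_cond_trivial c])
    show "(\<lambda>x. \<zero>\<^bsub>?Z\<^esub>) ` {\<zero>\<^bsub>?Z\<^esub>} \<subseteq> B" using submodD(3)[OF B'] by auto
    show "?q ` Z \<subseteq> carrier ?Q" using q(3) by auto
    show "{\<zero>\<^bsub>?Q\<^esub>} \<subseteq> carrier ?Q" using q(1) by simp
    fix y assume "y \<in> Z" "?q y \<in> {\<zero>\<^bsub>?Q\<^esub>}"
    then have "y \<in> B" using q(4)[of y] by simp
    moreover from this have "y = \<zero>\<^bsub>?Z\<^esub> \<oplus>\<^bsub>?Z\<^esub> y" using mod_l_zero[OF mZ, of y] BZ by auto
    ultimately show "\<exists>x\<in>{\<zero>\<^bsub>?Z\<^esub>}. \<exists>b\<in>B. y = \<zero>\<^bsub>?Z\<^esub> \<oplus>\<^bsub>?Z\<^esub> b" by blast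
  qed
  ultimately show ?thesis unfolding artinian_module_iff[OF q(1)] cc[symmetric] by blast
qed

text \<open>The choice inside \<open>local_cohomology\<close> depends on \<open>R\<close> and
  \<open>T\<close> but not on the ideal or the degree. One resolution therefore describes the local
  cohomology for all ideals and all degrees.\<close>

lemma local_cohomology_resolution:
  fixes T :: "('a, 't, 'm) module_scheme"
  assumes noeth: "noetherian_ring R" and T: "module R T"
  shows "\<exists>\<epsilon> (E :: nat \<Rightarrow> ('a, ('a + 't) list set) module) d. resolves R 0 T \<epsilon> E d \<and>
    (\<forall>I i. ideal I R \<longrightarrow> local_cohomology R I i T =
      quotient_module ((E i)\<lparr>carrier := cocycles (torsion_complex R I E) d i\<rparr>) (coboundaries (torsion_complex R I E) d i))"
proof -
  define pick where "pick = (SOME (\<epsilon> :: 't \<Rightarrow> ('a + 't) list set, E, d). injective_resolution R T \<epsilon> E d)"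
  obtain \<epsilon> E d where p: "pick = (\<epsilon>, E, d)" by (cases pick)
  obtain \<epsilon>' and K :: "nat \<Rightarrow> ('a, ('a + 't) list set) module" and e where "resolves R 0 T \<epsilon>' K e"
    by (rule ex_plain_resolution[OF noeth T])
  then have "case (\<epsilon>', K, e) of (\<epsilon>, E, d) \<Rightarrow> injective_resolution R T \<epsilon> E d"
    by (simp add: injective_resolution_iff[OF T])
  then have "case pick of (\<epsilon>, E, d) \<Rightarrow> injective_resolution R T \<epsilon> E d"
    unfolding pick_def by (rule someI)
  then have E: "resolves R 0 T \<epsilon> E d" by (simp add: p injective_resolution_iff[OF T])
  note mE = cochainD(1)[OF resolvesD(2)[OF E]]
  have "local_cohomology R I i T =
      quotient_module ((E i)\<lparr>carrier := cocycles (torsion_complex R I E) d i\<rparr>) (coboundaries (torsion_complex R I E) d i)"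
    if I: "ideal I R" for I i
  proof -
    have t: "torsion_part R I (E n) = torsion R I (E n)" for n by (rule torsion_part_eq[OF noeth I mE])
    show ?thesis
      unfolding local_cohomology_def pick_def[symmetric] p
      by (simp add: t cocycles_def coboundaries_def Let_def cong: nat.case_cong split: nat.split)
  qed
  then show ?thesis using E by blast
qed

lemma ideal_subset: "ideal I R \<Longrightarrow> I \<subseteq> carrier R"
  using ideal.Icarr[of I R] by auto

lemma artinian_local_cohomology:
  assumes "ideal I R" "resolves R 0 T \<epsilon> E d"
  shows "artinian_module R (quotient_module ((E i)\<lparr>carrier := cocycles (torsion_complex R I E) d i\<rparr>)
      (coboundaries (torsion_complex R I E) d i)) \<longleftrightarrow> artinian_at R (torsion_complex R I E) d i"
proof -
  let ?C = "torsion_complex R I E"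
  have C: "cochain R ?C d" by (rule cochain_torsion[OF resolvesD(2)[OF assms(2)] ideal_subset[OF assms(1)]])
  have "(?C i)\<lparr>carrier := cocycles ?C d i\<rparr> = (E i)\<lparr>carrier := cocycles ?C d i\<rparr>"
    by (simp add: torsion_complex_def)
  moreover have "artinian_module R (quotient_module ((?C i)\<lparr>carrier := cocycles ?C d i\<rparr>) (coboundaries ?C d i)) \<longleftrightarrow>
      artinian_at R ?C d i"
    unfolding artinian_at_def
    by (rule artinian_quotient_module[OF cochainD(1)[OF C] submod_coboundaries[OF C] submod_cocycles[OF C] coboundaries_subset[OF C]])
  ultimately show ?thesis by simp
qed

text \<open>Moves a resolution up by \<open>j\<close> degrees. The last clause covers the degrees
  below \<open>j\<close>, where the complex is zero.\<close>

lemma resolves_shifts: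
  assumes "resolves R 0 T \<epsilon> K e"
  shows "\<exists>K' e'. resolves R j T \<epsilon> K' e' \<and>
    (\<forall>S n. S \<subseteq> carrier R \<longrightarrow> (artinian_at R (torsion_complex R S K') e' (j + n) \<longleftrightarrow>
      artinian_at R (torsion_complex R S K) e n)) \<and>
    (\<forall>S n. S \<subseteq> carrier R \<longrightarrow> n < j \<longrightarrow> artinian_at R (torsion_complex R S K') e' n)"
proof (induction j)
  case 0
  then show ?case by (intro exI[of _ K] exI[of _ e]) (simp add: assms)
next
  case (Suc j)
  then obtain K' e' where K': "resolves R j T \<epsilon> K' e'"
    "\<And>S n. S \<subseteq> carrier R \<Longrightarrow> artinian_at R (torsion_complex R S K') e' (j + n) \<longleftrightarrow>
      artinian_at R (torsion_complex R S K) e n"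
    "\<And>S n. S \<subseteq> carrier R \<Longrightarrow> n < j \<Longrightarrow> artinian_at R (torsion_complex R S K') e' n" by blast
  note KC = resolvesD(2)[OF K'(1)]
  show ?case
  proof (intro exI[of _ "shift_complex K'"] exI[of _ "shift_d K' e'"] conjI allI impI)
    show "resolves R (Suc j) T \<epsilon> (shift_complex K') (shift_d K' e')" by (rule resolves_shift[OF K'(1)])
    fix S n assume S: "S \<subseteq> carrier R"
    show "artinian_at R (torsion_complex R S (shift_complex K')) (shift_d K' e') (Suc j + n) \<longleftrightarrow>
        artinian_at R (torsion_complex R S K) e n"
      using artinian_at_torsion_shift[OF KC S, of "j + n"] K'(2)[OF S] by simp
    show "artinian_at R (torsion_complex R S (shift_complex K')) (shift_d K' e') n" if "n < Suc j"
    proof (cases n)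
      case 0
      then show ?thesis using artinian_at_torsion_shift_0[OF KC S] by simp
    next
      case (Suc m)
      then show ?thesis using artinian_at_torsion_shift[OF KC S, of m] K'(3)[OF S, of m] that by simp
    qed
  qed
qed

end

section \<open>Killing the cohomology step by step\<close>

text \<open>\<open>T l\<close> is the cohomology in degree \<open>l + 1\<close>, so the resolution
  that kills \<open>T j\<close> can start in degree \<open>j\<close>. \<open>P\<close>,
  \<open>\<beta>\<close> and \<open>T\<close> stay the same when the complex is replaced by a cone;
  \<open>\<alpha>\<close> is the part that changes.\<close>

definition cohomology_above ::
    "('a, 'r) ring_scheme \<Rightarrow> (nat \<Rightarrow> ('a, 'x) module) \<Rightarrow> (nat \<Rightarrow> 'x \<Rightarrow> 'x) \<Rightarrow> nat \<Rightarrow>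
     (nat \<Rightarrow> ('a, 'p) module) \<Rightarrow> (nat \<Rightarrow> 'p \<Rightarrow> 't) \<Rightarrow> (nat \<Rightarrow> ('a, 't) module) \<Rightarrow> bool"
  where "cohomology_above R C d j P \<beta> T \<longleftrightarrow> cochain R C d \<and> (\<forall>n. baer_module R (C n)) \<and>
    (\<forall>n\<le>j. exact_at C d n) \<and> (\<forall>l\<ge>j. \<exists>\<alpha>. represents R C d (Suc l) (P l) \<alpha> (\<beta> l) (T l))"

lemma cohomology_aboveD:
  assumes "cohomology_above R C d j P \<beta> T"
  shows "cochain R C d" "baer_module R (C n)" "n \<le> j \<Longrightarrow> exact_at C d n"
    "l \<ge> j \<Longrightarrow> \<exists>\<alpha>. represents R C d (Suc l) (P l) \<alpha> (\<beta> l) (T l)"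
  using assms unfolding cohomology_above_def by blast+

context cring_pairing
begin

lemma ex_killing_cone:
  fixes D :: "nat \<Rightarrow> ('a, 'x) module" and K :: "nat \<Rightarrow> ('a, 'y) module"
  assumes D: "cohomology_above R D d j P \<beta> T" and res: "resolves R j (T j) \<epsilon> K e"
  obtains \<Phi> where "mapping_cone R pr p1 p2 D d K e \<Phi>"
    "cohomology_above R (mapping_cone.cone pr p1 p2 D K) (mapping_cone.cone_d pr p1 p2 D d e \<Phi>) (Suc j) P \<beta> T"
proof -
  obtain \<alpha> where "represents R D d (Suc j) (P j) \<alpha> (\<beta> j) (T j)"
    using cohomology_aboveD(4)[OF D order_refl] by blast
  from kill_cohomology[OF cohomology_aboveD(1-3)[OF D] this res] obtain \<Phi>
    where cone: "mapping_cone R pr p1 p2 D d K e \<Phi>"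
      and ex: "\<And>n. n \<le> Suc j \<Longrightarrow> exact_at (mapping_cone.cone pr p1 p2 D K) (mapping_cone.cone_d pr p1 p2 D d e \<Phi>) n"
    by metis
  interpret mapping_cone R pr p1 p2 D d K e \<Phi> by (rule cone)
  have "cohomology_above R cone cone_d (Suc j) P \<beta> T"
    unfolding cohomology_above_def
  proof (intro conjI allI impI)
    show "cochain R cone cone_d" by (rule cochain_cone)
    show "baer_module R (cone n)" for n by (rule baer_cone[OF cohomology_aboveD(2)[OF D] resolvesD(3)[OF res]])
    show "exact_at cone cone_d n" if "n \<le> Suc j" for n using ex that .
    fix l assume l: "Suc j \<le> l"
    then obtain \<alpha> where \<alpha>: "represents R D d (Suc l) (P l) \<alpha> (\<beta> l) (T l)"
      using cohomology_aboveD(4)[OF D, of l] by auto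
    show "\<exists>\<alpha>. represents R cone cone_d (Suc l) (P l) \<alpha> (\<beta> l) (T l)"
      by (rule exI, rule represents_cone[OF resolvesD(8)[OF res] resolvesD(8)[OF res] \<alpha>]) (use l in auto)
  qed
  then show ?thesis using that[OF cone] by blast
qed

end

context cring
begin

lemma represents_zero_exact:
  assumes rep: "represents R C d n P \<alpha> \<beta> T" and T: "carrier T = {\<zero>\<^bsub>T\<^esub>}" and C: "cochain R C d"
  shows "exact_at C d n"
  unfolding exact_at_def
proof
  fix z assume "z \<in> cocycles C d n"
  then obtain p b where pb: "p \<in> carrier P" "b \<in> coboundaries C d n" "z = \<alpha> p \<oplus>\<^bsub>C n\<^esub> b"
    using representsD(7)[OF rep] by blast
  have "\<beta> p = \<zero>\<^bsub>T\<^esub>" using representsD(5)[OF rep] pb(1) T by blast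
  then have "\<alpha> p \<in> coboundaries C d n" using representsD(8)[OF rep pb(1)] by blast
  then show "z \<in> coboundaries C d n" using submodD(4)[OF submod_coboundaries[OF C]] pb by blast
qed

lemma cohomology_above_exact:
  assumes D: "cohomology_above R D d j P \<beta> T" and T: "\<And>l. l \<ge> j \<Longrightarrow> carrier (T l) = {\<zero>\<^bsub>T l\<^esub>}"
  shows "exact_at D d n"
proof (cases "n \<le> j")
  case True then show ?thesis by (rule cohomology_aboveD(3)[OF D])
next
  case False
  then obtain l where l: "n = Suc l" "l \<ge> j" by (cases n) auto
  then obtain \<alpha> where "represents R D d (Suc l) (P l) \<alpha> (\<beta> l) (T l)" using cohomology_aboveD(4)[OF D] by blast
  then show ?thesis using represents_zero_exact[OF _ T[OF l(2)] cohomology_aboveD(1)[OF D]] l(1) by blast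
qed

end

text \<open>Killing the cohomology below degree \<open>f\<close> does not affect the Artinian property. Two further steps lead
  to an acyclic complex; they compare the resolution of \<open>T (Suc f)\<close> with the cone in between, and this
  cone with the resolution of \<open>T f\<close>.\<close>

lemma (in cring) artinian_at_two_cohomologies:
  fixes D :: "nat \<Rightarrow> ('a, 'z) module" and K :: "nat \<Rightarrow> nat \<Rightarrow> ('a, 'z) module" and qr :: "'z \<Rightarrow> 'z \<Rightarrow> 'z"
  assumes qr: "cring_pairing R qr q1 q2" and S: "S \<subseteq> carrier R"
    and D: "cohomology_above R D d 0 P \<beta> T" and D_artinian: "\<And>n. artinian_at R (torsion_complex R S D) d n"
    and K: "\<And>j. resolves R 0 (T j) (\<epsilon> j) (K j) (e j)"
    and K_artinian: "\<And>j n. j < f \<Longrightarrow> artinian_at R (torsion_complex R S (K j)) (e j) n"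
    and T: "\<And>j. j > Suc f \<Longrightarrow> carrier (T j) = {\<zero>\<^bsub>T j\<^esub>}"
  shows "artinian_at R (torsion_complex R S (K (Suc f))) (e (Suc f)) i \<longleftrightarrow>
    artinian_at R (torsion_complex R S (K f)) (e f) (i + 2)"
proof -
  interpret q: cring_pairing R qr q1 q2 by (rule qr)
  have "\<exists>(Y :: nat \<Rightarrow> ('a, 'z) module) d. cohomology_above R Y d j P \<beta> T \<and> (\<forall>n. artinian_at R (torsion_complex R S Y) d n)"
    if "j \<le> f" for j
    using that
  proof (induction j)
    case 0
    then show ?case using D D_artinian by blast
  next
    case (Suc j)
    then obtain Y :: "nat \<Rightarrow> ('a, 'z) module" and d where Y: "cohomology_above R Y d j P \<beta> T"
      "\<And>n. artinian_at R (torsion_complex R S Y) d n" by auto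
    obtain K' e' where K': "resolves R j (T j) (\<epsilon> j) K' e'"
      "\<And>n. artinian_at R (torsion_complex R S K') e' (j + n) \<longleftrightarrow> artinian_at R (torsion_complex R S (K j)) (e j) n"
      "\<And>n. n < j \<Longrightarrow> artinian_at R (torsion_complex R S K') e' n"
      using resolves_shifts[OF K[of j], of j] S by metis
    have art: "artinian_at R (torsion_complex R S K') e' n" for n
    proof (cases "n < j")
      case False
      then show ?thesis using K'(2)[of "n - j"] K_artinian[of j] Suc.prems by simp
    qed (rule K'(3))
    obtain \<Phi> where cn: "mapping_cone R qr q1 q2 Y d K' e' \<Phi>"
      "cohomology_above R (mapping_cone.cone qr q1 q2 Y K') (mapping_cone.cone_d qr q1 q2 Y d e' \<Phi>) (Suc j) P \<beta> T"
      by (rule q.ex_killing_cone[OF Y(1) K'(1)])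
    interpret mapping_cone R qr q1 q2 Y d K' e' \<Phi> by (rule cn(1))
    show ?case using cn(2) torsion_artinian_at_cone[OF S Y(2) art] by blast
  qed
  then obtain Y :: "nat \<Rightarrow> ('a, 'z) module" and d where Y: "cohomology_above R Y d f P \<beta> T"
    "\<And>n. artinian_at R (torsion_complex R S Y) d n" by blast
  obtain K1 e1 where K1: "resolves R f (T f) (\<epsilon> f) K1 e1"
    "\<And>n. artinian_at R (torsion_complex R S K1) e1 (f + n) \<longleftrightarrow> artinian_at R (torsion_complex R S (K f)) (e f) n"
    using resolves_shifts[OF K[of f], of f] S by metis
  obtain K2 e2 where K2: "resolves R (Suc f) (T (Suc f)) (\<epsilon> (Suc f)) K2 e2"
    "\<And>n. artinian_at R (torsion_complex R S K2) e2 (Suc f + n) \<longleftrightarrow>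
      artinian_at R (torsion_complex R S (K (Suc f))) (e (Suc f)) n"
    using resolves_shifts[OF K[of "Suc f"], of "Suc f"] S by metis
  obtain \<Phi> where cn: "mapping_cone R qr q1 q2 Y d K1 e1 \<Phi>"
    "cohomology_above R (mapping_cone.cone qr q1 q2 Y K1) (mapping_cone.cone_d qr q1 q2 Y d e1 \<Phi>) (Suc f) P \<beta> T"
    by (rule q.ex_killing_cone[OF Y(1) K1(1)])
  interpret c: mapping_cone R qr q1 q2 Y d K1 e1 \<Phi> by (rule cn(1))
  obtain \<Psi> where cn2: "mapping_cone R qr q1 q2 c.cone c.cone_d K2 e2 \<Psi>"
    "cohomology_above R (mapping_cone.cone qr q1 q2 c.cone K2) (mapping_cone.cone_d qr q1 q2 c.cone c.cone_d e2 \<Psi>)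
      (Suc (Suc f)) P \<beta> T"
    by (rule q.ex_killing_cone[OF cn(2) K2(1)])
  interpret cc: mapping_cone R qr q1 q2 c.cone c.cone_d K2 e2 \<Psi> by (rule cn2(1))
  have "exact_at cc.cone cc.cone_d n" for n
    by (rule cohomology_above_exact[OF cn2(2) T]) simp
  \<comment> \<open>The acyclic cone raises the degree by one; the cone in between agrees with
    \<open>K1\<close> up to the Artinian cohomology of the torsion of \<open>Y\<close>. As
    \<open>K1\<close> starts in degree \<open>f\<close>, the degree \<open>f + i + 2\<close> means
    \<open>i + 2\<close> for the resolution of \<open>T f\<close>.\<close>
  then have "artinian_at R (torsion_complex R S K2) e2 (Suc f + i) \<longleftrightarrow>
      artinian_at R (torsion_complex R S c.cone) c.cone_d (Suc (Suc f + i))"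
    by (rule cc.artinian_at_acyclic_cone[OF cohomology_aboveD(2)[OF cn(2)] resolvesD(3)[OF K2(1)] _ S])
  also have "\<dots> \<longleftrightarrow> artinian_at R (torsion_complex R S K1) e1 (Suc (Suc f + i))"
    using c.torsion_artinian_at_cone[OF S Y(2)] c.torsion_artinian_at_K[OF S _ Y(2)] by blast
  also have "Suc (Suc f + i) = f + (i + 2)" by simp
  finally show ?thesis unfolding K1(2) K2(2) .
qed

context cring
begin

lemma cring_pairing_inj:
  assumes "\<And>x y x' y'. p x y = p x' y' \<longleftrightarrow> x = x' \<and> y = y'"
  shows "cring_pairing R p (\<lambda>z. SOME x. \<exists>y. z = p x y) (\<lambda>z. SOME y. \<exists>x. z = p x y)"
  by unfold_locales (simp_all add: assms)

lemma cohomology_above_shift: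
  assumes C: "cochain R C d" and baer: "\<And>n. baer_module R (C n)"
    and rep: "\<And>l. represents R C d l (P l) (\<alpha> l) (\<beta> l) (T l)"
  shows "cohomology_above R (shift_complex C) (shift_d C d) 0 P \<beta> T"
  unfolding cohomology_above_def
proof (intro conjI allI impI)
  show "cochain R (shift_complex C) (shift_d C d)" by (rule cochain_shift[OF C])
  show "baer_module R (shift_complex C n)" for n by (rule baer_shift[OF baer])
  show "exact_at (shift_complex C) (shift_d C d) n" if "n \<le> 0" for n using that exact_at_shift(2) by simp
  show "\<exists>\<alpha>. represents R (shift_complex C) (shift_d C d) (Suc l) (P l) \<alpha> (\<beta> l) (T l)" for l
    using rep[of l] by (intro exI[of _ "\<alpha> l"]) (simp add: represents_def del: coboundaries_simps(2))
qed

text \<open>Adding a zero complex along an injective pairing \<open>p\<close> moves a complex into another type.\<close>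

lemma cohomology_above_embed:
  fixes D :: "nat \<Rightarrow> ('a, 'x) module" and Q :: "('a, 'y) module" and p :: "'x \<Rightarrow> 'y \<Rightarrow> 'z"
  assumes D: "cohomology_above R D d 0 P \<beta> T" and Q: "module R Q"
    and D0: "cocycles D d 0 \<subseteq> {\<zero>\<^bsub>D 0\<^esub>}"
    and inj: "\<And>x y x' y'. p x y = p x' y' \<longleftrightarrow> x = x' \<and> y = y'"
    and S: "S \<subseteq> carrier R" and art: "\<And>n. artinian_at R (torsion_complex R S D) d n"
  obtains D' :: "nat \<Rightarrow> ('a, 'z) module" and d' where "cohomology_above R D' d' 0 P \<beta> T"
    "\<And>n. artinian_at R (torsion_complex R S D') d' n"
proof -
  define Z :: "nat \<Rightarrow> ('a, 'y) module" where "Z n = Q\<lparr>carrier := {\<zero>\<^bsub>Q\<^esub>}\<rparr>" for n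
  let ?e = "\<lambda>(n :: nat) (y :: 'y). \<zero>\<^bsub>Q\<^esub>"
  have Z0 [simp]: "carrier (Z n) = {\<zero>\<^bsub>Q\<^esub>}" "\<zero>\<^bsub>Z n\<^esub> = \<zero>\<^bsub>Q\<^esub>" for n by (simp_all add: Z_def)
  have mZ: "module R (Z n)" for n unfolding Z_def by (rule submod_module[OF Q submod_trivial[OF Q]])
  have CZ: "cochain R Z ?e"
    unfolding cochain_def
  proof (intro allI conjI ballI)
    show "?e n \<in> module_hom R (Z n) (Z (Suc n))" for n using zero_hom[OF mZ, of "Suc n" "Z n"] by simp
  qed (simp_all add: mZ)
  have bZ: "baer_module R (Z n)" for n
    by (rule baer_zero[OF mZ]) simp
  have eZ: "exact_at Z ?e n" for n
    by (cases n) (auto simp: exact_at_def cocycles_def)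
  define p1 p2 where "p1 = (\<lambda>z. SOME x. \<exists>y. z = p x y)" and "p2 = (\<lambda>z. SOME y. \<exists>x. z = p x y)"
  have pair: "cring_pairing R p p1 p2" unfolding p1_def p2_def by (rule cring_pairing_inj[OF inj])
  note CD = cohomology_aboveD(1)[OF D]
  have tw: "twisting R D d Z ?e (\<lambda>n _. \<zero>\<^bsub>D (Suc n)\<^esub>)"
    unfolding twisting_def
  proof (intro allI conjI ballI)
    fix n
    note mD = cochainD(1)[OF CD]
    show "(\<lambda>_. \<zero>\<^bsub>D (Suc n)\<^esub>) \<in> module_hom R (Z n) (D (Suc n))" by (rule zero_hom[OF mD])
    show "d (Suc n) \<zero>\<^bsub>D (Suc n)\<^esub> \<oplus>\<^bsub>D (Suc (Suc n))\<^esub> \<zero>\<^bsub>D (Suc (Suc n))\<^esub> = \<zero>\<^bsub>D (Suc (Suc n))\<^esub>"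
      using hom_zero[OF mD mD cochainD(2)[OF CD, of "Suc n"]] mD by simp
  qed
  interpret mapping_cone R p p1 p2 D d Z ?e "\<lambda>n _. \<zero>\<^bsub>D (Suc n)\<^esub>"
    by (intro mapping_cone.intro mapping_cone_axioms.intro pair CD CZ tw)
  have "cohomology_above R cone cone_d 0 P \<beta> T"
    unfolding cohomology_above_def
  proof (intro conjI allI impI)
    show "cochain R cone cone_d" by (rule cochain_cone)
    show "baer_module R (cone n)" for n by (rule baer_cone[OF cohomology_aboveD(2)[OF D] bZ])
    have "exact_at cone cone_d 0" by (rule exact_at_cone_0[OF D0]) (auto simp: cocycles_def)
    then show "exact_at cone cone_d n" if "n \<le> 0" for n using that by simp
    fix l
    obtain \<alpha> where "represents R D d (Suc l) (P l) \<alpha> (\<beta> l) (T l)" using cohomology_aboveD(4)[OF D, of l] by auto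
    then show "\<exists>\<alpha>. represents R cone cone_d (Suc l) (P l) \<alpha> (\<beta> l) (T l)"
      using represents_cone[OF eZ eZ] by blast
  qed
  moreover have "artinian_at R (torsion_complex R S Z) ?e n" for n
    by (rule exact_artinian_at[OF cochain_torsion[OF CZ S] exact_torsion[OF CZ bZ S eZ]])
  ultimately show ?thesis using that torsion_artinian_at_cone[OF S art] by blast
qed

lemma represents_quotient:
  fixes n :: nat
  assumes C: "cochain R C d"
  defines "P \<equiv> (C n)\<lparr>carrier := cocycles C d n\<rparr>"
  shows "represents R C d n P (\<lambda>x. x) (\<lambda>x. coboundaries C d n +>\<^bsub>P\<^esub> x) (quotient_module P (coboundaries C d n))"
proof -
  note mC = cochainD(1)[OF C, of n] and Z = submod_cocycles[OF C, of n] and B = submod_coboundaries[OF C, of n]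
  have P: "module R P" unfolding P_def by (rule submod_module[OF mC Z])
  have BP: "submod R P (coboundaries C d n)"
    using B coboundaries_subset[OF C, of n] by (simp add: submod_def P_def)
  note q = quotient_module[OF P BP]
  show ?thesis
    unfolding represents_def
  proof (intro conjI ballI)
    show "(\<lambda>x. x) \<in> module_hom R P (C n)"
      unfolding P_def by (rule module_hom_restrict_dom[OF id_hom submodD(1)[OF Z]])
    fix z assume z: "z \<in> cocycles C d n"
    then have "z = z \<oplus>\<^bsub>C n\<^esub> \<zero>\<^bsub>C n\<^esub>" using mC submodD(2)[OF Z z] by simp
    then show "\<exists>p\<in>carrier P. \<exists>b\<in>coboundaries C d n. z = p \<oplus>\<^bsub>C n\<^esub> b"
      using z submodD(3)[OF B] by (auto simp: P_def)
  next
    fix x assume "x \<in> carrier P"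
    then show "x \<in> coboundaries C d n \<longleftrightarrow>
      coboundaries C d n +>\<^bsub>P\<^esub> x = \<zero>\<^bsub>quotient_module P (coboundaries C d n)\<^esub>" using q(4) by blast
  qed (use P q in \<open>auto simp: P_def\<close>)
qed

text \<open>The theorem for two ideals \<open>I\<close> and \<open>J\<close> whose union generates
  an ideal with Artinian quotient ring. Applied with \<open>I\<close> generated by the maximal ideal
  in degree 0 and \<open>J\<close> the irrelevant ideal.\<close>

lemma artinian_iterated_local_cohomology:
  fixes M :: "('a, 't, 'm) module_scheme"
  assumes noeth: "noetherian_ring R" and I: "ideal I R" and J: "ideal J R"
    and dcc: "chain_cond False R (regular_module R) (Idl (I \<union> J)) (carrier R)"
    and fg: "finitely_generated_module R M"
    and fgJ: "\<And>j. j < f \<Longrightarrow> finitely_generated_module R (local_cohomology R J j M)"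
    and zeroJ: "\<And>j. j > Suc f \<Longrightarrow> carrier (local_cohomology R J j M) = {\<zero>\<^bsub>local_cohomology R J j M\<^esub>}"
  shows "artinian_module R (local_cohomology R I i (local_cohomology R J (Suc f) M)) \<longleftrightarrow>
    artinian_module R (local_cohomology R I (i + 2) (local_cohomology R J f M))"
proof -
  have M: "module R M" using fg by (simp add: finitely_generated_module_def)
  note IR = ideal_subset[OF I] and JR = ideal_subset[OF J]
  obtain \<epsilon> and E :: "nat \<Rightarrow> ('a, ('a + 't) list set) module" and d where E: "resolves R 0 M \<epsilon> E d"
    and lc: "\<And>I i. ideal I R \<Longrightarrow> local_cohomology R I i M =
      quotient_module ((E i)\<lparr>carrier := cocycles (torsion_complex R I E) d i\<rparr>) (coboundaries (torsion_complex R I E) d i)"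
    using local_cohomology_resolution[OF noeth M] by blast
  note CE = resolvesD(2)[OF E]
  define C where "C = torsion_complex R J E"
  have C: "cochain R C d" unfolding C_def by (rule cochain_torsion[OF CE JR])
  have bC: "baer_module R (C n)" for n
    unfolding C_def torsion_complex_def by (rule baer_torsion[OF noeth resolvesD(3)[OF E] JR])
  let ?H = "\<lambda>j. local_cohomology R J j M"
  define P where "P j = (C j)\<lparr>carrier := cocycles C d j\<rparr>" for j
  define \<beta> where "\<beta> j = (\<lambda>x. coboundaries C d j +>\<^bsub>P j\<^esub> x)" for j
  have H: "?H j = quotient_module (P j) (coboundaries C d j)" for j
    unfolding lc[OF J] P_def C_def by (simp add: torsion_complex_def)
  have rep: "represents R C d j (P j) (\<lambda>x. x) (\<beta> j) (?H j)" for j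
    using represents_quotient[OF C, of j] unfolding H P_def[symmetric] \<beta>_def .
  note mH = representsD(2)[OF rep]
  \<comment> \<open>Subquotients of \<open>J\<close>-torsion modules are \<open>J\<close>-torsion.
    Hence \<open>artinian_at_torsion_module\<close> handles those local cohomology modules that are
    finitely generated.\<close>
  have tH: "torsion R J (?H j) = carrier (?H j)" for j
  proof (rule torsion_image[OF representsD(1)[OF rep[of j]] mH representsD(4,5)[OF rep[of j]] _ JR])
    have "carrier (P j) \<subseteq> torsion R J (E j)" using cocyclesD(1)[of _ C d j] by (auto simp: P_def C_def)
    then show "torsion R J (P j) = carrier (P j)" by (auto simp: torsion_def P_def C_def torsion_complex_def)
  qed
  have "\<forall>j. \<exists>\<epsilon> (K :: nat \<Rightarrow> ('a, ('a + ('a + 't) list set set) list set) module) e. resolves R 0 (?H j) \<epsilon> K e \<and>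
    (\<forall>I i. ideal I R \<longrightarrow> local_cohomology R I i (?H j) =
      quotient_module ((K i)\<lparr>carrier := cocycles (torsion_complex R I K) e i\<rparr>) (coboundaries (torsion_complex R I K) e i))"
    using local_cohomology_resolution[OF noeth mH] by blast
  then obtain \<epsilon>' and K :: "nat \<Rightarrow> nat \<Rightarrow> ('a, ('a + ('a + 't) list set set) list set) module" and e
    where K: "\<And>j. resolves R 0 (?H j) (\<epsilon>' j) (K j) (e j)"
      and lcH: "\<And>j I i. ideal I R \<Longrightarrow> local_cohomology R I i (?H j) =
        quotient_module ((K j i)\<lparr>carrier := cocycles (torsion_complex R I (K j)) (e j) i\<rparr>)
          (coboundaries (torsion_complex R I (K j)) (e j) i)"
    by metis
  have art: "artinian_module R (local_cohomology R I i (?H j)) \<longleftrightarrow>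
      artinian_at R (torsion_complex R I (K j)) (e j) i" for i j
    unfolding lcH[OF I] by (rule artinian_local_cohomology[OF I K])
  \<comment> \<open>Torsion for \<open>I\<close> after torsion for \<open>J\<close> is torsion for
    \<open>I \<union> J\<close>, and \<open>M\<close> is finitely generated. Degree 0 is the zero
    module added by the shift.\<close>
  have aE: "artinian_at R (torsion_complex R I (shift_complex C)) (shift_d C d) n" for n
  proof (cases n)
    case (Suc m)
    have "artinian_at R (torsion_complex R (I \<union> J) E) d m"
      by (rule artinian_at_finitely_generated[OF noeth _ dcc fg E]) (use IR JR in auto)
    then show ?thesis
      using artinian_at_torsion_shift[OF C IR, of m] unfolding Suc C_def torsion_complex_torsion_complex by blast
  qed (simp add: artinian_at_torsion_shift_0[OF C IR])
  \<comment> \<open>\<open>C\<close> lives in the type used for \<open>M\<close>, the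
    \<open>K j\<close> in a larger one built over the elements of local cohomology modules. The
    singleton \<open>{x}\<close> has the type of such elements, so \<open>[Inr {x}]\<close> is a
    word of the larger type.\<close>
  let ?p = "\<lambda>x (y :: ('a + ('a + 't) list set set) list set). pair_code {[Inr {x}]} y"
  obtain D :: "nat \<Rightarrow> ('a, ('a + ('a + 't) list set set) list set) module" and d'
    where D: "cohomology_above R D d' 0 P \<beta> ?H" "\<And>n. artinian_at R (torsion_complex R I D) d' n"
  proof (rule cohomology_above_embed[OF cohomology_above_shift[OF C bC rep] cochainD(1)[OF resolvesD(2)[OF K]] _ _ IR aE, where p = ?p])
  qed auto
  define q1 q2 where "q1 = (\<lambda>z :: ('a + ('a + 't) list set set) list set. SOME x. \<exists>y. z = pair_code x y)"
    and "q2 = (\<lambda>z :: ('a + ('a + 't) list set set) list set. SOME y. \<exists>x. z = pair_code x y)"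
  have "cring_pairing R pair_code q1 q2" unfolding q1_def q2_def by (rule cring_pairing_inj) simp
  from artinian_at_two_cohomologies[OF this IR D K _ zeroJ]
  show ?thesis
    unfolding art using artinian_at_torsion_module[OF noeth IR JR dcc fgJ tH K] by blast
qed

section \<open>The graded ring\<close>

text \<open>Covers the case that \<open>R/J\<close> is a field: a descending chain above
  \<open>J\<close> drops at most once.\<close>

lemma chain_cond_two_ideals:
  assumes two: "\<And>I. ideal I R \<Longrightarrow> J \<subseteq> I \<Longrightarrow> I = J \<or> I = carrier R"
  shows "chain_cond False R (regular_module R) J (carrier R)"
  unfolding chain_cond_def
proof (intro allI impI)
  fix N assume N: "\<forall>n. submod R (regular_module R) (N n) \<and> J \<subseteq> N n \<and> N n \<subseteq> carrier R \<and>
    (if False then N n \<subseteq> N (Suc n) else N (Suc n) \<subseteq> N n)"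
  have mono: "N n \<subseteq> N m" if "m \<le> n" for m n using lift_Suc_antimono_le[of N m n] N that by auto
  have N2: "N n = J \<or> N n = carrier R" for n using two[of "N n"] N submod_regular by blast
  show "\<exists>k. \<forall>n\<ge>k. N n = N k"
  proof (cases "\<exists>k. N k = J")
    case True
    then obtain k where k: "N k = J" by blast
    have "N n = N k" if "n \<ge> k" for n using mono[OF that] N k by blast
    then show ?thesis by blast
  next
    case False
    then show ?thesis using N2 by blast
  qed
qed

end

locale graded_cring = cring +
  fixes G :: "nat \<Rightarrow> 'a set"
  assumes graded: "graded_ring R G"
begin

lemma G_additive: "additive_subgroup (G n) R"
  using graded by (simp add: graded_ring_def internal_direct_sum_def)

lemma G_carrier: "a \<in> G n \<Longrightarrow> a \<in> carrier R"
  using additive_subgroup.a_subset[OF G_additive[of n]] by blast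

lemma G_zero: "\<zero> \<in> G n"
  by (rule additive_subgroup.zero_closed[OF G_additive])

lemma G_add: "a \<in> G n \<Longrightarrow> b \<in> G n \<Longrightarrow> a \<oplus> b \<in> G n"
  by (rule additive_subgroup.a_closed[OF G_additive])

lemma G_mult: "a \<in> G m \<Longrightarrow> b \<in> G n \<Longrightarrow> a \<otimes> b \<in> G (m + n)"
  using graded by (simp add: graded_ring_def)

lemma homogeneous_decomposition:
  assumes "a \<in> carrier R"
  obtains A f where "finite A" "\<And>n. f n \<in> G n" "a = (\<Oplus>n\<in>A. f n)"
  using assms graded unfolding graded_ring_def internal_direct_sum_def by blast

lemma irrelevantI: "finite A \<Longrightarrow> 0 \<notin> A \<Longrightarrow> (\<And>n. n \<in> A \<Longrightarrow> f n \<in> G n) \<Longrightarrow> (\<Oplus>n\<in>A. f n) \<in> irrelevant_ideal R G"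
  unfolding irrelevant_ideal_def by blast

text \<open>The family is made zero outside \<open>A\<close>, so that homogeneity can be used for
  every index.\<close>

lemma irrelevantE:
  assumes "x \<in> irrelevant_ideal R G"
  obtains A f where "finite A" "0 \<notin> A" "\<And>n. f n \<in> G n" "x = (\<Oplus>n\<in>A. f n)"
proof -
  obtain A f where A: "finite A" "0 \<notin> A" "\<And>n. n \<in> A \<Longrightarrow> f n \<in> G n" "x = (\<Oplus>n\<in>A. f n)"
    using assms unfolding irrelevant_ideal_def by blast
  let ?f = "\<lambda>n. if n \<in> A then f n else \<zero>"
  have "x = (\<Oplus>n\<in>A. ?f n)" unfolding A(4) by (rule finsum_cong') (use G_carrier[OF A(3)] in auto)
  then show ?thesis using that[OF A(1,2), of ?f] A(3) G_zero by simp
qed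

lemma irrelevant_add:
  assumes "x \<in> irrelevant_ideal R G" "y \<in> irrelevant_ideal R G"
  shows "x \<oplus> y \<in> irrelevant_ideal R G"
proof -
  obtain A f where A: "finite A" "0 \<notin> A" "\<And>n. f n \<in> G n" "x = (\<Oplus>n\<in>A. f n)" by (rule irrelevantE[OF assms(1)]) blast
  obtain B g where B: "finite B" "0 \<notin> B" "\<And>n. g n \<in> G n" "y = (\<Oplus>n\<in>B. g n)" by (rule irrelevantE[OF assms(2)]) blast
  have ext: "(\<Oplus>n\<in>A. f n) = (\<Oplus>n\<in>A \<union> B. if n \<in> A then f n else \<zero>)"
    if "\<And>n. f n \<in> G n" "finite A" "finite B" for A B f
    by (rule add.finprod_mono_neutral_cong_left) (use that G_carrier[OF that(1)] in auto)
  have "x \<oplus> y = (\<Oplus>n\<in>A \<union> B. (if n \<in> A then f n else \<zero>) \<oplus> (if n \<in> B then g n else \<zero>))"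
    unfolding A(4) B(4) ext[of f A B, OF A(3,1) B(1)] ext[of g B A, OF B(3,1) A(1)] Un_commute[of B A]
    by (rule finsum_addf[symmetric]) (use G_carrier[OF A(3)] G_carrier[OF B(3)] in auto)
  also have "\<dots> \<in> irrelevant_ideal R G"
    by (rule irrelevantI) (use A(1-3) B(1-3) G_zero in \<open>auto intro!: G_add\<close>)
  finally show ?thesis .
qed

lemma irrelevant_carrier: "x \<in> irrelevant_ideal R G \<Longrightarrow> x \<in> carrier R"
proof (erule irrelevantE)
  fix A f assume "\<And>n. f n \<in> G n" "x = (\<Oplus>n\<in>A. f n)"
  then show "x \<in> carrier R" using G_carrier[of "f n" n for n] by (simp add: finsum_closed Pi_I)
qed

lemma irrelevant_zero: "\<zero> \<in> irrelevant_ideal R G"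
  using irrelevantI[of "{}" "\<lambda>n. \<zero>"] by simp

lemma irrelevant_homogeneous: "a \<in> G n \<Longrightarrow> n \<noteq> 0 \<Longrightarrow> a \<in> irrelevant_ideal R G"
  using irrelevantI[of "{n}" "\<lambda>_. a"] G_carrier by simp

lemma irrelevant_finsum:
  assumes "finite A" "\<And>n. n \<in> A \<Longrightarrow> g n \<in> irrelevant_ideal R G"
  shows "(\<Oplus>n\<in>A. g n) \<in> irrelevant_ideal R G"
  using assms
proof (induction A rule: finite_induct)
  case empty
  then show ?case by (simp add: irrelevant_zero)
next
  case (insert k A)
  then have "(\<Oplus>n\<in>insert k A. g n) = g k \<oplus> (\<Oplus>n\<in>A. g n)"
    by (intro finsum_insert) (auto intro: irrelevant_carrier)
  then show ?case using irrelevant_add insert by simp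
qed

text \<open>A homogeneous element times one of positive degree has positive degree; the general case
  follows by decomposing both factors.\<close>

lemma ideal_irrelevant: "ideal (irrelevant_ideal R G) R"
  unfolding submod_regular[symmetric]
proof (rule submodI)
  fix r x assume r: "r \<in> carrier R" and x: "x \<in> irrelevant_ideal R G"
  obtain A f where A: "finite A" "0 \<notin> A" "\<And>n. f n \<in> G n" "x = (\<Oplus>n\<in>A. f n)" by (rule irrelevantE[OF x]) blast
  obtain B g where B: "finite B" "\<And>n. g n \<in> G n" "r = (\<Oplus>n\<in>B. g n)" by (rule homogeneous_decomposition[OF r]) blast
  have "s \<otimes> x \<in> irrelevant_ideal R G" if s: "s \<in> G m" for s m
  proof -
    have "s \<otimes> x = (\<Oplus>n\<in>A. s \<otimes> f n)"
      unfolding A(4) by (rule finsum_rdistr[OF A(1) G_carrier[OF s]]) (use G_carrier[OF A(3)] in auto)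
    also have "\<dots> \<in> irrelevant_ideal R G"
    proof (rule irrelevant_finsum[OF A(1)])
      fix n assume "n \<in> A"
      then show "s \<otimes> f n \<in> irrelevant_ideal R G"
        using irrelevant_homogeneous[OF G_mult[OF s A(3)[of n]]] A(2) by (cases n) auto
    qed
    finally show ?thesis .
  qed
  from irrelevant_finsum[OF B(1) this[OF B(2)]]
  have "(\<Oplus>n\<in>B. g n \<otimes> x) \<in> irrelevant_ideal R G" .
  moreover have "r \<otimes> x = (\<Oplus>n\<in>B. g n \<otimes> x)"
    unfolding B(3) by (rule finsum_ldistr[OF B(1) irrelevant_carrier[OF x]]) (use G_carrier[OF B(2)] in auto)
  ultimately show "r \<odot>\<^bsub>regular_module R\<^esub> x \<in> irrelevant_ideal R G" by simp
qed (auto simp: irrelevant_zero irrelevant_add irrelevant_carrier)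

lemma degree_zero_decomposition:
  assumes "a \<in> carrier R"
  obtains b p where "b \<in> G 0" "p \<in> irrelevant_ideal R G" "a = b \<oplus> p"
proof -
  obtain A f where A: "finite A" "\<And>n. f n \<in> G n" "a = (\<Oplus>n\<in>A. f n)" by (rule homogeneous_decomposition[OF assms]) blast
  have p: "(\<Oplus>n\<in>A - {0}. f n) \<in> irrelevant_ideal R G" by (rule irrelevantI) (use A in auto)
  have f: "f n \<in> carrier R" for n using A(2) G_carrier by blast
  show ?thesis
  proof (cases "0 \<in> A")
    case True
    then have "a = (\<Oplus>n\<in>insert 0 (A - {0}). f n)" using A(3) by (simp add: insert_absorb)
    also have "\<dots> = f 0 \<oplus> (\<Oplus>n\<in>A - {0}. f n)" by (rule finsum_insert) (use A(1) f in auto)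
    finally show ?thesis using that[OF A(2) p] by blast
  next
    case False
    then have "a = \<zero> \<oplus> (\<Oplus>n\<in>A - {0}. f n)" using A(3) assms by simp
    then show ?thesis using that[OF G_zero p] by blast
  qed
qed

text \<open>By maximality, \<open>\<mm>\<close> and \<open>b\<close> together generate the unit
  ideal of the degree zero ring. The resulting equation is stated in \<open>R\<close>, where it is
  used.\<close>

lemma degree_zero_unit:
  assumes loc: "local_ring (degree_zero_ring R G) \<mm>" and b: "b \<in> G 0" "b \<notin> \<mm>"
  obtains m c where "m \<in> \<mm>" "c \<in> G 0" "\<one> = m \<oplus> c \<otimes> b"
proof -
  let ?S = "degree_zero_ring R G"
  have S [simp]: "carrier ?S = G 0" "x \<oplus>\<^bsub>?S\<^esub> y = x \<oplus> y" "x \<otimes>\<^bsub>?S\<^esub> y = x \<otimes> y" "\<one>\<^bsub>?S\<^esub> = \<one>" "\<zero>\<^bsub>?S\<^esub> = \<zero>" for x y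
    by (simp_all add: degree_zero_ring_def)
  interpret S: cring ?S using loc by (simp add: local_ring_def)
  interpret maximalideal \<mm> ?S using loc by (simp add: local_ring_def)
  let ?J = "\<mm> <+>\<^bsub>?S\<^esub> (PIdl\<^bsub>?S\<^esub> b)"
  have J: "?J = {m \<oplus> c \<otimes> b | m c. m \<in> \<mm> \<and> c \<in> G 0}" by (auto simp: set_add_def' cgenideal_def)
  have idJ: "ideal ?J ?S"
    by (rule S.add_ideals[OF is_ideal S.cgenideal_ideal]) (simp add: b)
  have z: "\<zero> \<in> \<mm>" using zero_closed by simp
  have "\<mm> \<subseteq> ?J"
  proof
    fix m assume m: "m \<in> \<mm>"
    then have "m = m \<oplus> \<zero> \<otimes> b" using G_carrier[OF b(1)] G_carrier[of m 0] Icarr by simp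
    then show "m \<in> ?J" unfolding J using m G_zero by blast
  qed
  moreover have "b \<in> ?J"
  proof -
    have "b = \<zero> \<oplus> \<one> \<otimes> b" using G_carrier[OF b(1)] by simp
    then show ?thesis unfolding J using z S.one_closed by auto
  qed
  ultimately have "?J = carrier ?S" using I_maximal[OF idJ] ideal_subset b(2) S.ideal_subset[OF idJ] by blast
  then have "\<one> \<in> ?J" using S.one_closed by simp
  then show ?thesis unfolding J using that by blast
qed

text \<open>Modulo the irrelevant ideal an element equals its part of degree 0; if that part is
  outside \<open>\<mm>\<close>, it is a unit modulo \<open>\<mm>\<close>, so a strictly larger ideal
  contains one. The nested \<open>Idl\<close> matches the union of two ideals in
  \<open>artinian_iterated_local_cohomology\<close>.\<close>

lemma maximal_graded_ideal:
  assumes loc: "local_ring (degree_zero_ring R G) \<mm>"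
    and I: "ideal I R" "Idl (Idl \<mm> \<union> irrelevant_ideal R G) \<subseteq> I"
  shows "I = Idl (Idl \<mm> \<union> irrelevant_ideal R G) \<or> I = carrier R"
proof (cases "I \<subseteq> Idl (Idl \<mm> \<union> irrelevant_ideal R G)")
  case False
  let ?J = "Idl (Idl \<mm> \<union> irrelevant_ideal R G)"
  have mG: "\<mm> \<subseteq> G 0"
    using loc ideal.Icarr[of \<mm> "degree_zero_ring R G"] maximalideal.axioms(1)
    by (auto simp: local_ring_def degree_zero_ring_def)
  then have mR: "\<mm> \<subseteq> carrier R" using G_carrier by blast
  have "Idl \<mm> \<union> irrelevant_ideal R G \<subseteq> carrier R"
    using ideal_subset[OF genideal_ideal[OF mR]] ideal_subset[OF ideal_irrelevant] by blast
  note J = genideal_ideal[OF this] genideal_self[OF this]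
  have mJ: "\<mm> \<subseteq> ?J" "irrelevant_ideal R G \<subseteq> ?J"
    using order_trans[OF genideal_self[OF mR], of ?J] J(2) by simp_all
  note addI = additive_subgroup.a_closed[OF ideal.axioms(1)[OF I(1)]]
    and addJ = additive_subgroup.a_closed[OF ideal.axioms(1)[OF J(1)]]
  obtain a where a: "a \<in> I" "a \<notin> ?J" using False by (meson subsetI)
  obtain b p where bp: "b \<in> G 0" "p \<in> irrelevant_ideal R G" "a = b \<oplus> p"
    by (rule degree_zero_decomposition[OF ideal.Icarr[OF I(1) a(1)]])
  have "b \<notin> \<mm>" using a(2) bp(3) addJ[OF subsetD[OF mJ(1)] subsetD[OF mJ(2) bp(2)]] by metis
  then obtain m c where mc: "m \<in> \<mm>" "c \<in> G 0" "\<one> = m \<oplus> c \<otimes> b" by (rule degree_zero_unit[OF loc bp(1)])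
  have pI: "p \<in> I" using subsetD[OF I(2) subsetD[OF mJ(2) bp(2)]] .
  have bR: "b \<in> carrier R" "p \<in> carrier R" using G_carrier[OF bp(1)] irrelevant_carrier[OF bp(2)] by simp_all
  have "b = a \<oplus> \<ominus> p" unfolding bp(3) using bR by (simp add: a_assoc r_neg)
  then have "b \<in> I" using addI[OF a(1) additive_subgroup.a_inv_closed[OF ideal.axioms(1)[OF I(1)] pI]] by simp
  then have "c \<otimes> b \<in> I" by (rule ideal.I_l_closed[OF I(1) _ G_carrier[OF mc(2)]])
  then have "\<one> \<in> I"
    using addI[OF subsetD[OF I(2) subsetD[OF mJ(1) mc(1)]]] mc(3) by simp
  then show ?thesis using ideal.one_imp_carrier[OF I(1)] by simp
qed (use I(2) in blast)

end

theorem theorem2p8: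
  fixes R :: "('a, 'r) ring_scheme" and G :: "nat \<Rightarrow> 'a set"
    and M :: "('a, 'b, 'm) module_scheme" and H :: "int \<Rightarrow> 'b set"
    and \<mm>\<^sub>0 :: "'a set" and c f i :: nat
  assumes "graded_ring R G" and "noetherian_ring R"
    and "noetherian_ring (degree_zero_ring R G)" and "local_ring (degree_zero_ring R G) \<mm>\<^sub>0"
    and "generated_in_degree_one R G"
    and "graded_module R G M H" and "finitely_generated_module R M" and "carrier M \<noteq> {\<zero>\<^bsub>M\<^esub>}"
    and "cohomological_dimension R (irrelevant_ideal R G) M = enat c"
    and "finiteness_dimension R (irrelevant_ideal R G) M = enat f"
    and "cohomological_dimension R (irrelevant_ideal R G) M =
         finiteness_dimension R (irrelevant_ideal R G) M + 1"
  shows "artinian_module R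
           (local_cohomology R (Idl\<^bsub>R\<^esub> \<mm>\<^sub>0) i (local_cohomology R (irrelevant_ideal R G) c M)) \<longleftrightarrow>
         artinian_module R
           (local_cohomology R (Idl\<^bsub>R\<^esub> \<mm>\<^sub>0) (i + 2) (local_cohomology R (irrelevant_ideal R G) f M))"
proof -
  interpret cring R using assms(1) by (simp add: graded_ring_def)
  interpret graded_cring R G by unfold_locales (rule assms(1))
  let ?J = "irrelevant_ideal R G"
  \<comment> \<open>Both dimensions are finite, so the hypothesis becomes an equation of natural
    numbers.\<close>
  have c: "c = Suc f" using assms(9-11) by (simp add: one_enat_def)
  have "\<mm>\<^sub>0 \<subseteq> G 0"
    using assms(4) ideal.Icarr[of \<mm>\<^sub>0 "degree_zero_ring R G"] maximalideal.axioms(1)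
    by (auto simp: local_ring_def degree_zero_ring_def)
  then have m: "ideal (Idl\<^bsub>R\<^esub> \<mm>\<^sub>0) R" using genideal_ideal G_carrier by blast
  have fg: "finitely_generated_module R (local_cohomology R ?J j M)" if "j < f" for j
  proof (rule ccontr)
    assume "\<not> ?thesis"
    then have "finiteness_dimension R ?J M \<le> enat j" unfolding finiteness_dimension_def by (auto intro: Inf_lower)
    then show False using assms(10) that by simp
  qed
  have zero: "carrier (local_cohomology R ?J j M) = {\<zero>\<^bsub>local_cohomology R ?J j M\<^esub>}" if "j > Suc f" for j
  proof (rule ccontr)
    assume "\<not> ?thesis"
    then have "enat j \<le> cohomological_dimension R ?J M" unfolding cohomological_dimension_def by (auto intro: Sup_upper)
    then show False using assms(9) c that by simp
  qed
  have "chain_cond False R (regular_module R) (Idl\<^bsub>R\<^esub> (Idl\<^bsub>R\<^esub> \<mm>\<^sub>0 \<union> ?J)) (carrier R)"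
    by (rule chain_cond_two_ideals[OF maximal_graded_ideal[OF assms(4)]])
  from artinian_iterated_local_cohomology[OF assms(2) m ideal_irrelevant this assms(7) fg zero]
  show ?thesis unfolding c .
qed

end
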